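(* Let $\Omega\subseteq\mathbb R^n$ be an open set satisfying the cone condition $(h_1)$ stated in the context. Let $r\in\mathbb N$ and let $p,q$ be real numbers with $1\le p\le q<+\infty$, $q\ge \frac nr$, and moreover $q>\frac nr$ if $\frac nr=p>1$. Let $s\in\mathbb R$ with $s\le p$ and let $g\in\mathcal M^{q,\frac sp}_0(\Omega)$. Then for every $\epsilon>0$ there exist $c(\epsilon)>0$ and an open set $\Omega_\epsilon\subset\subset\Omega$ with the cone property such that $$\|gu\|_{L^p(\Omega)}\le\epsilon\|u\|_{W^{r,p}(\Omega)}+c(\epsilon)\|u\|_{L^p(\Omega_\epsilon)}\qquad\text{for all }u\in W^{r,p}(\Omega).$$
   Context: Functions are complex valued, $B_\rho(x)$ is the open ball in $\mathbb R^n$ of center $x$ and radius $\rho$, and $d>0$ is a fixed real number. $W^{r,p}(\Omega)$ is the usual Sobolev space. $\Omega_\epsilon\subset\subset\Omega$ means that $\overline{\Omega_\epsilon}$ is compact and contained in $\Omega$. An open set has the cone property if there is a fixed finite cone such that every point of the set is the vertex of a cone congruent to it and contained in the set. Cones: for $x\in\mathbb R^n$, an open infinite cone with vertex $x$ is a set $\{x+\lambda(y-x):\lambda>0,\ |y-z|<a\}$ with $a>0$, $z\in\mathbb R^n$, $|z-x|>a$. $C_\theta(x)$ denotes an open infinite cone with vertex $x$ and opening $\theta$, and $C_\theta(x,h)=C_\theta(x)\cap B_h(x)$. Condition $(h_1)$: there exists $\theta\in\,]0,\pi/2[$ such that for every $x\in\Omega$ there is a cone $C_\theta(x)$ with $\overline{C_\theta(x,\rho)}\subset\Omega$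 for all $\rho\in\,]0,d]$. Spaces: $\Omega_\rho(x)=B_\rho(x)\cap\Omega$. For $1\le p<+\infty$ and $\sigma\in\mathbb R$, $\mathcal M^{p,\sigma}(\Omega)$ is the space of $g\in L^p_{loc}(\overline\Omega)$ (i.e. $g\in L^p(\Omega\cap B)$ for every ball $B$) such that $$\|g\|_{\mathcal M^{p,\sigma}(\Omega)}=\sup_{x\in\Omega,\ \rho\in]0,d]}\rho^{\sigma-n/p}\|g\|_{L^p(\Omega_\rho(x))}<+\infty,$$ with this norm. $\mathcal M^{p,\sigma}_0(\Omega)$ is the closure of $C_0^\infty(\Omega)$ in $\mathcal M^{p,\sigma}(\Omega)$ (for $\sigma\ge0$ one has $C_0^\infty(\Omega)\subset \mathcal M^{p,\sigma}(\Omega)$; in general, the closure of $C_0^\infty(\Omega)\cap\mathcal M^{p,\sigma}(\Omega)$). *)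

theory Defs
  imports "HOL-Analysis.Analysis"
begin

text \<open>Euclidean n-space is \<^typ>\<open>real ^ 'n\<close>, with n = \<^term>\<open>CARD('n)\<close>. Functions on an open set
  are represented by total functions whose values outside the set are never used.\<close>


subsection \<open>Cones\<close>

definition inf_cone :: "real ^ 'n \<Rightarrow> real ^ 'n \<Rightarrow> real \<Rightarrow> (real ^ 'n) set" where
  "inf_cone x z a = {x + l *\<^sub>R (y - x) | l y. 0 < l \<and> dist y z < a}"

text \<open>The opening is the angle between the axis and the generatrices of the cone, that is
  \<open>arcsin (a / |z - x|)\<close>; it ranges over the open interval from 0 to \<open>pi / 2\<close>.\<close>

definition is_cone :: "real \<Rightarrow> real ^ 'n \<Rightarrow> (real ^ 'n) set \<Rightarrow> bool" where
  "is_cone \<theta> x C \<longleftrightarrow>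
     (\<exists>z a. 0 < a \<and> a < dist z x \<and> \<theta> = arcsin (a / dist z x) \<and> C = inf_cone x z a)"

definition cond_h1 :: "real \<Rightarrow> (real ^ 'n) set \<Rightarrow> bool" where
  "cond_h1 d \<Omega> \<longleftrightarrow>
     (\<exists>\<theta>\<in>{0<..<pi/2}. \<forall>x\<in>\<Omega>. \<exists>C. is_cone \<theta> x C \<and>
        (\<forall>\<rho>\<in>{0<..d}. closure (C \<inter> ball x \<rho>) \<subseteq> \<Omega>))"

definition finite_cone :: "real ^ 'n \<Rightarrow> (real ^ 'n) set \<Rightarrow> bool" where
  "finite_cone v K \<longleftrightarrow>
     (\<exists>\<theta> h C. \<theta> \<in> {0<..<pi/2} \<and> 0 < h \<and> is_cone \<theta> v C \<and> K = C \<inter> ball v h)"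

text \<open>The maps \<open>y \<mapsto> x + f (y - v)\<close> with \<open>f\<close> orthogonal are the isometries of the space
  taking the vertex \<open>v\<close> to \<open>x\<close>.\<close>

definition cone_property :: "(real ^ 'n) set \<Rightarrow> bool" where
  "cone_property U \<longleftrightarrow>
     (\<exists>(v :: real ^ 'n) K. finite_cone v K \<and>
        (\<forall>x\<in>U. \<exists>f. orthogonal_transformation f \<and> (\<lambda>y. x + f (y - v)) ` K \<subseteq> U))"


subsection \<open>Lebesgue spaces\<close>

definition Lp :: "real \<Rightarrow> (real ^ 'n) set \<Rightarrow> (real ^ 'n \<Rightarrow> complex) set" where
  "Lp p A = {f \<in> borel_measurable (lebesgue_on A).
               integrable (lebesgue_on A) (\<lambda>x. cmod (f x) powr p)}"

text \<open>Only meaningful for members of \<^const>\<open>Lp\<close>: the Bochner integral of a non-integrable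
  function is 0.\<close>

definition Lp_norm :: "real \<Rightarrow> (real ^ 'n) set \<Rightarrow> (real ^ 'n \<Rightarrow> complex) \<Rightarrow> real" where
  "Lp_norm p A f = (LINT x|lebesgue_on A. cmod (f x) powr p) powr (1 / p)"

definition Lp_loc_closure :: "real \<Rightarrow> (real ^ 'n) set \<Rightarrow> (real ^ 'n \<Rightarrow> complex) set" where
  "Lp_loc_closure p \<Omega> = {f. \<forall>x R. f \<in> Lp p (\<Omega> \<inter> ball x R)}"

definition L1_loc :: "(real ^ 'n) set \<Rightarrow> (real ^ 'n \<Rightarrow> complex) set" where
  "L1_loc \<Omega> = {f. \<forall>K. compact K \<and> K \<subseteq> \<Omega> \<longrightarrow> integrable (lebesgue_on K) f}"


subsection \<open>Test functions and Sobolev spaces\<close>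

definition partial :: "'n \<Rightarrow> (real ^ 'n \<Rightarrow> complex) \<Rightarrow> real ^ 'n \<Rightarrow> complex" where
  "partial i f x = vector_derivative (\<lambda>t. f (x + t *\<^sub>R axis i 1)) (at 0)"

definition partials :: "'n list \<Rightarrow> (real ^ 'n \<Rightarrow> complex) \<Rightarrow> real ^ 'n \<Rightarrow> complex" where
  "partials is f = foldr partial is f"

definition smooth :: "(real ^ 'n \<Rightarrow> complex) \<Rightarrow> bool" where
  "smooth f \<longleftrightarrow> (\<forall>is. partials is f differentiable_on UNIV)"

text \<open>A function of this space is identified with its extension by zero to the whole space.\<close>

definition C0_inf :: "(real ^ 'n) set \<Rightarrow> (real ^ 'n \<Rightarrow> complex) set" where
  "C0_inf \<Omega> = {\<phi>. smooth \<phi> \<and> compact (closure {x. \<phi> x \<noteq> 0}) \<and> closure {x. \<phi> x \<noteq> 0} \<subseteq> \<Omega>}"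

definition order_mi :: "('n::finite \<Rightarrow> nat) \<Rightarrow> nat" where
  "order_mi \<alpha> = (\<Sum>i\<in>UNIV. \<alpha> i)"

text \<open>\<open>v\<close> is a weak derivative of \<open>u\<close> of multi-index \<open>\<alpha>\<close>. The index type carries no order, so the
  derivative of the test function is taken along every list that contains each \<open>i\<close> exactly
  \<open>\<alpha> i\<close> times; as \<open>\<phi>\<close> is smooth, all these lists give the same function.\<close>

definition has_weak_deriv ::
  "(real ^ 'n) set \<Rightarrow> ('n \<Rightarrow> nat) \<Rightarrow> (real ^ 'n \<Rightarrow> complex) \<Rightarrow> (real ^ 'n \<Rightarrow> complex) \<Rightarrow> bool" where
  "has_weak_deriv \<Omega> \<alpha> u v \<longleftrightarrow>
     u \<in> L1_loc \<Omega> \<and> v \<in> L1_loc \<Omega> \<and>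
     (\<forall>\<phi>\<in>C0_inf \<Omega>. \<forall>is. (\<forall>i. count_list is i = \<alpha> i) \<longrightarrow>
        (LINT x|lebesgue_on \<Omega>. u x * partials is \<phi> x) =
          (- 1) ^ order_mi \<alpha> * (LINT x|lebesgue_on \<Omega>. v x * \<phi> x))"

text \<open>Weak derivatives are unique up to null sets, so \<open>L\<^sup>p\<close> membership and norm below do not
  depend on the choice.\<close>

definition weak_deriv ::
  "(real ^ 'n) set \<Rightarrow> ('n \<Rightarrow> nat) \<Rightarrow> (real ^ 'n \<Rightarrow> complex) \<Rightarrow> real ^ 'n \<Rightarrow> complex" where
  "weak_deriv \<Omega> \<alpha> u = (SOME v. has_weak_deriv \<Omega> \<alpha> u v)"

definition sobolev :: "nat \<Rightarrow> real \<Rightarrow> (real ^ 'n) set \<Rightarrow> (real ^ 'n \<Rightarrow> complex) set" where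
  "sobolev r p \<Omega> = {u \<in> Lp p \<Omega>. \<forall>\<alpha>. order_mi \<alpha> \<le> r \<longrightarrow>
     (\<exists>v. has_weak_deriv \<Omega> \<alpha> u v) \<and> weak_deriv \<Omega> \<alpha> u \<in> Lp p \<Omega>}"

definition sobolev_norm :: "nat \<Rightarrow> real \<Rightarrow> (real ^ 'n) set \<Rightarrow> (real ^ 'n \<Rightarrow> complex) \<Rightarrow> real" where
  "sobolev_norm r p \<Omega> u =
     (\<Sum>\<alpha> | order_mi \<alpha> \<le> r. Lp_norm p \<Omega> (weak_deriv \<Omega> \<alpha> u) powr p) powr (1 / p)"

lemma finite_order_mi_le: "finite {\<alpha> :: 'n::finite \<Rightarrow> nat. order_mi \<alpha> \<le> r}"
proof (rule finite_subset)
  show "{\<alpha> :: 'n \<Rightarrow> nat. order_mi \<alpha> \<le> r} \<subseteq> PiE UNIV (\<lambda>_. {..r})"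
    unfolding order_mi_def
    by (auto intro: order_trans[OF member_le_sum[of _ UNIV]])
qed (simp add: finite_PiE)


subsection \<open>Morrey type spaces\<close>

text \<open>The parameter \<open>d\<close> bounds the radii. The supremum is taken in \<^typ>\<open>ennreal\<close>, so that
  it is \<open>\<infinity>\<close> when unbounded and 0 when \<open>\<Omega>\<close> is empty.\<close>

definition morrey_norm ::
  "real \<Rightarrow> real \<Rightarrow> real \<Rightarrow> (real ^ 'n) set \<Rightarrow> (real ^ 'n \<Rightarrow> complex) \<Rightarrow> ennreal" where
  "morrey_norm d p \<sigma> \<Omega> g =
     (SUP (x, \<rho>) \<in> \<Omega> \<times> {0<..d}.
        ennreal (\<rho> powr (\<sigma> - real CARD('n) / p) * Lp_norm p (ball x \<rho> \<inter> \<Omega>) g))"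

definition morrey ::
  "real \<Rightarrow> real \<Rightarrow> real \<Rightarrow> (real ^ 'n) set \<Rightarrow> (real ^ 'n \<Rightarrow> complex) set" where
  "morrey d p \<sigma> \<Omega> = {g \<in> Lp_loc_closure p \<Omega>. morrey_norm d p \<sigma> \<Omega> g < \<infinity>}"

definition morrey0 ::
  "real \<Rightarrow> real \<Rightarrow> real \<Rightarrow> (real ^ 'n) set \<Rightarrow> (real ^ 'n \<Rightarrow> complex) set" where
  "morrey0 d p \<sigma> \<Omega> = {g \<in> morrey d p \<sigma> \<Omega>. \<forall>\<delta>>0.
     \<exists>\<phi> \<in> C0_inf \<Omega> \<inter> morrey d p \<sigma> \<Omega>. morrey_norm d p \<sigma> \<Omega> (\<lambda>x. g x - \<phi> x) < ennreal \<delta>}"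

end

theory Submission imports Defs begin

text \<open>Only the radius \<open>\<rho> = d\<close> of the Morrey norm matters: if \<open>\<gamma>\<close> has \<open>q\<close>-th power integrals at most \<open>m\<close> over all
  sets \<open>B\<^sub>d(x) \<inter> \<Omega>\<close>, then the \<open>p\<close>-th power of the norm of \<open>\<gamma> u\<close> in \<open>L\<^sup>p(\<Omega>)\<close> is at most a constant times \<open>m\<close> to the power
  \<open>p / q\<close> times the \<open>p\<close>-th power of the Sobolev norm of \<open>u\<close>. To see this, cover the unit sphere by finitely many small
  caps; the cone condition then gives finitely many parallelepipeds, one of which has a translate with vertex \<open>x\<close> inside
  \<open>\<Omega>\<close>, for every \<open>x \<in> \<Omega>\<close>. On the set of points belonging to one parallelepiped, a local Sobolev inequality
  (Gagliardo's method for \<open>r p \<le> n\<close>, Morrey's for \<open>r p > n\<close>, plain integration along the coordinates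
  for \<open>r \<ge> n\<close>) holds for mollified functions and passes to the limit by Fatou's lemma; averaging over balls of radius
  \<open>d / 2\<close> makes it global. Now write \<open>g = (g - \<phi>) + \<phi>\<close> with a test function \<open>\<phi>\<close> close to \<open>g\<close>. The first part is
  small by this embedding, and the second is bounded with support in a finite union of equal balls, which
  has the cone property.\<close>

subsection \<open>Powers of extended nonnegative reals and Hoelder's inequality\<close>

text \<open>A set with the cone condition need not admit an extension operator, so every estimate
  must run inside \<open>\<Omega>\<close>. Parallelepipeds serve because a linear map turns them
  into cubes with edges along the axes; on a unit segment the fundamental theorem of calculus bounds
  a value by an integral of the function and its derivative, without boundary values. Each order of
  differentiation consumes one unit cube, hence images of cubes of side \<open>r\<close>. The
  constants depend only on the linear map, the exponents, \<open>d\<close> and \<open>r\<close>, not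
  on the place of the ball, so averaging over centres costs just a ratio of volumes. The radius
  \<open>d / 2\<close> is forced by the Morrey norm, whose balls have centres in
  \<open>\<Omega>\<close>: if a ball of radius \<open>d / 2\<close> contains a point of
  \<open>\<Omega>\<close>, it lies in the ball of radius \<open>d\<close> about that point. Weak
  derivatives can be mollified only at positive distance from the complement, so sets with a margin
  are used and then exhaust the set of good vertices. Without a bound for the supremum, Hoelder's
  inequality needs \<open>|u|\<close> in the power \<open>t\<close> with
  \<open>1 / t = 1 / p - 1 / q\<close>; the excluded case \<open>n / r = p = q > 1\<close> would
  make \<open>t\<close> infinite.\<close>

text \<open>Unlike the real power, \<open>0 epowr 0 = 1\<close>; this lets Hoelder's inequality hold with exponents 0. Only
  nonnegative exponents are meaningful.\<close>

definition epowr :: "ennreal \<Rightarrow> real \<Rightarrow> ennreal"  (infixr "epowr" 80) where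
  "x epowr a = (if a = 0 then 1 else if x = top then top else ennreal (enn2real x powr a))"

lemma epowr_0 [simp]: "x epowr 0 = 1"
  by (simp add: epowr_def)

lemma epowr_1 [simp]: "x epowr 1 = x"
  by (cases x) (auto simp: epowr_def)

lemma one_epowr [simp]: "1 epowr a = 1"
  by (simp add: epowr_def)

lemma zero_epowr [simp]: "a \<noteq> 0 \<Longrightarrow> 0 epowr a = 0"
  by (simp add: epowr_def)

lemma ennreal_epowr: "0 \<le> x \<Longrightarrow> a \<noteq> 0 \<Longrightarrow> ennreal x epowr a = ennreal (x powr a)"
  by (simp add: epowr_def)

lemma epowr_eq_0_iff: "0 < a \<Longrightarrow> x epowr a = 0 \<longleftrightarrow> x = 0"
  by (cases x) (auto simp: epowr_def)

lemma epowr_eq_top_iff: "0 < a \<Longrightarrow> x epowr a = top \<longleftrightarrow> x = top"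
  by (auto simp: epowr_def)

lemma epowr_mono: "x \<le> y \<Longrightarrow> 0 \<le> a \<Longrightarrow> x epowr a \<le> y epowr a"
  by (cases x; cases y) (auto simp: epowr_def top_unique intro!: ennreal_leI powr_mono2)

lemma epowr_mult: "0 \<le> a \<Longrightarrow> (x * y) epowr a = x epowr a * y epowr a"
  by (cases x; cases y)
     (auto simp: epowr_def ennreal_mult_eq_top_iff ennreal_top_mult ennreal_mult_top enn2real_mult
        powr_mult ennreal_mult' ennreal_eq_0_iff)

lemma epowr_add: "0 \<le> a \<Longrightarrow> 0 \<le> b \<Longrightarrow> x epowr (a + b) = x epowr a * x epowr b"
  by (cases x) (auto simp: epowr_def powr_add ennreal_mult')

lemma epowr_epowr: "0 \<le> a \<Longrightarrow> 0 \<le> b \<Longrightarrow> (x epowr a) epowr b = x epowr (a * b)"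
  by (cases x) (auto simp: epowr_def powr_powr)

lemma epowr_sum_exp: "(\<And>i. i \<in> I \<Longrightarrow> 0 \<le> a i) \<Longrightarrow> x epowr (\<Sum>i\<in>I. a i) = (\<Prod>i\<in>I. x epowr a i)"
  by (induction I rule: infinite_finite_induct) (auto simp: epowr_add sum_nonneg)

lemma measurable_epowr [measurable]:
  "f \<in> borel_measurable M \<Longrightarrow> (\<lambda>x. f x epowr a) \<in> borel_measurable M"
  unfolding epowr_def by (cases "a = 0") auto

section \<open>Hoelder's inequality with finitely many factors\<close>

lemma weighted_AM_GM:
  fixes a x :: "'a \<Rightarrow> real"
  assumes "finite S" "\<And>j. j \<in> S \<Longrightarrow> 0 \<le> a j" "sum a S = 1" "\<And>j. j \<in> S \<Longrightarrow> 0 < x j"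
  shows "(\<Prod>j\<in>S. x j powr a j) \<le> (\<Sum>j\<in>S. a j * x j)"
proof -
  have ne: "S \<noteq> {}" using assms by auto
  have "exp (\<Sum>j\<in>S. a j *\<^sub>R ln (x j)) \<le> (\<Sum>j\<in>S. a j * exp (ln (x j)))"
    using assms ne by (intro convex_on_sum[OF _ _ exp_convex]) auto
  also have "exp (\<Sum>j\<in>S. a j *\<^sub>R ln (x j)) = (\<Prod>j\<in>S. x j powr a j)"
    using assms by (subst exp_sum) (auto simp: powr_def intro!: prod.cong dest: assms(4))
  also have "(\<Sum>j\<in>S. a j * exp (ln (x j))) = (\<Sum>j\<in>S. a j * x j)"
    using assms by (intro sum.cong) auto
  finally show ?thesis .
qed

text \<open>Indices of weight 0 are discarded first, since their factor is 1 whatever the value.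
  Among the others a vanishing value makes the left side 0 and an infinite one makes the right side
  infinite; only the last case needs the real inequality, which is convexity of
  \<open>exp\<close>.\<close>

lemma epowr_weighted_AM_GM:
  assumes fin: "finite S" and a: "\<And>j. j \<in> S \<Longrightarrow> 0 \<le> a j" and s: "sum a S = 1"
  shows "(\<Prod>j\<in>S. x j epowr a j) \<le> (\<Sum>j\<in>S. ennreal (a j) * x j)"
proof -
  define T where "T = {j\<in>S. a j \<noteq> 0}"
  have T: "finite T" "\<And>j. j \<in> T \<Longrightarrow> 0 < a j" "T \<subseteq> S"
    using fin a by (auto simp: T_def less_le)
  have sT: "sum a T = 1" unfolding s[symmetric] T_def
    by (rule sum.mono_neutral_left) (use fin in auto)
  have P: "(\<Prod>j\<in>S. x j epowr a j) = (\<Prod>j\<in>T. x j epowr a j)"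
    unfolding T_def by (rule prod.mono_neutral_right) (use fin in auto)
  have S: "(\<Sum>j\<in>S. ennreal (a j) * x j) = (\<Sum>j\<in>T. ennreal (a j) * x j)"
    unfolding T_def by (rule sum.mono_neutral_right) (use fin in auto)
  consider "\<exists>j\<in>T. x j = 0" | "\<exists>j\<in>T. x j = top" | "\<forall>j\<in>T. x j \<noteq> 0 \<and> x j \<noteq> top" by blast
  then show ?thesis
  proof cases
    case 1
    then obtain j where "j \<in> T" "x j epowr a j = 0" using T(2) by fastforce
    then have "(\<Prod>j\<in>T. x j epowr a j) = 0" using T(1) by (meson prod_zero)
    then show ?thesis unfolding P by (metis zero_le)
  next
    case 2
    then obtain j where "j \<in> T" "ennreal (a j) * x j = top"
      using T(2) by (force simp: ennreal_mult_top ennreal_eq_0_iff)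
    then have "(\<Sum>j\<in>T. ennreal (a j) * x j) = top"
      using T(1) member_le_sum[of j T "\<lambda>j. ennreal (a j) * x j"] by (simp add: top_unique)
    then show ?thesis unfolding S by simp
  next
    case 3
    define y where "y j = enn2real (x j)" for j
    have y: "x j = ennreal (y j)" "0 < y j" if "j \<in> T" for j
      using 3 that by (auto simp: y_def enn2real_positive_iff less_top zero_less_iff_neq_zero)
    have "(\<Prod>j\<in>T. x j epowr a j) = (\<Prod>j\<in>T. ennreal (y j powr a j))"
      using y T by (intro prod.cong refl) (metis ennreal_epowr less_eq_real_def less_numeral_extra(3))
    also have "\<dots> = ennreal (\<Prod>j\<in>T. y j powr a j)" by (rule prod_ennreal) auto
    also have "\<dots> \<le> ennreal (\<Sum>j\<in>T. a j * y j)"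
      using T y sT by (intro ennreal_leI weighted_AM_GM) (auto intro: less_imp_le)
    also have "\<dots> = (\<Sum>j\<in>T. ennreal (a j * y j))"
      using T y by (subst sum_ennreal) (auto intro!: mult_nonneg_nonneg less_imp_le)
    also have "\<dots> = (\<Sum>j\<in>T. ennreal (a j) * x j)"
      using T y by (intro sum.cong refl) (auto simp: ennreal_mult' less_imp_le)
    finally show ?thesis unfolding P S .
  qed
qed

text \<open>After each \<open>f j\<close> is divided by its integral, the pointwise weighted mean
  inequality integrates to at most the sum of the weights, which is 1. A vanishing integral must be
  treated before an infinite one: 0 times \<open>top\<close> is 0, so the left side has to vanish
  too, which it does because \<open>f j\<close> is 0 almost everywhere.\<close>

lemma nn_integral_Holder:
  assumes fin: "finite S" and a: "\<And>j. j \<in> S \<Longrightarrow> 0 \<le> a j" and s: "sum a S = 1"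
    and [measurable]: "\<And>j. j \<in> S \<Longrightarrow> f j \<in> borel_measurable M"
  shows "(\<integral>\<^sup>+x. (\<Prod>j\<in>S. f j x epowr a j) \<partial>M) \<le> (\<Prod>j\<in>S. (\<integral>\<^sup>+x. f j x \<partial>M) epowr a j)"
proof -
  define T where "T = {j\<in>S. a j \<noteq> 0}"
  have T: "finite T" "\<And>j. j \<in> T \<Longrightarrow> 0 < a j" "T \<subseteq> S"
    using fin a by (auto simp: T_def less_le)
  have sT: "sum a T = 1" unfolding s[symmetric] T_def
    by (rule sum.mono_neutral_left) (use fin in auto)
  have P: "(\<Prod>j\<in>S. u j epowr a j) = (\<Prod>j\<in>T. u j epowr a j)" for u
    unfolding T_def by (rule prod.mono_neutral_right) (use fin in auto)
  define I where "I j = (\<integral>\<^sup>+x. f j x \<partial>M)" for j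
  have [measurable]: "\<And>j. j \<in> T \<Longrightarrow> f j \<in> borel_measurable M" using T by auto
  consider "\<exists>j\<in>T. I j = 0" | "\<forall>j\<in>T. I j \<noteq> 0" "\<exists>j\<in>T. I j = top" | "\<forall>j\<in>T. I j \<noteq> 0 \<and> I j \<noteq> top" by blast
  then have "(\<integral>\<^sup>+x. (\<Prod>j\<in>T. f j x epowr a j) \<partial>M) \<le> (\<Prod>j\<in>T. I j epowr a j)"
  proof cases
    case 1
    then obtain j where j: "j \<in> T" "I j = 0" by blast
    then have "AE x in M. f j x = 0" unfolding I_def by (subst (asm) nn_integral_0_iff_AE) auto
    then have "AE x in M. (\<Prod>j\<in>T. f j x epowr a j) = 0"
      by eventually_elim (use T j in \<open>force simp: epowr_eq_0_iff\<close>)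
    then have "(\<integral>\<^sup>+x. (\<Prod>j\<in>T. f j x epowr a j) \<partial>M) = 0"
      by (subst nn_integral_0_iff_AE) auto
    then show ?thesis by simp
  next
    case 2
    then have "(\<Prod>j\<in>T. I j epowr a j) = top"
      using T by (auto simp: ennreal_prod_eq_top epowr_eq_top_iff epowr_eq_0_iff)
    then show ?thesis by simp
  next
    case 3
    define c where "c = (\<Prod>j\<in>T. I j epowr a j)"
    have eq: "(\<Prod>j\<in>T. f j x epowr a j) = c * (\<Prod>j\<in>T. (f j x / I j) epowr a j)" for x
      unfolding c_def prod.distrib[symmetric]
    proof (rule prod.cong[OF refl])
      fix j assume j: "j \<in> T"
      have "f j x = I j * (f j x / I j)"
        using 3 j by (metis ennreal_times_divide ennreal_mult_divide_eq mult.commute)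
      then show "f j x epowr a j = I j epowr a j * (f j x / I j) epowr a j"
        using T(2)[OF j] by (metis epowr_mult less_imp_le)
    qed
    have "(\<integral>\<^sup>+x. (\<Prod>j\<in>T. f j x epowr a j) \<partial>M) = c * (\<integral>\<^sup>+x. (\<Prod>j\<in>T. (f j x / I j) epowr a j) \<partial>M)"
      unfolding eq by (rule nn_integral_cmult) measurable
    also have "\<dots> \<le> c * (\<integral>\<^sup>+x. (\<Sum>j\<in>T. ennreal (a j) * (f j x / I j)) \<partial>M)"
      using T sT by (intro mult_left_mono nn_integral_mono epowr_weighted_AM_GM) (auto intro: less_imp_le)
    also have "(\<integral>\<^sup>+x. (\<Sum>j\<in>T. ennreal (a j) * (f j x / I j)) \<partial>M) = (\<Sum>j\<in>T. ennreal (a j) * (I j / I j))"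
      unfolding I_def by (subst nn_integral_sum) (auto simp: nn_integral_cmult nn_integral_divide)
    also have "\<dots> = (\<Sum>j\<in>T. ennreal (a j))"
      using 3 by (intro sum.cong) (auto simp: ennreal_divide_self less_top)
    also have "\<dots> = 1" using T sT by (subst sum_ennreal) (auto intro: less_imp_le)
    finally show ?thesis by (simp add: c_def)
  qed
  then show ?thesis unfolding P I_def .
qed

lemma nn_integral_Holder2:
  assumes [measurable]: "f \<in> borel_measurable M" "g \<in> borel_measurable M" and a: "0 \<le> a" "0 \<le> b" "a + b = 1"
  shows "(\<integral>\<^sup>+x. f x epowr a * g x epowr b \<partial>M) \<le> (\<integral>\<^sup>+x. f x \<partial>M) epowr a * (\<integral>\<^sup>+x. g x \<partial>M) epowr b"
  using nn_integral_Holder[of "UNIV::bool set" "\<lambda>c. if c then a else b" "\<lambda>c. if c then f else g" M] a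
  by (simp add: UNIV_bool mult.commute add.commute)

subsection \<open>Gagliardo's inequality\<close>

text \<open>Induction on the number of coordinates, by Hoelder's inequality in one variable at a time.\<close>

lemma grid_lines_inequality:
  fixes f :: "('i \<Rightarrow> real) \<Rightarrow> ennreal"
  assumes "finite I" "I \<noteq> {}" and p: "0 \<le> p" "(real (card I) - 1) * p \<le> 1"
    and "f \<in> borel_measurable (PiM I (\<lambda>_. lborel))"
  shows "(\<integral>\<^sup>+x. f x epowr (1 - (real (card I) - 1) * p) *
            (\<Prod>i\<in>I. (\<integral>\<^sup>+t. f (x(i := t)) \<partial>lborel) epowr p) \<partial>PiM I (\<lambda>_. lborel))
         \<le> (\<integral>\<^sup>+x. f x \<partial>PiM I (\<lambda>_. lborel)) epowr (1 + p)"
  using assms(1,2,4,5)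
proof (induction I arbitrary: f rule: finite_ne_induct)
  case (singleton i)
  note [measurable] = singleton(2)
  interpret product_sigma_finite "\<lambda>_::'i. lborel :: real measure" by standard
  let ?c = "\<integral>\<^sup>+x. f x \<partial>PiM {i} (\<lambda>_. lborel)"
  \<comment> \<open>With a single coordinate the update \<open>x(i := t)\<close> forgets all of
    \<open>x\<close>, so the line integral is the total integral.\<close>
  have c: "(\<integral>\<^sup>+t. f (x(i := t)) \<partial>lborel) = ?c" if "x \<in> space (PiM {i} (\<lambda>_. lborel :: real measure))" for x
  proof -
    have "x(i := t) = (\<lambda>_. undefined)(i := t)" for t
      using that by (auto simp: space_PiM PiE_def extensional_def)
    moreover have "?c = (\<integral>\<^sup>+t. f ((\<lambda>_. undefined)(i := t)) \<partial>lborel)"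
      by (subst product_nn_integral_insert) (auto simp: PiM_empty nn_integral_count_space_finite fun_upd_def)
    ultimately show ?thesis by simp
  qed
  have "(\<integral>\<^sup>+x. f x epowr (1 - (real (card {i}) - 1) * p) *
            (\<Prod>i\<in>{i}. (\<integral>\<^sup>+t. f (x(i := t)) \<partial>lborel) epowr p) \<partial>PiM {i} (\<lambda>_. lborel))
      = (\<integral>\<^sup>+x. f x * ?c epowr p \<partial>PiM {i} (\<lambda>_. lborel))"
    by (intro nn_integral_cong) (simp add: c)
  also have "\<dots> = ?c epowr (1 + p)"
    using p by (simp add: nn_integral_multc epowr_add)
  finally show ?case by (rule eq_refl)
next
  \<comment> \<open>The extra power of \<open>f\<close> with exponent
    \<open>1 - (card I - 1) p\<close> makes the induction close: one Hoelder step in coordinate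
    \<open>i\<close> spends it and produces the corresponding power of the marginal
    \<open>F\<close>, in which \<open>i\<close> has been integrated out.\<close>
  case (insert i J)
  note [measurable] = insert(6)
  interpret product_sigma_finite "\<lambda>_::'i. lborel :: real measure" by standard
  let ?M = "\<lambda>K. PiM K (\<lambda>_::'i. lborel :: real measure)"
  let ?m = "real (card J)"
  define F where "F x = (\<integral>\<^sup>+t. f (x(i := t)) \<partial>lborel)" for x
  have card: "real (card (insert i J)) = ?m + 1" using insert by simp
  have mp: "?m * p \<le> 1" using insert(5) card by simp
  have upd: "(\<lambda>z. (h z)(j := k z)) \<in> N \<rightarrow>\<^sub>M ?M (insert i J)"
    if "h \<in> N \<rightarrow>\<^sub>M ?M (insert i J)" "k \<in> N \<rightarrow>\<^sub>M lborel" "j \<in> insert i J"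
    for h k j and N :: "'z measure"
    by (rule measurable_fun_upd[where J = "insert i J"]) (use that in auto)
  have upd': "(\<lambda>z. (h z)(i := k z)) \<in> N \<rightarrow>\<^sub>M ?M (insert i J)"
    if "h \<in> N \<rightarrow>\<^sub>M ?M J" "k \<in> N \<rightarrow>\<^sub>M lborel"
    for h k and N :: "'z measure"
    by (rule measurable_fun_upd[where J = "J"]) (use that in auto)
  have F [measurable]: "F \<in> borel_measurable (?M J)"
    unfolding F_def by measurable
  have meas: "(\<lambda>x. \<integral>\<^sup>+t. f (x(j := t)) \<partial>lborel) \<in> borel_measurable (?M (insert i J))"
    if "j \<in> insert i J" for j
  proof -
    have "(\<lambda>z. (fst z)(j := snd z)) \<in> ?M (insert i J) \<Otimes>\<^sub>M lborel \<rightarrow>\<^sub>M ?M (insert i J)"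
      by (rule upd) (use that in auto)
    then have [measurable]: "(\<lambda>z. f ((fst z)(j := snd z))) \<in> borel_measurable (?M (insert i J) \<Otimes>\<^sub>M lborel)"
      by (rule measurable_compose) fact
    show ?thesis by measurable
  qed
  have [measurable]: "(\<lambda>x. \<Prod>j\<in>insert i J. (\<integral>\<^sup>+t. f (x(j := t)) \<partial>lborel) epowr p)
      \<in> borel_measurable (?M (insert i J))"
    by (intro borel_measurable_prod_ennreal measurable_epowr meas)
  have inner: "(\<integral>\<^sup>+t. f (x(i := t)) epowr (1 - ?m * p) *
      (\<Prod>j\<in>insert i J. (\<integral>\<^sup>+s. f (x(i := t, j := s)) \<partial>lborel) epowr p) \<partial>lborel)
     \<le> F x epowr (1 - (?m - 1) * p) * (\<Prod>j\<in>J. (\<integral>\<^sup>+s. F (x(j := s)) \<partial>lborel) epowr p)"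
    if x: "x \<in> space (?M J)" for x
  proof -
    \<comment> \<open>Hoelder in the variable \<open>t\<close> alone: weight \<open>1 - m p\<close>
      for \<open>f\<close>, with \<open>m\<close> the size of \<open>J\<close>, and weight
      \<open>p\<close> for the line integral in each direction of \<open>J\<close>. The line
      integral in direction \<open>i\<close> does not depend on \<open>t\<close>; it is the factor
      \<open>F x epowr p\<close> taken out in front.\<close>
    define G where "G k t = (if k = i then f (x(i := t)) else \<integral>\<^sup>+s. f (x(i := t, k := s)) \<partial>lborel)" for k t
    define a where "a k = (if k = i then 1 - ?m * p else p)" for k
    have const: "(\<lambda>z. x) \<in> N \<rightarrow>\<^sub>M ?M J" for N :: "'z measure" using x by simp
    have m1 [measurable]: "(\<lambda>t. f (x(i := t))) \<in> borel_measurable lborel"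
      by (rule measurable_compose[OF upd'[OF const] insert(6)]) simp
    have m2 [measurable]: "(\<lambda>z. f (x(i := fst z, k := snd z))) \<in> borel_measurable (lborel \<Otimes>\<^sub>M lborel)"
      if "k \<in> J" for k
      by (rule measurable_compose[OF upd[OF upd'[OF const]] insert(6)]) (use that in auto)
    have G [measurable]: "G k \<in> borel_measurable lborel" if "k \<in> insert i J" for k
    proof (cases "k = i")
      case True
      then show ?thesis unfolding G_def by simp
    next
      case False
      then have "k \<in> J" using that by simp
      from m2[OF this] show ?thesis unfolding G_def using False by simp
    qed
    have "(\<integral>\<^sup>+t. f (x(i := t)) epowr (1 - ?m * p) *
      (\<Prod>j\<in>insert i J. (\<integral>\<^sup>+s. f (x(i := t, j := s)) \<partial>lborel) epowr p) \<partial>lborel)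
      = (\<integral>\<^sup>+t. F x epowr p * (\<Prod>k\<in>insert i J. G k t epowr a k) \<partial>lborel)"
      using insert(1,3) by (intro nn_integral_cong)
        (auto simp: G_def a_def F_def ac_simps intro!: arg_cong2[where f="(*)"] prod.cong)
    also have "\<dots> = F x epowr p * (\<integral>\<^sup>+t. (\<Prod>k\<in>insert i J. G k t epowr a k) \<partial>lborel)"
      by (rule nn_integral_cmult) measurable
    also have "\<dots> \<le> F x epowr p * (\<Prod>k\<in>insert i J. (\<integral>\<^sup>+t. G k t \<partial>lborel) epowr a k)"
    proof (intro mult_left_mono nn_integral_Holder G)
      have "(\<Sum>k\<in>J. a k) = (\<Sum>k\<in>J. p)" using insert(3) by (intro sum.cong) (auto simp: a_def)
      then show "sum a (insert i J) = 1" using insert by (simp add: a_def)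
    qed (use insert mp p in \<open>auto simp: a_def\<close>)
    also have "(\<Prod>k\<in>insert i J. (\<integral>\<^sup>+t. G k t \<partial>lborel) epowr a k)
       = F x epowr (1 - ?m * p) * (\<Prod>k\<in>J. (\<integral>\<^sup>+t. G k t \<partial>lborel) epowr a k)"
      using insert by (simp add: G_def a_def F_def)
    also have "(\<Prod>k\<in>J. (\<integral>\<^sup>+t. G k t \<partial>lborel) epowr a k)
       = (\<Prod>k\<in>J. (\<integral>\<^sup>+s. F (x(k := s)) \<partial>lborel) epowr p)"
    proof (rule prod.cong[OF refl])
      \<comment> \<open>Tonelli exchanges \<open>t\<close> and \<open>s\<close>: integrating a line
        integral of \<open>f\<close> over \<open>t\<close> gives the line integral of the marginal
        \<open>F\<close>.\<close>
      fix k assume k: "k \<in> J"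
      then have ki: "k \<noteq> i" using insert by auto
      have "(\<integral>\<^sup>+t. G k t \<partial>lborel) = (\<integral>\<^sup>+t. \<integral>\<^sup>+s. f (x(i := t, k := s)) \<partial>lborel \<partial>lborel)"
        using ki by (simp add: G_def)
      also have "\<dots> = (\<integral>\<^sup>+s. \<integral>\<^sup>+t. f (x(i := t, k := s)) \<partial>lborel \<partial>lborel)"
        by (rule lborel_pair.Fubini'[symmetric]) (use m2[OF k] in \<open>simp add: split_beta'\<close>)
      also have "\<dots> = (\<integral>\<^sup>+s. F (x(k := s)) \<partial>lborel)"
        unfolding F_def using ki by (simp add: fun_upd_twist)
      finally show "(\<integral>\<^sup>+t. G k t \<partial>lborel) epowr a k = (\<integral>\<^sup>+s. F (x(k := s)) \<partial>lborel) epowr p"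
        using ki by (simp add: a_def)
    qed
    also have "F x epowr p * (F x epowr (1 - ?m * p) * (\<Prod>k\<in>J. (\<integral>\<^sup>+s. F (x(k := s)) \<partial>lborel) epowr p))
       = F x epowr (p + (1 - ?m * p)) * (\<Prod>k\<in>J. (\<integral>\<^sup>+s. F (x(k := s)) \<partial>lborel) epowr p)"
      using p mp by (subst epowr_add) (auto simp: mult.assoc)
    also have "p + (1 - ?m * p) = 1 - (?m - 1) * p" by (simp add: algebra_simps)
    finally show ?thesis .
  qed
  have "(\<integral>\<^sup>+x. f x epowr (1 - (real (card (insert i J)) - 1) * p) *
            (\<Prod>j\<in>insert i J. (\<integral>\<^sup>+t. f (x(j := t)) \<partial>lborel) epowr p) \<partial>?M (insert i J))
     = (\<integral>\<^sup>+x. (\<integral>\<^sup>+t. f (x(i := t)) epowr (1 - ?m * p) *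
            (\<Prod>j\<in>insert i J. (\<integral>\<^sup>+s. f (x(i := t, j := s)) \<partial>lborel) epowr p) \<partial>lborel) \<partial>?M J)"
    unfolding card
  proof (subst product_nn_integral_insert[OF insert(1) insert(3)])
    show "(\<lambda>x. f x epowr (1 - (?m + 1 - 1) * p) *
        (\<Prod>j\<in>insert i J. (\<integral>\<^sup>+t. f (x(j := t)) \<partial>lborel) epowr p)) \<in> borel_measurable (?M (insert i J))"
      by (intro borel_measurable_times_ennreal borel_measurable_prod_ennreal measurable_epowr meas insert(6))
  qed (simp only: add_diff_cancel_right')
  also have "\<dots> \<le> (\<integral>\<^sup>+x. F x epowr (1 - (?m - 1) * p) *
       (\<Prod>j\<in>J. (\<integral>\<^sup>+s. F (x(j := s)) \<partial>lborel) epowr p) \<partial>?M J)"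
    by (intro nn_integral_mono inner)
  also have "\<dots> \<le> (\<integral>\<^sup>+x. F x \<partial>?M J) epowr (1 + p)"
    using mp p by (intro insert.IH F) (simp add: algebra_simps)
  also have "(\<integral>\<^sup>+x. F x \<partial>?M J) = (\<integral>\<^sup>+x. f x \<partial>?M (insert i J))"
    unfolding F_def using insert(1,3) by (subst product_nn_integral_insert) auto
  finally show ?case .
qed

section \<open>Lebesgue measure on vectors as a product measure\<close>

lemma measurable_vec_lambda_PiM [measurable]:
  "(\<lambda>x. vec_lambda x) \<in> PiM UNIV (\<lambda>_::'n::finite. lborel :: real measure) \<rightarrow>\<^sub>M (borel :: (real ^ 'n) measure)"
proof (subst borel_measurable_euclidean_space, intro ballI)
  fix b :: "real ^ 'n" assume "b \<in> Basis"
  then obtain i where i: "b = axis i 1" by (auto simp: Basis_vec_def)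
  have "(\<lambda>x::'n \<Rightarrow> real. x i) \<in> borel_measurable (PiM UNIV (\<lambda>_. lborel))"
    using measurable_component_singleton[of i UNIV "\<lambda>_. lborel :: real measure"] by simp
  then show "(\<lambda>x. vec_lambda x \<bullet> b) \<in> borel_measurable (PiM UNIV (\<lambda>_::'n. lborel :: real measure))"
    by (simp add: i inner_axis)
qed

text \<open>Values on boxes determine Lebesgue measure, and boxes correspond to products of
  intervals. This carries the induction over sets of coordinates to vectors.\<close>

lemma lborel_vec:
  "(lborel :: (real ^ 'n::finite) measure) = distr (PiM UNIV (\<lambda>_. lborel)) borel (\<lambda>x. vec_lambda x)"
proof (rule lborel_eqI)
  interpret product_sigma_finite "\<lambda>_::'n. lborel :: real measure" by standard
  fix l u :: "real ^ 'n" assume le: "\<And>b. b \<in> Basis \<Longrightarrow> l \<bullet> b \<le> u \<bullet> b"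
  have le': "l $ i \<le> u $ i" for i
    using le[of "axis i 1"] by (auto simp: Basis_vec_def inner_axis)
  have "(\<lambda>x. vec_lambda x) -` box l u \<inter> space (PiM UNIV (\<lambda>_::'n. lborel :: real measure))
      = (\<Pi>\<^sub>E i\<in>UNIV. {l $ i<..<u $ i})"
    by (auto simp: space_PiM mem_box_cart PiE_iff)
  then have "emeasure (distr (PiM UNIV (\<lambda>_. lborel)) borel (\<lambda>x. vec_lambda x)) (box l u)
     = (\<Prod>i\<in>UNIV. emeasure lborel {l $ i<..<u $ i})"
    by (subst emeasure_distr) (auto simp: emeasure_PiM)
  also have "\<dots> = (\<Prod>i\<in>UNIV. ennreal ((u - l) $ i))"
    using le' by (intro prod.cong) auto
  also have "\<dots> = ennreal (\<Prod>i\<in>UNIV. (u - l) $ i)"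
    using le' by (intro prod_ennreal) auto
  also have "(\<Prod>i\<in>UNIV. (u - l) $ i) = (\<Prod>b\<in>Basis. (u - l) \<bullet> b)"
  proof -
    have "(\<Prod>b\<in>(\<lambda>i. axis i (1::real)) ` (UNIV :: 'n set). (u - l) \<bullet> b) = (\<Prod>i\<in>UNIV. (u - l) $ i)"
      by (subst prod.reindex) (auto simp: inj_on_def axis_eq_axis inner_axis)
    moreover have "(Basis :: (real ^ 'n) set) = (\<lambda>i. axis i 1) ` UNIV" by (auto simp: Basis_vec_def)
    ultimately show ?thesis by simp
  qed
  finally show "emeasure (distr (PiM UNIV (\<lambda>_. lborel)) borel (\<lambda>x. vec_lambda x)) (box l u)
     = ennreal (\<Prod>b\<in>Basis. (u - l) \<bullet> b)" .
qed simp

lemma nn_integral_lborel_vec: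
  fixes f :: "real ^ 'n::finite \<Rightarrow> ennreal"
  assumes "f \<in> borel_measurable borel"
  shows "(\<integral>\<^sup>+x. f x \<partial>lborel) = (\<integral>\<^sup>+x. f (vec_lambda x) \<partial>PiM UNIV (\<lambda>_. lborel))"
  by (subst lborel_vec, subst nn_integral_distr) (use assms in auto)

lemma nn_integral_lborel_shift:
  fixes f :: "real \<Rightarrow> ennreal"
  assumes "f \<in> borel_measurable borel"
  shows "(\<integral>\<^sup>+x. f (c + x) \<partial>lborel) = (\<integral>\<^sup>+x. f x \<partial>lborel)"
  using nn_integral_real_affine[OF assms, of 1 c] by simp

text \<open>The case \<open>p = 1 / (n - 1)\<close> of \<open>grid_lines_inequality\<close>, where
  the extra power of \<open>f\<close> has exponent 0. The integrals run over whole lines, so a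
  translation of the parameter bases them at \<open>x\<close>.\<close>

lemma Gagliardo_inequality:
  fixes K :: "real ^ 'n::finite \<Rightarrow> ennreal"
  assumes n: "2 \<le> CARD('n)" and K: "K \<in> borel_measurable borel"
  shows "(\<integral>\<^sup>+x. (\<Prod>i\<in>UNIV. (\<integral>\<^sup>+t. K (x + t *\<^sub>R axis i 1) \<partial>lborel) epowr (1 / (real CARD('n) - 1))) \<partial>lborel)
     \<le> (\<integral>\<^sup>+x. K x \<partial>lborel) epowr (real CARD('n) / (real CARD('n) - 1))"
proof -
  let ?m = "real CARD('n) - 1"
  have m: "?m > 0" using n by simp
  note [measurable] = K
  have line: "(\<integral>\<^sup>+t. K (vec_lambda x + t *\<^sub>R axis i 1) \<partial>lborel)
      = (\<integral>\<^sup>+t. K (vec_lambda (x(i := t))) \<partial>lborel)" for x i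
  proof -
    have "vec_lambda (x(i := x i + t)) = vec_lambda x + t *\<^sub>R axis i 1" for t
      by (vector axis_def)
    moreover have "(\<lambda>t. x(i := t)) \<in> borel \<rightarrow>\<^sub>M PiM UNIV (\<lambda>_. lborel)"
      by (rule measurable_fun_upd[where J = UNIV]) (auto simp: space_PiM)
    then have "(\<lambda>t. K (vec_lambda (x(i := t)))) \<in> borel_measurable borel"
      by (rule measurable_compose) measurable
    ultimately show ?thesis
      using nn_integral_lborel_shift[of "\<lambda>t. K (vec_lambda (x(i := t)))" "x i"]
      by (simp only:)
  qed
  have "(\<integral>\<^sup>+x. (\<Prod>i\<in>UNIV. (\<integral>\<^sup>+t. K (x + t *\<^sub>R axis i 1) \<partial>lborel) epowr (1 / ?m)) \<partial>lborel)
     = (\<integral>\<^sup>+x. K (vec_lambda x) epowr (1 - (real (card (UNIV :: 'n set)) - 1) * (1 / ?m)) *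
          (\<Prod>i\<in>UNIV. (\<integral>\<^sup>+t. K (vec_lambda (x(i := t))) \<partial>lborel) epowr (1 / ?m)) \<partial>PiM UNIV (\<lambda>_. lborel))"
    using m by (subst nn_integral_lborel_vec) (simp_all add: line)
  also have "\<dots> \<le> (\<integral>\<^sup>+x. K (vec_lambda x) \<partial>PiM UNIV (\<lambda>_. lborel)) epowr (1 + 1 / ?m)"
    using m by (intro grid_lines_inequality) auto
  also have "1 + 1 / ?m = real CARD('n) / ?m" using m by (simp add: field_simps)
  finally show ?thesis by (simp add: nn_integral_lborel_vec[symmetric])
qed

subsection \<open>Local Sobolev and Morrey inequalities of first order\<close>

definition grad_le :: "(real ^ 'n) set \<Rightarrow> (real ^ 'n \<Rightarrow> complex) \<Rightarrow> (real ^ 'n \<Rightarrow> real) \<Rightarrow> bool" where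
  "grad_le S f h \<longleftrightarrow> (\<forall>x\<in>S. \<forall>v. \<exists>D. ((\<lambda>t. f (x + t *\<^sub>R v)) has_vector_derivative D) (at 0) \<and>
     norm D \<le> norm v * h x)"

text \<open>The primitive of \<open>g\<close> majorizes the growth of \<open>F\<close>, so the mean
  value inequality applies. Since \<open>g\<close> is nonnegative and \<open>s\<close>,
  \<open>t\<close> come in any order, the bound is the integral over the full interval.\<close>

lemma norm_diff_le_integral:
  fixes F :: "real \<Rightarrow> 'a::real_normed_vector"
  assumes F: "\<And>t. t \<in> {0..1} \<Longrightarrow> (F has_vector_derivative F' t) (at t)"
    and le: "\<And>t. t \<in> {0..1} \<Longrightarrow> norm (F' t) \<le> g t"
    and g: "continuous_on {0..1} g" and st: "s \<in> {0..1}" "t \<in> {0..1}"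
  shows "norm (F t - F s) \<le> integral {0..1} g"
proof -
  define P where "P t = integral {0..t} g" for t
  have *: "norm (F t - F s) \<le> P t - P s" if "s < t" "s \<in> {0..1}" "t \<in> {0..1}" for s t
  proof (rule differentiable_bound_general[OF that(1), of F P F' g])
    show "continuous_on {s..t} F"
      using that by (intro continuous_at_imp_continuous_on ballI has_vector_derivative_continuous[OF F]) auto
    have P: "(P has_vector_derivative g x) (at x within {0..1})" if "x \<in> {0..1}" for x
      unfolding P_def by (rule integral_has_vector_derivative[OF g that])
    show "continuous_on {s..t} P"
      by (rule continuous_on_subset[of "{0..1}"])
        (use has_vector_derivative_continuous[OF P] that in \<open>auto simp: continuous_on_eq_continuous_within\<close>)
    fix x assume x: "s < x" "x < t"
    then have "x \<in> {0<..<1}" using that by auto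
    then have "at x within {0<..<1} = at x" by (intro at_within_open) auto
    moreover have "(P has_vector_derivative g x) (at x within {0<..<1})" using \<open>x \<in> {0<..<1}\<close>
      by (intro has_vector_derivative_within_subset[OF P]) auto
    ultimately show "(P has_vector_derivative g x) (at x)" by simp
    show "(F has_vector_derivative F' x) (at x)" "norm (F' x) \<le> g x" using F[of x] le[of x] x that by auto
  qed
  have gi: "g integrable_on {0..1}" using g by (rule integrable_continuous_real)
  have g0: "0 \<le> g t" if "t \<in> {0..1}" for t using le[OF that] norm_ge_zero order_trans by blast
  have P0: "0 \<le> P t" if "t \<in> {0..1}" for t
    unfolding P_def using g0 that by (intro integral_nonneg integrable_subinterval_real[OF gi]) auto
  have P1: "P t \<le> integral {0..1} g" if "t \<in> {0..1}" for t
    unfolding P_def using g0 that by (intro integral_subset_le integrable_subinterval_real[OF gi] gi) auto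
  consider "s < t" | "s = t" | "t < s" by linarith
  then show ?thesis
  proof cases
    case 1 then show ?thesis using *[OF 1] st P0[of s] P1[of t] by simp
  next
    case 2 then show ?thesis using P0[of 1] by (simp add: P_def)
  next
    case 3 then show ?thesis using *[OF 3] st P0[of t] P1[of s] by (simp add: norm_minus_commute)
  qed
qed

lemma has_vector_derivative_iff_quotient:
  fixes f :: "real \<Rightarrow> 'a::real_normed_vector"
  shows "(f has_vector_derivative D) (at t) \<longleftrightarrow> ((\<lambda>s. (f s - f t) /\<^sub>R (s - t)) \<longlongrightarrow> D) (at t)"
proof -
  have *: "norm (f s - f t - (s - t) *\<^sub>R D) / norm (s - t) = norm ((f s - f t) /\<^sub>R (s - t) - D)"
    if "s \<noteq> t" for s
  proof -
    have "f s - f t - (s - t) *\<^sub>R D = (s - t) *\<^sub>R ((f s - f t) /\<^sub>R (s - t) - D)"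
      using that by (simp add: scaleR_diff_right)
    then show ?thesis using that by simp
  qed
  have "(f has_vector_derivative D) (at t) \<longleftrightarrow>
      ((\<lambda>s. norm (f s - f t - (s - t) *\<^sub>R D) / norm (s - t)) \<longlongrightarrow> 0) (at t)"
    by (simp add: has_vector_derivative_def has_derivative_iff_norm bounded_linear_scaleR_left)
  also have "\<dots> \<longleftrightarrow> ((\<lambda>s. norm ((f s - f t) /\<^sub>R (s - t) - D)) \<longlongrightarrow> 0) (at t)"
    by (rule Lim_cong_within) (use * in auto)
  also have "\<dots> \<longleftrightarrow> ((\<lambda>s. (f s - f t) /\<^sub>R (s - t)) \<longlongrightarrow> D) (at t)"
    by (simp add: tendsto_norm_zero_iff Lim_null[symmetric])
  finally show ?thesis .
qed

text \<open>The modulus need not be differentiable at a zero of \<open>\<phi>\<close>, but there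
  \<open>\<gamma> > 1\<close> forces the derivative 0: in absolute value the quotient is that of
  \<open>\<phi>\<close> times \<open>|\<phi>|^(\<gamma> - 1)\<close>, a bounded factor times one
  that tends to 0.\<close>

lemma has_vector_derivative_norm_powr:
  fixes \<phi> :: "real \<Rightarrow> 'a::real_inner"
  assumes D: "(\<phi> has_vector_derivative D) (at t)" and \<gamma>: "1 < \<gamma>"
  shows "\<exists>E. ((\<lambda>t. norm (\<phi> t) powr \<gamma>) has_vector_derivative E) (at t) \<and>
     \<bar>E\<bar> \<le> \<gamma> * norm (\<phi> t) powr (\<gamma> - 1) * norm D"
proof (cases "\<phi> t = 0")
  case False
  have "(norm has_derivative (\<lambda>h. h \<bullet> sgn (\<phi> t))) (at (\<phi> t))"
    by (rule has_derivative_norm[OF False])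
  from has_derivative_compose[OF D[unfolded has_vector_derivative_def] this]
  have "((\<lambda>t. norm (\<phi> t)) has_real_derivative (D \<bullet> sgn (\<phi> t))) (at t)"
    by (simp add: has_field_derivative_def mult.commute[of _ "D \<bullet> sgn (\<phi> t)"])
  from DERIV_fun_powr[OF this, of \<gamma>] False
  have "((\<lambda>t. norm (\<phi> t) powr \<gamma>) has_real_derivative \<gamma> * norm (\<phi> t) powr (\<gamma> - 1) * (D \<bullet> sgn (\<phi> t))) (at t)"
    by simp
  moreover have "\<bar>D \<bullet> sgn (\<phi> t)\<bar> \<le> norm D"
    using Cauchy_Schwarz_ineq2[of D "sgn (\<phi> t)"] False by (simp add: norm_sgn)
  then have "\<bar>\<gamma> * norm (\<phi> t) powr (\<gamma> - 1) * (D \<bullet> sgn (\<phi> t))\<bar> \<le> \<gamma> * norm (\<phi> t) powr (\<gamma> - 1) * norm D"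
    using \<gamma> by (simp add: abs_mult mult_left_mono)
  ultimately show ?thesis
    by (auto simp: has_real_derivative_iff_has_vector_derivative)
next
  case True
  have "((\<lambda>s. (\<phi> s - \<phi> t) /\<^sub>R (s - t)) \<longlongrightarrow> D) (at t)"
    using D by (simp add: has_vector_derivative_iff_quotient)
  then have "((\<lambda>s. norm ((\<phi> s - \<phi> t) /\<^sub>R (s - t))) \<longlongrightarrow> norm D) (at t)" by (rule tendsto_norm)
  moreover have "(\<phi> \<longlongrightarrow> 0) (at t)"
    using has_vector_derivative_continuous[OF D] True by (simp add: isCont_def)
  then have "((\<lambda>s. norm (\<phi> s) powr (\<gamma> - 1)) \<longlongrightarrow> 0 powr (\<gamma> - 1)) (at t)"
    using \<gamma> by (intro tendsto_powr2[OF _ tendsto_const]) (auto intro: tendsto_norm_zero)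
  ultimately have "((\<lambda>s. norm ((\<phi> s - \<phi> t) /\<^sub>R (s - t)) * norm (\<phi> s) powr (\<gamma> - 1)) \<longlongrightarrow> norm D * 0 powr (\<gamma> - 1)) (at t)"
    by (rule tendsto_mult)
  moreover have "norm ((\<phi> s - \<phi> t) /\<^sub>R (s - t)) * norm (\<phi> s) powr (\<gamma> - 1)
      = norm ((norm (\<phi> s) powr \<gamma> - norm (\<phi> t) powr \<gamma>) / (s - t))" for s
    using True \<gamma> by (cases "\<phi> s = 0") (auto simp: powr_diff divide_simps)
  ultimately have "((\<lambda>s. (norm (\<phi> s) powr \<gamma> - norm (\<phi> t) powr \<gamma>) / (s - t)) \<longlongrightarrow> 0) (at t)"
    using tendsto_norm_zero_cancel[of "\<lambda>s. (norm (\<phi> s) powr \<gamma> - norm (\<phi> t) powr \<gamma>) / (s - t)"] by simp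
  then have "((\<lambda>t. norm (\<phi> t) powr \<gamma>) has_vector_derivative 0) (at t)"
    by (simp add: has_field_derivative_iff has_real_derivative_iff_has_vector_derivative[symmetric])
  then show ?thesis using \<gamma> by (intro exI[of _ 0]) simp
qed

lemma grad_le_line:
  assumes "grad_le S f h" "x + t *\<^sub>R v \<in> S"
  obtains D where "((\<lambda>t. f (x + t *\<^sub>R v)) has_vector_derivative D) (at t)" "norm D \<le> norm v * h (x + t *\<^sub>R v)"
proof -
  obtain D where D: "((\<lambda>s. f (x + t *\<^sub>R v + s *\<^sub>R v)) has_vector_derivative D) (at 0)"
      "norm D \<le> norm v * h (x + t *\<^sub>R v)"
    using assms unfolding grad_le_def by blast
  have "((\<lambda>s. s - t) has_real_derivative 1) (at t)"
    by (auto intro!: derivative_eq_intros)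
  from vector_diff_chain_at[OF this[unfolded has_real_derivative_iff_has_vector_derivative], of
      "\<lambda>s. f (x + t *\<^sub>R v + s *\<^sub>R v)" D] D(1)
  have "((\<lambda>t. f (x + t *\<^sub>R v)) has_vector_derivative D) (at t)"
    by (simp add: o_def scaleR_diff_left)
  with D(2) show ?thesis by (rule that[rotated])
qed

lemma ennreal_epowr_nonneg:
  "0 \<le> x \<Longrightarrow> ennreal x epowr a = ennreal (if a = 0 then 1 else x powr a)"
  by (simp add: epowr_def)

text \<open>For every \<open>s\<close> the value of \<open>|f|^\<gamma>\<close> at \<open>t0\<close>
  is at most its value at \<open>s\<close> plus \<open>\<gamma>\<close> times the integral of
  \<open>|f|^(\<gamma> - 1) h\<close>. Averaging over \<open>s\<close> replaces the usual vanishing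
  at an end point: because of \<open>|f| \<le> h\<close> the averaged value is at most the same
  integral, which gives the constant \<open>1 + \<gamma>\<close>.\<close>

lemma line_estimate:
  fixes f :: "real ^ 'n \<Rightarrow> complex"
  assumes cont: "continuous_on UNIV f" "continuous_on UNIV h" and gr: "grad_le S f h"
    and le: "\<And>x. norm (f x) \<le> h x" and \<gamma>: "1 \<le> \<gamma>" and v: "norm v \<le> 1"
    and seg: "\<And>t. t \<in> {0..1} \<Longrightarrow> x + t *\<^sub>R v \<in> S" and t0: "t0 \<in> {0..1}"
  shows "ennreal (norm (f (x + t0 *\<^sub>R v))) epowr \<gamma> \<le> ennreal (1 + \<gamma>) *
     (\<integral>\<^sup>+t. (ennreal (norm (f (x + t *\<^sub>R v))) epowr (\<gamma> - 1) * ennreal (h (x + t *\<^sub>R v))) * indicator {0..1} t \<partial>lborel)"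
proof -
  define \<phi> where "\<phi> t = f (x + t *\<^sub>R v)" for t
  define \<psi> where "\<psi> t = h (x + t *\<^sub>R v)" for t
  \<comment> \<open>The convention of \<open>epowr\<close> has to be reproduced: for
    \<open>\<gamma> = 1\<close> the factor is 1 even at zeros of \<open>f\<close>, where the real
    power would be 0.\<close>
  define P where "P t = (if \<gamma> - 1 = 0 then 1 else norm (\<phi> t) powr (\<gamma> - 1))" for t
  define g where "g t = P t * \<psi> t" for t
  have c1: "continuous_on T \<phi>" for T unfolding \<phi>_def
    by (rule continuous_on_compose2[OF cont(1)]) (auto intro!: continuous_intros)
  have c2: "continuous_on T \<psi>" for T unfolding \<psi>_def
    by (rule continuous_on_compose2[OF cont(2)]) (auto intro!: continuous_intros)
  have cP: "continuous_on T P" for T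
    unfolding P_def using \<gamma> c1[of T]
    by (cases "\<gamma> = 1") (auto intro!: continuous_intros continuous_on_powr')
  have cg: "continuous_on T g" for T unfolding g_def by (intro continuous_intros cP c2)
  have h0: "0 \<le> h x" for x using le[of x] norm_ge_zero order_trans by blast
  have P0: "0 \<le> P t" and g0: "0 \<le> g t" for t by (auto simp: P_def g_def \<psi>_def h0)
  have "\<forall>t\<in>{0..1}. \<exists>D. (\<phi> has_vector_derivative D) (at t) \<and> norm D \<le> \<psi> t"
  proof
    fix t :: real assume "t \<in> {0..1}"
    from grad_le_line[OF gr seg[OF this]] obtain D where
      "(\<phi> has_vector_derivative D) (at t)" "norm D \<le> norm v * h (x + t *\<^sub>R v)" unfolding \<phi>_def .
    moreover have "norm v * h (x + t *\<^sub>R v) \<le> \<psi> t"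
      using v h0 by (simp add: \<psi>_def mult_left_le_one_le)
    ultimately show "\<exists>D. (\<phi> has_vector_derivative D) (at t) \<and> norm D \<le> \<psi> t" by (meson order_trans)
  qed
  then obtain D where D: "\<And>t. t \<in> {0..1} \<Longrightarrow> (\<phi> has_vector_derivative D t) (at t)"
      "\<And>t. t \<in> {0..1} \<Longrightarrow> norm (D t) \<le> \<psi> t" by metis
  have gint: "g integrable_on {0..1}" using cg by (rule integrable_continuous_real)
  \<comment> \<open>For \<open>\<gamma> = 1\<close> the modulus may fail to be differentiable at
    zeros, so the mean value bound is applied to the complex function and followed by the triangle
    inequality; for \<open>\<gamma> > 1\<close> it is applied to the power of the modulus.\<close>
  have diff: "norm (\<phi> t0) powr \<gamma> \<le> norm (\<phi> s) powr \<gamma> + \<gamma> * integral {0..1} g" if s: "s \<in> {0..1}" for s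
  proof (cases "\<gamma> = 1")
    case True
    have "norm (\<phi> t0 - \<phi> s) \<le> integral {0..1} g"
      by (rule norm_diff_le_integral[OF D(1) _ cg s t0]) (use D(2) True in \<open>auto simp: g_def P_def\<close>)
    then have "norm (\<phi> t0) \<le> norm (\<phi> s) + integral {0..1} g" by norm
    then show ?thesis using True by simp
  next
    case False
    have "\<forall>t\<in>{0..1}. \<exists>E. ((\<lambda>t. norm (\<phi> t) powr \<gamma>) has_vector_derivative E) (at t) \<and>
     \<bar>E\<bar> \<le> \<gamma> * g t"
    proof
      fix t :: real assume t: "t \<in> {0..1}"
      obtain E where E: "((\<lambda>t. norm (\<phi> t) powr \<gamma>) has_vector_derivative E) (at t)"
         "\<bar>E\<bar> \<le> \<gamma> * norm (\<phi> t) powr (\<gamma> - 1) * norm (D t)"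
        using has_vector_derivative_norm_powr[OF D(1)[OF t], of \<gamma>] False \<gamma> by auto
      have "\<gamma> * norm (\<phi> t) powr (\<gamma> - 1) * norm (D t) \<le> \<gamma> * norm (\<phi> t) powr (\<gamma> - 1) * \<psi> t"
        using D(2)[OF t] \<gamma> by (intro mult_left_mono) auto
      then show "\<exists>E. ((\<lambda>t. norm (\<phi> t) powr \<gamma>) has_vector_derivative E) (at t) \<and> \<bar>E\<bar> \<le> \<gamma> * g t"
        using E False by (intro exI[of _ E]) (auto simp: g_def P_def mult.assoc)
    qed
    then obtain E where E: "\<And>t. t \<in> {0..1} \<Longrightarrow> ((\<lambda>t. norm (\<phi> t) powr \<gamma>) has_vector_derivative E t) (at t)"
      "\<And>t. t \<in> {0..1} \<Longrightarrow> \<bar>E t\<bar> \<le> \<gamma> * g t" by metis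
    have "norm (norm (\<phi> t0) powr \<gamma> - norm (\<phi> s) powr \<gamma>) \<le> integral {0..1} (\<lambda>t. \<gamma> * g t)"
      by (rule norm_diff_le_integral[OF E(1) _ _ s t0]) (use E(2) in \<open>auto intro!: continuous_intros cg\<close>)
    then show ?thesis by simp
  qed
  have powr_le: "norm (\<phi> s) powr \<gamma> \<le> g s" for s
  proof -
    have "norm (\<phi> s) powr \<gamma> = P s * norm (\<phi> s)"
      using \<gamma> by (cases "\<phi> s = 0") (auto simp: P_def powr_diff)
    also have "\<dots> \<le> g s" unfolding g_def using P0 le by (intro mult_left_mono) (auto simp: \<phi>_def \<psi>_def)
    finally show ?thesis .
  qed
  \<comment> \<open>The average over \<open>s\<close>; the interval has length 1, so the left side
    is unchanged.\<close>
  have "norm (\<phi> t0) powr \<gamma> = integral {0..1} (\<lambda>s::real. norm (\<phi> t0) powr \<gamma>)" by simp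
  also have "\<dots> \<le> integral {0..1} (\<lambda>s. g s + \<gamma> * integral {0..1} g)"
  proof (rule integral_le)
    show "(\<lambda>s. g s + \<gamma> * integral {0..1} g) integrable_on {0..1}"
      by (intro integrable_continuous_real continuous_intros cg)
    fix s :: real assume "s \<in> {0..1}"
    from diff[OF this] powr_le[of s] show "norm (\<phi> t0) powr \<gamma> \<le> g s + \<gamma> * integral {0..1} g" by linarith
  qed (auto intro: integrable_continuous_real)
  also have "\<dots> = (1 + \<gamma>) * integral {0..1} g"
    using gint by (subst Henstock_Kurzweil_Integration.integral_add) (auto simp: algebra_simps)
  finally have main: "norm (\<phi> t0) powr \<gamma> \<le> (1 + \<gamma>) * integral {0..1} g" .
  have "(\<integral>\<^sup>+t. ennreal (g t) * indicator {0..1} t \<partial>lborel) = ennreal (integral {0..1} g)"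
    using g0 gint by (intro nn_integral_has_integral_lebesgue') auto
  moreover have "ennreal (g t) = ennreal (norm (f (x + t *\<^sub>R v))) epowr (\<gamma> - 1) * ennreal (h (x + t *\<^sub>R v))" for t
    unfolding g_def ennreal_mult'[OF P0] by (simp add: P_def ennreal_epowr_nonneg \<phi>_def \<psi>_def)
  ultimately have eq: "(\<integral>\<^sup>+t. (ennreal (norm (f (x + t *\<^sub>R v))) epowr (\<gamma> - 1) * ennreal (h (x + t *\<^sub>R v))) * indicator {0..1} t \<partial>lborel) = ennreal (integral {0..1} g)"
    by simp
  have "ennreal (norm (f (x + t0 *\<^sub>R v))) epowr \<gamma> = ennreal (norm (\<phi> t0) powr \<gamma>)"
    using \<gamma> by (simp add: ennreal_epowr \<phi>_def)
  also have "\<dots> \<le> ennreal ((1 + \<gamma>) * integral {0..1} g)" using main by (rule ennreal_leI)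
  also have "\<dots> = ennreal (1 + \<gamma>) * ennreal (integral {0..1} g)" using \<gamma> by (intro ennreal_mult') auto
  finally show ?thesis unfolding eq .
qed

section \<open>Norms on a set and Gagliardo's method for one derivative\<close>

definition eLp :: "real \<Rightarrow> (real ^ 'n) set \<Rightarrow> (real ^ 'n \<Rightarrow> ennreal) \<Rightarrow> ennreal" where
  "eLp b G w = (\<integral>\<^sup>+x. w x epowr b * indicator G x \<partial>lborel) epowr (1 / b)"

lemma eLp_mono:
  "0 < b \<Longrightarrow> (\<And>x. x \<in> G \<Longrightarrow> w x \<le> w' x) \<Longrightarrow> G \<subseteq> G' \<Longrightarrow> eLp b G w \<le> eLp b G' w'"
  unfolding eLp_def by (intro epowr_mono nn_integral_mono) (auto simp: indicator_def intro: epowr_mono)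

text \<open>Hoelder's inequality with the indicator of \<open>G\<close> as the second
  factor.\<close>

lemma eLp_exponent_mono:
  assumes [measurable]: "w \<in> borel_measurable borel" "G \<in> sets borel" and ab: "0 < a" "a \<le> b"
  shows "eLp a G w \<le> emeasure lborel G epowr (1 / a - 1 / b) * eLp b G w"
proof -
  have "(\<integral>\<^sup>+x. w x epowr a * indicator G x \<partial>lborel)
     \<le> (\<integral>\<^sup>+x. (w x epowr b * indicator G x) epowr (a / b) * (indicator G x) epowr (1 - a / b) \<partial>lborel)"
    using ab by (intro nn_integral_mono) (auto simp: epowr_epowr indicator_def)
  also have "\<dots> \<le> (\<integral>\<^sup>+x. w x epowr b * indicator G x \<partial>lborel) epowr (a / b) * emeasure lborel G epowr (1 - a / b)"
    using ab nn_integral_Holder2[of "\<lambda>x. w x epowr b * indicator G x" lborel "indicator G" "a / b" "1 - a / b"]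
    by simp
  finally have "eLp a G w \<le> ((\<integral>\<^sup>+x. w x epowr b * indicator G x \<partial>lborel) epowr (a / b) * emeasure lborel G epowr (1 - a / b)) epowr (1 / a)"
    unfolding eLp_def using ab by (intro epowr_mono) auto
  also have "\<dots> = (\<integral>\<^sup>+x. w x epowr b * indicator G x \<partial>lborel) epowr (1 / b) * emeasure lborel G epowr (1 / a - 1 / b)"
    using ab by (simp add: epowr_mult epowr_epowr field_simps)
  finally show ?thesis by (simp add: eLp_def mult.commute)
qed

text \<open>The substitute for compact support in Gagliardo's argument: \<open>line_estimate\<close>
  can be applied in each coordinate direction on a unit segment that passes through \<open>x\<close>
  at parameter \<open>t0\<close>.\<close>

definition line_thick :: "(real ^ 'n) set \<Rightarrow> bool" where
  "line_thick G \<longleftrightarrow> (\<forall>x\<in>G. \<forall>i. \<exists>t0\<in>{0..1}. \<forall>t\<in>{0..1}. x + (t - t0) *\<^sub>R axis i 1 \<in> G)"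

text \<open>The power \<open>|f|^\<gamma>\<close> is bounded by a line integral in every direction,
  and the product of these bounds is integrated by \<open>Gagliardo_inequality\<close>. Hoelder
  splits the resulting integral of \<open>|f|^(\<gamma> - 1) h\<close> into a power of the
  \<open>b\<close>-integral of \<open>f\<close> and the norm of \<open>h\<close>; the first is
  absorbed on the left. The absorption is the reason for the hypothesis \<open>fin\<close>.\<close>

lemma Gagliardo_critical:
  fixes f :: "real ^ 'n \<Rightarrow> complex"
  assumes n: "2 \<le> CARD('n)"
    and cont: "continuous_on UNIV f" "continuous_on UNIV h" and gr: "grad_le G f h"
    and le: "\<And>x. norm (f x) \<le> h x" and G [measurable]: "G \<in> sets borel" and thick: "line_thick G"
    and b: "real CARD('n) / (real CARD('n) - 1) \<le> b" and a: "1 / a = 1 / b + 1 / real CARD('n)"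
    and fin: "(\<integral>\<^sup>+x. ennreal (norm (f x)) epowr b * indicator G x \<partial>lborel) < top"
  shows "eLp b G (\<lambda>x. ennreal (norm (f x))) \<le> ennreal (1 + b) * eLp a G (\<lambda>x. ennreal (h x))"
proof -
  define n where "n = real CARD('n)"
  have n2: "2 \<le> n" using n by (simp add: n_def)
  \<comment> \<open>Chosen so that the power \<open>n / (n - 1)\<close> of
    \<open>|f|^\<gamma>\<close> is \<open>|f|^b\<close>. The lower bound on \<open>b\<close> is
    exactly \<open>\<gamma> \<ge> 1\<close>, and the relation between \<open>a\<close> and
    \<open>b\<close> is exactly the Hoelder condition
    \<open>(\<gamma> - 1) / b + 1 / a = 1\<close>.\<close>
  define \<gamma> where "\<gamma> = b * (n - 1) / n"
  have b: "n / (n - 1) \<le> b" using b by (simp add: n_def)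
  have b1: "1 < b" using b n2 by (auto simp: field_simps intro: less_le_trans[of _ "n / (n-1)"])
  have \<gamma>: "1 \<le> \<gamma>" using b n2 by (simp add: \<gamma>_def field_simps)
  have \<gamma>b: "\<gamma> \<le> b" using n2 b1 by (simp add: \<gamma>_def field_simps)
  have g: "\<gamma> / b = (n - 1) / n" using b1 by (simp add: \<gamma>_def)
  have a: "1 / a = 1 / b + 1 / n" using a by (simp add: n_def)
  have "0 < 1 / a" unfolding a using b1 n2 by (intro add_pos_pos) auto
  then have a0: "0 < a" by simp
  have a1: "(\<gamma> - 1) / b + 1 / a = 1"
    unfolding a using g n2 by (simp add: diff_divide_distrib)
  define u where "u x = ennreal (norm (f x))" for x
  define H where "H x = ennreal (h x)" for x
  have fm: "f \<in> borel_measurable borel" and hm: "h \<in> borel_measurable borel"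
    using cont by (auto intro: borel_measurable_continuous_onI)
  have [measurable]: "u \<in> borel_measurable borel" "H \<in> borel_measurable borel"
    unfolding u_def[abs_def] H_def[abs_def] using fm hm by measurable
  define K where "K x = ennreal (1 + \<gamma>) * (u x epowr (\<gamma> - 1) * H x * indicator G x)" for x
  have [measurable]: "K \<in> borel_measurable borel" unfolding K_def by measurable
  define X where "X = (\<integral>\<^sup>+x. u x epowr b * indicator G x \<partial>lborel)"
  define Y where "Y = (\<integral>\<^sup>+x. H x epowr a * indicator G x \<partial>lborel)"
  have X: "X \<noteq> top" using fin by (simp add: X_def u_def)
  \<comment> \<open>The unit segment through \<open>x\<close> lies in \<open>G\<close>, so the
    indicator inside \<open>K\<close> is 1 on it; extending the integral to the whole line only
    increases it and permits the translation by \<open>t0\<close>.\<close>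
  have line: "u x epowr \<gamma> * indicator G x \<le> (\<integral>\<^sup>+t. K (x + t *\<^sub>R axis i 1) \<partial>lborel)" for x i
  proof (cases "x \<in> G")
    case True
    then obtain t0 where t0: "t0 \<in> {0..1}" "\<And>t. t \<in> {0..1} \<Longrightarrow> x + (t - t0) *\<^sub>R axis i 1 \<in> G"
      using thick unfolding line_thick_def by blast
    let ?y = "x - t0 *\<^sub>R axis i 1"
    have in_G: "?y + t *\<^sub>R axis i 1 \<in> G" if "t \<in> {0..1}" for t
      using t0(2)[OF that] by (simp add: algebra_simps)
    have "u x epowr \<gamma> = u (?y + t0 *\<^sub>R axis i 1) epowr \<gamma>" by simp
    also have "\<dots> \<le> ennreal (1 + \<gamma>) * (\<integral>\<^sup>+t. (u (?y + t *\<^sub>R axis i 1) epowr (\<gamma> - 1) * H (?y + t *\<^sub>R axis i 1)) * indicator {0..1} t \<partial>lborel)"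
      unfolding u_def H_def by (rule line_estimate[OF cont gr le \<gamma> _ in_G t0(1)]) auto
    also have "\<dots> = (\<integral>\<^sup>+t. ennreal (1 + \<gamma>) * (u (?y + t *\<^sub>R axis i 1) epowr (\<gamma> - 1) * H (?y + t *\<^sub>R axis i 1) * indicator {0..1} t) \<partial>lborel)"
      by (rule nn_integral_cmult[symmetric]) measurable
    also have "\<dots> \<le> (\<integral>\<^sup>+t. K (x + (- t0 + t) *\<^sub>R axis i 1) \<partial>lborel)"
      using in_G by (intro nn_integral_mono) (auto simp: K_def indicator_def algebra_simps)
    also have "\<dots> = (\<integral>\<^sup>+t. K (x + t *\<^sub>R axis i 1) \<partial>lborel)"
      by (rule nn_integral_lborel_shift) measurable
    finally show ?thesis using True by simp
  qed simp
  \<comment> \<open>The exponent \<open>n / (n - 1)\<close> is \<open>n\<close> equal shares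
    \<open>1 / (n - 1)\<close>, one for each direction, and each share is estimated by the line
    integral in its own direction.\<close>
  have "X \<le> (\<integral>\<^sup>+x. (\<Prod>i\<in>UNIV. (\<integral>\<^sup>+t. K (x + t *\<^sub>R axis i 1) \<partial>lborel) epowr (1 / (n - 1))) \<partial>lborel)"
    unfolding X_def
  proof (intro nn_integral_mono)
    fix x
    have "u x epowr b * indicator G x = (u x epowr \<gamma> * indicator G x) epowr (n / (n - 1))"
      using n2 \<gamma> b1 by (auto simp: indicator_def epowr_epowr \<gamma>_def)
    also have "n / (n - 1) = (\<Sum>i\<in>(UNIV::'n set). 1 / (n - 1))" by (simp add: n_def)
    also have "(u x epowr \<gamma> * indicator G x) epowr \<dots> = (\<Prod>i\<in>(UNIV::'n set). (u x epowr \<gamma> * indicator G x) epowr (1 / (n - 1)))"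
      using n2 by (intro epowr_sum_exp) auto
    also have "\<dots> \<le> (\<Prod>i\<in>UNIV. (\<integral>\<^sup>+t. K (x + t *\<^sub>R axis i 1) \<partial>lborel) epowr (1 / (n - 1)))"
      using n2 by (intro prod_mono_ennreal epowr_mono line) auto
    finally show "u x epowr b * indicator G x \<le> \<dots>" .
  qed
  also have "\<dots> \<le> (\<integral>\<^sup>+x. K x \<partial>lborel) epowr (n / (n - 1))"
    unfolding n_def using n by (intro Gagliardo_inequality) auto
  finally have 1: "X \<le> (\<integral>\<^sup>+x. K x \<partial>lborel) epowr (n / (n - 1))" .
  have "(\<integral>\<^sup>+x. K x \<partial>lborel) = ennreal (1 + \<gamma>) * (\<integral>\<^sup>+x. u x epowr (\<gamma> - 1) * H x * indicator G x \<partial>lborel)"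
    unfolding K_def by (rule nn_integral_cmult) measurable
  also have "(\<integral>\<^sup>+x. u x epowr (\<gamma> - 1) * H x * indicator G x \<partial>lborel)
     \<le> (\<integral>\<^sup>+x. (u x epowr b * indicator G x) epowr ((\<gamma> - 1) / b) * (H x epowr a * indicator G x) epowr (1 / a) \<partial>lborel)"
    using b1 \<gamma> a0 by (intro nn_integral_mono) (auto simp: epowr_epowr indicator_def)
  also have "\<dots> \<le> X epowr ((\<gamma> - 1) / b) * Y epowr (1 / a)"
    unfolding X_def Y_def using a1 b1 \<gamma> a0 by (intro nn_integral_Holder2) auto
  finally have 2: "(\<integral>\<^sup>+x. K x \<partial>lborel) \<le> ennreal (1 + \<gamma>) * (X epowr ((\<gamma> - 1) / b) * Y epowr (1 / a))"
    by (simp add: mult_left_mono)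
  have "X epowr (\<gamma> / b) \<le> ((\<integral>\<^sup>+x. K x \<partial>lborel) epowr (n / (n - 1))) epowr ((n - 1) / n)"
    unfolding g using 1 n2 by (intro epowr_mono) auto
  also have "\<dots> = (\<integral>\<^sup>+x. K x \<partial>lborel)" using n2 by (subst epowr_epowr) auto
  finally have "X epowr (\<gamma> / b) \<le> X epowr ((\<gamma> - 1) / b) * (ennreal (1 + \<gamma>) * Y epowr (1 / a))"
    using 2 by (simp add: ac_simps)
  moreover have "\<gamma> / b = (\<gamma> - 1) / b + 1 / b" by (simp add: diff_divide_distrib)
  ultimately have 3: "X epowr ((\<gamma> - 1) / b) * X epowr (1 / b) \<le> X epowr ((\<gamma> - 1) / b) * (ennreal (1 + \<gamma>) * Y epowr (1 / a))"
    using \<gamma> b1 by (simp add: epowr_add)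
  \<comment> \<open>Cancellation of the common power of \<open>X\<close>, which is neither 0 nor
    infinite once \<open>X = 0\<close> has been set apart.\<close>
  have "X epowr (1 / b) \<le> ennreal (1 + \<gamma>) * Y epowr (1 / a)"
  proof (cases "X = 0")
    case True
    then show ?thesis using b1 by simp
  next
    case False
    have "X epowr ((\<gamma> - 1) / b) \<noteq> 0" "X epowr ((\<gamma> - 1) / b) \<noteq> top"
      using False X \<gamma> b1 by (cases X; auto simp: epowr_def)+
    with 3 show ?thesis by (simp add: ennreal_mult_le_mult_iff)
  qed
  also have "\<dots> \<le> ennreal (1 + b) * Y epowr (1 / a)"
    using \<gamma>b by (intro mult_right_mono ennreal_leI) auto
  finally show ?thesis unfolding eLp_def X_def Y_def u_def H_def .
qed

lemma ennreal_epowr_finite [simp]: "ennreal x epowr a < top"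
  by (simp add: epowr_def)

text \<open>Exponents with slack are reduced to a critical pair: \<open>b\<close> is raised to
  \<open>b'\<close>, the exponent paired with \<open>b'\<close> is \<open>a' \<le> a\<close>, and
  the bound \<open>V\<close> on the measure of \<open>G\<close> pays for both changes. Boundedness
  of \<open>f\<close> on a set of finite measure provides the finiteness that
  \<open>Gagliardo_critical\<close> requires.\<close>

lemma Gagliardo_subcritical:
  assumes n: "2 \<le> CARD('n)" and a: "1 \<le> a" and ab: "a \<le> b" "1 / a - 1 / real CARD('n) \<le> 1 / b"
  shows "\<exists>C<top. \<forall>(f :: real ^ 'n \<Rightarrow> complex) h G. continuous_on UNIV f \<longrightarrow> continuous_on UNIV h \<longrightarrow> grad_le G f h \<longrightarrow>
     (\<forall>x. norm (f x) \<le> h x) \<longrightarrow> bounded (range f) \<longrightarrow> G \<in> sets borel \<longrightarrow> line_thick G \<longrightarrow>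
     emeasure lborel G \<le> ennreal V \<longrightarrow>
     eLp b G (\<lambda>x. ennreal (norm (f x))) \<le> C * eLp a G (\<lambda>x. ennreal (h x))"
proof -
  define n where "n = real CARD('n)"
  have n2: "2 \<le> n" using n by (simp add: n_def)
  define b' where "b' = max b (n / (n - 1))"
  define a' where "a' = 1 / (1 / b' + 1 / n)"
  have b': "b \<le> b'" "n / (n - 1) \<le> b'" "0 < b'" using a ab by (auto simp: b'_def)
  have "1 / a' = 1 / b' + 1 / n" by (simp add: a'_def)
  moreover have pos: "0 < 1 / b' + 1 / n" using b' n2 by (intro add_pos_pos) auto
  then have a'0: "0 < a'" by (simp add: a'_def)
  \<comment> \<open>Either \<open>b' = b\<close> and this is the assumed relation between
    \<open>a\<close> and \<open>b\<close>, or \<open>b' = n / (n - 1)\<close>, whose partner is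
    \<open>a' = 1 \<le> a\<close>.\<close>
  have "1 / a \<le> 1 / b' + 1 / n"
  proof (cases "b \<ge> n / (n - 1)")
    case True then show ?thesis using ab by (simp add: b'_def n_def max_def)
  next
    case False
    then have "1 / b' + 1 / n = 1" using n2 by (simp add: b'_def max_def field_simps)
    then show ?thesis using a by simp
  qed
  then have a'a: "a' \<le> a" using a pos unfolding a'_def by (simp add: field_simps)
  define C where "C = ennreal V epowr (1 / b - 1 / b') * (ennreal (1 + b') * ennreal V epowr (1 / a' - 1 / a))"
  have "C < top" unfolding C_def by (simp add: epowr_def ennreal_mult_less_top)
  moreover have "eLp b G (\<lambda>x. ennreal (norm (f x))) \<le> C * eLp a G (\<lambda>x. ennreal (h x))"
    if cont: "continuous_on UNIV f" "continuous_on UNIV h" and gr: "grad_le G f h"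
    and le: "\<forall>x. norm (f x) \<le> h x" and bd: "bounded (range f)" and G [measurable]: "G \<in> sets borel"
    and thick: "line_thick G" and V: "emeasure lborel G \<le> ennreal V"
    for f :: "real ^ 'n \<Rightarrow> complex" and h G
  proof -
    have fm [measurable]: "f \<in> borel_measurable borel" and hm [measurable]: "h \<in> borel_measurable borel"
      using cont by (auto intro: borel_measurable_continuous_onI)
    obtain B where B: "\<And>x. norm (f x) \<le> B" using bd by (auto simp: bounded_iff)
    have "(\<integral>\<^sup>+x. ennreal (norm (f x)) epowr b' * indicator G x \<partial>lborel)
       \<le> (\<integral>\<^sup>+x. ennreal B epowr b' * indicator G x \<partial>lborel)"
      using b' B by (intro nn_integral_mono mult_right_mono epowr_mono ennreal_leI) auto
    also have "\<dots> = ennreal B epowr b' * emeasure lborel G" by (simp add: nn_integral_cmult)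
    also have "\<dots> < top"
      using le_less_trans[OF V ennreal_less_top] b' by (simp add: ennreal_epowr_finite ennreal_mult_less_top)
    finally have fin: "(\<integral>\<^sup>+x. ennreal (norm (f x)) epowr b' * indicator G x \<partial>lborel) < top" .
    have "eLp b G (\<lambda>x. ennreal (norm (f x))) \<le> emeasure lborel G epowr (1 / b - 1 / b') * eLp b' G (\<lambda>x. ennreal (norm (f x)))"
      using a ab b' by (intro eLp_exponent_mono) auto
    also have "eLp b' G (\<lambda>x. ennreal (norm (f x))) \<le> ennreal (1 + b') * eLp a' G (\<lambda>x. ennreal (h x))"
      using n le b' by (intro Gagliardo_critical cont gr G thick fin) (auto simp: a'_def n_def)
    also have "eLp a' G (\<lambda>x. ennreal (h x)) \<le> emeasure lborel G epowr (1 / a' - 1 / a) * eLp a G (\<lambda>x. ennreal (h x))"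
      using a'0 a'a by (intro eLp_exponent_mono) auto
    finally have "eLp b G (\<lambda>x. ennreal (norm (f x))) \<le> emeasure lborel G epowr (1 / b - 1 / b') *
         (ennreal (1 + b') * (emeasure lborel G epowr (1 / a' - 1 / a) * eLp a G (\<lambda>x. ennreal (h x))))"
      by (simp add: mult_left_mono)
    also have "\<dots> \<le> ennreal V epowr (1 / b - 1 / b') *
         (ennreal (1 + b') * (ennreal V epowr (1 / a' - 1 / a) * eLp a G (\<lambda>x. ennreal (h x))))"
      using a ab b' a'0 a'a V by (intro mult_mono epowr_mono) (auto simp: frac_le)
    finally show ?thesis by (simp add: C_def mult.assoc)
  qed
  ultimately show ?thesis by blast
qed

section \<open>Morrey's inequality\<close>

lemma nn_integral_lborel_affine:
  fixes F :: "'a::euclidean_space \<Rightarrow> ennreal"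
  assumes [measurable]: "F \<in> borel_measurable borel" and c: "c \<noteq> 0"
  shows "(\<integral>\<^sup>+y. F y \<partial>lborel) = ennreal (\<bar>c\<bar> ^ DIM('a)) * (\<integral>\<^sup>+y. F (x + c *\<^sub>R y) \<partial>lborel)"
  by (subst lborel_affine[OF c, of x])
     (simp add: nn_integral_density nn_integral_distr nn_integral_cmult)

text \<open>The line estimate with \<open>\<gamma> = 1\<close> on the segment from \<open>x\<close>
  to \<open>x + y\<close> is averaged over \<open>y\<close> in a cube \<open>Q\<close>. For fixed
  \<open>t\<close> the substitution \<open>z = x + t y\<close> costs \<open>t^(-n)\<close>, which
  Hoelder with exponent \<open>b\<close> reduces to \<open>t^(-n/b)\<close>; this is integrable near
  0 because \<open>n < b\<close>.\<close>

lemma Morrey_inequality: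
  assumes b: "real CARD('n) < b"
  shows "\<exists>C<top. \<forall>(f :: real ^ 'n \<Rightarrow> complex) h S G x. continuous_on UNIV f \<longrightarrow> continuous_on UNIV h \<longrightarrow> grad_le S f h \<longrightarrow>
     (\<forall>x. norm (f x) \<le> h x) \<longrightarrow> (\<forall>y\<in>cbox 0 1. x + y \<in> S \<inter> G) \<longrightarrow> G \<in> sets borel \<longrightarrow>
     ennreal (norm (f x)) \<le> C * eLp b G (\<lambda>x. ennreal (h x))"
proof -
  define n where "n = real CARD('n)"
  have n1: "1 \<le> n" by (simp add: n_def Suc_leI)
  have b: "n < b" using b by (simp add: n_def)
  then have b0: "0 < b" "1 < b" using n1 by auto
  \<comment> \<open>Side \<open>1 / n\<close> guarantees \<open>norm y \<le> 1\<close>, as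
    \<open>line_estimate\<close> demands of its direction.\<close>
  define Q :: "(real ^ 'n) set" where "Q = cbox 0 (\<chi> i. 1 / n)"
  define m where "m = measure lborel Q"
  have Qm [measurable]: "Q \<in> sets borel" by (simp add: Q_def)
  have m0: "0 < m" unfolding m_def Q_def using n1
    by (subst content_pos_lt_eq) (auto simp: Basis_vec_def inner_axis)
  have mQ: "emeasure lborel Q = ennreal m" unfolding m_def Q_def
    by (rule emeasure_eq_ennreal_measure) (simp add: emeasure_lborel_cbox_eq)
  \<comment> \<open>The factors come from dividing by the volume of \<open>Q\<close>, from
    \<open>1 + \<gamma> = 2\<close>, from Hoelder on \<open>Q\<close>, and from the integral of
    \<open>t^(-n/b)\<close> over the unit interval.\<close>
  define C where "C = ennreal (1 / m) * 2 * ennreal (m powr (1 - 1 / b)) * ennreal (1 / (1 - n / b))"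
  have "C < top" by (simp add: C_def ennreal_mult_less_top)
  moreover have "ennreal (norm (f x)) \<le> C * eLp b G (\<lambda>x. ennreal (h x))"
    if cont: "continuous_on UNIV f" "continuous_on UNIV h" and gr: "grad_le S f h"
    and le: "\<forall>x. norm (f x) \<le> h x" and sub: "\<forall>y\<in>cbox 0 1. x + y \<in> S \<inter> G" and G [measurable]: "G \<in> sets borel"
    for f :: "real ^ 'n \<Rightarrow> complex" and h S G x
  proof -
    define H where "H x = ennreal (h x)" for x
    have hm: "h \<in> borel_measurable borel"
      using cont by (auto intro: borel_measurable_continuous_onI)
    have [measurable]: "H \<in> borel_measurable borel" unfolding H_def[abs_def] using hm by measurable
    define X where "X = (\<integral>\<^sup>+z. H z epowr b * indicator G z \<partial>lborel)"
    have inQ: "x + t *\<^sub>R y \<in> S \<inter> G" if y: "y \<in> Q" and t: "t \<in> {0..1}" for y t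
    proof -
      have "0 \<le> t * y $ i \<and> t * y $ i \<le> 1" for i
      proof -
        have "0 \<le> y $ i" "y $ i \<le> 1 / n" using y by (auto simp: Q_def mem_box_cart)
        moreover have "1 / n \<le> 1" using n1 by simp
        ultimately show ?thesis using t by (auto intro!: mult_nonneg_nonneg mult_le_one)
      qed
      then show ?thesis using sub by (auto simp: mem_box_cart)
    qed
    have step: "ennreal (norm (f x)) * indicator Q y \<le> 2 * (\<integral>\<^sup>+t. H (x + t *\<^sub>R y) * indicator {0..1} t * indicator Q y \<partial>lborel)" for y
    proof (cases "y \<in> Q")
      case True
      have "norm y \<le> (\<Sum>i\<in>UNIV. \<bar>y $ i\<bar>)" by (rule norm_le_l1_cart)
      also have "\<dots> \<le> (\<Sum>i\<in>(UNIV::'n set). 1 / n)"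
        using True by (intro sum_mono) (auto simp: Q_def mem_box_cart)
      also have "\<dots> = 1" using n1 by (simp add: n_def)
      finally have y1: "norm y \<le> 1" .
      have "ennreal (norm (f (x + 0 *\<^sub>R y))) epowr 1 \<le> ennreal (1 + 1) *
         (\<integral>\<^sup>+t. (ennreal (norm (f (x + t *\<^sub>R y))) epowr (1 - 1) * ennreal (h (x + t *\<^sub>R y))) * indicator {0..1} t \<partial>lborel)"
        using le inQ[OF True] y1 by (intro line_estimate[OF cont gr]) auto
      then show ?thesis using True by (simp add: H_def)
    qed simp
    have inner: "(\<integral>\<^sup>+y. H (x + t *\<^sub>R y) * indicator {0..1} t * indicator Q y \<partial>lborel)
       \<le> X epowr (1 / b) * ennreal (m powr (1 - 1 / b)) * (ennreal (t powr (- n / b)) * indicator {0..1} t)"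
      if t0: "t \<noteq> 0" for t
    proof (cases "t \<in> {0..1}")
      case True
      then have t: "0 < t" "t \<le> 1" using t0 by auto
      have "ennreal (t ^ CARD('n)) * (\<integral>\<^sup>+y. H (x + t *\<^sub>R y) epowr b * indicator Q y \<partial>lborel)
          \<le> ennreal (t ^ CARD('n)) * (\<integral>\<^sup>+y. H (x + t *\<^sub>R y) epowr b * indicator G (x + t *\<^sub>R y) \<partial>lborel)"
        using inQ True by (intro mult_left_mono nn_integral_mono) (auto simp: indicator_def)
      also have "\<dots> = X"
        unfolding X_def using t by (subst nn_integral_lborel_affine[of _ t x]) (auto simp: abs_of_pos)
      finally have "ennreal (t powr (-n)) * (ennreal (t powr n) * (\<integral>\<^sup>+y. H (x + t *\<^sub>R y) epowr b * indicator Q y \<partial>lborel))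
          \<le> ennreal (t powr (-n)) * X"
        using t by (intro mult_left_mono) (auto simp: n_def powr_realpow)
      moreover have "ennreal (t powr (-n)) * ennreal (t powr n) = 1"
        using t by (simp add: ennreal_mult'[symmetric] powr_add[symmetric])
      ultimately have 1: "(\<integral>\<^sup>+y. H (x + t *\<^sub>R y) epowr b * indicator Q y \<partial>lborel) \<le> ennreal (t powr (-n)) * X"
        by (simp add: mult.assoc[symmetric])
      have "(\<integral>\<^sup>+y. H (x + t *\<^sub>R y) * indicator {0..1} t * indicator Q y \<partial>lborel)
         = (\<integral>\<^sup>+y. (H (x + t *\<^sub>R y) epowr b * indicator Q y) epowr (1 / b) * indicator Q y epowr (1 - 1 / b) \<partial>lborel)"
        using True b0 by (intro nn_integral_cong) (auto simp: indicator_def epowr_epowr)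
      also have "\<dots> \<le> (\<integral>\<^sup>+y. H (x + t *\<^sub>R y) epowr b * indicator Q y \<partial>lborel) epowr (1 / b) * (\<integral>\<^sup>+y. indicator Q y \<partial>lborel) epowr (1 - 1 / b)"
        using b0 by (intro nn_integral_Holder2) auto
      also have "\<dots> \<le> (ennreal (t powr (-n)) * X) epowr (1 / b) * ennreal (m powr (1 - 1 / b))"
        using b0 m0 1 mQ by (intro mult_mono epowr_mono) (auto simp: ennreal_epowr)
      also have "\<dots> = X epowr (1 / b) * ennreal (m powr (1 - 1 / b)) * (ennreal (t powr (- n / b)) * indicator {0..1} t)"
        using b0 True by (simp add: epowr_mult ennreal_epowr powr_powr mult_ac)
      finally show ?thesis .
    qed simp
    have Fm: "(\<lambda>(y, t). H (x + t *\<^sub>R y) * indicator {0..1} t * indicator Q y) \<in> borel_measurable (lborel \<Otimes>\<^sub>M lborel)"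
      by measurable
    have one_d: "(\<integral>\<^sup>+t. ennreal (t powr (- n / b)) * indicator {0..1} t \<partial>lborel) = ennreal (1 / (1 - n / b))"
    proof -
      have "((\<lambda>t. t powr (- n / b)) has_integral (1 powr (- n / b + 1) / (- n / b + 1))) {0..1}"
        using b b0 by (intro has_integral_powr_from_0) (auto simp: field_simps)
      from nn_integral_has_integral_lebesgue'[OF _ this] show ?thesis by (simp add: algebra_simps)
    qed
    have "ennreal m * ennreal (norm (f x)) = (\<integral>\<^sup>+y. ennreal (norm (f x)) * indicator Q y \<partial>lborel)"
      by (subst nn_integral_cmult_indicator) (simp_all add: mQ mult.commute)
    also have "\<dots> \<le> (\<integral>\<^sup>+y. 2 * (\<integral>\<^sup>+t. H (x + t *\<^sub>R y) * indicator {0..1} t * indicator Q y \<partial>lborel) \<partial>lborel)"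
      by (intro nn_integral_mono step)
    also have "\<dots> = 2 * (\<integral>\<^sup>+y. (\<integral>\<^sup>+t. H (x + t *\<^sub>R y) * indicator {0..1} t * indicator Q y \<partial>lborel) \<partial>lborel)"
      by (rule nn_integral_cmult) measurable
    also have "(\<integral>\<^sup>+y. (\<integral>\<^sup>+t. H (x + t *\<^sub>R y) * indicator {0..1} t * indicator Q y \<partial>lborel) \<partial>lborel)
        = (\<integral>\<^sup>+t. (\<integral>\<^sup>+y. H (x + t *\<^sub>R y) * indicator {0..1} t * indicator Q y \<partial>lborel) \<partial>lborel)"
      by (rule pair_sigma_finite.Fubini'[OF _ Fm, symmetric])
         (simp add: pair_sigma_finite_def sigma_finite_lborel)
    also have "\<dots> \<le> (\<integral>\<^sup>+t. X epowr (1 / b) * ennreal (m powr (1 - 1 / b)) * (ennreal (t powr (- n / b)) * indicator {0..1} t) \<partial>lborel)"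
      by (rule nn_integral_mono_AE, rule AE_mp[OF AE_lborel_singleton[of "0::real"]], rule AE_I2, rule impI, erule inner)
    also have "\<dots> = X epowr (1 / b) * ennreal (m powr (1 - 1 / b)) * (\<integral>\<^sup>+t. (ennreal (t powr (- n / b)) * indicator {0..1} t) \<partial>lborel)"
      by (rule nn_integral_cmult) measurable
    finally have 2: "ennreal m * ennreal (norm (f x)) \<le> 2 * (X epowr (1 / b) * ennreal (m powr (1 - 1 / b)) * ennreal (1 / (1 - n / b)))"
      unfolding one_d by (auto simp: mult_left_mono)
    have "ennreal (norm (f x)) = ennreal (1 / m) * (ennreal m * ennreal (norm (f x)))"
      using m0 by (simp add: mult.assoc[symmetric] ennreal_mult'[symmetric])
    also have "\<dots> \<le> ennreal (1 / m) * (2 * (X epowr (1 / b) * ennreal (m powr (1 - 1 / b)) * ennreal (1 / (1 - n / b))))"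
      using 2 by (rule mult_left_mono) simp
    also have "\<dots> = C * X epowr (1 / b)" by (simp add: C_def mult_ac)
    finally show ?thesis by (simp add: eLp_def X_def H_def)
  qed
  ultimately show ?thesis by blast
qed

text \<open>Each application of \<open>step\<close> trades one order of \<open>H\<close> for an
  integration along one axis; after all axes the integral is over the unit cube with corner
  \<open>x\<close>. This is how as many derivatives as coordinates bound the supremum by an
  integral.\<close>

lemma iterated_line_bound:
  fixes H :: "nat \<Rightarrow> real ^ 'n \<Rightarrow> ennreal"
  assumes [measurable]: "\<And>k. H k \<in> borel_measurable borel" and G [measurable]: "G \<in> sets borel"
    and step: "\<And>k i y. k < CARD('n) \<Longrightarrow> (\<And>t. t \<in> {0..1} \<Longrightarrow> y + t *\<^sub>R axis i 1 \<in> S) \<Longrightarrow>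
        H k y \<le> C * (\<integral>\<^sup>+t. H (Suc k) (y + t *\<^sub>R axis i 1) * indicator {0..1} t \<partial>lborel)"
    and sub: "\<And>y. y \<in> cbox 0 1 \<Longrightarrow> x + y \<in> S \<inter> G"
  shows "H 0 x \<le> C ^ CARD('n) * (\<integral>\<^sup>+y. H CARD('n) y * indicator G y \<partial>lborel)"
proof -
  interpret product_sigma_finite "\<lambda>_::'n. lborel :: real measure" by standard
  define e :: "'n set \<Rightarrow> ('n \<Rightarrow> real) \<Rightarrow> real ^ 'n" where "e J z = (\<Sum>j\<in>J. z j *\<^sub>R axis j 1)" for J z
  have e_nth: "e J z $ i = (if i \<in> J then z i else 0)" for J z i
    by (simp add: e_def axis_def sum.delta if_distrib[of "\<lambda>c. _ * c"] cong: if_cong)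
  have em: "e J \<in> PiM J (\<lambda>_. lborel) \<rightarrow>\<^sub>M borel" for J
    unfolding e_def by measurable
  define Ind where "Ind J z = (\<Prod>j\<in>J. indicator {0..1} (z j) :: ennreal)" for J :: "'n set" and z :: "'n \<Rightarrow> real"
  have Im: "Ind J \<in> borel_measurable (PiM J (\<lambda>_. lborel))" for J
    unfolding Ind_def by measurable
  \<comment> \<open>\<open>J\<close> is the set of coordinates already integrated: the base point
    \<open>x + e J z\<close> has moved in these directions only, and the order of \<open>H\<close>
    has risen to their number.\<close>
  have "H 0 x \<le> C ^ card J * (\<integral>\<^sup>+z. H (card J) (x + e J z) * Ind J z \<partial>PiM J (\<lambda>_. lborel))" for J
    using finite[of J]
  proof (induction J rule: finite_induct)
    case empty
    then show ?case by (simp add: e_def Ind_def PiM_empty nn_integral_count_space_finite)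
  next
    case (insert i J)
    have m1: "(\<lambda>z. H (Suc (card J)) (x + e (insert i J) z) * Ind (insert i J) z) \<in> borel_measurable (PiM (insert i J) (\<lambda>_. lborel))"
      using em[of "insert i J"] Im[of "insert i J"] by measurable
    have cJ: "card J < CARD('n)"
      using insert by (metis UNIV_I finite psubsetI psubset_card_mono subset_UNIV)
    have upd: "e (insert i J) (z(i := t)) = e J z + t *\<^sub>R axis i 1" for z t
      using insert by (auto simp: vec_eq_iff e_nth axis_def)
    have updI: "Ind (insert i J) (z(i := t)) = indicator {0..1} t * Ind J z" for z t
    proof -
      have "(\<Prod>j\<in>J. indicator {0..1} ((z(i := t)) j) :: ennreal) = Ind J z"
        unfolding Ind_def using insert by (intro prod.cong) auto
      then show ?thesis unfolding Ind_def using insert by simp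
    qed
    have bound: "H (card J) (x + e J z) * Ind J z \<le> C * (\<integral>\<^sup>+t. H (Suc (card J)) (x + e (insert i J) (z(i := t))) * Ind (insert i J) (z(i := t)) \<partial>lborel)"
      (is "_ \<le> C * ?R") for z
    proof (cases "\<forall>j\<in>J. z j \<in> {0..1}")
      case True
      then have I1: "Ind J z = 1" unfolding Ind_def by (intro prod.neutral) auto
      have "x + e J z + t *\<^sub>R axis i 1 \<in> S" if "t \<in> {0..1}" for t
      proof -
        have "e J z + t *\<^sub>R axis i 1 \<in> cbox 0 1"
          using True that insert by (auto simp: mem_box_cart e_nth axis_def)
        from sub[OF this] show ?thesis by (simp add: add.assoc)
      qed
      from step[OF cJ this] have "H (card J) (x + e J z) \<le> C * (\<integral>\<^sup>+t. H (Suc (card J)) (x + e J z + t *\<^sub>R axis i 1) * indicator {0..1} t \<partial>lborel)" .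
      also have "(\<integral>\<^sup>+t. H (Suc (card J)) (x + e J z + t *\<^sub>R axis i 1) * indicator {0..1} t \<partial>lborel) = ?R"
        by (simp add: upd updI I1 add.assoc del: fun_upd_apply)
      finally show ?thesis by (simp add: I1 del: fun_upd_apply)
    next
      case False
      then have "Ind J z = 0" unfolding Ind_def by (auto intro!: prod_zero finite simp: indicator_def)
      then show ?thesis by simp
    qed
    have Rm: "(\<lambda>z. \<integral>\<^sup>+t. H (Suc (card J)) (x + e (insert i J) (z(i := t))) * Ind (insert i J) (z(i := t)) \<partial>lborel) \<in> borel_measurable (PiM J (\<lambda>_. lborel))"
      using measurable_compose[OF measurable_add_dim m1] by (intro lborel.borel_measurable_nn_integral) (simp add: split_beta')
    note insert.IH
    also have "C ^ card J * (\<integral>\<^sup>+z. H (card J) (x + e J z) * Ind J z \<partial>PiM J (\<lambda>_. lborel))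
       \<le> C ^ card J * (\<integral>\<^sup>+z. C * (\<integral>\<^sup>+t. H (Suc (card J)) (x + e (insert i J) (z(i := t))) * Ind (insert i J) (z(i := t)) \<partial>lborel) \<partial>PiM J (\<lambda>_. lborel))"
      by (intro mult_left_mono nn_integral_mono bound) simp
    also have "\<dots> = C ^ card J * (C * (\<integral>\<^sup>+z. (\<integral>\<^sup>+t. H (Suc (card J)) (x + e (insert i J) (z(i := t))) * Ind (insert i J) (z(i := t)) \<partial>lborel) \<partial>PiM J (\<lambda>_. lborel)))"
      by (subst nn_integral_cmult[OF Rm]) (rule refl)
    also have "(\<integral>\<^sup>+z. (\<integral>\<^sup>+t. H (Suc (card J)) (x + e (insert i J) (z(i := t))) * Ind (insert i J) (z(i := t)) \<partial>lborel) \<partial>PiM J (\<lambda>_. lborel))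
       = (\<integral>\<^sup>+z. H (Suc (card J)) (x + e (insert i J) z) * Ind (insert i J) z \<partial>PiM (insert i J) (\<lambda>_. lborel))"
      by (rule product_nn_integral_insert[OF insert(1,2) m1, symmetric])
    finally show ?case using insert by (simp add: mult_ac)
  qed
  from this[of UNIV] have "H 0 x \<le> C ^ CARD('n) * (\<integral>\<^sup>+z. H CARD('n) (x + vec_lambda z) * indicator (cbox 0 1) (vec_lambda z :: real ^ 'n) \<partial>PiM UNIV (\<lambda>_. lborel))"
  proof -
    have "e UNIV z = vec_lambda z" for z by (simp add: vec_eq_iff e_nth)
    moreover have "Ind UNIV z = indicator (cbox 0 1) (vec_lambda z :: real ^ 'n)" for z
    proof (cases "\<forall>j. z j \<in> {0..1}")
      case True
      then have "Ind UNIV z = 1" unfolding Ind_def by (intro prod.neutral) auto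
      then show ?thesis using True by (auto simp: mem_box_cart)
    next
      case False
      then have "Ind UNIV z = 0" unfolding Ind_def by (auto intro!: prod_zero finite simp: indicator_def)
      then show ?thesis using False by (auto simp: mem_box_cart indicator_def)
    qed
    ultimately show ?thesis using \<open>H 0 x \<le> C ^ card UNIV * _\<close> by simp
  qed
  also have "(\<integral>\<^sup>+z. H CARD('n) (x + vec_lambda z) * indicator (cbox 0 1) (vec_lambda z :: real ^ 'n) \<partial>PiM UNIV (\<lambda>_. lborel))
     = (\<integral>\<^sup>+y. H CARD('n) (x + y) * indicator (cbox 0 1) y \<partial>lborel)"
    by (rule nn_integral_lborel_vec[symmetric]) measurable
  also have "\<dots> \<le> (\<integral>\<^sup>+y. H CARD('n) (x + 1 *\<^sub>R y) * indicator G (x + 1 *\<^sub>R y) \<partial>lborel)"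
    using sub by (intro nn_integral_mono) (auto simp: indicator_def)
  also have "\<dots> = (\<integral>\<^sup>+y. H CARD('n) y * indicator G y \<partial>lborel)"
    by (subst (2) nn_integral_lborel_affine[of _ 1 x]) auto
  finally show ?thesis by (auto simp: mult_left_mono)
qed

subsection \<open>Local inequalities of higher order\<close>

text \<open>The Minkowski sum with the cube of side \<open>k\<close>. Passing from derivatives of
  one order to the next enlarges the domain by one unit cube, so \<open>k\<close> counts the orders
  consumed.\<close>

definition thicken :: "(real ^ 'n) set \<Rightarrow> nat \<Rightarrow> (real ^ 'n) set" where
  "thicken A k = (\<Union>x\<in>A. \<Union>y\<in>cbox 0 (\<chi> i. real k). {x + y})"

lemma mem_thicken: "z \<in> thicken A k \<longleftrightarrow> (\<exists>x y. x \<in> A \<and> (\<forall>i. 0 \<le> y $ i \<and> y $ i \<le> real k) \<and> z = x + y)"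
  by (simp add: thicken_def mem_box_cart Bex_def)

lemma open_thicken: "open A \<Longrightarrow> open (thicken A k)"
  unfolding thicken_def by (rule open_sums) simp

lemma subset_thicken: "A \<subseteq> thicken A k"
proof
  fix x assume "x \<in> A"
  then show "x \<in> thicken A k" unfolding mem_thicken by (intro exI[of _ x] exI[of _ 0]) auto
qed

lemma thicken_mono: "j \<le> k \<Longrightarrow> thicken A j \<subseteq> thicken A k"
proof
  fix z assume j: "j \<le> k" and "z \<in> thicken A j"
  then obtain x y where "x \<in> A" "\<forall>i. 0 \<le> y $ i \<and> y $ i \<le> real j" "z = x + y"
    unfolding mem_thicken by blast
  moreover from this j have "0 \<le> y $ i \<and> y $ i \<le> real k" for i
    by (meson of_nat_mono order_trans)
  ultimately show "z \<in> thicken A k" unfolding mem_thicken by blast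
qed

lemma thicken_add: "x \<in> thicken A k \<Longrightarrow> y \<in> cbox 0 1 \<Longrightarrow> x + y \<in> thicken A (Suc k)"
  unfolding mem_thicken
proof (elim exE conjE)
  fix a z assume y: "y \<in> cbox 0 1" and a: "a \<in> A" "\<forall>i. 0 \<le> z $ i \<and> z $ i \<le> real k" "x = a + z"
  then have "0 \<le> (z + y) $ i \<and> (z + y) $ i \<le> real (Suc k)" for i
  proof -
    have "0 \<le> z $ i" "z $ i \<le> real k" "0 \<le> y $ i" "y $ i \<le> 1" using a y by (auto simp: mem_box_cart)
    then show ?thesis by simp
  qed
  then show "\<exists>xa ya. xa \<in> A \<and> (\<forall>i. 0 \<le> ya $ i \<and> ya $ i \<le> real (Suc k)) \<and> x + y = xa + ya"
    using a by (intro exI[of _ a] exI[of _ "z + y"]) (auto simp: add.assoc)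
qed

text \<open>In the cube of side \<open>k + 1\<close> the coordinate \<open>y $ i\<close> can be
  moved over a unit interval: up from 0 if \<open>y $ i \<le> 1\<close>, otherwise from
  \<open>y $ i - 1\<close> to \<open>y $ i\<close>. Hence \<open>t0 = min 1 (y $ i)\<close>.\<close>

lemma line_thick_thicken: "line_thick (thicken A (Suc k))"
  unfolding line_thick_def
proof (intro ballI allI)
  fix x i assume "x \<in> thicken A (Suc k)"
  then obtain a y where a: "a \<in> A" "\<forall>i. 0 \<le> y $ i \<and> y $ i \<le> real (Suc k)" "x = a + y"
    unfolding mem_thicken by blast
  define t0 where "t0 = min 1 (y $ i)"
  have "x + (t - t0) *\<^sub>R axis i 1 \<in> thicken A (Suc k)" if t: "t \<in> {0..1}" for t
    unfolding mem_thicken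
  proof (intro exI conjI allI)
    show "a \<in> A" "x + (t - t0) *\<^sub>R axis i 1 = a + (y + (t - t0) *\<^sub>R axis i 1)" using a by auto
    fix j
    have "0 \<le> y $ i" "y $ i \<le> real (Suc k)" "0 \<le> y $ j" "y $ j \<le> real (Suc k)" using a by auto
    then show "0 \<le> (y + (t - t0) *\<^sub>R axis i 1) $ j" "(y + (t - t0) *\<^sub>R axis i 1) $ j \<le> real (Suc k)"
      using t by (auto simp: axis_def t0_def min_def)
  qed
  moreover have "t0 \<in> {0..1}" using a by (auto simp: t0_def)
  ultimately show "\<exists>t0\<in>{0..1}. \<forall>t\<in>{0..1}. x + (t - t0) *\<^sub>R axis i 1 \<in> thicken A (Suc k)" by blast
qed

text \<open>All orders up to \<open>k\<close> are included, so that the sum dominates each function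
  as well as its derivatives; \<open>line_estimate\<close> needs \<open>|f| \<le> h\<close> besides
  the bound on the gradient.\<close>

definition jet_sum :: "(('n::finite \<Rightarrow> nat) \<Rightarrow> real ^ 'n \<Rightarrow> complex) \<Rightarrow> nat \<Rightarrow> real ^ 'n \<Rightarrow> real" where
  "jet_sum F k x = (\<Sum>\<beta> | order_mi \<beta> \<le> k. norm (F \<beta> x))"

text \<open>The functions \<open>F \<alpha>\<close> play the role of the derivatives of \<open>F (\<lambda>_. 0)\<close> with respect to a
  basis that need not be the standard one; only bounds on the first derivatives of each member
  by the members of the next order are recorded.\<close>

definition jets :: "nat \<Rightarrow> real \<Rightarrow> (real ^ 'n) set \<Rightarrow> (('n::finite \<Rightarrow> nat) \<Rightarrow> real ^ 'n \<Rightarrow> complex) \<Rightarrow> bool" where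
  "jets r M S F \<longleftrightarrow> (\<forall>\<alpha>. order_mi \<alpha> \<le> r \<longrightarrow> continuous_on UNIV (F \<alpha>) \<and> bounded (range (F \<alpha>))) \<and>
     (\<forall>\<alpha>. order_mi \<alpha> < r \<longrightarrow> grad_le S (F \<alpha>) (\<lambda>x. M * jet_sum F (Suc (order_mi \<alpha>)) x))"

lemma jet_sum_nonneg: "0 \<le> jet_sum F k x"
  unfolding jet_sum_def by (intro sum_nonneg) auto

lemma jet_sum_mono: "j \<le> k \<Longrightarrow> jet_sum F j x \<le> jet_sum F k x"
  unfolding jet_sum_def by (intro sum_mono2 finite_order_mi_le) auto

lemma norm_le_jet_sum: "order_mi \<alpha> \<le> k \<Longrightarrow> norm (F \<alpha> x) \<le> jet_sum F k x"
  unfolding jet_sum_def by (rule member_le_sum) (auto intro: finite_order_mi_le)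

lemma order_mi_eq_0: "order_mi \<alpha> = 0 \<longleftrightarrow> \<alpha> = (\<lambda>_. 0)"
  by (auto simp: order_mi_def)

lemma jet_sum_0: "jet_sum F 0 x = norm (F (\<lambda>_. 0) x)"
  by (simp add: jet_sum_def order_mi_eq_0)

lemma continuous_jet_sum:
  assumes "jets r M S F" "k \<le> r"
  shows "continuous_on UNIV (jet_sum F k)"
  unfolding jet_sum_def[abs_def] using assms
  by (intro continuous_intros) (auto simp: jets_def)

lemma measurable_jet_sum:
  assumes "jets r M S F" "k \<le> r"
  shows "jet_sum F k \<in> borel_measurable borel"
  using continuous_jet_sum[OF assms] by (rule borel_measurable_continuous_onI)

lemma grad_le_mono:
  assumes "grad_le S f h" "S' \<subseteq> S" "\<And>x. x \<in> S' \<Longrightarrow> h x \<le> h' x"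
  shows "grad_le S' f h'"
  using assms unfolding grad_le_def by (meson mult_left_mono norm_ge_zero order_trans subsetD)

lemma jets_grad_le:
  assumes "jets r M S F" "order_mi \<alpha> \<le> k" "k < r" "0 \<le> M"
  shows "grad_le S (F \<alpha>) (\<lambda>x. M * jet_sum F (Suc k) x)"
proof (rule grad_le_mono)
  show "grad_le S (F \<alpha>) (\<lambda>x. M * jet_sum F (Suc (order_mi \<alpha>)) x)"
    using assms by (auto simp: jets_def)
qed (use assms in \<open>auto intro!: mult_left_mono jet_sum_mono\<close>)

section \<open>Iteration over the order of the derivatives\<close>

lemma epowr_sum_le:
  assumes "finite T" "0 < b"
  shows "(\<Sum>\<alpha>\<in>T. w \<alpha> :: ennreal) epowr b \<le> of_nat (card T) epowr b * (\<Sum>\<alpha>\<in>T. w \<alpha> epowr b)"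
proof (cases "T = {}")
  case False
  define m where "m = Max (w ` T)"
  have "m \<in> w ` T" unfolding m_def using assms False by (intro Max_in) auto
  then obtain \<alpha> where \<alpha>: "\<alpha> \<in> T" "m = w \<alpha>" by auto
  have "(\<Sum>\<alpha>\<in>T. w \<alpha>) \<le> of_nat (card T) * m"
    using assms by (intro sum_bounded_above) (auto simp: m_def)
  then have "(\<Sum>\<alpha>\<in>T. w \<alpha>) epowr b \<le> of_nat (card T) epowr b * m epowr b"
    using assms by (metis epowr_mono epowr_mult less_imp_le)
  also have "m epowr b \<le> (\<Sum>\<alpha>\<in>T. w \<alpha> epowr b)"
    unfolding \<alpha>(2) using assms \<alpha>(1) by (intro member_le_sum[of \<alpha> T "\<lambda>\<alpha>. w \<alpha> epowr b"]) auto
  finally show ?thesis by (simp add: mult_left_mono)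
qed (use assms in simp)

text \<open>A substitute for Minkowski's inequality, obtained by comparing the sum with its largest
  term.\<close>

lemma eLp_sum_le:
  assumes T: "finite T" and b: "0 < b" and G [measurable]: "G \<in> sets borel"
    and [measurable]: "\<And>\<alpha>. \<alpha> \<in> T \<Longrightarrow> w \<alpha> \<in> borel_measurable borel"
    and le: "\<And>\<alpha>. \<alpha> \<in> T \<Longrightarrow> eLp b G (w \<alpha>) \<le> Z"
  shows "eLp b G (\<lambda>x. \<Sum>\<alpha>\<in>T. w \<alpha> x) \<le> of_nat (card T) * of_nat (card T) epowr (1 / b) * Z"
proof -
  have "(\<integral>\<^sup>+x. (\<Sum>\<alpha>\<in>T. w \<alpha> x) epowr b * indicator G x \<partial>lborel)
      \<le> (\<integral>\<^sup>+x. of_nat (card T) epowr b * (\<Sum>\<alpha>\<in>T. w \<alpha> x epowr b * indicator G x) \<partial>lborel)"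
    unfolding sum_distrib_right[symmetric] mult.assoc[symmetric]
    using T b by (intro nn_integral_mono mult_right_mono epowr_sum_le) auto
  also have "\<dots> = of_nat (card T) epowr b * (\<integral>\<^sup>+x. (\<Sum>\<alpha>\<in>T. w \<alpha> x epowr b * indicator G x) \<partial>lborel)"
    by (rule nn_integral_cmult) measurable
  also have "(\<integral>\<^sup>+x. (\<Sum>\<alpha>\<in>T. w \<alpha> x epowr b * indicator G x) \<partial>lborel)
      = (\<Sum>\<alpha>\<in>T. (\<integral>\<^sup>+x. w \<alpha> x epowr b * indicator G x \<partial>lborel))"
    by (rule nn_integral_sum) measurable
  also have "\<dots> \<le> (\<Sum>\<alpha>\<in>T. Z epowr b)"
  proof (rule sum_mono)
    fix \<alpha> assume "\<alpha> \<in> T"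
    from le[OF this] have "eLp b G (w \<alpha>) epowr b \<le> Z epowr b" using b by (intro epowr_mono) auto
    then show "(\<integral>\<^sup>+x. w \<alpha> x epowr b * indicator G x \<partial>lborel) \<le> Z epowr b"
      unfolding eLp_def using b by (simp add: epowr_epowr)
  qed
  finally have "eLp b G (\<lambda>x. \<Sum>\<alpha>\<in>T. w \<alpha> x) \<le> (of_nat (card T) epowr b * (of_nat (card T) * Z epowr b)) epowr (1 / b)"
    unfolding eLp_def using b by (intro epowr_mono) (auto simp: mult_left_mono)
  also have "\<dots> = of_nat (card T) * of_nat (card T) epowr (1 / b) * Z"
    using b by (simp add: epowr_mult epowr_epowr mult.assoc)
  finally show ?thesis .
qed

lemma eLp_cmult:
  assumes [measurable]: "w \<in> borel_measurable borel" "G \<in> sets borel" and b: "0 < b"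
  shows "eLp b G (\<lambda>x. c * w x) = c * eLp b G w"
  unfolding eLp_def using b
  by (simp add: epowr_mult mult.assoc nn_integral_cmult epowr_epowr)

text \<open>\<open>Gagliardo_subcritical\<close> is applied to each \<open>F \<alpha>\<close> of
  order at most \<open>j\<close> with \<open>h = M * jet_sum F (Suc j)\<close>; here
  \<open>M \<ge> 1\<close> ensures \<open>|F \<alpha>| \<le> h\<close>. The set has to be
  line-thick, so the estimate takes place on \<open>thicken A (Suc j)\<close>, one cube larger than
  on the left.\<close>

lemma Sobolev_step:
  assumes n: "2 \<le> CARD('n)" and a: "1 \<le> a" and ab: "a \<le> b" "1 / a - 1 / real CARD('n) \<le> 1 / b" and M: "1 \<le> M"
  shows "\<exists>C<top. \<forall>(F :: ('n::finite \<Rightarrow> nat) \<Rightarrow> real ^ 'n \<Rightarrow> complex) S A. jets r M S F \<longrightarrow> j < r \<longrightarrow> open A \<longrightarrow>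
     thicken A r \<subseteq> S \<longrightarrow> emeasure lborel (thicken A r) \<le> ennreal V \<longrightarrow>
     eLp b (thicken A j) (jet_sum F j) \<le> C * eLp a (thicken A (Suc j)) (jet_sum F (Suc j))"
proof -
  obtain C where C: "C < top" "\<forall>(f :: real ^ 'n \<Rightarrow> complex) h G. continuous_on UNIV f \<longrightarrow> continuous_on UNIV h \<longrightarrow> grad_le G f h \<longrightarrow>
     (\<forall>x. norm (f x) \<le> h x) \<longrightarrow> bounded (range f) \<longrightarrow> G \<in> sets borel \<longrightarrow> line_thick G \<longrightarrow>
     emeasure lborel G \<le> ennreal V \<longrightarrow>
     eLp b G (\<lambda>x. ennreal (norm (f x))) \<le> C * eLp a G (\<lambda>x. ennreal (h x))"
    using Gagliardo_subcritical[OF n a ab, of V] by (elim exE conjE) (rule that)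
  let ?T = "{\<alpha> :: 'n \<Rightarrow> nat. order_mi \<alpha> \<le> j}"
  define N where "N = of_nat (card ?T) * of_nat (card ?T) epowr (1 / b) * (C * ennreal M)"
  have "N < top" using C(1) a ab
    by (auto simp: N_def ennreal_mult_less_top ennreal_of_nat_eq_real_of_nat)
  moreover have "eLp b (thicken A j) (jet_sum F j) \<le> N * eLp a (thicken A (Suc j)) (jet_sum F (Suc j))"
    if F: "jets r M S F" and j: "j < r" and A: "open A" and S: "thicken A r \<subseteq> S"
      and V: "emeasure lborel (thicken A r) \<le> ennreal V"
    for F :: "('n \<Rightarrow> nat) \<Rightarrow> real ^ 'n \<Rightarrow> complex" and S A
  proof -
    let ?G = "thicken A (Suc j)"
    have G [measurable]: "?G \<in> sets borel" by (intro borel_open open_thicken A)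
    have [measurable]: "jet_sum F (Suc j) \<in> borel_measurable borel"
      using F j by (intro measurable_jet_sum) auto
    have GS: "?G \<subseteq> thicken A r" using j by (intro thicken_mono) auto
    have GV: "emeasure lborel ?G \<le> ennreal V"
      using emeasure_mono[OF GS, of lborel] V borel_open[OF open_thicken[OF A]] by (simp add: order_trans)
    have each: "eLp b ?G (\<lambda>x. ennreal (norm (F \<alpha> x))) \<le> C * ennreal M * eLp a ?G (jet_sum F (Suc j))"
      if \<alpha>: "\<alpha> \<in> ?T" for \<alpha>
    proof -
      have "eLp b ?G (\<lambda>x. ennreal (norm (F \<alpha> x))) \<le> C * eLp a ?G (\<lambda>x. ennreal (M * jet_sum F (Suc j) x))"
      proof (rule C(2)[rule_format])
        show "continuous_on UNIV (F \<alpha>)" "bounded (range (F \<alpha>))" using F \<alpha> j by (auto simp: jets_def)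
        show "continuous_on UNIV (\<lambda>x. M * jet_sum F (Suc j) x)"
          using F j by (intro continuous_intros continuous_jet_sum) auto
        show "grad_le ?G (F \<alpha>) (\<lambda>x. M * jet_sum F (Suc j) x)"
          using GS S F j M \<alpha> by (intro grad_le_mono[OF jets_grad_le[OF F, of \<alpha> j]]) auto
        have "norm (F \<alpha> x) \<le> 1 * jet_sum F (Suc j) x" for x using norm_le_jet_sum[of \<alpha> "Suc j" F x] \<alpha> by simp
        also have "1 * jet_sum F (Suc j) x \<le> M * jet_sum F (Suc j) x" for x
          using M by (intro mult_right_mono jet_sum_nonneg) auto
        finally show "norm (F \<alpha> x) \<le> M * jet_sum F (Suc j) x" for x .
      qed (use G GV line_thick_thicken in auto)
      also have "(\<lambda>x. ennreal (M * jet_sum F (Suc j) x)) = (\<lambda>x. ennreal M * ennreal (jet_sum F (Suc j) x))"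
        using M by (simp add: ennreal_mult')
      also have "eLp a ?G \<dots> = ennreal M * eLp a ?G (jet_sum F (Suc j))"
        using a by (intro eLp_cmult) auto
      finally show ?thesis by (simp add: mult.assoc)
    qed
    have Fm: "(\<lambda>x. ennreal (norm (F \<alpha> x))) \<in> borel_measurable borel" if "\<alpha> \<in> ?T" for \<alpha>
    proof -
      have "F \<alpha> \<in> borel_measurable borel"
        using F that j by (intro borel_measurable_continuous_onI) (auto simp: jets_def)
      then show ?thesis by measurable
    qed
    have "eLp b (thicken A j) (jet_sum F j) \<le> eLp b ?G (jet_sum F j)"
      using a ab thicken_mono[of j "Suc j" A] by (intro eLp_mono) auto
    also have "\<dots> = eLp b ?G (\<lambda>x. \<Sum>\<alpha>\<in>?T. ennreal (norm (F \<alpha> x)))"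
      by (simp add: jet_sum_def sum_ennreal)
    also have "\<dots> \<le> of_nat (card ?T) * of_nat (card ?T) epowr (1 / b) * (C * ennreal M * eLp a ?G (jet_sum F (Suc j)))"
      using a ab by (intro eLp_sum_le finite_order_mi_le each Fm G) auto
    finally show ?thesis by (simp add: N_def mult.assoc)
  qed
  ultimately show ?thesis by blast
qed

text \<open>Each order of differentiation lowers the reciprocal of the exponent by at most
  \<open>1 / n\<close>, and \<open>m\<close> orders cover the gap between \<open>1 / a\<close> and
  \<open>1 / b\<close>.\<close>

lemma Sobolev_chain:
  assumes n: "2 \<le> CARD('n)" and a: "1 \<le> a" and ab: "a \<le> b" "1 / a - real m / real CARD('n) \<le> 1 / b" and M: "1 \<le> M"
  shows "\<exists>C<top. \<forall>(F :: ('n::finite \<Rightarrow> nat) \<Rightarrow> real ^ 'n \<Rightarrow> complex) S A. jets r M S F \<longrightarrow> j + m \<le> r \<longrightarrow> open A \<longrightarrow>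
     thicken A r \<subseteq> S \<longrightarrow> emeasure lborel (thicken A r) \<le> ennreal V \<longrightarrow>
     eLp b (thicken A j) (jet_sum F j) \<le> C * eLp a (thicken A (j + m)) (jet_sum F (j + m))"
  using ab
proof (induction m arbitrary: b j)
  case 0
  then have "a = b" using a by (simp add: field_simps)
  then show ?case by (intro exI[of _ 1]) auto
next
  case (Suc m)
  define n where "n = real CARD('n)"
  have n2: "2 \<le> n" using n by (simp add: n_def)
  \<comment> \<open>The exponent after one step back from \<open>b\<close>: its reciprocal is larger
    by \<open>1 / n\<close>, but is capped at \<open>1 / a\<close> so that \<open>c\<close> stays
    above \<open>a\<close>. The cap also keeps \<open>c \<ge> 1\<close>.\<close>
  define c where "c = 1 / min (1 / a) (1 / b + 1 / n)"
  have b: "1 \<le> b" using a Suc by simp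
  have pos: "0 < 1 / a" "0 < 1 / b + 1 / n" using a b n2 by (auto intro: add_pos_pos)
  have c: "1 / c = min (1 / a) (1 / b + 1 / n)" by (simp add: c_def)
  have c0: "0 < c" unfolding c_def using pos by (simp add: min_def)
  have ac: "a \<le> c" using pos a c c0 by (metis divide_le_cancel frac_le_eq min.cobounded1 inverse_eq_divide le_imp_inverse_le inverse_le_iff_le zero_less_one_class.zero_le_one less_le_trans zero_less_one)
  have "1 / b \<le> 1 / c" unfolding c using a b n2 Suc by (auto simp: frac_le)
  then have cb: "c \<le> b" using c0 b by (simp add: field_simps)
  have s1: "1 / c - 1 / real CARD('n) \<le> 1 / b" unfolding c n_def by auto
  have s2: "1 / a - real m / real CARD('n) \<le> 1 / c"
  proof -
    have "0 \<le> real m / n" using n2 by simp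
    moreover have "1 / a - (real m / n + 1 / n) \<le> 1 / b"
      using Suc(3) by (simp add: n_def add_divide_distrib add.commute)
    ultimately show ?thesis unfolding c by (auto simp: n_def)
  qed
  obtain C1 where C1: "C1 < top" "\<forall>(F :: ('n \<Rightarrow> nat) \<Rightarrow> real ^ 'n \<Rightarrow> complex) S A. jets r M S F \<longrightarrow> j < r \<longrightarrow> open A \<longrightarrow>
     thicken A r \<subseteq> S \<longrightarrow> emeasure lborel (thicken A r) \<le> ennreal V \<longrightarrow>
     eLp b (thicken A j) (jet_sum F j) \<le> C1 * eLp c (thicken A (Suc j)) (jet_sum F (Suc j))"
    using Sobolev_step[OF n order_trans[OF a ac] cb s1 M, of r j V] by (elim exE conjE) (rule that)
  obtain C2 where C2: "C2 < top" "\<forall>(F :: ('n \<Rightarrow> nat) \<Rightarrow> real ^ 'n \<Rightarrow> complex) S A. jets r M S F \<longrightarrow> Suc j + m \<le> r \<longrightarrow> open A \<longrightarrow>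
     thicken A r \<subseteq> S \<longrightarrow> emeasure lborel (thicken A r) \<le> ennreal V \<longrightarrow>
     eLp c (thicken A (Suc j)) (jet_sum F (Suc j)) \<le> C2 * eLp a (thicken A (Suc j + m)) (jet_sum F (Suc j + m))"
    using Suc.IH[OF ac s2, of "Suc j"] by (elim exE conjE) (rule that)
  show ?case
  proof (intro exI[of _ "C1 * C2"] conjI allI impI)
    show "C1 * C2 < top" using C1 C2 by (simp add: ennreal_mult_less_top)
    fix F :: "('n \<Rightarrow> nat) \<Rightarrow> real ^ 'n \<Rightarrow> complex" and S A
    assume *: "jets r M S F" "j + Suc m \<le> r" "open A" "thicken A r \<subseteq> S" "emeasure lborel (thicken A r) \<le> ennreal V"
    have "eLp b (thicken A j) (jet_sum F j) \<le> C1 * eLp c (thicken A (Suc j)) (jet_sum F (Suc j))"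
      using * by (intro C1(2)[rule_format]) auto
    also have "\<dots> \<le> C1 * (C2 * eLp a (thicken A (Suc j + m)) (jet_sum F (Suc j + m)))"
      using * by (intro mult_left_mono C2(2)[rule_format]) auto
    finally show "eLp b (thicken A j) (jet_sum F j) \<le> C1 * C2 * eLp a (thicken A (j + Suc m)) (jet_sum F (j + Suc m))"
      by (simp add: mult.assoc)
  qed
qed

text \<open>Two independent routes to the supremum: for \<open>r \<ge> n\<close> one integration
  along each axis, and for \<open>r p > n\<close> a gain of integrability from \<open>r - 1\<close>
  derivatives followed by Morrey's inequality with the last one.\<close>

lemma Sobolev_sup:
  assumes r: "1 \<le> r" and p: "1 \<le> p" and M: "1 \<le> M" and cases: "CARD('n) \<le> r \<or> real CARD('n) / real r < p"
  shows "\<exists>C<top. \<forall>(F :: ('n::finite \<Rightarrow> nat) \<Rightarrow> real ^ 'n \<Rightarrow> complex) S A. jets r M S F \<longrightarrow> open A \<longrightarrow>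
     thicken A r \<subseteq> S \<longrightarrow> emeasure lborel (thicken A r) \<le> ennreal V \<longrightarrow>
     (\<forall>x\<in>A. ennreal (norm (F (\<lambda>_. 0) x)) \<le> C * eLp p (thicken A r) (jet_sum F r))"
proof (cases "CARD('n) \<le> r")
  case True
  \<comment> \<open>The number of summands of \<open>jet_sum\<close> times the constant
    \<open>1 + \<gamma> = 2\<close> of the line estimate and the factor \<open>M\<close> of the
    jets.\<close>
  define c where "c = of_nat (card {\<alpha> :: 'n \<Rightarrow> nat. order_mi \<alpha> \<le> r}) * ennreal (2 * M)"
  define C where "C = c ^ CARD('n) * ennreal V epowr (1 - 1 / p)"
  have "C < top" by (simp add: C_def c_def ennreal_mult_less_top power_less_top_ennreal of_nat_less_top)
  moreover have "ennreal (norm (F (\<lambda>_. 0) x)) \<le> C * eLp p (thicken A r) (jet_sum F r)"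
    if F: "jets r M S F" and A: "open A" and S: "thicken A r \<subseteq> S"
      and V: "emeasure lborel (thicken A r) \<le> ennreal V" and x: "x \<in> A"
    for F :: "('n \<Rightarrow> nat) \<Rightarrow> real ^ 'n \<Rightarrow> complex" and S A x
  proof -
    let ?G = "thicken A r"
    have G [measurable]: "?G \<in> sets borel" by (intro borel_open open_thicken A)
    \<comment> \<open>Cut off above \<open>r\<close>, where \<open>jets\<close> says nothing about
      measurability; \<open>iterated_line_bound\<close> asks for it at every index but only uses
      orders up to \<open>n \<le> r\<close>.\<close>
    define H where "H k x = (if k \<le> r then ennreal (jet_sum F k x) else 0)" for k x
    have Hm: "H k \<in> borel_measurable borel" for k
      unfolding H_def[abs_def] using measurable_jet_sum[OF F, of k] by (cases "k \<le> r") auto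
    have sub: "x + y \<in> S \<inter> ?G" if "y \<in> cbox 0 1" for y
    proof -
      have "x + y \<in> thicken A (Suc 0)" using subset_thicken x that by (intro thicken_add) auto
      also have "\<dots> \<subseteq> thicken A r" using r by (intro thicken_mono) auto
      finally show ?thesis using S by auto
    qed
    have step: "H k y \<le> c * (\<integral>\<^sup>+t. H (Suc k) (y + t *\<^sub>R axis i 1) * indicator {0..1} t \<partial>lborel)"
      if k: "k < CARD('n)" and seg: "\<And>t. t \<in> {0..1} \<Longrightarrow> y + t *\<^sub>R axis i 1 \<in> S" for k y i
    proof -
      have kr: "k < r" "Suc k \<le> r" using k True by auto
      let ?I = "\<integral>\<^sup>+t. H (Suc k) (y + t *\<^sub>R axis i 1) * indicator {0..1} t \<partial>lborel"
      note Hm[measurable]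
      have each: "ennreal (norm (F \<alpha> y)) \<le> ennreal (2 * M) * ?I" if \<alpha>: "order_mi \<alpha> \<le> k" for \<alpha>
      proof -
        have "ennreal (norm (F \<alpha> (y + 0 *\<^sub>R axis i 1))) epowr 1 \<le> ennreal (1 + 1) *
          (\<integral>\<^sup>+t. (ennreal (norm (F \<alpha> (y + t *\<^sub>R axis i 1))) epowr (1 - 1) *
             ennreal (M * jet_sum F (Suc k) (y + t *\<^sub>R axis i 1))) * indicator {0..1} t \<partial>lborel)"
        proof (rule line_estimate)
          show "continuous_on UNIV (F \<alpha>)" using F \<alpha> kr by (auto simp: jets_def)
          show "continuous_on UNIV (\<lambda>x. M * jet_sum F (Suc k) x)"
            using F kr by (intro continuous_intros continuous_jet_sum) auto
          show "grad_le S (F \<alpha>) (\<lambda>x. M * jet_sum F (Suc k) x)"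
            using kr \<alpha> M by (intro jets_grad_le[OF F]) auto
          have "norm (F \<alpha> x) \<le> 1 * jet_sum F (Suc k) x" for x using norm_le_jet_sum[of \<alpha> "Suc k" F x] \<alpha> by simp
          also have "1 * jet_sum F (Suc k) x \<le> M * jet_sum F (Suc k) x" for x
            using M by (intro mult_right_mono jet_sum_nonneg) auto
          finally show "norm (F \<alpha> x) \<le> M * jet_sum F (Suc k) x" for x .
        qed (use seg in auto)
        also have "(\<integral>\<^sup>+t. (ennreal (norm (F \<alpha> (y + t *\<^sub>R axis i 1))) epowr (1 - 1) *
             ennreal (M * jet_sum F (Suc k) (y + t *\<^sub>R axis i 1))) * indicator {0..1} t \<partial>lborel)
           = (\<integral>\<^sup>+t. ennreal M * (H (Suc k) (y + t *\<^sub>R axis i 1) * indicator {0..1} t) \<partial>lborel)"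
          using M kr by (intro nn_integral_cong) (simp add: H_def ennreal_mult' mult.assoc)
        also have "\<dots> = ennreal M * ?I" by (rule nn_integral_cmult) measurable
        finally show ?thesis using M by (simp add: ennreal_mult' mult.assoc)
      qed
      have "H k y = (\<Sum>\<alpha> | order_mi \<alpha> \<le> k. ennreal (norm (F \<alpha> y)))"
        using kr by (simp add: H_def jet_sum_def sum_ennreal)
      also have "\<dots> \<le> of_nat (card {\<alpha> :: 'n \<Rightarrow> nat. order_mi \<alpha> \<le> k}) * (ennreal (2 * M) * ?I)"
        using each by (intro sum_bounded_above) auto
      also have "\<dots> \<le> of_nat (card {\<alpha> :: 'n \<Rightarrow> nat. order_mi \<alpha> \<le> r}) * (ennreal (2 * M) * ?I)"
        using kr by (intro mult_right_mono of_nat_mono card_mono finite_order_mi_le) auto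
      finally show ?thesis by (simp add: c_def mult.assoc)
    qed
    have "H 0 x \<le> c ^ CARD('n) * (\<integral>\<^sup>+y. H CARD('n) y * indicator ?G y \<partial>lborel)"
      by (rule iterated_line_bound[where S = S]) (fact Hm G step sub)+
    also have "(\<integral>\<^sup>+y. H CARD('n) y * indicator ?G y \<partial>lborel) = eLp 1 ?G (H CARD('n))"
      by (simp add: eLp_def)
    also have "\<dots> \<le> eLp 1 ?G (jet_sum F r)"
      using True by (intro eLp_mono) (auto simp: H_def intro!: ennreal_leI jet_sum_mono)
    also have "\<dots> \<le> emeasure lborel ?G epowr (1 / 1 - 1 / p) * eLp p ?G (jet_sum F r)"
      using p measurable_jet_sum[OF F] by (intro eLp_exponent_mono) auto
    also have "\<dots> \<le> ennreal V epowr (1 / 1 - 1 / p) * eLp p ?G (jet_sum F r)"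
      using p V by (intro mult_right_mono epowr_mono) auto
    finally show ?thesis by (simp add: C_def H_def jet_sum_0 mult.assoc mult_left_mono)
  qed
  ultimately show ?thesis by blast
next
  case False
  define n where "n = real CARD('n)"
  have n2: "2 \<le> CARD('n)" using False r by simp
  then have n0: "2 \<le> n" by (simp add: n_def)
  have pn: "1 / p < real r / n" using cases False p n0 r by (simp add: field_simps n_def)
  \<comment> \<open>Morrey's inequality needs \<open>1 / b < 1 / n\<close>, the chain of length
    \<open>r - 1\<close> needs \<open>1 / b \<ge> 1 / p - (r - 1) / n\<close>. The number
    \<open>y\<close> is this lower bound made nonnegative; \<open>r p > n\<close> says that it is
    below \<open>1 / n\<close>, and the midpoint, capped at \<open>1 / p\<close>, serves as
    \<open>1 / b\<close>.\<close>
  define y where "y = max 0 (1 / p - (real r - 1) / n)"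
  have y: "0 \<le> y" "y < 1 / n" "1 / p - (real r - 1) / n \<le> y"
    using pn n0 by (auto simp: y_def diff_divide_distrib)
  define b where "b = 1 / min (1 / p) ((y + 1 / n) / 2)"
  have b: "1 / b = min (1 / p) ((y + 1 / n) / 2)" by (simp add: b_def)
  have mpos: "0 < min (1 / p) ((y + 1 / n) / 2)" using p y n0 by (auto intro!: add_nonneg_pos)
  then have b0: "0 < b" by (simp add: b_def)
  have half: "(y + w) / 2 < w \<and> y \<le> (y + w) / 2" if "y < w" for w :: real using that by auto
  have y2: "(y + 1 / n) / 2 < 1 / n" "y \<le> (y + 1 / n) / 2" using half[OF y(2)] by auto
  then have "1 / b < 1 / n" unfolding b by (simp only: min_less_iff_disj simp_thms)
  then have nb: "real CARD('n) < b" using b0 n0 by (simp add: field_simps n_def)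
  have "1 / b \<le> 1 / p" unfolding b by simp
  then have pb: "p \<le> b" using b0 p by (simp add: field_simps)
  have chain: "1 / p - real (r - 1) / real CARD('n) \<le> 1 / b"
  proof -
    have "0 \<le> (real r - 1) / n" using r n0 by simp
    then have "1 / p - (real r - 1) / n \<le> 1 / p" by linarith
    moreover have "1 / p - (real r - 1) / n \<le> (y + 1 / n) / 2" using y(3) y2(2) by linarith
    moreover have "real (r - 1) = real r - 1" using r by simp
    ultimately show ?thesis unfolding b n_def[symmetric] by (simp only: min.bounded_iff simp_thms)
  qed
  obtain C1 where C1: "C1 < top" "\<forall>(f :: real ^ 'n \<Rightarrow> complex) h S G x. continuous_on UNIV f \<longrightarrow> continuous_on UNIV h \<longrightarrow> grad_le S f h \<longrightarrow>
     (\<forall>x. norm (f x) \<le> h x) \<longrightarrow> (\<forall>y\<in>cbox 0 1. x + y \<in> S \<inter> G) \<longrightarrow> G \<in> sets borel \<longrightarrow>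
     ennreal (norm (f x)) \<le> C1 * eLp b G (\<lambda>x. ennreal (h x))"
    using Morrey_inequality[OF nb] by (elim exE conjE) (rule that)
  obtain C2 where C2: "C2 < top" "\<forall>(F :: ('n \<Rightarrow> nat) \<Rightarrow> real ^ 'n \<Rightarrow> complex) S A. jets r M S F \<longrightarrow> Suc 0 + (r - 1) \<le> r \<longrightarrow> open A \<longrightarrow>
     thicken A r \<subseteq> S \<longrightarrow> emeasure lborel (thicken A r) \<le> ennreal V \<longrightarrow>
     eLp b (thicken A (Suc 0)) (jet_sum F (Suc 0)) \<le> C2 * eLp p (thicken A (Suc 0 + (r - 1))) (jet_sum F (Suc 0 + (r - 1)))"
    using Sobolev_chain[OF n2 p pb chain M, of r "Suc 0" V] by (elim exE conjE) (rule that)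
  have "ennreal (norm (F (\<lambda>_. 0) x)) \<le> (C1 * (ennreal M * C2)) * eLp p (thicken A r) (jet_sum F r)"
    if F: "jets r M S F" and A: "open A" and S: "thicken A r \<subseteq> S"
      and V: "emeasure lborel (thicken A r) \<le> ennreal V" and x: "x \<in> A"
    for F :: "('n \<Rightarrow> nat) \<Rightarrow> real ^ 'n \<Rightarrow> complex" and S A x
  proof -
    let ?G = "thicken A (Suc 0)"
    have G [measurable]: "?G \<in> sets borel" by (intro borel_open open_thicken A)
    have [measurable]: "jet_sum F (Suc 0) \<in> borel_measurable borel"
      using F r by (intro measurable_jet_sum) auto
    have "ennreal (norm (F (\<lambda>_. 0) x)) \<le> C1 * eLp b ?G (\<lambda>x. ennreal (M * jet_sum F (Suc 0) x))"
    proof (rule C1(2)[rule_format])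
      show "continuous_on UNIV (F (\<lambda>_. 0))" using F by (auto simp: jets_def order_mi_def)
      show "continuous_on UNIV (\<lambda>x. M * jet_sum F (Suc 0) x)"
        using F r by (intro continuous_intros continuous_jet_sum) auto
      show "grad_le S (F (\<lambda>_. 0)) (\<lambda>x. M * jet_sum F (Suc 0) x)"
        using r M by (intro jets_grad_le[OF F]) (auto simp: order_mi_def)
      have "norm (F (\<lambda>_. 0) x) \<le> 1 * jet_sum F (Suc 0) x" for x
        using norm_le_jet_sum[of "\<lambda>_. 0" "Suc 0" F x] by (simp add: order_mi_def)
      also have "1 * jet_sum F (Suc 0) x \<le> M * jet_sum F (Suc 0) x" for x
        using M by (intro mult_right_mono jet_sum_nonneg) auto
      finally show "norm (F (\<lambda>_. 0) x) \<le> M * jet_sum F (Suc 0) x" for x .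
      fix y :: "real ^ 'n" assume "y \<in> cbox 0 1"
      then have "x + y \<in> ?G" using subset_thicken x by (intro thicken_add) auto
      moreover have "?G \<subseteq> thicken A r" using r by (intro thicken_mono) auto
      ultimately show "x + y \<in> S \<inter> ?G" using S by auto
    qed (rule G)
    also have "(\<lambda>x. ennreal (M * jet_sum F (Suc 0) x)) = (\<lambda>x. ennreal M * ennreal (jet_sum F (Suc 0) x))"
      using M by (simp add: ennreal_mult')
    also have "eLp b ?G \<dots> = ennreal M * eLp b ?G (jet_sum F (Suc 0))"
      using b0 by (intro eLp_cmult) auto
    also have "eLp b ?G (jet_sum F (Suc 0)) \<le> C2 * eLp p (thicken A (Suc 0 + (r - 1))) (jet_sum F (Suc 0 + (r - 1)))"
      using r by (intro C2(2)[rule_format, OF F _ A S V]) auto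
    finally show ?thesis using r by (simp add: mult.assoc mult_left_mono)
  qed
  moreover have "C1 * (ennreal M * C2) < top" using C1 C2 by (simp add: ennreal_mult_less_top)
  ultimately show ?thesis by blast
qed

lemma epowr_less_top: "x < top \<Longrightarrow> x epowr a < top"
  by (cases x) (auto simp: epowr_def)

text \<open>With a bound for the supremum, \<open>|u|^p\<close> is taken out and Hoelder on the
  bounded measure of \<open>A\<close> handles \<open>\<gamma>^p\<close>. Otherwise Hoelder pairs
  \<open>\<gamma>\<close> in the power \<open>q\<close> with \<open>u\<close> in the power
  \<open>t\<close>, and the \<open>t\<close>-norm comes from a chain of \<open>r\<close>
  steps.\<close>

lemma Sobolev_local_cube:
  assumes r: "1 \<le> r" and p: "1 \<le> p" "p \<le> q" and q: "real CARD('n) / real r \<le> q"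
    and crit: "real CARD('n) / real r = p \<and> 1 < p \<longrightarrow> real CARD('n) / real r < q" and M: "1 \<le> M"
  shows "\<exists>C<top. \<forall>(F :: ('n::finite \<Rightarrow> nat) \<Rightarrow> real ^ 'n \<Rightarrow> complex) S A \<gamma>. jets r M S F \<longrightarrow> open A \<longrightarrow>
     thicken A r \<subseteq> S \<longrightarrow> emeasure lborel (thicken A r) \<le> ennreal V \<longrightarrow> \<gamma> \<in> borel_measurable borel \<longrightarrow>
     (\<integral>\<^sup>+x. (\<gamma> x * ennreal (norm (F (\<lambda>_. 0) x))) epowr p * indicator A x \<partial>lborel)
     \<le> C * (\<integral>\<^sup>+x. \<gamma> x epowr q * indicator A x \<partial>lborel) epowr (p / q) *
         (\<integral>\<^sup>+x. ennreal (jet_sum F r x) epowr p * indicator (thicken A r) x \<partial>lborel)"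
proof (cases "CARD('n) \<le> r \<or> real CARD('n) / real r < p")
  case True
  obtain C where C: "C < top" "\<forall>(F :: ('n::finite \<Rightarrow> nat) \<Rightarrow> real ^ 'n \<Rightarrow> complex) S A. jets r M S F \<longrightarrow> open A \<longrightarrow>
     thicken A r \<subseteq> S \<longrightarrow> emeasure lborel (thicken A r) \<le> ennreal V \<longrightarrow>
     (\<forall>x\<in>A. ennreal (norm (F (\<lambda>_. 0) x)) \<le> C * eLp p (thicken A r) (jet_sum F r))"
    using Sobolev_sup[OF r p(1) M True, of V] by (elim exE conjE) (rule that)
  define D where "D = C epowr p * ennreal V epowr (1 - p / q)"
  have "D < top" using C(1) p by (auto simp: D_def ennreal_mult_less_top epowr_less_top)
  moreover have "(\<integral>\<^sup>+x. (\<gamma> x * ennreal (norm (F (\<lambda>_. 0) x))) epowr p * indicator A x \<partial>lborel)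
     \<le> D * (\<integral>\<^sup>+x. \<gamma> x epowr q * indicator A x \<partial>lborel) epowr (p / q) *
         (\<integral>\<^sup>+x. ennreal (jet_sum F r x) epowr p * indicator (thicken A r) x \<partial>lborel)"
    if F: "jets r M S F" and A: "open A" and S: "thicken A r \<subseteq> S"
      and V: "emeasure lborel (thicken A r) \<le> ennreal V" and [measurable]: "\<gamma> \<in> borel_measurable borel"
    for F :: "('n \<Rightarrow> nat) \<Rightarrow> real ^ 'n \<Rightarrow> complex" and S A \<gamma>
  proof -
    define J where "J = (\<integral>\<^sup>+x. ennreal (jet_sum F r x) epowr p * indicator (thicken A r) x \<partial>lborel)"
    have [measurable]: "A \<in> sets borel" using A by simp
    have AV: "emeasure lborel A \<le> ennreal V"
      using emeasure_mono[OF subset_thicken, of A r lborel] V borel_open[OF open_thicken[OF A]] by (simp add: order_trans)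
    have sup: "ennreal (norm (F (\<lambda>_. 0) x)) epowr p \<le> C epowr p * J" if "x \<in> A" for x
    proof -
      have "ennreal (norm (F (\<lambda>_. 0) x)) \<le> C * eLp p (thicken A r) (jet_sum F r)"
        using C(2) F A S V that by blast
      then have "ennreal (norm (F (\<lambda>_. 0) x)) epowr p \<le> (C * eLp p (thicken A r) (jet_sum F r)) epowr p"
        using p by (intro epowr_mono) auto
      also have "\<dots> = C epowr p * J"
        using p by (simp add: eLp_def J_def epowr_mult epowr_epowr)
      finally show ?thesis .
    qed
    have "(\<integral>\<^sup>+x. (\<gamma> x * ennreal (norm (F (\<lambda>_. 0) x))) epowr p * indicator A x \<partial>lborel)
       \<le> (\<integral>\<^sup>+x. C epowr p * J * ((\<gamma> x epowr q * indicator A x) epowr (p / q) * indicator A x epowr (1 - p / q)) \<partial>lborel)"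
    proof (intro nn_integral_mono)
      fix x
      show "(\<gamma> x * ennreal (norm (F (\<lambda>_. 0) x))) epowr p * indicator A x
        \<le> C epowr p * J * ((\<gamma> x epowr q * indicator A x) epowr (p / q) * indicator A x epowr (1 - p / q))"
      proof (cases "x \<in> A")
        case True
        have "(\<gamma> x * ennreal (norm (F (\<lambda>_. 0) x))) epowr p = ennreal (norm (F (\<lambda>_. 0) x)) epowr p * \<gamma> x epowr p"
          using p by (simp add: epowr_mult mult.commute)
        also have "\<dots> \<le> C epowr p * J * \<gamma> x epowr p"
          using sup[OF True] by (rule mult_right_mono) simp
        finally show ?thesis using True p by (simp add: epowr_epowr)
      qed simp
    qed
    also have "\<dots> = C epowr p * J * (\<integral>\<^sup>+x. (\<gamma> x epowr q * indicator A x) epowr (p / q) * indicator A x epowr (1 - p / q) \<partial>lborel)"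
      by (rule nn_integral_cmult) measurable
    finally have main: "(\<integral>\<^sup>+x. (\<gamma> x * ennreal (norm (F (\<lambda>_. 0) x))) epowr p * indicator A x \<partial>lborel)
      \<le> C epowr p * J * (\<integral>\<^sup>+x. (\<gamma> x epowr q * indicator A x) epowr (p / q) * indicator A x epowr (1 - p / q) \<partial>lborel)" .
    have "(\<integral>\<^sup>+x. (\<gamma> x epowr q * indicator A x) epowr (p / q) * indicator A x epowr (1 - p / q) \<partial>lborel)
       \<le> (\<integral>\<^sup>+x. \<gamma> x epowr q * indicator A x \<partial>lborel) epowr (p / q) * (\<integral>\<^sup>+x. indicator A x \<partial>lborel) epowr (1 - p / q)"
      using p by (intro nn_integral_Holder2) auto
    also have "\<dots> \<le> (\<integral>\<^sup>+x. \<gamma> x epowr q * indicator A x \<partial>lborel) epowr (p / q) * ennreal V epowr (1 - p / q)"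
      using AV p by (intro mult_left_mono epowr_mono) auto
    finally have "C epowr p * J * (\<integral>\<^sup>+x. (\<gamma> x epowr q * indicator A x) epowr (p / q) * indicator A x epowr (1 - p / q) \<partial>lborel)
      \<le> C epowr p * J * ((\<integral>\<^sup>+x. \<gamma> x epowr q * indicator A x \<partial>lborel) epowr (p / q) * ennreal V epowr (1 - p / q))"
      by (rule mult_left_mono) simp
    from order_trans[OF main this] show ?thesis by (simp add: D_def J_def mult_ac)
  qed
  ultimately show ?thesis by blast
next
  case False
  have n2: "2 \<le> CARD('n)" using False r by simp
  \<comment> \<open>If \<open>p = q\<close>, the assumption on \<open>q\<close> and the failure of
    both alternatives force \<open>n / r = p\<close>; then \<open>crit\<close> leaves only
    \<open>p = 1\<close>, that is \<open>n = r\<close>, which the first alternative covers.\<close>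
  have pq: "p < q"
  proof (rule ccontr)
    assume "\<not> p < q"
    then have "p = q" using p by simp
    then have eq: "real CARD('n) / real r = p" using False q by simp
    then have "p = 1" using crit \<open>p = q\<close> p by auto
    then show False using eq False r by (simp add: field_simps)
  qed
  \<comment> \<open>The Hoelder partner of \<open>q\<close>. The chain reaches it because
    \<open>q \<ge> n / r\<close> means
    \<open>1 / p - r / n \<le> 1 / p - 1 / q = 1 / t\<close>.\<close>
  define t where "t = 1 / (1 / p - 1 / q)"
  have pt: "0 < 1 / p - 1 / q" using pq p by (simp add: field_simps)
  then have t0: "0 < t" by (simp add: t_def)
  have t1: "1 / t = 1 / p - 1 / q" by (simp add: t_def)
  have "1 / t \<le> 1 / p" unfolding t1 using p by simp
  then have tp: "p \<le> t" using t0 p by (simp add: field_simps)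
  have rn: "1 / q \<le> real r / real CARD('n)" using q p r n2 by (simp add: field_simps)
  have s: "1 / p - real r / real CARD('n) \<le> 1 / t" unfolding t1 using rn by simp
  have ptq: "p / q + p / t = 1" 
  proof -
    have "p / q + p / t = p * (1 / q + 1 / t)" by (simp add: field_simps)
    then show ?thesis unfolding t1 using p by simp
  qed
  obtain C where C: "C < top" "\<forall>(F :: ('n::finite \<Rightarrow> nat) \<Rightarrow> real ^ 'n \<Rightarrow> complex) S A. jets r M S F \<longrightarrow> 0 + r \<le> r \<longrightarrow> open A \<longrightarrow>
     thicken A r \<subseteq> S \<longrightarrow> emeasure lborel (thicken A r) \<le> ennreal V \<longrightarrow>
     eLp t (thicken A 0) (jet_sum F 0) \<le> C * eLp p (thicken A (0 + r)) (jet_sum F (0 + r))"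
    using Sobolev_chain[OF n2 p(1) tp s M, of r 0 V] by (elim exE conjE) (rule that)
  define D where "D = C epowr p"
  have "D < top" using C(1) p by (auto simp: D_def epowr_less_top)
  moreover have "(\<integral>\<^sup>+x. (\<gamma> x * ennreal (norm (F (\<lambda>_. 0) x))) epowr p * indicator A x \<partial>lborel)
     \<le> D * (\<integral>\<^sup>+x. \<gamma> x epowr q * indicator A x \<partial>lborel) epowr (p / q) *
         (\<integral>\<^sup>+x. ennreal (jet_sum F r x) epowr p * indicator (thicken A r) x \<partial>lborel)"
    if F: "jets r M S F" and A: "open A" and S: "thicken A r \<subseteq> S"
      and V: "emeasure lborel (thicken A r) \<le> ennreal V" and [measurable]: "\<gamma> \<in> borel_measurable borel"
    for F :: "('n \<Rightarrow> nat) \<Rightarrow> real ^ 'n \<Rightarrow> complex" and S A \<gamma>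
  proof -
    define J where "J = (\<integral>\<^sup>+x. ennreal (jet_sum F r x) epowr p * indicator (thicken A r) x \<partial>lborel)"
    have [measurable]: "A \<in> sets borel" using A by simp
    have [measurable]: "F (\<lambda>_. 0) \<in> borel_measurable borel"
      using F by (intro borel_measurable_continuous_onI) (auto simp: jets_def order_mi_def)
    define u where "u x = ennreal (norm (F (\<lambda>_. 0) x))" for x
    have [measurable]: "u \<in> borel_measurable borel" unfolding u_def[abs_def] by measurable
    have main: "(\<integral>\<^sup>+x. (\<gamma> x * u x) epowr p * indicator A x \<partial>lborel)
       \<le> (\<integral>\<^sup>+x. \<gamma> x epowr q * indicator A x \<partial>lborel) epowr (p / q) * (\<integral>\<^sup>+x. u x epowr t * indicator A x \<partial>lborel) epowr (p / t)"
    proof -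
      have "(\<integral>\<^sup>+x. (\<gamma> x * u x) epowr p * indicator A x \<partial>lborel)
       = (\<integral>\<^sup>+x. (\<gamma> x epowr q * indicator A x) epowr (p / q) * (u x epowr t * indicator A x) epowr (p / t) \<partial>lborel)"
      using p t0 by (intro nn_integral_cong) (auto simp: epowr_mult epowr_epowr indicator_def)
    also have "\<dots> \<le> (\<integral>\<^sup>+x. \<gamma> x epowr q * indicator A x \<partial>lborel) epowr (p / q) * (\<integral>\<^sup>+x. u x epowr t * indicator A x \<partial>lborel) epowr (p / t)"
      using p t0 ptq by (intro nn_integral_Holder2) auto
    finally show ?thesis .
    qed
    have "(\<integral>\<^sup>+x. u x epowr t * indicator A x \<partial>lborel) epowr (p / t) = eLp t A u epowr p"
      using p t0 by (simp add: eLp_def epowr_epowr)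
    also have "\<dots> \<le> eLp t (thicken A 0) (jet_sum F 0) epowr p"
      using p t0 subset_thicken[of A 0] by (intro epowr_mono eLp_mono) (auto simp: jet_sum_0 u_def)
    also have "\<dots> \<le> (C * eLp p (thicken A (0 + r)) (jet_sum F (0 + r))) epowr p"
      using p F A S V by (intro epowr_mono C(2)[rule_format]) auto
    also have "\<dots> = D * J"
      using p by (simp add: eLp_def J_def D_def epowr_mult epowr_epowr)
    finally have "(\<integral>\<^sup>+x. \<gamma> x epowr q * indicator A x \<partial>lborel) epowr (p / q) * (\<integral>\<^sup>+x. u x epowr t * indicator A x \<partial>lborel) epowr (p / t)
      \<le> (\<integral>\<^sup>+x. \<gamma> x epowr q * indicator A x \<partial>lborel) epowr (p / q) * (D * J)"
      by (rule mult_left_mono) simp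
    from order_trans[OF main this] show ?thesis by (simp add: J_def u_def mult_ac)
  qed
  ultimately show ?thesis by blast
qed

subsection \<open>Linear images of cubes\<close>

text \<open>The change of variables formula for linear maps in the library needs a well-ordered index type; this form
  follows from the uniqueness of translation invariant measures.\<close>

lemma nn_integral_lborel_linear:
  fixes L :: "'a::euclidean_space \<Rightarrow> 'a"
  assumes "linear L" "inj L"
  shows "\<exists>c>0. \<forall>f\<in>borel_measurable borel. (\<integral>\<^sup>+x. f (L x) \<partial>lborel) = ennreal c * (\<integral>\<^sup>+x. f x \<partial>lborel)"
proof -
  obtain L' where L': "linear L'" "\<And>x. L' (L x) = x" "\<And>x. L (L' x) = x"
    using linear_injective_isomorphism[OF assms] by blast
  have cont [measurable]: "L \<in> borel_measurable borel" "L' \<in> borel_measurable borel"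
    using assms(1) L'(1) by (auto intro!: borel_measurable_continuous_onI linear_continuous_on simp: linear_conv_bounded_linear)
  define Q :: "'a set" where "Q = ball 0 1"
  have Q [measurable]: "Q \<in> sets borel" by (simp add: Q_def)
  define k where "k = emeasure lborel Q"
  define c where "c = (\<integral>\<^sup>+x. indicator Q (- L x) \<partial>lborel)"
  have k: "k \<noteq> 0" "k \<noteq> top" unfolding k_def Q_def
    using emeasure_lborel_ball_finite[of "0::'a" 1] content_ball_pos[of 1 "0::'a"]
    by (auto simp: measure_def)
  \<comment> \<open>The double integral of \<open>f (L x)\<close> times the indicator of
    \<open>Q\<close> at \<open>y - L x\<close> is computed in two orders. Integrating over
    \<open>y\<close> first gives the volume of \<open>Q\<close>; shifting \<open>x\<close> by
    \<open>L' y\<close> first turns \<open>f (L x)\<close> into \<open>f (L x + y)\<close> and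
    leaves the constant \<open>c\<close>.\<close>
  have main: "(\<integral>\<^sup>+x. f (L x) \<partial>lborel) * k = c * (\<integral>\<^sup>+x. f x \<partial>lborel)"
    if [measurable]: "f \<in> borel_measurable borel" for f
  proof -
    have trans: "(\<integral>\<^sup>+y. g (z + y) \<partial>lborel) = (\<integral>\<^sup>+y. g y \<partial>lborel)" if "g \<in> borel_measurable borel" for g :: "'a \<Rightarrow> ennreal" and z
      using nn_integral_lborel_affine[OF that, of 1 z] by simp
    have "(\<integral>\<^sup>+x. f (L x) \<partial>lborel) * k = (\<integral>\<^sup>+x. f (L x) * (\<integral>\<^sup>+y. indicator Q (- L x + y) \<partial>lborel) \<partial>lborel)"
      by (subst trans) (auto simp: nn_integral_multc k_def)
    also have "\<dots> = (\<integral>\<^sup>+x. (\<integral>\<^sup>+y. f (L x) * indicator Q (- L x + y) \<partial>lborel) \<partial>lborel)"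
      by (simp add: nn_integral_cmult)
    also have "\<dots> = (\<integral>\<^sup>+y. (\<integral>\<^sup>+x. f (L x) * indicator Q (- L x + y) \<partial>lborel) \<partial>lborel)"
      by (rule lborel_pair.Fubini'[symmetric]) measurable
    also have "\<dots> = (\<integral>\<^sup>+y. (\<integral>\<^sup>+x. f (L (L' y + x)) * indicator Q (- L (L' y + x) + y) \<partial>lborel) \<partial>lborel)"
    proof (rule nn_integral_cong)
      fix y
      show "(\<integral>\<^sup>+x. f (L x) * indicator Q (- L x + y) \<partial>lborel)
          = (\<integral>\<^sup>+x. f (L (L' y + x)) * indicator Q (- L (L' y + x) + y) \<partial>lborel)"
        using trans[of "\<lambda>x. f (L x) * indicator Q (- L x + y)" "L' y"] by simp
    qed
    also have "\<dots> = (\<integral>\<^sup>+y. (\<integral>\<^sup>+x. f (L x + y) * indicator Q (- L x) \<partial>lborel) \<partial>lborel)"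
      using assms(1) L' by (simp add: linear_add add.commute)
    also have "\<dots> = (\<integral>\<^sup>+x. (\<integral>\<^sup>+y. f (L x + y) * indicator Q (- L x) \<partial>lborel) \<partial>lborel)"
      by (rule lborel_pair.Fubini') measurable
    also have "\<dots> = (\<integral>\<^sup>+x. (\<integral>\<^sup>+y. f y \<partial>lborel) * indicator Q (- L x) \<partial>lborel)"
      by (intro nn_integral_cong) (simp add: nn_integral_multc trans)
    also have "\<dots> = c * (\<integral>\<^sup>+x. f x \<partial>lborel)"
      by (simp add: nn_integral_cmult c_def mult.commute)
    finally show ?thesis .
  qed
  obtain B where B: "0 < B" "\<And>x. norm (L' x) \<le> B * norm x"
    using linear_bounded_pos[OF L'(1)] by blast
  have "c \<le> (\<integral>\<^sup>+x. indicator (ball (0::'a) (B + 1)) x \<partial>lborel)"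
    unfolding c_def
  proof (intro nn_integral_mono)
    fix x
    have "norm x < B + 1" if "- L x \<in> Q"
    proof -
      have "norm x \<le> B * norm (L x)" using B(2)[of "L x"] L' by simp
      also have "\<dots> \<le> B * 1" using that B by (intro mult_left_mono) (auto simp: Q_def)
      finally show ?thesis by simp
    qed
    then show "indicator Q (- L x) \<le> (indicator (ball 0 (B + 1)) x :: ennreal)" by (auto simp: indicator_def)
  qed
  also have "\<dots> < top" using emeasure_lborel_ball_finite by (simp add: less_top)
  finally have ctop: "c \<noteq> top" by simp
  have c0: "c \<noteq> 0"
  proof
    assume "c = 0"
    with main[of "indicator UNIV"] k have "emeasure lborel (UNIV :: 'a set) = 0" by simp
    then show False by simp
  qed
  define C where "C = enn2real (c / k)"
  have "c / k \<noteq> 0" "c / k \<noteq> top" using c0 ctop k by (auto simp: ennreal_divide_eq_top_iff divide_eq_0_iff ennreal_divide_eq_0_iff)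
  then have C: "ennreal C = c / k" "0 < C"
    by (auto simp: C_def less_top enn2real_positive_iff zero_less_iff_neq_zero)
  have "(\<integral>\<^sup>+x. f (L x) \<partial>lborel) = ennreal C * (\<integral>\<^sup>+x. f x \<partial>lborel)" if "f \<in> borel_measurable borel" for f
  proof -
    have "(\<integral>\<^sup>+x. f (L x) \<partial>lborel) = (\<integral>\<^sup>+x. f (L x) \<partial>lborel) * k / k"
      using k by (simp add: ennreal_mult_divide_eq)
    also have "\<dots> = c * (\<integral>\<^sup>+x. f x \<partial>lborel) / k" using main[OF that] by simp
    also have "\<dots> = ennreal C * (\<integral>\<^sup>+x. f x \<partial>lborel)"
      unfolding C by (simp add: divide_ennreal_def mult_ac)
    finally show ?thesis .
  qed
  with C(2) show ?thesis by blast
qed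

lemma emeasure_lborel_ball_translate: "emeasure lborel (ball (z :: 'a) R) = emeasure lborel (ball (0 :: 'a::euclidean_space) R)"
proof -
  have "emeasure lborel (ball z R) = (\<integral>\<^sup>+y. indicator (ball z R) y \<partial>lborel)" by simp
  also have "\<dots> = (\<integral>\<^sup>+y. indicator (ball z R) (z + y) \<partial>lborel)"
    by (subst nn_integral_lborel_affine[of _ 1 z]) (auto intro!: borel_measurable_indicator)
  also have "(\<lambda>y. indicator (ball z R) (z + y) :: ennreal) = indicator (ball 0 R)"
    by (auto simp: indicator_def dist_norm)
  finally show ?thesis by simp
qed

text \<open>Everything is pulled back by \<open>L\<close>, which makes the parallelepiped a cube and
  multiplies gradients by at most the bound \<open>K\<close> of \<open>L\<close>. Confining
  \<open>A\<close> to a ball of radius \<open>R\<close> bounds the volume of the thickened set for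
  all centres \<open>z\<close> at once, so \<open>C\<close> does not depend on
  \<open>z\<close>.\<close>

lemma Sobolev_local:
  fixes L :: "real ^ 'n \<Rightarrow> real ^ 'n"
  assumes L: "linear L" "inj L"
    and r: "1 \<le> r" and p: "1 \<le> p" "p \<le> q" and q: "real CARD('n) / real r \<le> q"
    and crit: "real CARD('n) / real r = p \<and> 1 < p \<longrightarrow> real CARD('n) / real r < q" and M: "1 \<le> M"
  shows "\<exists>C<top. \<forall>(F :: ('n::finite \<Rightarrow> nat) \<Rightarrow> real ^ 'n \<Rightarrow> complex) S A G z \<gamma>. jets r M S F \<longrightarrow> open A \<longrightarrow>
     A \<subseteq> ball z R \<longrightarrow> (\<forall>x\<in>A. \<forall>y\<in>cbox 0 (\<chi> i. real r). x + L y \<in> S \<inter> G) \<longrightarrow> G \<in> sets borel \<longrightarrow> \<gamma> \<in> borel_measurable borel \<longrightarrow>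
     (\<integral>\<^sup>+x. (\<gamma> x * ennreal (norm (F (\<lambda>_. 0) x))) epowr p * indicator A x \<partial>lborel)
     \<le> C * (\<integral>\<^sup>+x. \<gamma> x epowr q * indicator A x \<partial>lborel) epowr (p / q) *
         (\<integral>\<^sup>+x. ennreal (jet_sum F r x) epowr p * indicator G x \<partial>lborel)"
proof -
  obtain c where c: "0 < c" "\<And>f. f \<in> borel_measurable borel \<Longrightarrow> (\<integral>\<^sup>+x. f (L x) \<partial>lborel) = ennreal c * (\<integral>\<^sup>+x. f x \<partial>lborel)"
    using nn_integral_lborel_linear[OF L] by auto
  obtain K where K: "0 < K" "\<And>x. norm (L x) \<le> K * norm x"
    using linear_bounded_pos[OF L(1)] by blast
  have contL: "continuous_on UNIV L" using L(1) by (simp add: linear_continuous_on linear_conv_bounded_linear)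
  then have [measurable]: "L \<in> borel_measurable borel" by (rule borel_measurable_continuous_onI)
  \<comment> \<open>Points of the cube have norm at most \<open>n r\<close>, so their images have
    norm at most \<open>K n r\<close>.\<close>
  define R' where "R' = R + K * (real CARD('n) * real r)"
  define V where "V = c * measure lborel (ball (0 :: real ^ 'n) R')"
  obtain C where C: "C < top" "\<forall>(F :: ('n::finite \<Rightarrow> nat) \<Rightarrow> real ^ 'n \<Rightarrow> complex) S A \<gamma>. jets r (max 1 K * M) S F \<longrightarrow> open A \<longrightarrow>
     thicken A r \<subseteq> S \<longrightarrow> emeasure lborel (thicken A r) \<le> ennreal V \<longrightarrow> \<gamma> \<in> borel_measurable borel \<longrightarrow>
     (\<integral>\<^sup>+x. (\<gamma> x * ennreal (norm (F (\<lambda>_. 0) x))) epowr p * indicator A x \<partial>lborel)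
     \<le> C * (\<integral>\<^sup>+x. \<gamma> x epowr q * indicator A x \<partial>lborel) epowr (p / q) *
         (\<integral>\<^sup>+x. ennreal (jet_sum F r x) epowr p * indicator (thicken A r) x \<partial>lborel)"
  proof -
    have "1 * 1 \<le> max 1 K * M" using M by (intro mult_mono) auto
    then have "1 \<le> max 1 K * M" by simp
    from Sobolev_local_cube[OF r p q crit this, of V] show ?thesis by (elim exE conjE) (rule that)
  qed
  \<comment> \<open>The change of variables puts a factor \<open>c\<close> on both sides; what
    remains is its power \<open>p / q\<close> from the integral of \<open>\<gamma>\<close>.\<close>
  define D where "D = C * ennreal c epowr (p / q)"
  have "D < top" using C(1) by (simp add: D_def ennreal_mult_less_top)
  moreover have "(\<integral>\<^sup>+x. (\<gamma> x * ennreal (norm (F (\<lambda>_. 0) x))) epowr p * indicator A x \<partial>lborel)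
     \<le> D * (\<integral>\<^sup>+x. \<gamma> x epowr q * indicator A x \<partial>lborel) epowr (p / q) *
         (\<integral>\<^sup>+x. ennreal (jet_sum F r x) epowr p * indicator G x \<partial>lborel)"
    if F: "jets r M S F" and A: "open A" and AR: "A \<subseteq> ball z R"
      and sub: "\<forall>x\<in>A. \<forall>y\<in>cbox 0 (\<chi> i. real r). x + L y \<in> S \<inter> G"
      and G [measurable]: "G \<in> sets borel" and [measurable]: "\<gamma> \<in> borel_measurable borel"
    for F :: "('n \<Rightarrow> nat) \<Rightarrow> real ^ 'n \<Rightarrow> complex" and S A G z \<gamma>
  proof -
    define F' where "F' \<alpha> x = F \<alpha> (L x)" for \<alpha> x
    have js: "jet_sum F' k x = jet_sum F k (L x)" for k x by (simp add: jet_sum_def F'_def)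
    define A' where "A' = L -` A"
    have A': "open A'" unfolding A'_def using A contL by (rule open_vimage)
    have [measurable]: "A \<in> sets borel" using A by simp
    have F': "jets r (max 1 K * M) (L -` S) F'"
      unfolding jets_def
    proof (intro conjI allI impI)
      fix \<alpha> :: "'n \<Rightarrow> nat" assume "order_mi \<alpha> \<le> r"
      then have *: "continuous_on UNIV (F \<alpha>)" "bounded (range (F \<alpha>))" using F by (auto simp: jets_def)
      show "continuous_on UNIV (F' \<alpha>)" unfolding F'_def
        by (rule continuous_on_compose2[OF *(1) contL]) auto
      show "bounded (range (F' \<alpha>))" by (rule bounded_subset[OF *(2)]) (auto simp: F'_def)
    next
      fix \<alpha> :: "'n \<Rightarrow> nat" assume "order_mi \<alpha> < r"
      then have g: "grad_le S (F \<alpha>) (\<lambda>x. M * jet_sum F (Suc (order_mi \<alpha>)) x)" using F by (auto simp: jets_def)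
      show "grad_le (L -` S) (F' \<alpha>) (\<lambda>x. max 1 K * M * jet_sum F' (Suc (order_mi \<alpha>)) x)"
        unfolding grad_le_def
      proof (intro ballI allI)
        fix x v assume "x \<in> L -` S"
        then obtain E where E: "((\<lambda>t. F \<alpha> (L x + t *\<^sub>R L v)) has_vector_derivative E) (at 0)"
          "norm E \<le> norm (L v) * (M * jet_sum F (Suc (order_mi \<alpha>)) (L x))"
          using g unfolding grad_le_def by blast
        note E(2)
        also have "norm (L v) * (M * jet_sum F (Suc (order_mi \<alpha>)) (L x)) \<le> (max 1 K * norm v) * (M * jet_sum F (Suc (order_mi \<alpha>)) (L x))"
        proof (rule mult_right_mono)
          have "K * norm v \<le> max 1 K * norm v" by (rule mult_right_mono) auto
          then show "norm (L v) \<le> max 1 K * norm v" using K(2)[of v] by linarith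
        qed (use M jet_sum_nonneg[of F] in auto)
        finally have "norm E \<le> norm v * (max 1 K * M * jet_sum F' (Suc (order_mi \<alpha>)) x)" by (simp add: js mult_ac)
        moreover have "F' \<alpha> (x + t *\<^sub>R v) = F \<alpha> (L x + t *\<^sub>R L v)" for t
          using L(1) by (simp add: F'_def linear_add linear_scale)
        ultimately show "\<exists>D. ((\<lambda>t. F' \<alpha> (x + t *\<^sub>R v)) has_vector_derivative D) (at 0) \<and>
            norm D \<le> norm v * (max 1 K * M * jet_sum F' (Suc (order_mi \<alpha>)) x)"
          using E(1) by auto
      qed
    qed
    have thick: "L w \<in> S \<inter> G \<inter> ball z R'" if w0: "w \<in> thicken A' r" for w
    proof -
      obtain a y where w: "a \<in> A'" "\<forall>i. 0 \<le> y $ i \<and> y $ i \<le> real r" "w = a + y"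
        using w0 unfolding mem_thicken by blast
      have Lw: "L w = L a + L y" using w L(1) by (simp add: linear_add)
      have y: "y \<in> cbox 0 (\<chi> i. real r)" using w by (simp add: mem_box_cart)
      have "norm (L y) \<le> K * norm y" by (rule K)
      also have "norm y \<le> (\<Sum>i\<in>UNIV. \<bar>y $ i\<bar>)" by (rule norm_le_l1_cart)
      also have "\<dots> \<le> (\<Sum>i\<in>(UNIV::'n set). real r)" using w by (intro sum_mono) auto
      finally have "norm (L y) \<le> K * (real CARD('n) * real r)" using K(1) by (simp add: mult_left_mono)
      moreover have "dist z (L a) < R" using w AR by (auto simp: A'_def)
      moreover have "dist z (L a + L y) \<le> dist z (L a) + norm (L y)" by norm
      ultimately have "dist z (L w) < R'" unfolding Lw R'_def by linarith
      moreover have "L a + L y \<in> S \<inter> G" using sub w(1) y by (auto simp: A'_def)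
      ultimately show ?thesis by (simp add: Lw)
    qed
    have tS: "thicken A' r \<subseteq> L -` S" using thick by auto
    have "emeasure lborel (thicken A' r) = (\<integral>\<^sup>+x. indicator (thicken A' r) x \<partial>lborel)"
      using borel_open[OF open_thicken[OF A']] by simp
    also have "\<dots> \<le> (\<integral>\<^sup>+x. indicator (ball z R') (L x) \<partial>lborel)"
      using thick by (intro nn_integral_mono) (auto simp: indicator_def)
    also have "\<dots> = ennreal c * emeasure lborel (ball z R')"
      by (subst c(2)) (auto intro!: borel_measurable_indicator)
    also have "\<dots> = ennreal V"
      unfolding V_def using c(1) emeasure_lborel_ball_finite[of "0 :: real ^ 'n" R']
      by (simp add: ennreal_mult' emeasure_lborel_ball_translate[of z] emeasure_eq_ennreal_measure)
    finally have tV: "emeasure lborel (thicken A' r) \<le> ennreal V" .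
    have mF [measurable]: "F (\<lambda>_. 0) \<in> borel_measurable borel"
      using F by (intro borel_measurable_continuous_onI) (auto simp: jets_def order_mi_def)
    have mJ [measurable]: "jet_sum F r \<in> borel_measurable borel" using F by (rule measurable_jet_sum) simp
    have indA: "indicator A' x = (indicator A (L x) :: ennreal)" for x by (simp add: A'_def indicator_def)
    define X where "X = (\<integral>\<^sup>+x. (\<gamma> x * ennreal (norm (F (\<lambda>_. 0) x))) epowr p * indicator A x \<partial>lborel)"
    define Y where "Y = (\<integral>\<^sup>+x. \<gamma> x epowr q * indicator A x \<partial>lborel)"
    define Z where "Z = (\<integral>\<^sup>+x. ennreal (jet_sum F r x) epowr p * indicator G x \<partial>lborel)"
    have X: "ennreal c * X = (\<integral>\<^sup>+x. (\<gamma> (L x) * ennreal (norm (F' (\<lambda>_. 0) x))) epowr p * indicator A' x \<partial>lborel)"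
      unfolding X_def by (subst c(2)[symmetric]) (auto simp: F'_def indA)
    have Y: "(\<integral>\<^sup>+x. \<gamma> (L x) epowr q * indicator A' x \<partial>lborel) = ennreal c * Y"
      unfolding Y_def by (subst c(2)[symmetric]) (auto simp: indA)
    have "(\<integral>\<^sup>+x. ennreal (jet_sum F' r x) epowr p * indicator (thicken A' r) x \<partial>lborel)
        \<le> (\<integral>\<^sup>+x. ennreal (jet_sum F r (L x)) epowr p * indicator G (L x) \<partial>lborel)"
      using thick by (intro nn_integral_mono) (auto simp: js indicator_def)
    also have "\<dots> = ennreal c * Z"
      unfolding Z_def by (subst c(2)[symmetric]) auto
    finally have Z: "(\<integral>\<^sup>+x. ennreal (jet_sum F' r x) epowr p * indicator (thicken A' r) x \<partial>lborel) \<le> ennreal c * Z" .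
    have "ennreal c * X \<le> C * (ennreal c * Y) epowr (p / q) *
         (\<integral>\<^sup>+x. ennreal (jet_sum F' r x) epowr p * indicator (thicken A' r) x \<partial>lborel)"
      unfolding X Y[symmetric] using C(2)[rule_format, OF F' A' tS tV, of "\<lambda>x. \<gamma> (L x)"] by simp
    also have "\<dots> \<le> C * (ennreal c * Y) epowr (p / q) * (ennreal c * Z)"
      using Z by (rule mult_left_mono) simp
    finally have "ennreal c * X \<le> ennreal c * (D * Y epowr (p / q) * Z)"
      using p by (simp add: epowr_mult D_def mult_ac)
    then show ?thesis using c(1) by (simp add: ennreal_mult_le_mult_iff X_def Y_def Z_def)
  qed
  ultimately show ?thesis by blast
qed

subsection \<open>Bump functions\<close>

text \<open>The powers of \<open>1 / t\<close> arise from differentiation, so that the derivative of each member of the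
  family is a combination of two others.\<close>

definition exp_inv :: "nat \<Rightarrow> real \<Rightarrow> real" where
  "exp_inv k t = (if 0 < t then exp (- (1 / t)) / t ^ k else 0)"

lemma exp_inv_tendsto_0: "(exp_inv k \<longlongrightarrow> 0) (at 0)"
proof (rule filterlim_split_at)
  have "((\<lambda>t::real. inverse t ^ k / exp (inverse t)) \<longlongrightarrow> 0) (at_right 0)"
    using tendsto_power_div_exp_0 filterlim_inverse_at_top_right by (rule filterlim_compose)
  moreover have "eventually (\<lambda>t::real. inverse t ^ k / exp (inverse t) = exp_inv k t) (at_right 0)"
    by (auto simp: eventually_at_filter exp_inv_def exp_minus field_simps)
  ultimately show "(exp_inv k \<longlongrightarrow> 0) (at_right 0)" by (rule Lim_transform_eventually)
  show "(exp_inv k \<longlongrightarrow> 0) (at_left 0)"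
    by (rule Lim_transform_eventually[OF tendsto_const]) (auto simp: eventually_at_filter exp_inv_def)
qed

lemma exp_inv_deriv:
  "(exp_inv k has_real_derivative (exp_inv (k + 2) t - real k * exp_inv (Suc k) t)) (at t)"
proof -
  consider "0 < t" | "t = 0" | "t < 0" by linarith
  then show ?thesis
  proof cases
    case 1
    have "((\<lambda>t. exp (- (1 / t)) / t ^ k) has_real_derivative (exp_inv (k + 2) t - real k * exp_inv (Suc k) t)) (at t)"
      using 1 by (auto intro!: derivative_eq_intros simp: exp_inv_def divide_simps power_add power2_eq_square)
         (cases k; simp add: field_simps)
    then show ?thesis
      by (rule DERIV_cong_ev[THEN iffD1, OF refl _ refl, rotated])
         (use 1 in \<open>auto simp: exp_inv_def intro!: eventually_mono[OF order_tendstoD(1)[OF tendsto_ident_at 1, of UNIV]] eventually_nhds_in_open[of "{0<..}" t, THEN eventually_mono]\<close>)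
  next
    \<comment> \<open>The difference quotient of \<open>exp_inv k\<close> at 0 is
      \<open>exp_inv (Suc k)\<close>, so differentiability at 0 is the limit already known.\<close>
    case 2
    have "((\<lambda>s. (exp_inv k s - exp_inv k 0) / (s - 0)) \<longlongrightarrow> 0) (at 0)"
      by (rule Lim_transform_eventually[OF exp_inv_tendsto_0[of "Suc k"]])
         (auto simp: eventually_at_filter exp_inv_def)
    then show ?thesis using 2 by (simp add: has_field_derivative_iff exp_inv_def)
  next
    case 3
    have "((\<lambda>t. 0) has_real_derivative (exp_inv (k + 2) t - real k * exp_inv (Suc k) t)) (at t)"
      using 3 by (auto simp: exp_inv_def)
    then show ?thesis
      by (rule DERIV_cong_ev[THEN iffD1, OF refl _ refl, rotated])
         (use 3 in \<open>auto simp: exp_inv_def intro!: eventually_nhds_in_open[of "{..<0}" t, THEN eventually_mono]\<close>)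
  qed
qed

section \<open>Partial derivatives and the smoothing kernel\<close>

lemma has_derivative_partial:
  fixes f :: "real ^ 'n \<Rightarrow> complex"
  assumes "f differentiable (at x)"
  shows "(f has_derivative (\<lambda>h. \<Sum>i\<in>UNIV. h $ i *\<^sub>R partial i f x)) (at x)"
proof -
  obtain D where D: "(f has_derivative D) (at x)" using assms by (auto simp: differentiable_def)
  interpret D: bounded_linear D by (rule has_derivative_bounded_linear[OF D])
  have p: "partial i f x = D (axis i 1)" for i
  proof -
    have "((\<lambda>t. x + t *\<^sub>R axis i 1) has_derivative (\<lambda>t. t *\<^sub>R axis i 1)) (at (0::real))"
      by (auto intro!: derivative_eq_intros)
    from has_derivative_compose[OF this, of f D] D
    have "((\<lambda>t. f (x + t *\<^sub>R axis i 1)) has_vector_derivative D (axis i 1)) (at 0)"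
      by (simp add: has_vector_derivative_def D.scaleR)
    then show ?thesis unfolding partial_def by (rule vector_derivative_at)
  qed
  have "D h = (\<Sum>i\<in>UNIV. h $ i *\<^sub>R partial i f x)" for h
  proof -
    have "D h = D (\<Sum>i\<in>UNIV. h $ i *\<^sub>R axis i 1)"
      by (simp add: basis_expansion[of h, unfolded scalar_mult_eq_scaleR])
    then show ?thesis by (simp add: D.sum D.scaleR p)
  qed
  then have "D = (\<lambda>h. \<Sum>i\<in>UNIV. h $ i *\<^sub>R partial i f x)" by blast
  with D show ?thesis by simp
qed

lemma partial_eqI:
  fixes f :: "real ^ 'n \<Rightarrow> complex"
  assumes "(f has_derivative (\<lambda>h. \<Sum>j\<in>UNIV. h $ j *\<^sub>R f' j)) (at x)"
  shows "partial i f x = f' i"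
proof -
  have "((\<lambda>t. x + t *\<^sub>R axis i 1) has_derivative (\<lambda>t. t *\<^sub>R axis i 1)) (at (0::real))"
    by (auto intro!: derivative_eq_intros)
  from has_derivative_compose[OF this, of f "\<lambda>h. \<Sum>j\<in>UNIV. h $ j *\<^sub>R f' j"] assms
  have "((\<lambda>t. f (x + t *\<^sub>R axis i 1)) has_derivative (\<lambda>t. \<Sum>j\<in>UNIV. (t *\<^sub>R axis i 1) $ j *\<^sub>R f' j)) (at 0)"
    by simp
  moreover have "(\<Sum>j\<in>UNIV. (t *\<^sub>R axis i 1) $ j *\<^sub>R f' j) = t *\<^sub>R f' i" for t :: real
    by (simp add: axis_def if_distrib[of "\<lambda>c. _ * c"] if_distrib[of "\<lambda>c. c *\<^sub>R _"] sum.delta cong: if_cong)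
  ultimately have "((\<lambda>t. f (x + t *\<^sub>R axis i 1)) has_vector_derivative f' i) (at 0)"
    by (simp add: has_vector_derivative_def)
  then show ?thesis unfolding partial_def by (rule vector_derivative_at)
qed

text \<open>An algebra of functions that contains the bump functions and is closed under partial derivatives.\<close>

inductive bump_poly :: "(real ^ 'n \<Rightarrow> complex) \<Rightarrow> bool" where
  const: "bump_poly (\<lambda>x. c)"
| base: "bump_poly (\<lambda>x. of_real (exp_inv k (a * x $ i + b)))"
| add: "bump_poly f \<Longrightarrow> bump_poly g \<Longrightarrow> bump_poly (\<lambda>x. f x + g x)"
| mult: "bump_poly f \<Longrightarrow> bump_poly g \<Longrightarrow> bump_poly (\<lambda>x. f x * g x)"

lemma bump_poly_deriv:
  assumes "bump_poly (f :: real ^ 'n \<Rightarrow> complex)"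
  shows "\<exists>f'. (\<forall>i. bump_poly (f' i)) \<and> (\<forall>x. (f has_derivative (\<lambda>h. \<Sum>i\<in>UNIV. h $ i *\<^sub>R f' i x)) (at x))"
  using assms
proof induction
  case (const c)
  show ?case by (intro exI[of _ "\<lambda>i x. 0"]) (auto intro: bump_poly.const)
next
  case (base k a i b)
  define g where "g x = complex_of_real a * (of_real (exp_inv (k + 2) (a * x $ i + b)) + of_real (- real k) * of_real (exp_inv (Suc k) (a * x $ i + b)))" for x :: "real ^ 'n"
  have g: "bump_poly g" unfolding g_def by (intro bump_poly.intros)
  have "((\<lambda>x. complex_of_real (exp_inv k (a * x $ i + b))) has_derivative
       (\<lambda>h. \<Sum>j\<in>UNIV. h $ j *\<^sub>R (if j = i then g else (\<lambda>x. 0)) x)) (at x)" for x :: "real ^ 'n"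
  proof -
    have "((\<lambda>x::real ^ 'n. a * x $ i + b) has_derivative (\<lambda>h. a * h $ i)) (at x)"
      by (auto intro!: derivative_eq_intros bounded_linear.has_derivative[OF bounded_linear_vec_nth])
    from has_derivative_compose[OF this exp_inv_deriv[unfolded has_field_derivative_def, of k]]
    have "((\<lambda>x. exp_inv k (a * x $ i + b)) has_derivative (\<lambda>h. (exp_inv (k + 2) (a * x $ i + b) - real k * exp_inv (Suc k) (a * x $ i + b)) * (a * h $ i))) (at x)" .
    from has_derivative_of_real[OF this]
    have "((\<lambda>x. complex_of_real (exp_inv k (a * x $ i + b))) has_derivative (\<lambda>h. of_real ((exp_inv (k + 2) (a * x $ i + b) - real k * exp_inv (Suc k) (a * x $ i + b)) * (a * h $ i)))) (at x)" .
    moreover have "(\<Sum>j\<in>UNIV. h $ j *\<^sub>R (if j = i then g else (\<lambda>x. 0)) x) = h $ i *\<^sub>R g x" for h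
      by (subst sum.remove[of _ i]) auto
    moreover have "h $ i *\<^sub>R g x = of_real ((exp_inv (k + 2) (a * x $ i + b) - real k * exp_inv (Suc k) (a * x $ i + b)) * (a * h $ i))" for h :: "real ^ 'n"
      by (simp add: g_def scaleR_conv_of_real algebra_simps)
    ultimately show ?thesis by simp
  qed
  then show ?case using g by (intro exI[of _ "\<lambda>j. if j = i then g else (\<lambda>x. 0)"]) (auto intro: bump_poly.const)
next
  case (add f g)
  then obtain f' g' where *: "\<forall>i. bump_poly (f' i)" "\<forall>i. bump_poly (g' i)"
     "\<And>x. (f has_derivative (\<lambda>h. \<Sum>i\<in>UNIV. h $ i *\<^sub>R f' i x)) (at x)"
     "\<And>x. (g has_derivative (\<lambda>h. \<Sum>i\<in>UNIV. h $ i *\<^sub>R g' i x)) (at x)" by blast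
  have "((\<lambda>x. f x + g x) has_derivative (\<lambda>h. \<Sum>i\<in>UNIV. h $ i *\<^sub>R (f' i x + g' i x))) (at x)" for x
    using has_derivative_add[OF *(3)[of x] *(4)[of x]] by (simp add: scaleR_add_right sum.distrib)
  then show ?case using * by (intro exI[of _ "\<lambda>i x. f' i x + g' i x"]) (auto intro: bump_poly.add)
next
  case (mult f g)
  then obtain f' g' where *: "\<forall>i. bump_poly (f' i)" "\<forall>i. bump_poly (g' i)"
     "\<And>x. (f has_derivative (\<lambda>h. \<Sum>i\<in>UNIV. h $ i *\<^sub>R f' i x)) (at x)"
     "\<And>x. (g has_derivative (\<lambda>h. \<Sum>i\<in>UNIV. h $ i *\<^sub>R g' i x)) (at x)" by blast
  have "((\<lambda>x. f x * g x) has_derivative (\<lambda>h. \<Sum>i\<in>UNIV. h $ i *\<^sub>R (f x * g' i x + f' i x * g x))) (at x)" for x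
    using has_derivative_mult[OF *(3)[of x] *(4)[of x]]
    by (simp add: scaleR_add_right sum.distrib sum_distrib_left sum_distrib_right)
  then show ?case using * mult by (intro exI[of _ "\<lambda>i x. f x * g' i x + f' i x * g x"]) (auto intro!: bump_poly.add bump_poly.mult)
qed

lemma bump_poly_partial: "bump_poly f \<Longrightarrow> bump_poly (partial i f)"
proof -
  assume "bump_poly f"
  from bump_poly_deriv[OF this] obtain f' where f': "\<And>i. bump_poly (f' i)"
    "\<And>x. (f has_derivative (\<lambda>h. \<Sum>i\<in>UNIV. h $ i *\<^sub>R f' i x)) (at x)" by blast
  have "partial i f = f' i" using partial_eqI[OF f'(2)] by blast
  then show ?thesis using f'(1) by simp
qed

lemma bump_poly_smooth: "bump_poly f \<Longrightarrow> smooth f"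
proof -
  assume f: "bump_poly f"
  have "bump_poly (partials is f)" for "is"
    unfolding partials_def by (induction "is") (auto intro: f bump_poly_partial)
  then show ?thesis unfolding smooth_def differentiable_on_def differentiable_def
    using bump_poly_deriv has_derivative_at_withinI by blast
qed

lemma bump_poly_prod: "finite I \<Longrightarrow> (\<And>i. i \<in> I \<Longrightarrow> bump_poly (f i)) \<Longrightarrow> bump_poly (\<lambda>x. \<Prod>i\<in>I. f i x)"
  by (induction I rule: finite_induct) (auto intro: bump_poly.intros)

text \<open>The kernel is real for the sake of positivity; its smoothness is stated for the
  complex-valued version because test functions are complex.\<close>

locale mollifier =
  fixes \<eta> :: "real ^ 'n \<Rightarrow> real"
  assumes smooth_eta: "smooth (\<lambda>x. complex_of_real (\<eta> x))"
    and eta_nonneg: "0 \<le> \<eta> x"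
    and eta_support: "1 < norm x \<Longrightarrow> \<eta> x = 0"
    and eta_integral: "(\<integral>\<^sup>+x. ennreal (\<eta> x) \<partial>lborel) = 1"

lemma smooth_differentiable: "smooth f \<Longrightarrow> partials is f differentiable (at x)"
  by (auto simp: smooth_def differentiable_on_def)

lemma smooth_continuous: "smooth f \<Longrightarrow> continuous_on UNIV (partials is f)"
  by (auto simp: smooth_def intro: differentiable_imp_continuous_on)

text \<open>A product of one-dimensional bumps vanishes outside the cube of half side
  \<open>1 / n\<close>, and this cube lies in the unit ball since the norm is at most the sum of the
  coordinates in absolute value. Division by the integral normalizes it.\<close>

lemma mollifier_exists: "\<exists>\<eta> :: real ^ 'n \<Rightarrow> real. mollifier \<eta>"
proof -
  let ?n = "real CARD('n)"
  define \<eta>0 where "\<eta>0 x = (\<Prod>i\<in>UNIV. exp_inv 0 (1 / ?n - x $ i) * exp_inv 0 (1 / ?n + x $ i))" for x :: "real ^ 'n"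
  have bp: "bump_poly (\<lambda>x. complex_of_real (\<eta>0 x))"
  proof -
    have "bump_poly (\<lambda>x. \<Prod>i\<in>UNIV. complex_of_real (exp_inv 0 (- 1 * x $ i + 1 / ?n)) * complex_of_real (exp_inv 0 (1 * x $ i + 1 / ?n)))"
      by (intro bump_poly_prod bump_poly.mult bump_poly.base) auto
    then show ?thesis by (simp add: \<eta>0_def add.commute)
  qed
  have nonneg: "0 \<le> \<eta>0 x" for x unfolding \<eta>0_def by (intro prod_nonneg) (auto simp: exp_inv_def)
  have supp: "\<eta>0 x = 0" if "1 < norm x" for x
  proof (rule ccontr)
    assume "\<eta>0 x \<noteq> 0"
    then have "exp_inv 0 (1 / ?n - x $ i) \<noteq> 0 \<and> exp_inv 0 (1 / ?n + x $ i) \<noteq> 0" for i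
      unfolding \<eta>0_def by auto
    then have "\<bar>x $ i\<bar> \<le> 1 / ?n" for i
      by (smt (verit) exp_inv_def)
    then have "(\<Sum>i\<in>UNIV. \<bar>x $ i\<bar>) \<le> (\<Sum>i\<in>(UNIV::'n set). 1 / ?n)" by (intro sum_mono)
    also have "\<dots> = 1" by simp
    finally show False using norm_le_l1_cart[of x] that by simp
  qed
  have cont: "continuous_on UNIV \<eta>0"
  proof -
    have "continuous_on UNIV (\<lambda>x. Re (complex_of_real (\<eta>0 x)))"
      using smooth_continuous[OF bump_poly_smooth[OF bp], of "[]"] by (intro continuous_intros) (simp add: partials_def)
    then show ?thesis by simp
  qed
  then have [measurable]: "\<eta>0 \<in> borel_measurable borel" by (rule borel_measurable_continuous_onI)
  define I where "I = (\<integral>\<^sup>+x. ennreal (\<eta>0 x) \<partial>lborel)"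
  have "compact (\<eta>0 ` cball 0 1)"
    using cont by (intro compact_continuous_image) (auto intro: continuous_on_subset)
  then have "bounded (\<eta>0 ` cball 0 1)" by (rule compact_imp_bounded)
  then obtain B where "\<forall>y\<in>\<eta>0 ` cball 0 1. norm y \<le> B" by (auto simp: bounded_iff)
  then have B: "\<bar>\<eta>0 x\<bar> \<le> B" if "x \<in> cball 0 1" for x using that by auto
  have "I \<le> (\<integral>\<^sup>+x. ennreal B * indicator (cball (0 :: real ^ 'n) 1) x \<partial>lborel)"
    unfolding I_def
  proof (intro nn_integral_mono)
    fix x
    show "ennreal (\<eta>0 x) \<le> ennreal B * indicator (cball 0 1) x"
      using supp[of x] B[of x] by (auto simp: indicator_def intro!: ennreal_leI)
  qed
  also have "\<dots> < top"
    using emeasure_lborel_cball_finite[of "0 :: real ^ 'n" 1] by (simp add: nn_integral_cmult_indicator ennreal_mult_less_top less_top)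
  finally have Itop: "I < top" .
  have "\<eta>0 0 > 0" unfolding \<eta>0_def by (intro prod_pos) (auto simp: exp_inv_def)
  then have "open (\<eta>0 -` {\<eta>0 0 / 2<..})" "0 \<in> \<eta>0 -` {\<eta>0 0 / 2<..}"
    using cont by (auto intro!: open_vimage)
  then obtain \<delta> where \<delta>: "0 < \<delta>" "ball 0 \<delta> \<subseteq> \<eta>0 -` {\<eta>0 0 / 2<..}" by (metis openE)
  have "0 < ennreal (\<eta>0 0 / 2) * ennreal (measure lborel (ball (0 :: real ^ 'n) \<delta>))"
    using content_ball_pos[OF \<delta>(1), of "0 :: real ^ 'n"] \<open>\<eta>0 0 > 0\<close> by (simp add: ennreal_zero_less_mult_iff)
  also have "\<dots> = (\<integral>\<^sup>+x. ennreal (\<eta>0 0 / 2) * indicator (ball (0 :: real ^ 'n) \<delta>) x \<partial>lborel)"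
    using emeasure_lborel_ball_finite[of "0 :: real ^ 'n" \<delta>]
    by (subst nn_integral_cmult_indicator) (auto simp: emeasure_eq_ennreal_measure less_top)
  also have "\<dots> \<le> I"
    unfolding I_def
  proof (intro nn_integral_mono)
    fix x :: "real ^ 'n"
    show "ennreal (\<eta>0 0 / 2) * indicator (ball 0 \<delta>) x \<le> ennreal (\<eta>0 x)"
    proof (cases "x \<in> ball 0 \<delta>")
      case True
      then have "\<eta>0 0 / 2 < \<eta>0 x" using \<delta>(2) by blast
      then show ?thesis using True by (simp add: ennreal_leI)
    qed simp
  qed
  finally have I0: "0 < I" .
  define J where "J = enn2real I"
  have J: "I = ennreal J" "0 < J" using Itop I0 by (auto simp: J_def enn2real_positive_iff less_top)
  have "mollifier (\<lambda>x. \<eta>0 x / J)"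
  proof
    have "bump_poly (\<lambda>x. complex_of_real (1 / J) * complex_of_real (\<eta>0 x))"
      by (intro bump_poly.intros bp)
    then show "smooth (\<lambda>x. complex_of_real (\<eta>0 x / J))" by (simp add: bump_poly_smooth)
    show "0 \<le> \<eta>0 x / J" for x using nonneg J by simp
    show "1 < norm x \<Longrightarrow> \<eta>0 x / J = 0" for x using supp by simp
    have "(\<integral>\<^sup>+x. ennreal (\<eta>0 x / J) \<partial>lborel) = (\<integral>\<^sup>+x. ennreal (1 / J) * ennreal (\<eta>0 x) \<partial>lborel)"
      using J nonneg by (simp add: ennreal_mult'[symmetric])
    also have "\<dots> = ennreal (1 / J) * I" unfolding I_def by (rule nn_integral_cmult) measurable
    also have "\<dots> = 1" using J by (simp add: ennreal_mult'[symmetric])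
    finally show "(\<integral>\<^sup>+x. ennreal (\<eta>0 x / J) \<partial>lborel) = 1" .
  qed
  then show ?thesis by blast
qed

lemma partial_affine:
  fixes f :: "real ^ 'n \<Rightarrow> complex"
  assumes "f differentiable (at (a + c *\<^sub>R y))"
  shows "partial i (\<lambda>y. k * f (a + c *\<^sub>R y)) y = k * of_real c * partial i f (a + c *\<^sub>R y)"
    and "(\<lambda>y. k * f (a + c *\<^sub>R y)) differentiable (at y)"
proof -
  have "((\<lambda>y. a + c *\<^sub>R y) has_derivative (\<lambda>h. c *\<^sub>R h)) (at y)"
    by (auto intro!: derivative_eq_intros)
  from has_derivative_compose[OF this has_derivative_partial[OF assms]]
  have "((\<lambda>y. f (a + c *\<^sub>R y)) has_derivative (\<lambda>h. \<Sum>i\<in>UNIV. (c *\<^sub>R h) $ i *\<^sub>R partial i f (a + c *\<^sub>R y))) (at y)" .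
  from has_derivative_mult_right[OF this, of k]
  have "((\<lambda>y. k * f (a + c *\<^sub>R y)) has_derivative (\<lambda>h. \<Sum>i\<in>UNIV. h $ i *\<^sub>R (k * of_real c * partial i f (a + c *\<^sub>R y)))) (at y)"
  proof -
    have oc: "k * of_real c * z = c *\<^sub>R (k * z)" for z :: complex by (simp add: scaleR_conv_of_real)
    show ?thesis unfolding oc
      using \<open>((\<lambda>y. k * f (a + c *\<^sub>R y)) has_derivative _) _\<close> by (simp add: sum_distrib_left mult.commute[of c])
  qed
  from partial_eqI[OF this] this
  show "partial i (\<lambda>y. k * f (a + c *\<^sub>R y)) y = k * of_real c * partial i f (a + c *\<^sub>R y)"
    "(\<lambda>y. k * f (a + c *\<^sub>R y)) differentiable (at y)" by (auto simp: differentiable_def)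
qed

lemma smooth_affine:
  fixes f :: "real ^ 'n \<Rightarrow> complex"
  assumes f: "smooth f"
  shows "smooth (\<lambda>y. k * f (a + c *\<^sub>R y))"
proof -
  have eq: "partials is (\<lambda>y. k * f (a + c *\<^sub>R y)) = (\<lambda>y. k * of_real c ^ length is * partials is f (a + c *\<^sub>R y))" for "is"
  proof (induction "is")
    case (Cons i "is")
    have step: "partials (i # is) g = partial i (partials is g)" for g :: "real ^ 'n \<Rightarrow> complex" by (simp add: partials_def)
    then have "partials (i # is) (\<lambda>y. k * f (a + c *\<^sub>R y)) = partial i (\<lambda>y. k * of_real c ^ length is * partials is f (a + c *\<^sub>R y))"
      by (simp only: Cons.IH)
    also have "\<dots> = (\<lambda>y. k * of_real c ^ length (i # is) * partials (i # is) f (a + c *\<^sub>R y))"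
      unfolding step by (rule ext, subst partial_affine(1)[OF smooth_differentiable[OF f]]) simp
    finally show ?case .
  qed (simp add: partials_def)
  show ?thesis unfolding smooth_def eq differentiable_on_def
    using partial_affine(2)[OF smooth_differentiable[OF f]] differentiable_at_withinI by blast
qed

subsection \<open>Mollification\<close>

definition locally_integrable :: "(real ^ 'n \<Rightarrow> complex) \<Rightarrow> bool" where
  "locally_integrable v \<longleftrightarrow> v \<in> borel_measurable borel \<and> (\<forall>z R. integrable lborel (\<lambda>y. indicator (ball z R) y *\<^sub>R v y))"

definition conv_kernel :: "real \<Rightarrow> (real ^ 'n \<Rightarrow> complex) \<Rightarrow> bool" where
  "conv_kernel \<epsilon> k \<longleftrightarrow> continuous_on UNIV k \<and> (\<forall>x. \<epsilon> < norm x \<longrightarrow> k x = 0)"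

definition conv :: "(real ^ 'n \<Rightarrow> complex) \<Rightarrow> (real ^ 'n \<Rightarrow> complex) \<Rightarrow> real ^ 'n \<Rightarrow> complex" where
  "conv k v x = (LINT y|lborel. k (x - y) * v y)"

lemma conv_kernel_bounded:
  assumes "conv_kernel \<epsilon> (k :: real ^ 'n \<Rightarrow> complex)"
  obtains B where "0 \<le> B" "\<And>x. norm (k x) \<le> B"
proof -
  have "compact (k ` cball 0 \<epsilon>)"
    using assms by (intro compact_continuous_image) (auto simp: conv_kernel_def intro: continuous_on_subset)
  then have "bounded (k ` cball 0 \<epsilon>)" by (rule compact_imp_bounded)
  then obtain B where B: "\<forall>y\<in>k ` cball 0 \<epsilon>. norm y \<le> B" by (auto simp: bounded_iff)
  have "norm (k x) \<le> max B 0" for x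
  proof (cases "norm x \<le> \<epsilon>")
    case True
    then show ?thesis using B by (auto intro: max.coboundedI1)
  next
    case False
    then show ?thesis using assms by (simp add: conv_kernel_def)
  qed
  then show thesis by (intro that[of "max B 0"]) auto
qed

lemma conv_kernel_measurable: "conv_kernel \<epsilon> k \<Longrightarrow> k \<in> borel_measurable borel"
  unfolding conv_kernel_def by (auto intro: borel_measurable_continuous_onI)

text \<open>One majorant for all \<open>x\<close> near \<open>z\<close>: the kernel is bounded and
  sees only points within \<open>\<epsilon>\<close> of \<open>x\<close>. It supplies both
  integrability and dominated convergence.\<close>

lemma conv_dominated:
  assumes v: "locally_integrable v" and k: "conv_kernel \<epsilon> k"
    and B: "\<And>x. norm (k x) \<le> B" and z: "dist x z < R"
  shows "norm (k (x - y) * v y) \<le> norm (B *\<^sub>R (indicator (ball z (R + \<epsilon>)) y *\<^sub>R v y))"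
proof (cases "y \<in> ball z (R + \<epsilon>)")
  case True
  have "norm (k (x - y)) \<le> \<bar>B\<bar>" using B[of "x - y"] by linarith
  then show ?thesis using True by (auto simp: norm_mult intro!: mult_right_mono)
next
  case False
  have "R + \<epsilon> \<le> dist z y" using False by simp
  also have "dist z y \<le> dist x z + norm (x - y)" by norm
  finally have "\<epsilon> < norm (x - y)" using z by linarith
  then show ?thesis using k False by (simp add: conv_kernel_def)
qed

lemma conv_integrable:
  assumes v: "locally_integrable v" and k: "conv_kernel \<epsilon> k"
  shows "integrable lborel (\<lambda>y. k (x - y) * v y)"
proof -
  obtain B where B: "\<And>x. norm (k x) \<le> B" using conv_kernel_bounded[OF k] by metis
  note [measurable] = conv_kernel_measurable[OF k]
  have [measurable]: "v \<in> borel_measurable borel" using v by (simp add: locally_integrable_def)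
  show ?thesis
  proof (rule Bochner_Integration.integrable_bound)
    show "integrable lborel (\<lambda>y. B *\<^sub>R (indicator (ball x (1 + \<epsilon>)) y *\<^sub>R v y))"
      using v unfolding locally_integrable_def by (intro integrable_scaleR_right) blast
    show "AE y in lborel. norm (k (x - y) * v y) \<le> norm (B *\<^sub>R (indicator (ball x (1 + \<epsilon>)) y *\<^sub>R v y))"
      by (intro AE_I2 conv_dominated[OF v k B]) simp
  qed measurable
qed

lemma conv_continuous:
  assumes v: "locally_integrable v" and k: "conv_kernel \<epsilon> k"
  shows "continuous_on UNIV (conv k v)"
proof -
  obtain B where B: "\<And>x. norm (k x) \<le> B" using conv_kernel_bounded[OF k] by metis
  note [measurable] = conv_kernel_measurable[OF k]
  have [measurable]: "v \<in> borel_measurable borel" using v by (simp add: locally_integrable_def)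
  have "(\<lambda>n. conv k v (X n)) \<longlonglongrightarrow> conv k v x" if X: "X \<longlonglongrightarrow> x" for X x
  proof -
    obtain N where N: "\<forall>n\<ge>N. dist (X n) x < 1"
      using X[unfolded lim_sequentially, rule_format, of 1] by auto
    have "(\<lambda>n. conv k v (X (n + N))) \<longlonglongrightarrow> conv k v x"
      unfolding conv_def
    proof (rule integral_dominated_convergence)
      show "integrable lborel (\<lambda>y. norm (B *\<^sub>R (indicator (ball x (1 + \<epsilon>)) y *\<^sub>R v y)))"
        using v unfolding locally_integrable_def by (intro integrable_norm integrable_scaleR_right) blast
      show "AE y in lborel. norm (k (X (n + N) - y) * v y) \<le> norm (B *\<^sub>R (indicator (ball x (1 + \<epsilon>)) y *\<^sub>R v y))" for n
        using N by (intro AE_I2 conv_dominated[OF v k B]) simp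
      have "(\<lambda>n. k (X (n + N) - y)) \<longlonglongrightarrow> k (x - y)" for y
      proof (rule isCont_tendsto_compose[where g = k])
        show "isCont k (x - y)" using k by (simp add: conv_kernel_def continuous_on_eq_continuous_at)
        show "(\<lambda>n. X (n + N) - y) \<longlonglongrightarrow> x - y"
          using LIMSEQ_ignore_initial_segment[OF X] by (intro tendsto_intros)
      qed
      then show "AE y in lborel. (\<lambda>n. k (X (n + N) - y) * v y) \<longlonglongrightarrow> k (x - y) * v y"
        by (intro AE_I2 tendsto_mult_right)
    qed measurable
    then show ?thesis by (rule LIMSEQ_offset)
  qed
  then show ?thesis
    by (auto simp: continuous_on_eq_continuous_at continuous_at_sequentially o_def)
qed

text \<open>Differentiation under the integral: by the mean value inequality the difference
  quotients of \<open>k\<close> are bounded by \<open>M\<close>, and they vanish outside a common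
  ball, so dominated convergence applies to the locally integrable \<open>v\<close>.\<close>

lemma conv_deriv:
  assumes v: "locally_integrable v" and k: "conv_kernel \<epsilon> k" and dk: "\<And>x. k differentiable (at x)"
    and pk: "\<And>i. conv_kernel \<epsilon> (partial i k)"
  shows "((\<lambda>t. conv k v (x + t *\<^sub>R h)) has_vector_derivative (\<Sum>i\<in>UNIV. h $ i *\<^sub>R conv (partial i k) v x)) (at 0)"
proof -
  note [measurable] = conv_kernel_measurable[OF k] conv_kernel_measurable[OF pk]
  have [measurable]: "v \<in> borel_measurable borel" using v by (simp add: locally_integrable_def)
  have "\<forall>i. \<exists>B\<ge>0. \<forall>x. norm (partial i k x) \<le> B" using conv_kernel_bounded[OF pk] by metis
  then obtain B where B: "\<And>i. 0 \<le> B i" "\<And>i x. norm (partial i k x) \<le> B i" by metis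
  define M where "M = (\<Sum>i\<in>UNIV. \<bar>h $ i\<bar> * B i)"
  have line: "((\<lambda>t. k (z + t *\<^sub>R h)) has_vector_derivative (\<Sum>i\<in>UNIV. h $ i *\<^sub>R partial i k (z + t *\<^sub>R h))) (at t)" for z t
  proof -
    have "((\<lambda>t. z + t *\<^sub>R h) has_derivative (\<lambda>s. s *\<^sub>R h)) (at t)"
      by (auto intro!: derivative_eq_intros)
    from has_derivative_compose[OF this has_derivative_partial[OF dk]]
    show ?thesis by (simp add: has_vector_derivative_def scaleR_sum_right)
  qed
  have lip: "norm (k (z + s *\<^sub>R h) - k z) \<le> \<bar>s\<bar> * M" for z s
  proof -
    have "norm (k (z + s *\<^sub>R h) - k (z + 0 *\<^sub>R h)) \<le> M * norm (s - 0)"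
    proof (rule differentiable_bound[where S = UNIV and f' = "\<lambda>t r. r *\<^sub>R (\<Sum>i\<in>UNIV. h $ i *\<^sub>R partial i k (z + t *\<^sub>R h))"])
      fix t :: real
      show "((\<lambda>t. k (z + t *\<^sub>R h)) has_derivative (\<lambda>r. r *\<^sub>R (\<Sum>i\<in>UNIV. h $ i *\<^sub>R partial i k (z + t *\<^sub>R h)))) (at t within UNIV)"
        using line[of z t] by (simp add: has_vector_derivative_def)
      have "norm (\<Sum>i\<in>UNIV. h $ i *\<^sub>R partial i k (z + t *\<^sub>R h)) \<le> M"
        unfolding M_def using B by (intro order_trans[OF norm_sum] sum_mono) (auto intro: mult_left_mono)
      then show "onorm (\<lambda>r. r *\<^sub>R (\<Sum>i\<in>UNIV. h $ i *\<^sub>R partial i k (z + t *\<^sub>R h))) \<le> M"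
        by (intro onorm_le) (simp add: mult.commute[of M] mult_left_mono)
    qed auto
    then show ?thesis by (simp add: mult.commute)
  qed
  define G where "G y = (\<Sum>i\<in>UNIV. h $ i *\<^sub>R partial i k (x - y)) * v y" for y
  have [measurable]: "G \<in> borel_measurable borel" unfolding G_def by measurable
  have IG: "(LINT y|lborel. G y) = (\<Sum>i\<in>UNIV. h $ i *\<^sub>R conv (partial i k) v x)"
    unfolding G_def conv_def sum_distrib_right using conv_integrable[OF v pk]
    by (subst Bochner_Integration.integral_sum) auto
  have "((\<lambda>s. (conv k v (x + s *\<^sub>R h) - conv k v x) /\<^sub>R s) \<longlongrightarrow> (LINT y|lborel. G y)) (at 0)"
    unfolding tendsto_at_iff_sequentially
  proof (intro allI impI)
    fix S :: "nat \<Rightarrow> real" assume S: "\<forall>n. S n \<in> UNIV - {0}" "S \<longlonglongrightarrow> 0"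
    obtain N where N: "\<forall>n\<ge>N. \<bar>S n\<bar> < 1"
      using S(2)[unfolded lim_sequentially, rule_format, of 1] by auto
    \<comment> \<open>Increments \<open>s\<close> with \<open>|s| < 1\<close> move the point by at
      most \<open>norm h\<close>, and the kernel reaches \<open>\<epsilon>\<close> further; the 1
      makes the inequality strict.\<close>
    define R where "R = norm h + 1 + \<epsilon>"
    have "(\<lambda>n. LINT y|lborel. (k (x + S (n + N) *\<^sub>R h - y) - k (x - y)) /\<^sub>R S (n + N) * v y) \<longlonglongrightarrow> (LINT y|lborel. G y)"
    proof (rule integral_dominated_convergence)
      show "integrable lborel (\<lambda>y. norm (M *\<^sub>R (indicator (ball x R) y *\<^sub>R v y)))"
        using v unfolding locally_integrable_def by (intro integrable_norm integrable_scaleR_right) blast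
      have M0: "0 \<le> M" unfolding M_def using B by (intro sum_nonneg) auto
      show "AE y in lborel. norm ((k (x + S (n + N) *\<^sub>R h - y) - k (x - y)) /\<^sub>R S (n + N) * v y) \<le> norm (M *\<^sub>R (indicator (ball x R) y *\<^sub>R v y))" for n
      proof (intro AE_I2)
        fix y
        let ?s = "S (n + N)"
        have s: "?s \<noteq> 0" "\<bar>?s\<bar> < 1" using S N by auto
        show "norm ((k (x + ?s *\<^sub>R h - y) - k (x - y)) /\<^sub>R ?s * v y) \<le> norm (M *\<^sub>R (indicator (ball x R) y *\<^sub>R v y))"
        proof (cases "y \<in> ball x R")
          case True
          have "norm ((k (x + ?s *\<^sub>R h - y) - k (x - y)) /\<^sub>R ?s) \<le> M"
          proof -
            have xy: "x - y + ?s *\<^sub>R h = x + ?s *\<^sub>R h - y" by simp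
            have "norm (k (x + ?s *\<^sub>R h - y) - k (x - y)) \<le> M * \<bar>?s\<bar>"
              using lip[of "x - y" ?s] unfolding xy by (simp add: mult.commute)
            then have "norm (k (x + ?s *\<^sub>R h - y) - k (x - y)) / \<bar>?s\<bar> \<le> M"
              using s by (subst pos_divide_le_eq) auto
            then show ?thesis unfolding norm_scaleR by (simp add: divide_inverse mult.commute)
          qed
          then have "norm ((k (x + ?s *\<^sub>R h - y) - k (x - y)) /\<^sub>R ?s * v y) \<le> M * norm (v y)"
            unfolding norm_mult by (rule mult_right_mono) simp
          also have "M * norm (v y) = norm (M *\<^sub>R (indicator (ball x R) y *\<^sub>R v y))" using True M0 by simp
          finally show ?thesis .
        next
          case False
          then have y: "R \<le> norm (x - y)" by (simp add: dist_norm)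
          have "norm (?s *\<^sub>R h) \<le> 1 * norm h" unfolding norm_scaleR using s by (intro mult_right_mono) auto
          moreover have "norm (x - y) \<le> norm (x + w - y) + norm w" for w by norm
          from this[of "?s *\<^sub>R h"] have "norm (x - y) \<le> norm (x + ?s *\<^sub>R h - y) + norm (?s *\<^sub>R h)" .
          ultimately have "\<epsilon> < norm (x + ?s *\<^sub>R h - y)" "\<epsilon> < norm (x - y)" using y unfolding R_def
            using norm_ge_zero[of h] by linarith+
          then have "k (x + ?s *\<^sub>R h - y) = 0" "k (x - y) = 0" using k by (auto simp: conv_kernel_def)
          then show ?thesis by simp
        qed
      qed
      have "(\<lambda>n. (k (x + S (n + N) *\<^sub>R h - y) - k (x - y)) /\<^sub>R S (n + N) * v y) \<longlonglongrightarrow> G y" for y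
      proof -
        have "((\<lambda>s. (k (x - y + s *\<^sub>R h) - k (x - y)) /\<^sub>R s) \<longlongrightarrow> (\<Sum>i\<in>UNIV. h $ i *\<^sub>R partial i k (x - y))) (at 0)"
          using line[of "x - y" 0] by (simp add: has_vector_derivative_iff_quotient)
        then have "(\<lambda>n. (k (x - y + S n *\<^sub>R h) - k (x - y)) /\<^sub>R S n) \<longlonglongrightarrow> (\<Sum>i\<in>UNIV. h $ i *\<^sub>R partial i k (x - y))"
          unfolding tendsto_at_iff_sequentially using S by (auto simp: o_def)
        from LIMSEQ_ignore_initial_segment[OF this, of N]
        have "(\<lambda>n. (k (x + S (n + N) *\<^sub>R h - y) - k (x - y)) /\<^sub>R S (n + N)) \<longlonglongrightarrow> (\<Sum>i\<in>UNIV. h $ i *\<^sub>R partial i k (x - y))"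
          by (simp add: algebra_simps)
        then show ?thesis unfolding G_def by (rule tendsto_mult_right)
      qed
      then show "AE y in lborel. (\<lambda>n. (k (x + S (n + N) *\<^sub>R h - y) - k (x - y)) /\<^sub>R S (n + N) * v y) \<longlonglongrightarrow> G y"
        by (intro AE_I2)
    qed measurable
    moreover have "(LINT y|lborel. (k (x + s *\<^sub>R h - y) - k (x - y)) /\<^sub>R s * v y) = (conv k v (x + s *\<^sub>R h) - conv k v x) /\<^sub>R s" for s
    proof -
      have "(LINT y|lborel. (k (x + s *\<^sub>R h - y) - k (x - y)) /\<^sub>R s * v y)
         = (LINT y|lborel. (k (x + s *\<^sub>R h - y) * v y - k (x - y) * v y) /\<^sub>R s)"
        by (simp add: algebra_simps)
      also have "\<dots> = (conv k v (x + s *\<^sub>R h) - conv k v x) /\<^sub>R s"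
        unfolding conv_def by (simp add: conv_integrable[OF v k])
      finally show ?thesis .
    qed
    ultimately have "(\<lambda>n. (conv k v (x + S (n + N) *\<^sub>R h) - conv k v x) /\<^sub>R S (n + N)) \<longlonglongrightarrow> (LINT y|lborel. G y)" by (simp only:)
    then show "((\<lambda>s. (conv k v (x + s *\<^sub>R h) - conv k v x) /\<^sub>R s) \<circ> S) \<longlonglongrightarrow> (LINT y|lborel. G y)"
      unfolding o_def by (rule LIMSEQ_offset)
  qed
  then show ?thesis unfolding has_vector_derivative_iff_quotient IG by simp
qed

lemma le_one_plus_powr:
  fixes x :: real
  assumes "0 \<le> x" "1 \<le> p"
  shows "x \<le> 1 + x powr p"
proof (cases "x \<le> 1")
  case False
  then have "x powr 1 \<le> x powr p" using assms by (intro powr_mono) auto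
  then show ?thesis using False by simp
next
  case True
  then show ?thesis using powr_ge_zero[of x p] by linarith
qed

lemma locally_integrable_Lp:
  assumes [measurable]: "v \<in> borel_measurable borel" and p: "1 \<le> p"
    and I: "integrable lborel (\<lambda>x. norm (v x) powr p)"
  shows "locally_integrable v"
  unfolding locally_integrable_def
proof (intro conjI allI)
  fix z :: "real ^ 'a" and R
  have fin: "emeasure lborel (ball z R) < \<infinity>" using emeasure_lborel_ball_finite by (simp add: less_top)
  have vp: "norm (v y) \<le> 1 + norm (v y) powr p" for y
    using p by (intro le_one_plus_powr) auto
  show "integrable lborel (\<lambda>y. indicator (ball z R) y *\<^sub>R v y)"
  proof (rule Bochner_Integration.integrable_bound)
    show "integrable lborel (\<lambda>y. indicator (ball z R) y + norm (v y) powr p :: real)"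
      using I fin by (intro Bochner_Integration.integrable_add) (auto simp: integrable_indicator_iff)
    show "AE y in lborel. norm (indicator (ball z R) y *\<^sub>R v y) \<le> norm (indicator (ball z R) y + norm (v y) powr p)"
      using vp by (intro AE_I2) (auto simp: indicator_def abs_of_nonneg)
    have "v \<in> borel_measurable lborel" using assms(1) by simp
    then show "(\<lambda>y. indicator (ball z R) y *\<^sub>R v y) \<in> borel_measurable lborel"
      by (intro borel_measurable_scaleR borel_measurable_indicator) auto
  qed
qed fact

text \<open>Within reach of the kernel \<open>|v| \<le> 1 + |v|^p\<close>, and the integral of the
  right side over a ball is bounded uniformly in its centre. Global boundedness is part of
  \<open>jets\<close>, where it feeds the absorption in \<open>Gagliardo_critical\<close>.\<close>

lemma conv_bounded:
  assumes k: "conv_kernel \<epsilon> k" and [measurable]: "v \<in> borel_measurable borel" and p: "1 \<le> p"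
    and I: "integrable lborel (\<lambda>x. norm (v x) powr p)"
  shows "bounded (range (conv k v))"
proof -
  obtain B where B: "0 \<le> B" "\<And>x. norm (k x) \<le> B" using conv_kernel_bounded[OF k] by metis
  note [measurable] = conv_kernel_measurable[OF k]
  have vp: "norm (v y) \<le> 1 + norm (v y) powr p" for y
    using p by (intro le_one_plus_powr) auto
  define C where "C = B * (measure lborel (ball (0 :: real ^ 'a) (\<epsilon> + 1)) + (LINT y|lborel. norm (v y) powr p))"
  have "norm (conv k v x) \<le> C" for x
  proof -
    have fin: "emeasure lborel (ball x (\<epsilon> + 1)) < \<infinity>" using emeasure_lborel_ball_finite by (simp add: less_top)
    have int: "integrable lborel (\<lambda>y. B * (indicator (ball x (\<epsilon> + 1)) y + norm (v y) powr p))"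
      using I fin by (intro integrable_mult_right Bochner_Integration.integrable_add) (auto simp: integrable_indicator_iff)
    have "norm (conv k v x) \<le> (LINT y|lborel. B * (indicator (ball x (\<epsilon> + 1)) y + norm (v y) powr p))"
      unfolding conv_def
    proof (rule order_trans[OF integral_norm_bound Bochner_Integration.integral_mono[OF integrable_norm int]])
      show "integrable lborel (\<lambda>y. k (x - y) * v y)"
        by (rule conv_integrable[OF locally_integrable_Lp[OF _ p I] k]) measurable
      fix y
      show "norm (k (x - y) * v y) \<le> B * (indicator (ball x (\<epsilon> + 1)) y + norm (v y) powr p)"
      proof (cases "y \<in> ball x (\<epsilon> + 1)")
        case True
        have "norm (k (x - y) * v y) \<le> B * (1 + norm (v y) powr p)"
          unfolding norm_mult using B vp by (intro mult_mono) auto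
        then show ?thesis using True by simp
      next
        case False
        then have "\<epsilon> < norm (x - y)" by (simp add: dist_norm)
        then have "k (x - y) = 0" using k by (simp add: conv_kernel_def)
        then show ?thesis using B by simp
      qed
    qed
    also have "\<dots> = B * (measure lborel (ball x (\<epsilon> + 1)) + (LINT y|lborel. norm (v y) powr p))"
      using I fin by (subst integral_mult_right_zero, subst Bochner_Integration.integral_add) (auto simp: integrable_indicator_iff)
    also have "measure lborel (ball x (\<epsilon> + 1)) = measure lborel (ball (0 :: real ^ 'a) (\<epsilon> + 1))"
      by (simp add: measure_def emeasure_lborel_ball_translate[of x])
    finally show ?thesis by (simp add: C_def)
  qed
  then show ?thesis by (auto simp: bounded_iff)
qed

lemma nn_integral_lborel_reflect:
  fixes F :: "'a::euclidean_space \<Rightarrow> ennreal"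
  assumes "F \<in> borel_measurable borel"
  shows "(\<integral>\<^sup>+y. F (x - y) \<partial>lborel) = (\<integral>\<^sup>+y. F y \<partial>lborel)"
  using nn_integral_lborel_affine[OF assms, of "-1" x] by simp

section \<open>Continuity of translations in the integral norm\<close>

lemma ennreal_tendsto_0I:
  fixes X :: "'a \<Rightarrow> ennreal"
  assumes "\<And>e. 0 < e \<Longrightarrow> eventually (\<lambda>m. X m \<le> ennreal e) F"
  shows "(X \<longlongrightarrow> 0) F"
proof (rule order_tendstoI)
  fix a :: ennreal assume "0 < a"
  then obtain b where b: "0 < b" "b < a" using dense by blast
  then have "b \<noteq> top" by auto
  then have "b = ennreal (enn2real b)" "0 < enn2real b" using b by (auto simp: less_top enn2real_positive_iff)
  with assms[of "enn2real b"] have "eventually (\<lambda>m. X m \<le> b) F" by simp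
  then show "eventually (\<lambda>m. X m < a) F" by eventually_elim (use b in auto)
qed simp

text \<open>The modulus of continuity of \<open>f\<close> in the \<open>L\<^sup>1\<close> norm, for
  the translation by \<open>z\<close>.\<close>

definition shift_diff :: "('a::euclidean_space \<Rightarrow> complex) \<Rightarrow> 'a \<Rightarrow> ennreal" where
  "shift_diff f z = (\<integral>\<^sup>+x. ennreal (norm (f (x - z) - f x)) \<partial>lborel)"

lemma nn_integral_lborel_shift_minus:
  fixes F :: "'a::euclidean_space \<Rightarrow> ennreal"
  assumes "F \<in> borel_measurable borel"
  shows "(\<integral>\<^sup>+x. F (x - z) \<partial>lborel) = (\<integral>\<^sup>+x. F x \<partial>lborel)"
  using nn_integral_lborel_affine[OF assms, of 1 "-z"] by simp

lemma shift_diff_le: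
  assumes [measurable]: "f \<in> borel_measurable borel" "g \<in> borel_measurable borel"
  shows "shift_diff f z \<le> shift_diff g z + 2 * (\<integral>\<^sup>+x. ennreal (norm (f x - g x)) \<partial>lborel)"
proof -
  have "shift_diff f z \<le> (\<integral>\<^sup>+x. ennreal (norm (g (x - z) - g x)) + ennreal (norm (f (x - z) - g (x - z))) + ennreal (norm (f x - g x)) \<partial>lborel)"
    unfolding shift_diff_def
  proof (intro nn_integral_mono)
    fix x
    have "norm (f (x - z) - f x) \<le> norm (g (x - z) - g x) + norm (f (x - z) - g (x - z)) + norm (f x - g x)" by norm
    then show "ennreal (norm (f (x - z) - f x)) \<le> ennreal (norm (g (x - z) - g x)) + ennreal (norm (f (x - z) - g (x - z))) + ennreal (norm (f x - g x))"
      by (simp add: ennreal_plus[symmetric] ennreal_leI del: ennreal_plus)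
  qed
  also have "\<dots> = shift_diff g z + (\<integral>\<^sup>+x. ennreal (norm (f (x - z) - g (x - z))) \<partial>lborel) + (\<integral>\<^sup>+x. ennreal (norm (f x - g x)) \<partial>lborel)"
    unfolding shift_diff_def by (simp add: nn_integral_add)
  also have "(\<integral>\<^sup>+x. ennreal (norm (f (x - z) - g (x - z))) \<partial>lborel) = (\<integral>\<^sup>+x. ennreal (norm (f x - g x)) \<partial>lborel)"
    by (rule nn_integral_lborel_shift_minus) measurable
  finally show ?thesis by (simp add: mult_2 add.assoc)
qed

text \<open>A point of the open set \<open>U\<close> stays in \<open>U\<close> under small shifts,
  so the part of \<open>U\<close> outside its translate shrinks by dominated convergence. The part
  of the translate outside \<open>U\<close> has the same measure, both sets having the same finite
  measure; hence the factor 2.\<close>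

lemma shift_diff_indicator_open:
  assumes U: "open (U :: 'a::euclidean_space set)" "emeasure lborel U < top" and z: "z \<longlonglongrightarrow> 0"
  shows "(\<lambda>m. shift_diff (indicator U) (z m)) \<longlonglongrightarrow> 0"
proof -
  have [measurable]: "U \<in> sets borel" using U by simp
  define D where "D m = (\<integral>\<^sup>+x. indicator U x * (1 - indicator U (x - z m)) \<partial>lborel :: ennreal)" for m
  have "D \<longlonglongrightarrow> (\<integral>\<^sup>+x. 0 \<partial>(lborel :: 'a measure))"
    unfolding D_def
  proof (rule nn_integral_dominated_convergence[where w = "indicator U"])
    show "AE x in lborel. indicator U x * (1 - indicator U (x - z m)) \<le> (indicator U x :: ennreal)" for m
      by (intro AE_I2) (auto simp: indicator_def)
    show "(\<integral>\<^sup>+x. indicator U x \<partial>lborel) < \<infinity>" using U by simp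
    show "AE x in lborel. (\<lambda>m. indicator U x * (1 - indicator U (x - z m))) \<longlonglongrightarrow> (0 :: ennreal)"
    proof (intro AE_I2)
      fix x
      show "(\<lambda>m. indicator U x * (1 - indicator U (x - z m))) \<longlonglongrightarrow> (0 :: ennreal)"
      proof (cases "x \<in> U")
        case True
        have "(\<lambda>m. x - z m) \<longlonglongrightarrow> x - 0" by (intro tendsto_intros z)
        then have "eventually (\<lambda>m. x - z m \<in> U) sequentially"
          using U True by (auto dest: topological_tendstoD)
        then have "eventually (\<lambda>m. 0 = indicator U x * (1 - indicator U (x - z m) :: ennreal)) sequentially"
          by eventually_elim simp
        then show ?thesis by (rule Lim_transform_eventually[OF tendsto_const])
      qed simp
    qed
  qed measurable
  then have D: "(\<lambda>m. 2 * D m) \<longlonglongrightarrow> 2 * 0" by (intro ennreal_tendsto_cmult) auto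
  have "shift_diff (indicator U) (z m) = 2 * D m" for m
  proof -
    have "emeasure lborel U + shift_diff (indicator U) (z m) = (\<integral>\<^sup>+x. indicator U x + ennreal (norm (indicator U (x - z m) - indicator U x :: complex)) \<partial>lborel)"
      unfolding shift_diff_def by (simp add: nn_integral_add)
    also have "\<dots> = (\<integral>\<^sup>+x. indicator U (x - z m) + 2 * (indicator U x * (1 - indicator U (x - z m))) \<partial>lborel)"
      by (intro nn_integral_cong) (auto simp: indicator_def)
    also have "\<dots> = (\<integral>\<^sup>+x. indicator U (x - z m) \<partial>lborel) + 2 * D m"
      unfolding D_def by (subst nn_integral_add) (auto simp: nn_integral_cmult)
    also have "(\<integral>\<^sup>+x. indicator U (x - z m) \<partial>lborel) = emeasure lborel U"
      by (subst nn_integral_lborel_shift_minus) (auto intro!: borel_measurable_indicator)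
    finally show ?thesis using U by (auto simp: ennreal_add_left_cancel)
  qed
  with D show ?thesis by simp
qed

lemma shift_diff_cmult:
  assumes [measurable]: "f \<in> borel_measurable borel"
  shows "shift_diff (\<lambda>x. c * f x) z = ennreal (norm c) * shift_diff f z"
proof -
  have "ennreal (norm (c * f (x - z) - c * f x)) = ennreal (norm c) * ennreal (norm (f (x - z) - f x))" for x
    by (simp add: right_diff_distrib[symmetric] norm_mult ennreal_mult')
  then show ?thesis unfolding shift_diff_def by (simp add: nn_integral_cmult)
qed

text \<open>Functions with vanishing modulus of continuity are closed under approximation in the
  mean: the error enters twice, once shifted and once not.\<close>

lemma shift_diff_approx:
  assumes f: "f \<in> borel_measurable borel"
    and ap: "\<And>e::real. 0 < e \<Longrightarrow> \<exists>g. g \<in> borel_measurable borel \<and> (\<lambda>m. shift_diff g (z m)) \<longlonglongrightarrow> 0 \<and>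
       (\<integral>\<^sup>+x. ennreal (norm (f x - g x)) \<partial>lborel) \<le> ennreal e"
  shows "(\<lambda>m. shift_diff f (z m)) \<longlonglongrightarrow> 0"
proof (rule ennreal_tendsto_0I)
  fix e :: real assume e: "0 < e"
  then obtain g where g: "g \<in> borel_measurable borel" "(\<lambda>m. shift_diff g (z m)) \<longlonglongrightarrow> 0"
     "(\<integral>\<^sup>+x. ennreal (norm (f x - g x)) \<partial>lborel) \<le> ennreal (e / 4)" using ap[of "e / 4"] by auto
  have "eventually (\<lambda>m. shift_diff g (z m) < ennreal (e / 2)) sequentially"
    using g(2) e by (auto intro: order_tendstoD)
  then show "eventually (\<lambda>m. shift_diff f (z m) \<le> ennreal e) sequentially"
  proof eventually_elim
    case (elim m)
    have "shift_diff f (z m) \<le> shift_diff g (z m) + 2 * (\<integral>\<^sup>+x. ennreal (norm (f x - g x)) \<partial>lborel)"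
      by (rule shift_diff_le[OF f g(1)])
    also have "\<dots> \<le> ennreal (e / 2) + 2 * ennreal (e / 4)"
      using elim g(3) by (intro add_mono mult_left_mono) auto
    also have "\<dots> = ennreal e"
    proof -
      have "2 * ennreal (e / 4) = ennreal (2 * (e / 4))" using e by (subst ennreal_mult) auto
      then show ?thesis using e by (simp add: ennreal_plus[symmetric] del: ennreal_plus)
    qed
    finally show ?case .
  qed
qed

text \<open>Outer regularity reduces indicators to open sets; sums and dominated limits then reach
  all integrable functions.\<close>

lemma shift_diff_tendsto_0:
  fixes f :: "'a::euclidean_space \<Rightarrow> complex"
  assumes "integrable lborel f" and z: "z \<longlonglongrightarrow> 0"
  shows "(\<lambda>m. shift_diff f (z m)) \<longlonglongrightarrow> 0"
  using assms(1)
proof (induction rule: integrable_induct)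
  case (base A c)
  then have [measurable]: "A \<in> sets borel" by simp
  have "(\<lambda>m. shift_diff (indicator A) (z m)) \<longlonglongrightarrow> 0"
  proof (rule shift_diff_approx)
    fix e :: real assume e: "0 < e"
    have "A \<in> sets lebesgue" by simp
    then obtain U where U: "open U" "A \<subseteq> U" "U - A \<in> lmeasurable" "emeasure lebesgue (U - A) < ennreal e"
      using sets_lebesgue_outer_open e by metis
    have [measurable]: "U \<in> sets borel" using U by simp
    have d: "emeasure lborel (U - A) < ennreal e" using U(4) by simp
    have "emeasure lborel U = emeasure lborel A + emeasure lborel (U - A)"
      using U(2) by (subst plus_emeasure) (auto simp: Un_absorb1)
    also have "\<dots> < top" using base d by (auto simp: less_top[symmetric] ennreal_add_eq_top)
    finally have "(\<lambda>m. shift_diff (indicator U) (z m)) \<longlonglongrightarrow> 0"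
      by (intro shift_diff_indicator_open U z)
    moreover have "(\<integral>\<^sup>+x. ennreal (norm (indicator A x - indicator U x :: complex)) \<partial>lborel) = (\<integral>\<^sup>+x. indicator (U - A) x \<partial>lborel)"
      using U(2) by (intro nn_integral_cong) (auto simp: indicator_def)
    ultimately show "\<exists>g. g \<in> borel_measurable borel \<and> (\<lambda>m. shift_diff g (z m)) \<longlonglongrightarrow> 0 \<and>
       (\<integral>\<^sup>+x. ennreal (norm (indicator A x - g x)) \<partial>lborel) \<le> ennreal e"
      using d by (intro exI[of _ "indicator U"]) auto
  qed measurable
  then have "(\<lambda>m. ennreal (norm c) * shift_diff (indicator A) (z m)) \<longlonglongrightarrow> ennreal (norm c) * 0"
    by (intro ennreal_tendsto_cmult) auto
  moreover have "(\<lambda>x. indicator A x *\<^sub>R c) = (\<lambda>x. c * indicator A x)" by (auto simp: indicator_def)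
  ultimately show ?case by (simp add: shift_diff_cmult)
next
  case (add f g)
  then have [measurable]: "f \<in> borel_measurable borel" "g \<in> borel_measurable borel" by auto
  have le: "shift_diff (\<lambda>x. f x + g x) w \<le> shift_diff f w + shift_diff g w" for w
  proof -
    have "shift_diff (\<lambda>x. f x + g x) w \<le> (\<integral>\<^sup>+x. ennreal (norm (f (x - w) - f x)) + ennreal (norm (g (x - w) - g x)) \<partial>lborel)"
      unfolding shift_diff_def
    proof (intro nn_integral_mono)
      fix x
      have "norm (f (x - w) + g (x - w) - (f x + g x)) \<le> norm (f (x - w) - f x) + norm (g (x - w) - g x)" by norm
      then show "ennreal (norm (f (x - w) + g (x - w) - (f x + g x))) \<le> ennreal (norm (f (x - w) - f x)) + ennreal (norm (g (x - w) - g x))"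
        by (simp add: ennreal_plus[symmetric] ennreal_leI del: ennreal_plus)
    qed
    also have "\<dots> = shift_diff f w + shift_diff g w" unfolding shift_diff_def by (rule nn_integral_add) measurable
    finally show ?thesis .
  qed
  have "(\<lambda>m. shift_diff f (z m) + shift_diff g (z m)) \<longlonglongrightarrow> 0 + 0" using add by (intro tendsto_add) auto
  then show ?case
    using tendsto_sandwich[where f = "\<lambda>_. 0" and g = "\<lambda>m. shift_diff (\<lambda>x. f x + g x) (z m)"
      and h = "\<lambda>m. shift_diff f (z m) + shift_diff g (z m)" and c = 0] le by simp
next
  case (lim f s)
  have bnd: "norm (s i x) \<le> 2 * norm (f x)" and cnv: "(\<lambda>i. s i x) \<longlonglongrightarrow> f x"
    and IH: "(\<lambda>m. shift_diff (s i) (z m)) \<longlonglongrightarrow> 0" for i x using lim by simp_all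
  show ?case
  proof (rule shift_diff_approx)
    show "f \<in> borel_measurable borel" using lim by auto
    fix e :: real assume e: "0 < e"
    have [measurable]: "f \<in> borel_measurable borel" "s i \<in> borel_measurable borel" for i using lim by auto
    have "(\<lambda>i. \<integral>\<^sup>+x. ennreal (norm (f x - s i x)) \<partial>lborel) \<longlonglongrightarrow> (\<integral>\<^sup>+x. 0 \<partial>(lborel :: 'a measure))"
    proof (rule nn_integral_dominated_convergence[where w = "\<lambda>x. ennreal (3 * norm (f x))"])
      have "norm (f x - s i x) \<le> 3 * norm (f x)" for x i
        using bnd[of i x] norm_triangle_ineq4[of "f x" "s i x"] by simp
      then show "AE x in lborel. ennreal (norm (f x - s i x)) \<le> ennreal (3 * norm (f x))" for i
        by (intro AE_I2 ennreal_leI)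
      have "integrable lborel (\<lambda>x. 3 * norm (f x))" using lim by auto
      then show "(\<integral>\<^sup>+x. ennreal (3 * norm (f x)) \<partial>lborel) < \<infinity>" by (subst nn_integral_eq_integral) auto
      have "(\<lambda>i. ennreal (norm (f x - s i x))) \<longlonglongrightarrow> ennreal (norm (f x - f x))" for x
        using cnv[of x] by (intro tendsto_intros) auto
      then show "AE x in lborel. (\<lambda>i. ennreal (norm (f x - s i x))) \<longlonglongrightarrow> 0" by simp
    qed measurable
    then have "eventually (\<lambda>i. (\<integral>\<^sup>+x. ennreal (norm (f x - s i x)) \<partial>lborel) < ennreal e) sequentially"
      using e by (auto intro: order_tendstoD)
    then obtain i where "(\<integral>\<^sup>+x. ennreal (norm (f x - s i x)) \<partial>lborel) < ennreal e"
      by (auto simp: eventually_sequentially)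
    then show "\<exists>g. g \<in> borel_measurable borel \<and> (\<lambda>m. shift_diff g (z m)) \<longlonglongrightarrow> 0 \<and>
       (\<integral>\<^sup>+x. ennreal (norm (f x - g x)) \<partial>lborel) \<le> ennreal e"
      using IH[of i] by (intro exI[of _ "s i"]) auto
  qed
qed

section \<open>Approximation by convolution with the scaled kernel\<close>

context mollifier
begin

definition ker :: "real \<Rightarrow> real ^ 'n \<Rightarrow> real" where
  "ker \<epsilon> x = \<eta> ((1 / \<epsilon>) *\<^sub>R x) / \<epsilon> ^ CARD('n)"

definition cker :: "real \<Rightarrow> real ^ 'n \<Rightarrow> complex" where
  "cker \<epsilon> x = complex_of_real (ker \<epsilon> x)"

lemma smooth_cker: "smooth (cker \<epsilon>)"
proof -
  have "cker \<epsilon> = (\<lambda>x. complex_of_real (1 / \<epsilon> ^ CARD('n)) * complex_of_real (\<eta> (0 + (1 / \<epsilon>) *\<^sub>R x)))"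
    by (auto simp: cker_def ker_def)
  then show ?thesis using smooth_affine[OF smooth_eta] by metis
qed

lemma ker_nonneg: "0 < \<epsilon> \<Longrightarrow> 0 \<le> ker \<epsilon> x"
  by (simp add: ker_def eta_nonneg)

lemma ker_support: "0 < \<epsilon> \<Longrightarrow> \<epsilon> < norm x \<Longrightarrow> ker \<epsilon> x = 0"
  by (simp add: ker_def eta_support divide_simps)

lemma norm_cker: "0 < \<epsilon> \<Longrightarrow> norm (cker \<epsilon> x) = ker \<epsilon> x"
  by (simp add: cker_def ker_nonneg)

lemma cker_kernel: "0 < \<epsilon> \<Longrightarrow> conv_kernel \<epsilon> (cker \<epsilon>)"
  using smooth_continuous[OF smooth_cker, of "[]"] by (simp add: conv_kernel_def ker_support cker_def partials_def)

lemma cker_differentiable: "cker \<epsilon> differentiable (at x)"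
  using smooth_differentiable[OF smooth_cker, of "[]"] by (simp add: partials_def)

lemma partial_cker_kernel:
  assumes "0 < \<epsilon>"
  shows "conv_kernel \<epsilon> (partial i (cker \<epsilon>))"
  unfolding conv_kernel_def
proof (intro conjI allI impI)
  show "continuous_on UNIV (partial i (cker \<epsilon>))"
    using smooth_continuous[OF smooth_cker, of "[i]"] by (simp add: partials_def)
  fix x :: "real ^ 'n" assume x: "\<epsilon> < norm x"
  have "open {x :: real ^ 'n. \<epsilon> < norm x}" by (intro open_Collect_less continuous_intros)
  moreover have "((\<lambda>_. 0) has_derivative (\<lambda>h. 0)) (at x)" by simp
  ultimately have "(cker \<epsilon> has_derivative (\<lambda>h. 0)) (at x)"
    using x assms has_derivative_transform_within_open[of "\<lambda>_. 0" "\<lambda>h. 0" x UNIV "{x. \<epsilon> < norm x}" "cker \<epsilon>"]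
    by (simp add: cker_def ker_support)
  then show "partial i (cker \<epsilon>) x = 0" by (intro partial_eqI) simp
qed

lemma measurable_eta [measurable]: "\<eta> \<in> borel_measurable borel"
proof -
  have "continuous_on UNIV (\<lambda>x. Re (complex_of_real (\<eta> x)))"
    using smooth_continuous[OF smooth_eta, of "[]"] by (intro continuous_intros) (simp add: partials_def)
  then show ?thesis by (intro borel_measurable_continuous_onI) simp
qed

lemma measurable_ker [measurable]: "ker \<epsilon> \<in> borel_measurable borel"
  unfolding ker_def by measurable

lemma nn_integral_ker:
  assumes [measurable]: "F \<in> borel_measurable borel" and e: "0 < \<epsilon>"
  shows "(\<integral>\<^sup>+z. ennreal (ker \<epsilon> z) * F z \<partial>lborel) = (\<integral>\<^sup>+w. ennreal (\<eta> w) * F (\<epsilon> *\<^sub>R w) \<partial>lborel)"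
proof -
  have "(\<integral>\<^sup>+z. ennreal (ker \<epsilon> z) * F z \<partial>lborel) = ennreal (\<bar>\<epsilon>\<bar> ^ DIM(real ^ 'n)) * (\<integral>\<^sup>+w. ennreal (ker \<epsilon> (0 + \<epsilon> *\<^sub>R w)) * F (0 + \<epsilon> *\<^sub>R w) \<partial>lborel)"
    using e by (intro nn_integral_lborel_affine) auto
  also have "\<dots> = (\<integral>\<^sup>+w. ennreal (\<epsilon> ^ CARD('n)) * (ennreal (ker \<epsilon> (\<epsilon> *\<^sub>R w)) * F (\<epsilon> *\<^sub>R w)) \<partial>lborel)"
    using e by (subst nn_integral_cmult) auto
  also have "\<dots> = (\<integral>\<^sup>+w. ennreal (\<eta> w) * F (\<epsilon> *\<^sub>R w) \<partial>lborel)"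
    using e by (intro nn_integral_cong) (simp add: ker_def mult.assoc[symmetric] ennreal_mult'[symmetric])
  finally show ?thesis .
qed

lemma nn_integral_ker_1: "0 < \<epsilon> \<Longrightarrow> (\<integral>\<^sup>+z. ennreal (ker \<epsilon> z) \<partial>lborel) = 1"
  using nn_integral_ker[of "\<lambda>_. 1" \<epsilon>] eta_integral by simp

lemma norm_conv_le:
  assumes v: "locally_integrable v" and e: "0 < \<epsilon>"
  shows "ennreal (norm (conv (cker \<epsilon>) v x)) \<le> (\<integral>\<^sup>+z. ennreal (ker \<epsilon> z) * ennreal (norm (v (x - z))) \<partial>lborel)"
proof -
  have [measurable]: "v \<in> borel_measurable borel" using v by (simp add: locally_integrable_def)
  have "ennreal (norm (conv (cker \<epsilon>) v x)) \<le> (\<integral>\<^sup>+y. ennreal (norm (cker \<epsilon> (x - y) * v y)) \<partial>lborel)"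
    unfolding conv_def by (rule integral_norm_bound_ennreal[OF conv_integrable[OF v cker_kernel[OF e]]])
  also have "\<dots> = (\<integral>\<^sup>+y. ennreal (ker \<epsilon> (x - y)) * ennreal (norm (v (x - (x - y)))) \<partial>lborel)"
    using e by (simp add: norm_mult norm_cker ennreal_mult' ker_nonneg)
  also have "\<dots> = (\<integral>\<^sup>+z. ennreal (ker \<epsilon> z) * ennreal (norm (v (x - z))) \<partial>lborel)"
    by (rule nn_integral_lborel_reflect) measurable
  finally show ?thesis .
qed

text \<open>The kernel is a probability density, so Hoelder bounds the power of the average by the
  average of the power; Tonelli and translation invariance finish. Only points within
  \<open>\<epsilon>\<close> of \<open>G'\<close> are seen, and they belong to
  \<open>G\<close>.\<close>

lemma conv_Lp_le:
  assumes v: "locally_integrable v" and e: "0 < \<epsilon>" and p: "1 \<le> p"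
    and [measurable]: "G' \<in> sets borel" "G \<in> sets borel" and sub: "\<And>x. x \<in> G' \<Longrightarrow> cball x \<epsilon> \<subseteq> G"
  shows "(\<integral>\<^sup>+x. ennreal (norm (conv (cker \<epsilon>) v x)) epowr p * indicator G' x \<partial>lborel)
     \<le> (\<integral>\<^sup>+x. ennreal (norm (v x)) epowr p * indicator G x \<partial>lborel)"
proof -
  have [measurable]: "v \<in> borel_measurable borel" using v by (simp add: locally_integrable_def)
  define W where "W x = ennreal (norm (v x)) epowr p * indicator G x" for x
  have [measurable]: "W \<in> borel_measurable borel" unfolding W_def by measurable
  have pt: "ennreal (norm (conv (cker \<epsilon>) v x)) epowr p * indicator G' x \<le> (\<integral>\<^sup>+z. ennreal (ker \<epsilon> z) * W (x - z) \<partial>lborel)" for x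
  proof (cases "x \<in> G'")
    case True
    have "ennreal (norm (conv (cker \<epsilon>) v x)) \<le> (\<integral>\<^sup>+z. ennreal (ker \<epsilon> z) * ennreal (norm (v (x - z))) \<partial>lborel)"
      by (rule norm_conv_le[OF v e])
    also have "\<dots> \<le> (\<integral>\<^sup>+z. (ennreal (ker \<epsilon> z) * W (x - z)) epowr (1 / p) * ennreal (ker \<epsilon> z) epowr (1 - 1 / p) \<partial>lborel)"
    proof (intro nn_integral_mono)
      fix z
      show "ennreal (ker \<epsilon> z) * ennreal (norm (v (x - z))) \<le> (ennreal (ker \<epsilon> z) * W (x - z)) epowr (1 / p) * ennreal (ker \<epsilon> z) epowr (1 - 1 / p)"
      proof (cases "norm z \<le> \<epsilon>")
        case zle: True
        then have "x - z \<in> cball x \<epsilon>" by (simp add: dist_norm)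
        then have "x - z \<in> G" using sub[OF True] by blast
        then have "(ennreal (ker \<epsilon> z) * W (x - z)) epowr (1 / p) = ennreal (ker \<epsilon> z) epowr (1 / p) * ennreal (norm (v (x - z)))"
          using p by (simp add: W_def epowr_mult epowr_epowr)
        moreover have "ennreal (ker \<epsilon> z) epowr (1 / p) * ennreal (ker \<epsilon> z) epowr (1 - 1 / p) = ennreal (ker \<epsilon> z)"
          using p by (subst epowr_add[symmetric]) auto
        ultimately show ?thesis by (simp add: mult_ac)
      next
        case False
        then show ?thesis using ker_support[OF e, of z] by simp
      qed
    qed
    also have "\<dots> \<le> (\<integral>\<^sup>+z. ennreal (ker \<epsilon> z) * W (x - z) \<partial>lborel) epowr (1 / p) * (\<integral>\<^sup>+z. ennreal (ker \<epsilon> z) \<partial>lborel) epowr (1 - 1 / p)"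
      using p by (intro nn_integral_Holder2) auto
    finally have "ennreal (norm (conv (cker \<epsilon>) v x)) epowr p \<le> ((\<integral>\<^sup>+z. ennreal (ker \<epsilon> z) * W (x - z) \<partial>lborel) epowr (1 / p)) epowr p"
      using p e by (intro epowr_mono) (auto simp: nn_integral_ker_1)
    then show ?thesis using True p by (simp add: epowr_epowr)
  qed simp
  have "(\<integral>\<^sup>+x. ennreal (norm (conv (cker \<epsilon>) v x)) epowr p * indicator G' x \<partial>lborel)
     \<le> (\<integral>\<^sup>+x. (\<integral>\<^sup>+z. ennreal (ker \<epsilon> z) * W (x - z) \<partial>lborel) \<partial>lborel)"
    by (intro nn_integral_mono pt)
  also have "\<dots> = (\<integral>\<^sup>+z. (\<integral>\<^sup>+x. ennreal (ker \<epsilon> z) * W (x - z) \<partial>lborel) \<partial>lborel)"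
    by (rule lborel_pair.Fubini') measurable
  also have "\<dots> = (\<integral>\<^sup>+z. ennreal (ker \<epsilon> z) * (\<integral>\<^sup>+x. W x \<partial>lborel) \<partial>lborel)"
    by (simp add: nn_integral_cmult nn_integral_lborel_shift_minus)
  also have "\<dots> = (\<integral>\<^sup>+x. W x \<partial>lborel)"
    using e by (simp add: nn_integral_multc nn_integral_ker_1)
  finally show ?thesis by (simp add: W_def)
qed

lemma integral_cker: "0 < \<epsilon> \<Longrightarrow> (LINT y|lborel. cker \<epsilon> (x - y)) = 1"
proof -
  assume e: "0 < \<epsilon>"
  have "(\<integral>\<^sup>+y. ennreal (ker \<epsilon> (x - y)) \<partial>lborel) = ennreal 1"
    using nn_integral_lborel_reflect[of "\<lambda>z. ennreal (ker \<epsilon> z)" x] e by (simp add: nn_integral_ker_1)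
  then have "(LINT y|lborel. ker \<epsilon> (x - y)) = 1"
    using e by (subst integral_eq_nn_integral) (auto simp: ker_nonneg)
  then show ?thesis by (simp add: cker_def)
qed

text \<open>As the kernel has integral 1, \<open>f x\<close> can be subtracted under the integral.
  The substitution \<open>z = \<epsilon> w\<close> leaves \<open>\<epsilon>\<close> only inside
  \<open>shift_diff\<close>, ready for dominated convergence in \<open>w\<close>.\<close>

lemma conv_L1_le:
  assumes f: "integrable lborel f" "locally_integrable f" and e: "0 < \<epsilon>"
  shows "(\<integral>\<^sup>+x. ennreal (norm (conv (cker \<epsilon>) f x - f x)) \<partial>lborel) \<le> (\<integral>\<^sup>+w. ennreal (\<eta> w) * shift_diff f (\<epsilon> *\<^sub>R w) \<partial>lborel)"
proof -
  have [measurable]: "f \<in> borel_measurable borel" using f by (simp add: locally_integrable_def)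
  note ci = conv_integrable[OF f(2) cker_kernel[OF e]]
  have one: "locally_integrable (\<lambda>_. 1)"
    unfolding locally_integrable_def using emeasure_lborel_ball_finite
    by (auto simp: less_top intro!: integrable_scaleR_left integrable_real_indicator)
  note c1 = conv_integrable[OF one cker_kernel[OF e]]
  have "ennreal (norm (conv (cker \<epsilon>) f x - f x)) \<le> (\<integral>\<^sup>+z. ennreal (ker \<epsilon> z) * ennreal (norm (f (x - z) - f x)) \<partial>lborel)" for x
  proof -
    have "conv (cker \<epsilon>) f x - f x = (LINT y|lborel. cker \<epsilon> (x - y) * f y) - (LINT y|lborel. cker \<epsilon> (x - y) * f x)"
      using integral_cker[OF e, of x] by (simp add: conv_def)
    also have "\<dots> = (LINT y|lborel. cker \<epsilon> (x - y) * (f y - f x))"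
      using ci[of x] c1[of x] by (simp add: algebra_simps)
    finally have "ennreal (norm (conv (cker \<epsilon>) f x - f x)) \<le> (\<integral>\<^sup>+y. ennreal (norm (cker \<epsilon> (x - y) * (f y - f x))) \<partial>lborel)"
      using ci[of x] c1[of x] by (simp only:) (intro integral_norm_bound_ennreal, simp add: algebra_simps)
    also have "\<dots> = (\<integral>\<^sup>+y. ennreal (ker \<epsilon> (x - y)) * ennreal (norm (f (x - (x - y)) - f x)) \<partial>lborel)"
      using e by (simp add: norm_mult norm_cker ennreal_mult' ker_nonneg)
    also have "\<dots> = (\<integral>\<^sup>+z. ennreal (ker \<epsilon> z) * ennreal (norm (f (x - z) - f x)) \<partial>lborel)"
      by (rule nn_integral_lborel_reflect) measurable
    finally show ?thesis .
  qed
  then have "(\<integral>\<^sup>+x. ennreal (norm (conv (cker \<epsilon>) f x - f x)) \<partial>lborel)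
     \<le> (\<integral>\<^sup>+x. (\<integral>\<^sup>+z. ennreal (ker \<epsilon> z) * ennreal (norm (f (x - z) - f x)) \<partial>lborel) \<partial>lborel)"
    by (intro nn_integral_mono)
  also have "\<dots> = (\<integral>\<^sup>+z. (\<integral>\<^sup>+x. ennreal (ker \<epsilon> z) * ennreal (norm (f (x - z) - f x)) \<partial>lborel) \<partial>lborel)"
    by (rule lborel_pair.Fubini') measurable
  also have "\<dots> = (\<integral>\<^sup>+z. ennreal (ker \<epsilon> z) * shift_diff f z \<partial>lborel)"
    by (simp add: nn_integral_cmult shift_diff_def)
  also have "\<dots> = (\<integral>\<^sup>+w. ennreal (\<eta> w) * shift_diff f (\<epsilon> *\<^sub>R w) \<partial>lborel)"
    using e by (intro nn_integral_ker) (auto simp: shift_diff_def)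
  finally show ?thesis .
qed

text \<open>Convergence in the mean yields a subsequence that converges almost everywhere, which is
  enough for an application of Fatou's lemma.\<close>

lemma conv_AE_subseq:
  assumes f: "integrable lborel f" "locally_integrable f" and e: "\<And>m. 0 < e m" "e \<longlonglongrightarrow> 0"
  shows "\<exists>\<phi>::nat \<Rightarrow> nat. strict_mono \<phi> \<and> (AE x in lborel. (\<lambda>m. conv (cker (e (\<phi> m))) f x) \<longlonglongrightarrow> f x)"
proof -
  have [measurable]: "f \<in> borel_measurable borel" using f by (simp add: locally_integrable_def)
  have cm [measurable]: "conv (cker (e m)) f \<in> borel_measurable borel" for m
    using conv_continuous[OF f(2) cker_kernel[OF e(1)]] by (rule borel_measurable_continuous_onI)
  define N where "N = (\<integral>\<^sup>+x. ennreal (norm (f x)) \<partial>lborel)"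
  have N: "N < top" using f(1) by (simp add: N_def integrable_iff_bounded)
  have sm [measurable]: "shift_diff f \<in> borel_measurable borel" unfolding shift_diff_def by measurable
  have "shift_diff (\<lambda>_. 0) z = 0" for z :: "real ^ 'n" by (simp add: shift_diff_def)
  then have sN: "shift_diff f z \<le> 2 * N" for z
    using shift_diff_le[of f "\<lambda>_. 0" z] by (simp add: N_def)
  define J where "J m = (\<integral>\<^sup>+w. ennreal (\<eta> w) * shift_diff f (e m *\<^sub>R w) \<partial>lborel)" for m
  have dom: "(\<integral>\<^sup>+w. ennreal (\<eta> w) * (2 * N) \<partial>lborel) < top"
    using N by (simp add: nn_integral_multc eta_integral ennreal_mult_less_top)
  have "J \<longlonglongrightarrow> (\<integral>\<^sup>+w. 0 \<partial>(lborel :: (real ^ 'n) measure))"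
    unfolding J_def
  proof (rule nn_integral_dominated_convergence[where w = "\<lambda>w. ennreal (\<eta> w) * (2 * N)"])
    show "AE w in lborel. ennreal (\<eta> w) * shift_diff f (e m *\<^sub>R w) \<le> ennreal (\<eta> w) * (2 * N)" for m
      by (intro AE_I2 mult_left_mono sN) simp
    show "(\<integral>\<^sup>+w. ennreal (\<eta> w) * (2 * N) \<partial>lborel) < \<infinity>" using dom by simp
    have "(\<lambda>m. shift_diff f (e m *\<^sub>R w)) \<longlonglongrightarrow> 0" for w
      by (rule shift_diff_tendsto_0[OF f(1)]) (use tendsto_scaleR[OF e(2) tendsto_const[of w]] in simp)
    then have "(\<lambda>m. ennreal (\<eta> w) * shift_diff f (e m *\<^sub>R w)) \<longlonglongrightarrow> ennreal (\<eta> w) * 0" for w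
      by (intro ennreal_tendsto_cmult) auto
    then show "AE w in lborel. (\<lambda>m. ennreal (\<eta> w) * shift_diff f (e m *\<^sub>R w)) \<longlonglongrightarrow> 0" by simp
  qed measurable
  then have J: "J \<longlonglongrightarrow> 0" by simp
  define X where "X m = (\<integral>\<^sup>+x. ennreal (norm (conv (cker (e m)) f x - f x)) \<partial>lborel)" for m
  have XJ: "X m \<le> J m" for m unfolding X_def J_def by (rule conv_L1_le[OF f e(1)])
  have X0: "X \<longlonglongrightarrow> 0" using XJ by (intro tendsto_sandwich[OF _ _ tendsto_const J]) auto
  have Xfin: "X m < top" for m
  proof -
    have "J m \<le> (\<integral>\<^sup>+w. ennreal (\<eta> w) * (2 * N) \<partial>lborel)"
      unfolding J_def by (intro nn_integral_mono mult_left_mono sN) simp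
    then show ?thesis using dom XJ[of m] by (auto intro: le_less_trans)
  qed
  have "\<exists>\<phi>. strict_mono \<phi> \<and> (AE x in lborel. (\<lambda>m. conv (cker (e (\<phi> m))) f x - f x) \<longlonglongrightarrow> 0)"
  proof (rule tendsto_L1_AE_subseq)
    show int: "integrable lborel (\<lambda>x. conv (cker (e m)) f x - f x)" for m
      using Xfin[of m] by (simp add: integrable_iff_bounded X_def)
    have "(LINT x|lborel. norm (conv (cker (e m)) f x - f x)) = enn2real (X m)" for m
      unfolding X_def by (intro integral_eq_nn_integral) auto
    moreover have "(\<lambda>m. enn2real (X m)) \<longlonglongrightarrow> enn2real 0"
      using X0 by (intro tendsto_enn2real) auto
    ultimately show "(\<lambda>m. LINT x|lborel. norm (conv (cker (e m)) f x - f x)) \<longlonglongrightarrow> 0" by simp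
  qed
  then show ?thesis by (simp add: Lim_null[symmetric])
qed

end

subsection \<open>Weak derivatives\<close>

definition inc_mi :: "('n \<Rightarrow> nat) \<Rightarrow> 'n \<Rightarrow> 'n \<Rightarrow> nat" where
  "inc_mi \<alpha> i = \<alpha>(i := Suc (\<alpha> i))"

lemma order_inc_mi: "order_mi (inc_mi \<alpha> i) = Suc (order_mi (\<alpha> :: 'n::finite \<Rightarrow> nat))"
proof -
  have "order_mi (inc_mi \<alpha> i) = inc_mi \<alpha> i i + (\<Sum>j\<in>UNIV - {i}. inc_mi \<alpha> i j)"
    unfolding order_mi_def by (rule sum.remove) auto
  also have "(\<Sum>j\<in>UNIV - {i}. inc_mi \<alpha> i j) = (\<Sum>j\<in>UNIV - {i}. \<alpha> j)"
    by (rule sum.cong) (auto simp: inc_mi_def)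
  finally show ?thesis
    unfolding order_mi_def by (subst sum.remove[of UNIV i \<alpha>]) (auto simp: inc_mi_def)
qed

lemma inj_inc_mi: "inj (inc_mi \<alpha>)"
proof (rule injI)
  fix i j assume "inc_mi \<alpha> i = inc_mi \<alpha> j"
  then have "inc_mi \<alpha> i i = inc_mi \<alpha> j i" by simp
  then show "i = j" by (auto simp: inc_mi_def split: if_splits)
qed

text \<open>Borel representatives \<open>V \<alpha>\<close> on the whole space of the weak derivatives on \<open>\<Omega>\<close>.\<close>

definition weak_jet :: "nat \<Rightarrow> real \<Rightarrow> (real ^ 'n::finite) set \<Rightarrow> (('n \<Rightarrow> nat) \<Rightarrow> real ^ 'n \<Rightarrow> complex) \<Rightarrow> bool" where
  "weak_jet r p \<Omega> V \<longleftrightarrow>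
     (\<forall>\<alpha>. order_mi \<alpha> \<le> r \<longrightarrow> V \<alpha> \<in> borel_measurable borel \<and> integrable lborel (\<lambda>x. norm (V \<alpha> x) powr p)) \<and>
     (\<forall>\<alpha> i. \<forall>\<phi>\<in>C0_inf \<Omega>. order_mi \<alpha> < r \<longrightarrow>
        (LINT x|lborel. V \<alpha> x * partial i \<phi> x) = - (LINT x|lborel. V (inc_mi \<alpha> i) x * \<phi> x))"

context mollifier
begin

text \<open>The kernel centred at \<open>x\<close> is an admissible test function once its ball lies
  in \<open>\<Omega>\<close>. The sign from the reflection cancels the one in the definition of weak
  derivatives.\<close>

lemma cker_test_function:
  assumes e: "0 < \<epsilon>" and sub: "cball x \<epsilon> \<subseteq> \<Omega>"
  shows "(\<lambda>y. cker \<epsilon> (x - y)) \<in> C0_inf \<Omega>"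
    and "partial i (\<lambda>y. cker \<epsilon> (x - y)) y = - partial i (cker \<epsilon>) (x - y)"
proof -
  have eq: "(\<lambda>y. cker \<epsilon> (x - y)) = (\<lambda>y. 1 * cker \<epsilon> (x + (-1) *\<^sub>R y))" by simp
  have "smooth (\<lambda>y. cker \<epsilon> (x - y))" unfolding eq by (rule smooth_affine[OF smooth_cker])
  moreover have "{y. cker \<epsilon> (x - y) \<noteq> 0} \<subseteq> cball x \<epsilon>"
    using ker_support[OF e] by (force simp: cker_def dist_norm)
  then have "closure {y. cker \<epsilon> (x - y) \<noteq> 0} \<subseteq> cball x \<epsilon>" by (intro closure_minimal) auto
  moreover from this have "compact (closure {y. cker \<epsilon> (x - y) \<noteq> 0})"
    by (meson bounded_cball bounded_subset closed_closure compact_eq_bounded_closed)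
  ultimately show "(\<lambda>y. cker \<epsilon> (x - y)) \<in> C0_inf \<Omega>" using sub by (auto simp: C0_inf_def)
  show "partial i (\<lambda>y. cker \<epsilon> (x - y)) y = - partial i (cker \<epsilon>) (x - y)"
    unfolding eq by (subst partial_affine(1)[OF cker_differentiable]) simp
qed

text \<open>Away from the complement of \<open>\<Omega>\<close>, mollification commutes with
  differentiation: the derivative falls on the kernel, which is a test function, and the weak
  derivative takes it over. So the mollified family is a jet with constant 1.\<close>

lemma mollified_jets:
  assumes V: "weak_jet r p \<Omega> V" and p: "1 \<le> p" and e: "0 < \<epsilon>"
  shows "jets r 1 {x. cball x \<epsilon> \<subseteq> \<Omega>} (\<lambda>\<alpha>. conv (cker \<epsilon>) (V \<alpha>))"
  unfolding jets_def
proof (intro conjI allI impI)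
  have V': "V \<alpha> \<in> borel_measurable borel" "integrable lborel (\<lambda>x. norm (V \<alpha> x) powr p)" if "order_mi \<alpha> \<le> r" for \<alpha>
    using V that by (auto simp: weak_jet_def)
  have loc: "locally_integrable (V \<alpha>)" if "order_mi \<alpha> \<le> r" for \<alpha>
    using locally_integrable_Lp[OF V'(1) p V'(2)] that by blast
  fix \<alpha> :: "'n \<Rightarrow> nat"
  {
    assume "order_mi \<alpha> \<le> r"
    then show "continuous_on UNIV (conv (cker \<epsilon>) (V \<alpha>))" "bounded (range (conv (cker \<epsilon>) (V \<alpha>)))"
      using conv_continuous[OF loc cker_kernel[OF e]] conv_bounded[OF cker_kernel[OF e] V'(1) p V'(2)] by auto
  next
    assume \<alpha>: "order_mi \<alpha> < r"
    define F where "F \<beta> = conv (cker \<epsilon>) (V \<beta>)" for \<beta>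
    show "grad_le {x. cball x \<epsilon> \<subseteq> \<Omega>} (conv (cker \<epsilon>) (V \<alpha>)) (\<lambda>x. 1 * jet_sum (\<lambda>\<alpha>. conv (cker \<epsilon>) (V \<alpha>)) (Suc (order_mi \<alpha>)) x)"
      unfolding grad_le_def F_def[symmetric]
    proof (intro ballI allI exI conjI)
      fix x h :: "real ^ 'n" assume x: "x \<in> {x. cball x \<epsilon> \<subseteq> \<Omega>}"
      then have sub: "cball x \<epsilon> \<subseteq> \<Omega>" by simp
      have part: "conv (partial i (cker \<epsilon>)) (V \<alpha>) x = F (inc_mi \<alpha> i) x" for i
      proof -
        have "conv (partial i (cker \<epsilon>)) (V \<alpha>) x = - (LINT y|lborel. V \<alpha> y * partial i (\<lambda>y. cker \<epsilon> (x - y)) y)"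
          by (simp add: conv_def cker_test_function(2)[OF e sub] mult.commute)
        also have "\<dots> = (LINT y|lborel. V (inc_mi \<alpha> i) y * cker \<epsilon> (x - y))"
          using V \<alpha> cker_test_function(1)[OF e sub] by (simp add: weak_jet_def)
        finally show ?thesis by (simp add: F_def conv_def mult.commute)
      qed
      show "((\<lambda>t. F \<alpha> (x + t *\<^sub>R h)) has_vector_derivative (\<Sum>i\<in>UNIV. h $ i *\<^sub>R F (inc_mi \<alpha> i) x)) (at 0)"
        unfolding part[symmetric] unfolding F_def
        using \<alpha> by (intro conv_deriv[OF loc cker_kernel[OF e] cker_differentiable partial_cker_kernel[OF e]]) auto
      have "norm (\<Sum>i\<in>UNIV. h $ i *\<^sub>R F (inc_mi \<alpha> i) x) \<le> (\<Sum>i\<in>UNIV. norm h * norm (F (inc_mi \<alpha> i) x))"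
        by (intro order_trans[OF norm_sum] sum_mono) (auto intro!: mult_right_mono component_le_norm_cart)
      \<comment> \<open>The first derivatives of order \<open>\<alpha>\<close> belong to distinct
        multi-indices, so their sum is part of \<open>jet_sum\<close>.\<close>
      also have "\<dots> = norm h * (\<Sum>\<beta>\<in>range (inc_mi \<alpha>). norm (F \<beta> x))"
        by (simp add: sum_distrib_left sum.reindex[OF inj_inc_mi])
      also have "\<dots> \<le> norm h * jet_sum F (Suc (order_mi \<alpha>)) x"
        unfolding jet_sum_def
        by (intro mult_left_mono sum_mono2 finite_order_mi_le) (auto simp: order_inc_mi)
      finally show "norm (\<Sum>i\<in>UNIV. h $ i *\<^sub>R F (inc_mi \<alpha> i) x) \<le> norm h * (1 * jet_sum F (Suc (order_mi \<alpha>)) x)" by simp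
    qed
  }
qed

end

text \<open>The margin \<open>\<delta>\<close> makes all mollifications of width at most
  \<open>\<delta>\<close> admissible with the same constant. On the right mollification does not
  increase the norms, on the left Fatou's lemma passes to the limit. The function \<open>u\<close>
  and the derivative of order 0 are tied only by their action on test functions.\<close>

lemma Sobolev_local_weak:
  fixes L :: "real ^ 'n::finite \<Rightarrow> real ^ 'n"
  assumes L: "linear L" "inj L"
    and r: "1 \<le> r" and p: "1 \<le> p" "p \<le> q" and q: "real CARD('n) / real r \<le> q"
    and crit: "real CARD('n) / real r = p \<and> 1 < p \<longrightarrow> real CARD('n) / real r < q"
  shows "\<exists>C<top. \<forall>\<Omega> V u A G z \<gamma> \<delta>. weak_jet r p \<Omega> V \<longrightarrow> u \<in> borel_measurable borel \<longrightarrow>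
     integrable lborel (\<lambda>x. norm (u x) powr p) \<longrightarrow>
     (\<forall>\<phi>\<in>C0_inf \<Omega>. (LINT x|lborel. u x * \<phi> x) = (LINT x|lborel. V (\<lambda>_. 0) x * \<phi> x)) \<longrightarrow>
     open A \<longrightarrow> A \<subseteq> ball z R \<longrightarrow> 0 < \<delta> \<longrightarrow>
     (\<forall>x\<in>A. \<forall>y\<in>cbox 0 (\<chi> i. real r). cball (x + L y) \<delta> \<subseteq> \<Omega> \<inter> G) \<longrightarrow> G \<in> sets borel \<longrightarrow>
     \<gamma> \<in> borel_measurable borel \<longrightarrow> (\<forall>x. 0 \<le> \<gamma> x) \<longrightarrow>
     (\<integral>\<^sup>+x. ennreal ((\<gamma> x * norm (u x)) powr p) * indicator A x \<partial>lborel)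
     \<le> C * (\<integral>\<^sup>+x. ennreal (\<gamma> x) epowr q * indicator A x \<partial>lborel) epowr (p / q) *
         (\<Sum>\<alpha> | order_mi \<alpha> \<le> r. \<integral>\<^sup>+x. ennreal (norm (V \<alpha> x)) epowr p * indicator G x \<partial>lborel)"
proof -
  obtain C where C: "C < top" "\<forall>(F :: ('n::finite \<Rightarrow> nat) \<Rightarrow> real ^ 'n \<Rightarrow> complex) S A G z \<gamma>. jets r 1 S F \<longrightarrow> open A \<longrightarrow>
     A \<subseteq> ball z R \<longrightarrow> (\<forall>x\<in>A. \<forall>y\<in>cbox 0 (\<chi> i. real r). x + L y \<in> S \<inter> G) \<longrightarrow> G \<in> sets borel \<longrightarrow> \<gamma> \<in> borel_measurable borel \<longrightarrow>
     (\<integral>\<^sup>+x. (\<gamma> x * ennreal (norm (F (\<lambda>_. 0) x))) epowr p * indicator A x \<partial>lborel)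
     \<le> C * (\<integral>\<^sup>+x. \<gamma> x epowr q * indicator A x \<partial>lborel) epowr (p / q) *
         (\<integral>\<^sup>+x. ennreal (jet_sum F r x) epowr p * indicator G x \<partial>lborel)"
    using Sobolev_local[OF L r p q crit order_refl, of R] by (elim exE conjE) (rule that)
  let ?T = "{\<alpha> :: 'n \<Rightarrow> nat. order_mi \<alpha> \<le> r}"
  define D where "D = C * of_nat (card ?T) epowr p"
  have "D < top" using C(1) by (simp add: D_def ennreal_mult_less_top epowr_less_top of_nat_less_top)
  obtain \<eta> :: "real ^ 'n \<Rightarrow> real" where "mollifier \<eta>" using mollifier_exists by blast
  then interpret mollifier \<eta> .
  have "(\<integral>\<^sup>+x. ennreal ((\<gamma> x * norm (u x)) powr p) * indicator A x \<partial>lborel)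
     \<le> D * (\<integral>\<^sup>+x. ennreal (\<gamma> x) epowr q * indicator A x \<partial>lborel) epowr (p / q) *
         (\<Sum>\<alpha> | order_mi \<alpha> \<le> r. \<integral>\<^sup>+x. ennreal (norm (V \<alpha> x)) epowr p * indicator G x \<partial>lborel)"
    if V: "weak_jet r p \<Omega> V" and u [measurable]: "u \<in> borel_measurable borel"
     and ui: "integrable lborel (\<lambda>x. norm (u x) powr p)"
     and uV: "\<forall>\<phi>\<in>C0_inf \<Omega>. (LINT x|lborel. u x * \<phi> x) = (LINT x|lborel. V (\<lambda>_. 0) x * \<phi> x)"
     and A: "open A" "A \<subseteq> ball z R" and \<delta>: "0 < \<delta>"
     and sub: "\<forall>x\<in>A. \<forall>y\<in>cbox 0 (\<chi> i. real r). cball (x + L y) \<delta> \<subseteq> \<Omega> \<inter> G"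
     and G [measurable]: "G \<in> sets borel" and [measurable]: "\<gamma> \<in> borel_measurable borel" and \<gamma>0: "\<forall>x. 0 \<le> \<gamma> x"
    for \<Omega> V u A G z \<gamma> \<delta>
  proof -
    have [measurable]: "A \<in> sets borel" using A by simp
    have V': "V \<alpha> \<in> borel_measurable borel" "integrable lborel (\<lambda>x. norm (V \<alpha> x) powr p)" if "order_mi \<alpha> \<le> r" for \<alpha>
      using V that by (auto simp: weak_jet_def)
    have loc: "locally_integrable (V \<alpha>)" if "order_mi \<alpha> \<le> r" for \<alpha>
      using locally_integrable_Lp[OF V'(1) p(1) V'(2)] that by blast
    have locu: "locally_integrable u" by (rule locally_integrable_Lp[OF u p(1) ui])
    \<comment> \<open>The union of the parallelepipeds with vertex in \<open>A\<close>. The smooth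
      estimate is integrated over this smaller set, whose \<open>\<delta>\<close>-neighbourhood is
      in \<open>G\<close>, so that \<open>conv_Lp_le\<close> returns to the functions
      \<open>V \<alpha>\<close> on \<open>G\<close>.\<close>
    define G' where "G' = (\<Union>x\<in>A. \<Union>w\<in>L ` cbox 0 (\<chi> i. real r). {x + w})"
    have G'o: "open G'" unfolding G'_def using A by (intro open_sums) auto
    then have [measurable]: "G' \<in> sets borel" by simp
    have G': "cball x \<delta> \<subseteq> \<Omega> \<inter> G" if "x \<in> G'" for x
      using that sub by (auto simp: G'_def)
    define e where "e m = \<delta> / real (Suc m)" for m
    have e: "0 < e m" "e m \<le> \<delta>" for m using \<delta> by (auto simp: e_def divide_simps mult_le_cancel_left1)
    have e0: "e \<longlonglongrightarrow> 0" unfolding e_def by (rule LIMSEQ_Suc[OF lim_const_over_n])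
    define Y where "Y = (\<integral>\<^sup>+x. ennreal (\<gamma> x) epowr q * indicator A x \<partial>lborel) epowr (p / q)"
    define Z where "Z = (\<Sum>\<alpha> | order_mi \<alpha> \<le> r. \<integral>\<^sup>+x. ennreal (norm (V \<alpha> x)) epowr p * indicator G x \<partial>lborel)"
    define w where "w m = conv (cker (e m)) u" for m
    have [measurable]: "w m \<in> borel_measurable borel" for m
      unfolding w_def using conv_continuous[OF locu cker_kernel[OF e(1)]] by (rule borel_measurable_continuous_onI)
    have zero: "(0 :: real ^ 'n) \<in> cbox 0 (\<chi> i. real r)" by (simp add: mem_box_cart)
    have L0: "L 0 = 0" using L(1) by (rule linear_0)
    have Asub: "cball x \<delta> \<subseteq> \<Omega>" if "x \<in> A" for x
      using sub[rule_format, OF that zero] L0 by auto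
    have bound: "(\<integral>\<^sup>+x. ennreal ((\<gamma> x * norm (w m x)) powr p) * indicator A x \<partial>lborel) \<le> D * Y * Z" for m
    proof -
      define F where "F \<alpha> = conv (cker (e m)) (V \<alpha>)" for \<alpha>
      have F: "jets r 1 {x. cball x (e m) \<subseteq> \<Omega>} F"
        unfolding F_def by (rule mollified_jets[OF V p(1) e(1)])
      have Fm: "F \<alpha> \<in> borel_measurable borel" if "order_mi \<alpha> \<le> r" for \<alpha>
        using F that by (intro borel_measurable_continuous_onI) (auto simp: jets_def)
      have mono: "cball x (e m) \<subseteq> cball x \<delta>" for x :: "real ^ 'n" using e(2) by (rule subset_cball)
      \<comment> \<open>Testing the relation between \<open>u\<close> and
        \<open>V (\<lambda>_. 0)\<close> with the kernel centred at \<open>x\<close> shows that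
        their mollifications agree on \<open>A\<close>.\<close>
      have wF: "w m x = F (\<lambda>_. 0) x" if "x \<in> A" for x
      proof -
        have "cball x (e m) \<subseteq> \<Omega>" using Asub[OF that] mono by blast
        from uV[rule_format, OF cker_test_function(1)[OF e(1) this]]
        show ?thesis by (simp add: w_def F_def conv_def mult.commute)
      qed
      have "(\<integral>\<^sup>+x. ennreal ((\<gamma> x * norm (w m x)) powr p) * indicator A x \<partial>lborel)
         = (\<integral>\<^sup>+x. (ennreal (\<gamma> x) * ennreal (norm (F (\<lambda>_. 0) x))) epowr p * indicator A x \<partial>lborel)"
        using \<gamma>0 p wF by (intro nn_integral_cong) (auto simp: indicator_def ennreal_mult'[symmetric] ennreal_epowr)
      also have "\<dots> \<le> C * (\<integral>\<^sup>+x. ennreal (\<gamma> x) epowr q * indicator A x \<partial>lborel) epowr (p / q) *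
         (\<integral>\<^sup>+x. ennreal (jet_sum F r x) epowr p * indicator G' x \<partial>lborel)"
      proof (rule C(2)[rule_format, OF F A])
        fix x y :: "real ^ 'n" assume "x \<in> A" "y \<in> cbox 0 (\<chi> i. real r)"
        then have "x + L y \<in> G'" by (auto simp: G'_def)
        then show "x + L y \<in> {x. cball x (e m) \<subseteq> \<Omega>} \<inter> G'" using G' mono by blast
      qed auto
      also have "(\<integral>\<^sup>+x. ennreal (jet_sum F r x) epowr p * indicator G' x \<partial>lborel) \<le> of_nat (card ?T) epowr p * Z"
      proof -
        have "(\<integral>\<^sup>+x. ennreal (jet_sum F r x) epowr p * indicator G' x \<partial>lborel)
           \<le> (\<integral>\<^sup>+x. of_nat (card ?T) epowr p * (\<Sum>\<alpha>\<in>?T. ennreal (norm (F \<alpha> x)) epowr p * indicator G' x) \<partial>lborel)"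
        proof (intro nn_integral_mono)
          fix x
          have "ennreal (jet_sum F r x) = (\<Sum>\<alpha>\<in>?T. ennreal (norm (F \<alpha> x)))" by (simp add: jet_sum_def sum_ennreal)
          then have "ennreal (jet_sum F r x) epowr p \<le> of_nat (card ?T) epowr p * (\<Sum>\<alpha>\<in>?T. ennreal (norm (F \<alpha> x)) epowr p)"
            using epowr_sum_le[OF finite_order_mi_le, of p "\<lambda>\<alpha>. ennreal (norm (F \<alpha> x))" r] p by simp
          then show "ennreal (jet_sum F r x) epowr p * indicator G' x \<le> of_nat (card ?T) epowr p * (\<Sum>\<alpha>\<in>?T. ennreal (norm (F \<alpha> x)) epowr p * indicator G' x)"
            by (auto simp: indicator_def)
        qed
        also have "\<dots> = of_nat (card ?T) epowr p * (\<Sum>\<alpha>\<in>?T. \<integral>\<^sup>+x. ennreal (norm (F \<alpha> x)) epowr p * indicator G' x \<partial>lborel)"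
          using Fm by (subst nn_integral_cmult, measurable) (auto intro!: arg_cong2[where f = "(*)"] nn_integral_sum)
        also have "\<dots> \<le> of_nat (card ?T) epowr p * Z"
        proof -
          have "cball x (e m) \<subseteq> G" if "x \<in> G'" for x using G'[OF that] mono[of x] by blast
          then show ?thesis unfolding Z_def F_def
            by (intro mult_left_mono sum_mono conv_Lp_le[OF loc e(1) p(1)]) auto
        qed
        finally show ?thesis .
      qed
      finally have "(\<integral>\<^sup>+x. ennreal ((\<gamma> x * norm (w m x)) powr p) * indicator A x \<partial>lborel)
         \<le> C * Y * (of_nat (card ?T) epowr p * Z)" by (simp add: Y_def mult_left_mono)
      then show ?thesis by (simp add: D_def mult_ac)
    qed
    \<comment> \<open>A truncation that makes \<open>u\<close> integrable for
      \<open>conv_AE_subseq\<close>; kernels centred in \<open>A\<close> with width at most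
      \<open>\<delta>\<close> do not see the difference.\<close>
    define f where "f x = indicator (ball z (R + \<delta> + 1)) x *\<^sub>R u x" for x
    have fi: "integrable lborel f" unfolding f_def using locu unfolding locally_integrable_def by blast
    have [measurable]: "f \<in> borel_measurable borel"
      unfolding f_def using u by (intro borel_measurable_scaleR borel_measurable_indicator) auto
    have floc: "locally_integrable f"
      unfolding locally_integrable_def
    proof (intro conjI allI)
      fix z' and R' :: real
      show "integrable lborel (\<lambda>y. indicator (ball z' R') y *\<^sub>R f y)"
      proof (rule Bochner_Integration.integrable_bound[OF fi])
        have "f \<in> borel_measurable lborel" by simp
        then show "(\<lambda>y. indicator (ball z' R') y *\<^sub>R f y) \<in> borel_measurable lborel"
          by (intro borel_measurable_scaleR borel_measurable_indicator) auto
      qed (auto simp: indicator_def)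
    qed measurable
    obtain \<phi> :: "nat \<Rightarrow> nat" where \<phi>: "strict_mono \<phi>" "AE x in lborel. (\<lambda>m. conv (cker (e (\<phi> m))) f x) \<longlonglongrightarrow> f x"
      using conv_AE_subseq[OF fi floc e(1) e0] by blast
    have wf: "conv (cker (e m)) f x = w m x" if x: "x \<in> A" for m x
      unfolding w_def conv_def
    proof (rule Bochner_Integration.integral_cong[OF refl])
      fix y
      show "cker (e m) (x - y) * f y = cker (e m) (x - y) * u y"
      proof (cases "norm (x - y) \<le> e m")
        case True
        have "dist z y \<le> dist z x + norm (x - y)" by norm
        then have "y \<in> ball z (R + \<delta> + 1)" using A x True e(2)[of m] by force
        then show ?thesis by (simp add: f_def)
      next
        case False
        then show ?thesis using ker_support[OF e(1)[of m], of "x - y"] by (simp add: cker_def)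
      qed
    qed
    have lim: "AE x in lborel. x \<in> A \<longrightarrow> (\<lambda>m. w (\<phi> m) x) \<longlonglongrightarrow> u x"
      using \<phi>(2)
    proof eventually_elim
      case (elim x)
      show ?case
      proof
        assume x: "x \<in> A"
        then have "x \<in> ball z (R + \<delta> + 1)" using A \<delta> by force
        then show "(\<lambda>m. w (\<phi> m) x) \<longlonglongrightarrow> u x" using elim wf[OF x] by (simp add: f_def)
      qed
    qed
    have "(\<integral>\<^sup>+x. ennreal ((\<gamma> x * norm (u x)) powr p) * indicator A x \<partial>lborel)
       = (\<integral>\<^sup>+x. liminf (\<lambda>m. ennreal ((\<gamma> x * norm (w (\<phi> m) x)) powr p) * indicator A x) \<partial>lborel)"
    proof (rule nn_integral_cong_AE)
      show "AE x in lborel. ennreal ((\<gamma> x * norm (u x)) powr p) * indicator A x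
         = liminf (\<lambda>m. ennreal ((\<gamma> x * norm (w (\<phi> m) x)) powr p) * indicator A x)"
        using lim
      proof eventually_elim
        case (elim x)
        show ?case
        proof (cases "x \<in> A")
          case True
          then have "(\<lambda>m. w (\<phi> m) x) \<longlonglongrightarrow> u x" using elim by blast
          then have "(\<lambda>m. ennreal ((\<gamma> x * norm (w (\<phi> m) x)) powr p)) \<longlonglongrightarrow> ennreal ((\<gamma> x * norm (u x)) powr p)"
            using \<gamma>0 p by (intro tendsto_ennrealI tendsto_powr2 tendsto_mult tendsto_norm tendsto_const) auto
          from lim_imp_Liminf[OF sequentially_bot this] show ?thesis using True by simp
        qed (simp add: Liminf_const)
      qed
    qed
    \<comment> \<open>Fatou's lemma; the bound is the same for every member of the sequence.\<close>
    also have "\<dots> \<le> liminf (\<lambda>m. \<integral>\<^sup>+x. ennreal ((\<gamma> x * norm (w (\<phi> m) x)) powr p) * indicator A x \<partial>lborel)"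
      by (rule nn_integral_liminf) measurable
    also have "\<dots> \<le> D * Y * Z"
    proof (rule order_trans[OF Liminf_mono])
      show "eventually (\<lambda>m. (\<integral>\<^sup>+x. ennreal ((\<gamma> x * norm (w (\<phi> m) x)) powr p) * indicator A x \<partial>lborel) \<le> D * Y * Z) sequentially"
        using bound by simp
    qed (simp add: Liminf_const)
    finally show ?thesis by (simp add: Y_def Z_def)
  qed
  with \<open>D < top\<close> show ?thesis by blast
qed

subsection \<open>Borel representatives\<close>

text \<open>Product measures and convolutions are handled with Borel functions on the whole space,
  whereas the spaces in question consist of Lebesgue measurable functions on
  \<open>\<Omega>\<close>. Vanishing outside \<open>\<Omega>\<close> makes integrals over the whole
  space equal to those over \<open>\<Omega>\<close>.\<close>

definition borel_rep :: "'a::euclidean_space set \<Rightarrow> ('a \<Rightarrow> complex) \<Rightarrow> ('a \<Rightarrow> complex) \<Rightarrow> bool" where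
  "borel_rep \<Omega> f f' \<longleftrightarrow> f' \<in> borel_measurable borel \<and> (\<forall>x. x \<notin> \<Omega> \<longrightarrow> f' x = 0) \<and>
     (AE x in lebesgue. x \<in> \<Omega> \<longrightarrow> f x = f' x)"

lemma borel_rep_exists:
  assumes f: "f \<in> borel_measurable (lebesgue_on \<Omega>)" and \<Omega>: "\<Omega> \<in> sets borel"
  shows "\<exists>f'. borel_rep \<Omega> f f'"
proof -
  define g where "g x = indicator \<Omega> x *\<^sub>R f x" for x
  have "\<Omega> \<in> sets lebesgue" using \<Omega> by simp
  then have g: "g \<in> borel_measurable lebesgue"
    using f unfolding g_def by (subst (asm) borel_measurable_restrict_space_iff) auto
  have "(\<lambda>x. Re (g x)) \<in> borel_measurable (completion lborel)" "(\<lambda>x. Im (g x)) \<in> borel_measurable (completion lborel)"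
    using g by measurable
  then obtain a b where [measurable]: "a \<in> borel_measurable lborel" "b \<in> borel_measurable lborel"
    and ab: "AE x in lborel. Re (g x) = a x" "AE x in lborel. Im (g x) = b x"
    using completion_ex_borel_measurable_real by metis
  define f' where "f' x = indicator \<Omega> x *\<^sub>R (of_real (a x) + \<i> * of_real (b x))" for x
  note \<Omega>[measurable]
  have "f' \<in> borel_measurable lborel" unfolding f'_def by measurable
  moreover have "AE x in lborel. x \<in> \<Omega> \<longrightarrow> f x = f' x"
    using ab by eventually_elim (auto simp: f'_def g_def complex_eq_iff)
  ultimately show ?thesis unfolding borel_rep_def
    by (intro exI[of _ f']) (auto simp: f'_def AE_completion)
qed

lemma borel_rep_nn_integral:
  assumes "borel_rep \<Omega> f f'" "A \<in> sets borel" "A \<subseteq> \<Omega>"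
  shows "(\<integral>\<^sup>+x. h x (f x) \<partial>lebesgue_on A) = (\<integral>\<^sup>+x. h x (f' x) * indicator A x \<partial>lborel)"
proof -
  have "A \<in> sets lebesgue" using assms by simp
  then have "(\<integral>\<^sup>+x. h x (f x) \<partial>lebesgue_on A) = (\<integral>\<^sup>+x. h x (f x) * indicator A x \<partial>lebesgue)"
    by (subst nn_integral_restrict_space) auto
  also have "\<dots> = (\<integral>\<^sup>+x. h x (f' x) * indicator A x \<partial>lebesgue)"
  proof (rule nn_integral_cong_AE)
    have "AE x in lebesgue. x \<in> \<Omega> \<longrightarrow> f x = f' x" using assms by (simp add: borel_rep_def)
    then show "AE x in lebesgue. h x (f x) * indicator A x = h x (f' x) * indicator A x"
      by eventually_elim (use assms in \<open>auto simp: indicator_def\<close>)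
  qed
  finally show ?thesis by (simp add: nn_integral_completion)
qed

lemma borel_rep_integral:
  assumes rep: "borel_rep \<Omega> f f'" and f: "f \<in> borel_measurable (lebesgue_on \<Omega>)"
    and \<Omega>: "\<Omega> \<in> sets borel" and \<phi>: "\<phi> \<in> borel_measurable borel"
  shows "(LINT x|lebesgue_on \<Omega>. f x * \<phi> x) = (LINT x|lborel. f' x * \<phi> x)"
proof -
  have \<Omega>l: "\<Omega> \<in> sets lebesgue" using \<Omega> by simp
  have f': "f' \<in> borel_measurable borel" using rep by (simp add: borel_rep_def)
  have g: "(\<lambda>x. indicator \<Omega> x *\<^sub>R f x) \<in> borel_measurable lebesgue"
    using f \<Omega>l by (subst (asm) borel_measurable_restrict_space_iff) auto
  have \<phi>l: "\<phi> \<in> borel_measurable lebesgue" "f' \<in> borel_measurable lebesgue"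
    using \<phi> f' by (auto intro: measurable_completion)
  have "(LINT x|lebesgue_on \<Omega>. f x * \<phi> x) = (LINT x|lebesgue. (indicator \<Omega> x *\<^sub>R f x) * \<phi> x)"
    using \<Omega>l by (subst integral_restrict_space) auto
  also have "\<dots> = (LINT x|lebesgue. f' x * \<phi> x)"
  proof (rule integral_cong_AE)
    have "AE x in lebesgue. x \<in> \<Omega> \<longrightarrow> f x = f' x" using rep by (simp add: borel_rep_def)
    then show "AE x in lebesgue. (indicator \<Omega> x *\<^sub>R f x) * \<phi> x = f' x * \<phi> x"
      by eventually_elim (use rep in \<open>auto simp: indicator_def borel_rep_def\<close>)
  qed (rule borel_measurable_times[OF g \<phi>l(1)] borel_measurable_times[OF \<phi>l(2,1)])+
  also have "\<dots> = (LINT x|lborel. f' x * \<phi> x)"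
    using f' \<phi> by (intro integral_completion) auto
  finally show ?thesis .
qed

lemma Lp_norm_powr:
  assumes "f \<in> Lp p A" "0 < p"
  shows "ennreal (Lp_norm p A f powr p) = (\<integral>\<^sup>+x. ennreal (cmod (f x) powr p) \<partial>lebesgue_on A)"
proof -
  have i: "integrable (lebesgue_on A) (\<lambda>x. cmod (f x) powr p)" using assms by (simp add: Lp_def)
  have "0 \<le> (LINT x|lebesgue_on A. cmod (f x) powr p)" by (intro integral_nonneg_AE AE_I2) simp
  then have "Lp_norm p A f powr p = (LINT x|lebesgue_on A. cmod (f x) powr p)"
    using assms by (simp add: Lp_norm_def powr_powr)
  then show ?thesis using nn_integral_eq_integral[OF i] by simp
qed

lemma Lp_I:
  assumes "f \<in> borel_measurable (lebesgue_on A)"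
    and "(\<integral>\<^sup>+x. ennreal (cmod (f x) powr p) \<partial>lebesgue_on A) < top"
  shows "f \<in> Lp p A"
  using assms by (simp add: Lp_def integrable_iff_bounded)

lemma borel_rep_Lp:
  assumes rep: "borel_rep \<Omega> f f'" and f: "f \<in> Lp p \<Omega>" and \<Omega>: "\<Omega> \<in> sets borel" and p: "0 < p"
  shows "integrable lborel (\<lambda>x. norm (f' x) powr p)"
    and "(\<integral>\<^sup>+x. ennreal (norm (f' x)) epowr p \<partial>lborel) = ennreal (Lp_norm p \<Omega> f powr p)"
proof -
  have [measurable]: "f' \<in> borel_measurable borel" using rep by (simp add: borel_rep_def)
  have "(\<integral>\<^sup>+x. ennreal (norm (f' x) powr p) \<partial>lborel) = (\<integral>\<^sup>+x. ennreal (norm (f' x) powr p) * indicator \<Omega> x \<partial>lborel)"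
    using rep p by (intro nn_integral_cong) (auto simp: borel_rep_def indicator_def)
  also have "\<dots> = (\<integral>\<^sup>+x. ennreal (cmod (f x) powr p) \<partial>lebesgue_on \<Omega>)"
    by (rule borel_rep_nn_integral[OF rep \<Omega> order_refl, symmetric])
  also have "\<dots> = ennreal (Lp_norm p \<Omega> f powr p)" by (rule Lp_norm_powr[OF f p, symmetric])
  finally have eq: "(\<integral>\<^sup>+x. ennreal (norm (f' x) powr p) \<partial>lborel) = ennreal (Lp_norm p \<Omega> f powr p)" .
  then show "integrable lborel (\<lambda>x. norm (f' x) powr p)" by (simp add: integrable_iff_bounded)
  show "(\<integral>\<^sup>+x. ennreal (norm (f' x)) epowr p \<partial>lborel) = ennreal (Lp_norm p \<Omega> f powr p)"
    using eq p by (simp add: ennreal_epowr)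
qed

lemma C0_inf_partial:
  assumes "\<phi> \<in> C0_inf \<Omega>"
  shows "partial i \<phi> \<in> C0_inf \<Omega>"
proof -
  let ?K = "closure {x. \<phi> x \<noteq> 0}"
  have sm: "smooth \<phi>" and K: "compact ?K" "?K \<subseteq> \<Omega>" using assms by (auto simp: C0_inf_def)
  have "smooth (partial i \<phi>)"
    unfolding smooth_def
  proof
    fix "is"
    have "partials is (partial i \<phi>) = partials (is @ [i]) \<phi>" by (simp add: partials_def)
    then show "partials is (partial i \<phi>) differentiable_on UNIV" using sm by (simp only: smooth_def)
  qed
  moreover have "partial i \<phi> x = 0" if x: "x \<notin> ?K" for x
  proof -
    have o: "open (- ?K)" by (intro open_Compl closed_closure)
    have D: "((\<lambda>_. 0) has_derivative (\<lambda>h. 0)) (at x)" by simp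
    have eq: "0 = \<phi> y" if "y \<in> - ?K" for y using that closure_subset[of "{x. \<phi> x \<noteq> 0}"] by auto
    have "(\<phi> has_derivative (\<lambda>h. 0)) (at x)"
      by (rule has_derivative_transform_within_open[OF D o]) (use x in simp, rule eq)
    then show ?thesis by (intro partial_eqI) simp
  qed
  then have sub: "closure {x. partial i \<phi> x \<noteq> 0} \<subseteq> ?K" by (intro closure_minimal) auto
  moreover have "compact (closure {x. partial i \<phi> x \<noteq> 0})"
    using compact_Int_closed[OF K(1) closed_closure, of "{x. partial i \<phi> x \<noteq> 0}"] sub
    by (simp only: inf.absorb2)
  ultimately show ?thesis using K by (auto simp: C0_inf_def)
qed

lemma C0_inf_measurable: "\<phi> \<in> C0_inf \<Omega> \<Longrightarrow> \<phi> \<in> borel_measurable borel"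
  using smooth_continuous[of \<phi> "[]"] by (auto simp: C0_inf_def partials_def intro: borel_measurable_continuous_onI)

text \<open>The definition of weak derivatives speaks about all lists with given multiplicities; at
  least one is needed to extract information from it.\<close>

lemma exists_list_of_mi: "\<exists>is. \<forall>i. count_list is i = (\<alpha> :: 'n::finite \<Rightarrow> nat) i"
proof (induction "order_mi \<alpha>" arbitrary: \<alpha>)
  case 0
  then have "\<alpha> = (\<lambda>_. 0)" using order_mi_eq_0[of \<alpha>] by simp
  then show ?case by (intro exI[of _ "[]"]) simp
next
  case (Suc k)
  have "\<exists>i. \<alpha> i \<noteq> 0"
  proof (rule ccontr)
    assume "\<not> (\<exists>i. \<alpha> i \<noteq> 0)"
    then show False using Suc(2) by (simp add: order_mi_def)
  qed
  then obtain i where i: "\<alpha> i \<noteq> 0" by blast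
  define \<beta> where "\<beta> = \<alpha>(i := \<alpha> i - 1)"
  have \<alpha>: "\<alpha> = inc_mi \<beta> i" using i by (auto simp: \<beta>_def inc_mi_def)
  then have "k = order_mi \<beta>" using Suc(2) by (simp add: order_inc_mi)
  then obtain "is" where "\<forall>j. count_list is j = \<beta> j" using Suc(1) by blast
  then show ?case unfolding \<alpha> by (intro exI[of _ "i # is"]) (auto simp: inc_mi_def)
qed

text \<open>The weak derivatives of \<open>u\<close> are defined separately for each multi-index;
  comparing the defining identities of \<open>\<alpha>\<close> and \<open>inc_mi \<alpha> i\<close>
  shows that each derivative is a weak first derivative of the previous one.\<close>

lemma sobolev_borel_rep:
  assumes \<Omega>: "open \<Omega>" and u: "u \<in> sobolev r p \<Omega>" and p: "1 \<le> p" and rep: "borel_rep \<Omega> u u'"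
  obtains V where "weak_jet r p \<Omega> V"
    "\<And>\<phi>. \<phi> \<in> C0_inf \<Omega> \<Longrightarrow> (LINT x|lborel. u' x * \<phi> x) = (LINT x|lborel. V (\<lambda>_. 0) x * \<phi> x)"
    "(\<Sum>\<alpha> | order_mi \<alpha> \<le> r. \<integral>\<^sup>+x. ennreal (norm (V \<alpha> x)) epowr p \<partial>lborel) = ennreal (sobolev_norm r p \<Omega> u powr p)"
proof -
  have \<Omega>b: "\<Omega> \<in> sets borel" using \<Omega> by simp
  define v where "v \<alpha> = weak_deriv \<Omega> \<alpha> u" for \<alpha>
  have v: "v \<alpha> \<in> Lp p \<Omega>" if "order_mi \<alpha> \<le> r" for \<alpha>
    using u that by (simp add: v_def sobolev_def)
  have w: "has_weak_deriv \<Omega> \<alpha> u (v \<alpha>)" if "order_mi \<alpha> \<le> r" for \<alpha>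
  proof -
    have "\<exists>v. has_weak_deriv \<Omega> \<alpha> u v" using u that by (simp add: sobolev_def)
    then show ?thesis unfolding v_def weak_deriv_def by (rule someI_ex)
  qed
  have vm: "v \<alpha> \<in> borel_measurable (lebesgue_on \<Omega>)" if "order_mi \<alpha> \<le> r" for \<alpha>
    using v[OF that] by (simp add: Lp_def)
  define V where "V \<alpha> = (SOME f'. borel_rep \<Omega> (v \<alpha>) f')" for \<alpha>
  have V: "borel_rep \<Omega> (v \<alpha>) (V \<alpha>)" if "order_mi \<alpha> \<le> r" for \<alpha>
    unfolding V_def by (rule someI_ex[OF borel_rep_exists[OF vm[OF that] \<Omega>b]])
  have um: "u \<in> borel_measurable (lebesgue_on \<Omega>)" using u by (simp add: sobolev_def Lp_def)
  have int: "(LINT x|lebesgue_on \<Omega>. v \<alpha> x * \<phi> x) = (LINT x|lborel. V \<alpha> x * \<phi> x)"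
    if "order_mi \<alpha> \<le> r" "\<phi> \<in> C0_inf \<Omega>" for \<alpha> \<phi>
    using that by (intro borel_rep_integral[OF V vm \<Omega>b C0_inf_measurable])
  have p0: "0 < p" using p by simp
  show ?thesis
  proof (rule that)
    show "weak_jet r p \<Omega> V"
      unfolding weak_jet_def
    proof (intro conjI allI impI ballI)
      fix \<alpha> :: "'a \<Rightarrow> nat" assume \<alpha>: "order_mi \<alpha> \<le> r"
      show "V \<alpha> \<in> borel_measurable borel" using V[OF \<alpha>] by (simp add: borel_rep_def)
      show "integrable lborel (\<lambda>x. norm (V \<alpha> x) powr p)" by (rule borel_rep_Lp(1)[OF V[OF \<alpha>] v[OF \<alpha>] \<Omega>b p0])
    next
      fix \<alpha> :: "'a \<Rightarrow> nat" and i \<phi> assume \<phi>: "\<phi> \<in> C0_inf \<Omega>" and \<alpha>: "order_mi \<alpha> < r"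
      obtain "is" where is1: "\<forall>i. count_list is i = \<alpha> i" using exists_list_of_mi by blast
      \<comment> \<open>The list for \<open>inc_mi \<alpha> i\<close> ends in \<open>i\<close>, so
        that the derivative in direction \<open>i\<close> is applied to \<open>\<phi>\<close> first
        and the two identities have the same left side. Their signs differ by one factor -1.\<close>
      then have is2: "\<forall>j. count_list (is @ [i]) j = inc_mi \<alpha> i j" by (auto simp: inc_mi_def)
      have \<alpha>1: "order_mi \<alpha> \<le> r" "order_mi (inc_mi \<alpha> i) \<le> r" using \<alpha> by (auto simp: order_inc_mi)
      have "(LINT x|lebesgue_on \<Omega>. u x * partials is (partial i \<phi>) x) =
          (- 1) ^ order_mi \<alpha> * (LINT x|lebesgue_on \<Omega>. v \<alpha> x * partial i \<phi> x)"
        using w[OF \<alpha>1(1)] is1 C0_inf_partial[OF \<phi>] by (simp add: has_weak_deriv_def)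
      moreover have "(LINT x|lebesgue_on \<Omega>. u x * partials (is @ [i]) \<phi> x) =
          (- 1) ^ order_mi (inc_mi \<alpha> i) * (LINT x|lebesgue_on \<Omega>. v (inc_mi \<alpha> i) x * \<phi> x)"
        using w[OF \<alpha>1(2)] is2 \<phi> unfolding has_weak_deriv_def by blast
      moreover have "partials is (partial i \<phi>) = partials (is @ [i]) \<phi>" by (simp add: partials_def)
      ultimately have "(- 1) ^ order_mi \<alpha> * (LINT x|lebesgue_on \<Omega>. v \<alpha> x * partial i \<phi> x)
         = (- 1) ^ order_mi \<alpha> * (- (LINT x|lebesgue_on \<Omega>. v (inc_mi \<alpha> i) x * \<phi> x))"
        by (simp add: order_inc_mi)
      then have "(LINT x|lebesgue_on \<Omega>. v \<alpha> x * partial i \<phi> x) = - (LINT x|lebesgue_on \<Omega>. v (inc_mi \<alpha> i) x * \<phi> x)"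
        by (subst (asm) mult_cancel_left) auto
      then show "(LINT x|lborel. V \<alpha> x * partial i \<phi> x) = - (LINT x|lborel. V (inc_mi \<alpha> i) x * \<phi> x)"
        using int[OF \<alpha>1(1) C0_inf_partial[OF \<phi>]] int[OF \<alpha>1(2) \<phi>] by simp
    qed
  next
    fix \<phi> assume \<phi>: "\<phi> \<in> C0_inf \<Omega>"
    have z: "order_mi (\<lambda>_::'a. 0) = 0" by (simp add: order_mi_def)
    have "(LINT x|lebesgue_on \<Omega>. u x * partials [] \<phi> x) = (- 1) ^ order_mi (\<lambda>_::'a. 0) * (LINT x|lebesgue_on \<Omega>. v (\<lambda>_. 0) x * \<phi> x)"
    proof -
      have "has_weak_deriv \<Omega> (\<lambda>_. 0) u (v (\<lambda>_. 0))" by (rule w) (simp add: z)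
      then have "(\<forall>i. count_list [] i = (\<lambda>_::'a. 0) i) \<longrightarrow> ?thesis"
        unfolding has_weak_deriv_def using \<phi> by blast
      then show ?thesis by simp
    qed
    then have "(LINT x|lebesgue_on \<Omega>. u x * \<phi> x) = (LINT x|lebesgue_on \<Omega>. v (\<lambda>_. 0) x * \<phi> x)"
      by (simp add: z partials_def)
    then show "(LINT x|lborel. u' x * \<phi> x) = (LINT x|lborel. V (\<lambda>_. 0) x * \<phi> x)"
      using int[of "\<lambda>_. 0", OF _ \<phi>] z borel_rep_integral[OF rep um \<Omega>b C0_inf_measurable[OF \<phi>]] by simp
  next
    have "(\<Sum>\<alpha> | order_mi \<alpha> \<le> r. \<integral>\<^sup>+x. ennreal (norm (V \<alpha> x)) epowr p \<partial>lborel)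
       = (\<Sum>\<alpha> | order_mi \<alpha> \<le> r. ennreal (Lp_norm p \<Omega> (v \<alpha>) powr p))"
      by (intro sum.cong refl borel_rep_Lp(2)[OF V v \<Omega>b p0]) auto
    also have "\<dots> = ennreal (\<Sum>\<alpha> | order_mi \<alpha> \<le> r. Lp_norm p \<Omega> (v \<alpha>) powr p)" by (rule sum_ennreal) simp
    also have "(\<Sum>\<alpha> | order_mi \<alpha> \<le> r. Lp_norm p \<Omega> (v \<alpha>) powr p) = sobolev_norm r p \<Omega> u powr p"
      unfolding sobolev_norm_def v_def using p0 by (simp add: powr_powr sum_nonneg)
    finally show "(\<Sum>\<alpha> | order_mi \<alpha> \<le> r. \<integral>\<^sup>+x. ennreal (norm (V \<alpha> x)) epowr p \<partial>lborel) = ennreal (sobolev_norm r p \<Omega> u powr p)" .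
  qed
qed

subsection \<open>The cone condition\<close>

text \<open>A direction \<open>w\<close> within \<open>sin \<theta>\<close> of the unit axis
  \<open>e\<close>, prolonged to the distance of \<open>z\<close>, ends within \<open>a\<close> of
  \<open>z\<close>, because \<open>a = dist z x * sin \<theta>\<close>.\<close>

lemma inf_cone_axis:
  assumes a: "0 < a" "a < dist z x" and \<theta>: "\<theta> = arcsin (a / dist z x)"
  defines "e \<equiv> (1 / dist z x) *\<^sub>R (z - x)"
  shows "norm e = 1"
    and "0 < l \<Longrightarrow> norm (w - e) < sin \<theta> \<Longrightarrow> x + l *\<^sub>R w \<in> inf_cone x z a"
proof -
  let ?D = "dist z x"
  have D: "0 < ?D" using a by linarith
  show "norm e = 1" using D by (simp add: e_def dist_norm)
  assume l: "0 < l" and w: "norm (w - e) < sin \<theta>"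
  have "a / ?D \<le> 1" "- 1 \<le> a / ?D" using a D by (auto simp: divide_simps intro: order_trans[of _ 0])
  then have s: "sin \<theta> = a / ?D" unfolding \<theta> by (rule sin_arcsin[rotated])
  have "?D *\<^sub>R e = z - x" using D by (simp add: e_def)
  then have eq: "(x + ?D *\<^sub>R w) - z = ?D *\<^sub>R (w - e)" by (simp add: scaleR_diff_right algebra_simps)
  have "dist (x + ?D *\<^sub>R w) z = ?D * norm (w - e)"
    unfolding dist_norm[of "x + ?D *\<^sub>R w"] eq by simp
  also have "\<dots> < ?D * (a / ?D)" using w s D by (intro mult_strict_left_mono) auto
  finally have "dist (x + ?D *\<^sub>R w) z < a" using D by simp
  moreover have "x + l *\<^sub>R w = x + (l / ?D) *\<^sub>R ((x + ?D *\<^sub>R w) - x)" using D by simp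
  ultimately show "x + l *\<^sub>R w \<in> inf_cone x z a"
    unfolding inf_cone_def using l D by (intro CollectI exI[of _ "l / ?D"] exI[of _ "x + ?D *\<^sub>R w"]) auto
qed

text \<open>For small \<open>\<tau>\<close> the positive orthant is taken into a narrow cone with axis \<open>e\<close>; the sign of \<open>\<tau>\<close> serves to
  make the map injective.\<close>

definition skew_map :: "real \<Rightarrow> real \<Rightarrow> real ^ 'n \<Rightarrow> real ^ 'n \<Rightarrow> real ^ 'n" where
  "skew_map \<kappa> \<tau> e y = \<kappa> *\<^sub>R (\<tau> *\<^sub>R y + (\<Sum>i\<in>UNIV. y $ i) *\<^sub>R e)"

lemma linear_skew_map:
  fixes e :: "real ^ 'n"
  shows "linear (skew_map \<kappa> \<tau> e)"
proof (rule linearI)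
  show "skew_map \<kappa> \<tau> e (x + y) = skew_map \<kappa> \<tau> e x + skew_map \<kappa> \<tau> e y" for x y
    by (simp add: skew_map_def sum.distrib scaleR_add_left scaleR_add_right)
  fix c and x :: "real ^ 'n"
  have "(\<Sum>i\<in>UNIV. (c *\<^sub>R x) $ i) = c * (\<Sum>i\<in>UNIV. x $ i)" by (simp add: sum_distrib_left)
  then show "skew_map \<kappa> \<tau> e (c *\<^sub>R x) = c *\<^sub>R skew_map \<kappa> \<tau> e x"
    unfolding skew_map_def by (simp only: scaleR_add_right scaleR_scaleR) (simp only: mult_ac)
qed

text \<open>Summing the coordinates of a kernel equation gives
  \<open>s (\<tau> + \<Sum> e) = 0\<close> for the coordinate sum \<open>s\<close> of
  \<open>y\<close>; hence \<open>s = 0\<close>, and then \<open>\<tau> y = 0\<close>.\<close>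

lemma inj_skew_map:
  assumes \<kappa>: "\<kappa> \<noteq> 0" and \<tau>: "\<tau> \<noteq> 0" and ne: "\<tau> + (\<Sum>i\<in>UNIV. e $ i) \<noteq> 0"
  shows "inj (skew_map \<kappa> \<tau> e)"
  unfolding linear_injective_0[OF linear_skew_map]
proof (intro allI impI)
  fix y assume "skew_map \<kappa> \<tau> e y = 0"
  then have 0: "\<tau> *\<^sub>R y + (\<Sum>i\<in>UNIV. y $ i) *\<^sub>R e = 0" using \<kappa> by (simp add: skew_map_def)
  define s where "s = (\<Sum>i\<in>UNIV. y $ i)"
  have c: "\<tau> * y $ i + s * e $ i = 0" for i
    using arg_cong[OF 0, of "\<lambda>v. v $ i"] by (simp add: s_def)
  have "(\<Sum>i\<in>UNIV. \<tau> * y $ i) = \<tau> * s" "(\<Sum>i\<in>UNIV. s * e $ i) = s * (\<Sum>i\<in>UNIV. e $ i)"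
    by (simp_all add: s_def sum_distrib_left)
  then have "(\<Sum>i\<in>UNIV. \<tau> * y $ i + s * e $ i) = s * (\<tau> + (\<Sum>i\<in>UNIV. e $ i))"
    by (simp only: sum.distrib distrib_left) (simp only: mult.commute)
  then have "s * (\<tau> + (\<Sum>i\<in>UNIV. e $ i)) = 0" using c by simp
  then have "s = 0" using ne by simp
  then show "y = 0" using c \<tau> by (auto simp: vec_eq_iff)
qed

text \<open>A finite net of directions on the unit sphere reduces the cone condition to finitely many
  parallelepipeds.\<close>

lemma cond_h1_parallelepipeds:
  fixes \<Omega> :: "(real ^ 'n::finite) set"
  assumes d: "0 < d" and h1: "cond_h1 d \<Omega>"
  shows "\<exists>\<L> :: (real ^ 'n \<Rightarrow> real ^ 'n) set. finite \<L> \<and> (\<forall>L\<in>\<L>. linear L \<and> inj L) \<and>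
     (\<forall>x\<in>\<Omega>. \<exists>L\<in>\<L>. \<forall>y\<in>cbox 0 (\<chi> i. real r). x + L y \<in> \<Omega>)"
proof -
  obtain \<theta> where \<theta>: "0 < \<theta>" "\<theta> < pi / 2"
    and cone: "\<And>x. x \<in> \<Omega> \<Longrightarrow> \<exists>C. is_cone \<theta> x C \<and> (\<forall>\<rho>\<in>{0<..d}. closure (C \<inter> ball x \<rho>) \<subseteq> \<Omega>)"
    using h1 unfolding cond_h1_def by auto
  \<comment> \<open>Half of the admissible deviation \<open>sin \<theta>\<close> goes to the
    distance from the net \<open>E\<close>, the other half to the tilt by
    \<open>\<tau>\<close>.\<close>
  define \<sigma> where "\<sigma> = sin \<theta> / 2"
  have "0 < sin \<theta>" "sin \<theta> \<le> 1" using \<theta> by (auto intro: sin_gt_zero)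
  then have \<sigma>: "0 < \<sigma>" "\<sigma> < 1" unfolding \<sigma>_def by linarith+
  have "compact (sphere (0 :: real ^ 'n) 1)" by simp
  then obtain E where E: "finite E" "E \<subseteq> sphere (0 :: real ^ 'n) 1" "sphere 0 1 \<subseteq> (\<Union>e\<in>E. ball e \<sigma>)"
  proof (rule compactE_image[of "sphere (0 :: real ^ 'n) 1" "sphere (0 :: real ^ 'n) 1" "\<lambda>e. ball e \<sigma>"])
    show "sphere 0 1 \<subseteq> (\<Union>e\<in>sphere (0 :: real ^ 'n) 1. ball e \<sigma>)" using \<sigma> by force
  qed auto
  \<comment> \<open>The sign follows that of the coordinate sum of \<open>e\<close>, so the two
    cannot cancel.\<close>
  define \<tau> where "\<tau> e = (if 0 \<le> (\<Sum>i\<in>UNIV. e $ i) then \<sigma> / 2 else - \<sigma> / 2)" for e :: "real ^ 'n"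
  have \<tau>: "\<tau> e \<noteq> 0" "\<bar>\<tau> e\<bar> < \<sigma>" "\<tau> e + (\<Sum>i\<in>UNIV. e $ i) \<noteq> 0" for e
    using \<sigma> by (auto simp: \<tau>_def)
  \<comment> \<open>With coordinate sum at most \<open>n r\<close> and \<open>norm w \<le> 2\<close>
    this keeps the image of the cube within \<open>2 d / 3 < d\<close> of the vertex.\<close>
  define \<kappa> where "\<kappa> = d / (3 * (real CARD('n) * real r + 1))"
  have \<kappa>: "0 < \<kappa>" unfolding \<kappa>_def using d by (intro divide_pos_pos) (auto intro: add_nonneg_pos)
  define L where "L e = skew_map \<kappa> (\<tau> e) e" for e
  have lin: "linear (L e) \<and> inj (L e)" for e
  proof -
    have "\<kappa> \<noteq> 0" using \<kappa> by simp
    then show ?thesis unfolding L_def using linear_skew_map inj_skew_map[OF _ \<tau>(1) \<tau>(3)] by blast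
  qed
  have main: "\<exists>e\<in>E. \<forall>y\<in>cbox 0 (\<chi> i. real r). x + L e y \<in> \<Omega>" if x: "x \<in> \<Omega>" for x
  proof -
    obtain C where C: "is_cone \<theta> x C" "\<forall>\<rho>\<in>{0<..d}. closure (C \<inter> ball x \<rho>) \<subseteq> \<Omega>" using cone[OF x] by blast
    then obtain z a where za: "0 < a" "a < dist z x" "\<theta> = arcsin (a / dist z x)" "C = inf_cone x z a"
      unfolding is_cone_def by blast
    define e0 where "e0 = (1 / dist z x) *\<^sub>R (z - x)"
    have "norm e0 = 1" unfolding e0_def by (rule inf_cone_axis(1)[OF za(1-3)])
    then obtain e where e: "e \<in> E" "dist e e0 < \<sigma>" using E(3) by (force simp: subset_iff)
    then have ne: "norm e = 1" using E(2) by auto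
    have "x + L e y \<in> \<Omega>" if y: "y \<in> cbox 0 (\<chi> i. real r)" for y
    \<comment> \<open>The open cone omits its vertex, so the corner of the parallelepiped is treated
      apart.\<close>
    proof (cases "y = 0")
      case True
      then show ?thesis using x by (simp add: L_def skew_map_def)
    next
      case False
      have yi: "0 \<le> y $ i" "y $ i \<le> real r" for i using y by (auto simp: mem_box_cart)
      define s where "s = (\<Sum>i\<in>UNIV. y $ i)"
      have "norm y \<le> (\<Sum>i\<in>UNIV. \<bar>y $ i\<bar>)" by (rule norm_le_l1_cart)
      also have "\<dots> = s" using yi by (simp add: s_def)
      finally have ys: "norm y \<le> s" .
      then have s0: "0 < s" using False by (metis less_le_trans zero_less_norm_iff)
      have "s \<le> (\<Sum>i\<in>(UNIV::'n set). real r)" unfolding s_def using yi by (intro sum_mono)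
      then have sr: "s \<le> real CARD('n) * real r" by simp
      \<comment> \<open>The direction of \<open>L e y\<close>. Since \<open>norm y \<le> s\<close>
        for nonnegative coordinates, it differs from \<open>e\<close> by at most
        \<open>|\<tau> e| < \<sigma>\<close>, and \<open>e\<close> differs from the true axis by
        less than \<open>\<sigma>\<close>.\<close>
      define w where "w = (\<tau> e / s) *\<^sub>R y + e"
      have Lw: "L e y = (\<kappa> * s) *\<^sub>R w"
        unfolding L_def skew_map_def w_def s_def[symmetric] using s0 by (simp add: scaleR_add_right)
      have "norm ((\<tau> e / s) *\<^sub>R y) = \<bar>\<tau> e\<bar> * (norm y / s)" using s0 by (simp add: abs_divide)
      also have "\<dots> \<le> \<bar>\<tau> e\<bar> * 1" using ys s0 by (intro mult_left_mono) auto
      finally have t: "norm ((\<tau> e / s) *\<^sub>R y) < \<sigma>" using \<tau>(2)[of e] by simp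
      have "norm (w - e0) \<le> norm ((\<tau> e / s) *\<^sub>R y) + norm (e - e0)"
        unfolding w_def using norm_triangle_ineq[of "(\<tau> e / s) *\<^sub>R y" "e - e0"] by (simp add: algebra_simps)
      moreover have "norm (e - e0) < \<sigma>" using e(2) by (simp add: dist_norm)
      ultimately have "norm (w - e0) < sin \<theta>" using t unfolding \<sigma>_def by linarith
      then have inC: "x + L e y \<in> C"
        unfolding Lw za(4) e0_def using \<kappa> s0 by (intro inf_cone_axis(2)[OF za(1-3)]) auto
      have "norm w \<le> norm ((\<tau> e / s) *\<^sub>R y) + norm e" unfolding w_def by (rule norm_triangle_ineq)
      then have w2: "norm w \<le> 2" using t ne \<sigma> by simp
      have "norm (L e y) = \<kappa> * s * norm w" unfolding Lw using \<kappa> s0 by (simp add: abs_mult)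
      also have "\<dots> \<le> \<kappa> * (real CARD('n) * real r + 1) * 2"
        using \<kappa> s0 sr w2 by (intro mult_mono) auto
      also have "\<dots> = d * (2 / 3)"
      proof -
        have "d / (3 * N) * N * 2 = d * (2 / 3)" if "0 < N" for N :: real using that by simp
        moreover have "0 < real CARD('n) * real r + 1" by (intro add_nonneg_pos) auto
        ultimately show ?thesis unfolding \<kappa>_def by blast
      qed
      also have "\<dots> < d" using d by simp
      finally have "x + L e y \<in> ball x d" by (simp add: dist_norm)
      with inC have "x + L e y \<in> C \<inter> ball x d" by (rule IntI)
      moreover have "closure (C \<inter> ball x d) \<subseteq> \<Omega>" using C(2)[rule_format, of d] d by simp
      ultimately show ?thesis by (meson closure_subset subsetD)
    qed
    then show ?thesis by (intro bexI[OF _ e(1)] ballI)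
  qed
  show ?thesis
  proof (intro exI[of _ "L ` E"] conjI ballI)
    show "finite (L ` E)" using E(1) by simp
    show "linear M" "inj M" if "M \<in> L ` E" for M using that lin by auto
    fix x assume "x \<in> \<Omega>"
    from main[OF this] show "\<exists>M\<in>L ` E. \<forall>y\<in>cbox 0 (\<chi> i. real r). x + M y \<in> \<Omega>"
      by (simp only: bex_simps)
  qed
qed

section \<open>From one parallelepiped to the whole set\<close>

lemma open_translates_in:
  fixes \<Omega> :: "'a::euclidean_space set"
  assumes "open \<Omega>" "compact K"
  shows "open {x. \<forall>w\<in>K. x + w \<in> \<Omega>}"
proof -
  \<comment> \<open>The complement is the difference of a closed and a compact set, hence
    closed.\<close>
  have "{x. \<forall>w\<in>K. x + w \<in> \<Omega>} = - (\<Union>y\<in>- \<Omega>. \<Union>w\<in>K. {y - w})"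
  proof (intro set_eqI iffI)
    fix x assume x: "x \<in> - (\<Union>y\<in>- \<Omega>. \<Union>w\<in>K. {y - w})"
    have "x + w \<in> \<Omega>" if "w \<in> K" for w
    proof (rule ccontr)
      assume "x + w \<notin> \<Omega>"
      moreover have "x = (x + w) - w" by simp
      ultimately have "x \<in> (\<Union>y\<in>- \<Omega>. \<Union>w\<in>K. {y - w})" using that by blast
      then show False using x by blast
    qed
    then show "x \<in> {x. \<forall>w\<in>K. x + w \<in> \<Omega>}" by blast
  qed auto
  moreover have "closed (\<Union>y\<in>- \<Omega>. \<Union>w\<in>K. {y - w})"
    using assms by (intro closed_compact_differences) (auto simp: closed_Compl)
  ultimately show ?thesis by (simp only: open_Compl)
qed

text \<open>In each ball the local inequality holds with the same constant, with the integral of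
  \<open>\<gamma>\<close> bounded by \<open>m\<close>. Integration over the centre \<open>z\<close>
  turns both sides into multiples of integrals over the whole space.\<close>

lemma Sobolev_embedding_parallelepiped:
  fixes L :: "real ^ 'n::finite \<Rightarrow> real ^ 'n" and \<Omega> :: "(real ^ 'n) set"
  assumes L: "linear L" "inj L" and \<Omega>: "open \<Omega>" and d: "0 < d"
    and r: "1 \<le> r" and p: "1 \<le> p" "p \<le> q" and q: "real CARD('n) / real r \<le> q"
    and crit: "real CARD('n) / real r = p \<and> 1 < p \<longrightarrow> real CARD('n) / real r < q"
  shows "\<exists>C<top. \<forall>V u \<gamma> m. weak_jet r p \<Omega> V \<longrightarrow> u \<in> borel_measurable borel \<longrightarrow>
     integrable lborel (\<lambda>x. norm (u x) powr p) \<longrightarrow>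
     (\<forall>\<phi>\<in>C0_inf \<Omega>. (LINT x|lborel. u x * \<phi> x) = (LINT x|lborel. V (\<lambda>_. 0) x * \<phi> x)) \<longrightarrow>
     \<gamma> \<in> borel_measurable borel \<longrightarrow> (\<forall>x. 0 \<le> \<gamma> x) \<longrightarrow>
     (\<forall>x\<in>\<Omega>. (\<integral>\<^sup>+y. ennreal (\<gamma> y) epowr q * indicator (ball x d \<inter> \<Omega>) y \<partial>lborel) \<le> m) \<longrightarrow>
     (\<integral>\<^sup>+x. ennreal ((\<gamma> x * norm (u x)) powr p) * indicator {x\<in>\<Omega>. \<forall>y\<in>cbox 0 (\<chi> i. real r). x + L y \<in> \<Omega>} x \<partial>lborel)
     \<le> C * m epowr (p / q) *
         (\<Sum>\<alpha> | order_mi \<alpha> \<le> r. \<integral>\<^sup>+x. ennreal (norm (V \<alpha> x)) epowr p \<partial>lborel)"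
proof -
  let ?Q = "cbox 0 (\<chi> i. real r) :: (real ^ 'n) set"
  \<comment> \<open>Half of \<open>d\<close>, since \<open>m\<close> controls only balls with centre
    in \<open>\<Omega>\<close>: a subset of \<open>\<Omega>\<close> in a ball of radius
    \<open>\<rho>\<close> lies in the ball of radius \<open>d\<close> about any of its own
    points.\<close>
  define \<rho> where "\<rho> = d / 2"
  have \<rho>: "0 < \<rho>" using d by (simp add: \<rho>_def)
  obtain C where C: "C < top" "\<forall>\<Omega> V u A G z \<gamma> \<delta>. weak_jet r p \<Omega> V \<longrightarrow> u \<in> borel_measurable borel \<longrightarrow>
     integrable lborel (\<lambda>x. norm (u x) powr p) \<longrightarrow>
     (\<forall>\<phi>\<in>C0_inf \<Omega>. (LINT x|lborel. u x * \<phi> x) = (LINT x|lborel. V (\<lambda>_. 0) x * \<phi> x)) \<longrightarrow>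
     open A \<longrightarrow> A \<subseteq> ball z \<rho> \<longrightarrow> 0 < \<delta> \<longrightarrow>
     (\<forall>x\<in>A. \<forall>y\<in>?Q. cball (x + L y) \<delta> \<subseteq> \<Omega> \<inter> G) \<longrightarrow> G \<in> sets borel \<longrightarrow>
     \<gamma> \<in> borel_measurable borel \<longrightarrow> (\<forall>x. 0 \<le> \<gamma> x) \<longrightarrow>
     (\<integral>\<^sup>+x. ennreal ((\<gamma> x * norm (u x)) powr p) * indicator A x \<partial>lborel)
     \<le> C * (\<integral>\<^sup>+x. ennreal (\<gamma> x) epowr q * indicator A x \<partial>lborel) epowr (p / q) *
         (\<Sum>\<alpha> | order_mi \<alpha> \<le> r. \<integral>\<^sup>+x. ennreal (norm (V \<alpha> x)) epowr p * indicator G x \<partial>lborel)"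
    using Sobolev_local_weak[OF L r p q crit, of \<rho>] by (elim exE conjE) (rule that)
  have contL: "continuous_on UNIV L" using L(1) by (simp add: linear_continuous_on linear_conv_bounded_linear)
  have cLQ: "compact (L ` ?Q)"
    by (intro compact_continuous_image continuous_on_subset[OF contL] compact_cbox) auto
  from compact_imp_bounded[OF cLQ] obtain B where "\<forall>x\<in>L ` ?Q. norm x \<le> B" by (auto simp: bounded_iff)
  then have B: "norm (L y) \<le> B" if "y \<in> ?Q" for y using that by auto
  \<comment> \<open>Radius of the ball, plus the largest size \<open>B\<close> of the
    parallelepiped, plus the margin, which is at most 1.\<close>
  define R where "R = \<rho> + B + 1"
  define \<Omega>L where "\<Omega>L = {x\<in>\<Omega>. \<forall>y\<in>?Q. x + L y \<in> \<Omega>}"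
  have oL: "open \<Omega>L"
  proof -
    have "open (\<Omega> \<inter> {x. \<forall>w\<in>L ` ?Q. x + w \<in> \<Omega>})" using \<Omega> cLQ by (intro open_Int open_translates_in)
    moreover have "\<Omega>L = \<Omega> \<inter> {x. \<forall>w\<in>L ` ?Q. x + w \<in> \<Omega>}" by (auto simp: \<Omega>L_def)
    ultimately show ?thesis by simp
  qed
  then have oLb [measurable]: "\<Omega>L \<in> sets borel" by simp
  define k where "k r = emeasure lborel (ball (0 :: real ^ 'n) r)" for r
  have kfin: "k r < top" for r unfolding k_def using emeasure_lborel_ball_finite[of 0 r] by simp
  have k\<rho>: "k \<rho> \<noteq> 0" unfolding k_def using content_ball_pos[OF \<rho>, of "0 :: real ^ 'n"] by (auto simp: measure_def)
  \<comment> \<open>In the average over \<open>z\<close> each point is counted with the volume of a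
    ball of radius \<open>\<rho>\<close> on the left and of radius \<open>R\<close> on the
    right.\<close>
  define D where "D = C * k R / k \<rho>"
  have "C * k R < top" using C(1) kfin[of R] by (simp add: ennreal_mult_less_top)
  then have "D < top" unfolding D_def using k\<rho> by (simp add: less_top[symmetric] ennreal_divide_eq_top_iff)
  have "(\<integral>\<^sup>+x. ennreal ((\<gamma> x * norm (u x)) powr p) * indicator \<Omega>L x \<partial>lborel)
     \<le> D * m epowr (p / q) *
         (\<Sum>\<alpha> | order_mi \<alpha> \<le> r. \<integral>\<^sup>+x. ennreal (norm (V \<alpha> x)) epowr p \<partial>lborel)"
    if V: "weak_jet r p \<Omega> V" and u [measurable]: "u \<in> borel_measurable borel"
     and ui: "integrable lborel (\<lambda>x. norm (u x) powr p)"
     and uV: "\<forall>\<phi>\<in>C0_inf \<Omega>. (LINT x|lborel. u x * \<phi> x) = (LINT x|lborel. V (\<lambda>_. 0) x * \<phi> x)"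
     and \<gamma>m [measurable]: "\<gamma> \<in> borel_measurable borel" and \<gamma>0: "\<forall>x. 0 \<le> \<gamma> x"
     and m: "\<forall>x\<in>\<Omega>. (\<integral>\<^sup>+y. ennreal (\<gamma> y) epowr q * indicator (ball x d \<inter> \<Omega>) y \<partial>lborel) \<le> m"
    for V u \<gamma> m
  proof -
    define f where "f x = ennreal ((\<gamma> x * norm (u x)) powr p)" for x
    have fm [measurable]: "f \<in> borel_measurable borel" unfolding f_def by measurable
    define S where "S x = (\<Sum>\<alpha> | order_mi \<alpha> \<le> r. ennreal (norm (V \<alpha> x)) epowr p)" for x
    have Vm: "V \<alpha> \<in> borel_measurable borel" if "\<alpha> \<in> {\<alpha>. order_mi \<alpha> \<le> r}" for \<alpha> using V that by (auto simp: weak_jet_def)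
    have Sm [measurable]: "S \<in> borel_measurable borel" unfolding S_def using Vm by measurable
    have S: "(\<Sum>\<alpha> | order_mi \<alpha> \<le> r. \<integral>\<^sup>+x. ennreal (norm (V \<alpha> x)) epowr p * indicator G x \<partial>lborel)
       = (\<integral>\<^sup>+x. S x * indicator G x \<partial>lborel)" if "G \<in> sets borel" for G
      unfolding S_def sum_distrib_right using Vm that by (subst nn_integral_sum) auto
    have loc: "(\<integral>\<^sup>+x. f x * indicator (\<Omega>L \<inter> ball z \<rho>) x \<partial>lborel)
        \<le> C * m epowr (p / q) * (\<integral>\<^sup>+x. S x * indicator (ball z R) x \<partial>lborel)" for z
    proof -
      define \<delta> where "\<delta> j = 1 / real (Suc j)" for j
      have \<delta>: "0 < \<delta> j" "\<delta> j \<le> 1" for j by (auto simp: \<delta>_def divide_simps)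
      \<comment> \<open>Vertices whose parallelepiped stays at distance more than
        \<open>\<delta> j\<close> from the complement. These sets increase to the required one
        because a compact subset of \<open>\<Omega>\<close> always has some margin; monotone
        convergence follows.\<close>
      define A where "A j = {x. \<forall>w\<in>(\<Union>a\<in>L ` ?Q. \<Union>b\<in>cball 0 (\<delta> j). {a + b}). x + w \<in> \<Omega>} \<inter> (\<Omega> \<inter> ball z \<rho>)" for j
      have A: "x \<in> A j \<longleftrightarrow> x \<in> \<Omega> \<inter> ball z \<rho> \<and> (\<forall>y\<in>?Q. cball (x + L y) (\<delta> j) \<subseteq> \<Omega>)" for x j
      proof -
        have "(\<forall>b\<in>cball 0 (\<delta> j). x + (a + b) \<in> \<Omega>) \<longleftrightarrow> cball (x + a) (\<delta> j) \<subseteq> \<Omega>" for a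
        proof
          assume *: "\<forall>b\<in>cball 0 (\<delta> j). x + (a + b) \<in> \<Omega>"
          show "cball (x + a) (\<delta> j) \<subseteq> \<Omega>"
          proof
            fix c assume "c \<in> cball (x + a) (\<delta> j)"
            then have "c - (x + a) \<in> cball 0 (\<delta> j)" by (simp add: dist_norm norm_minus_commute)
            with * have "x + (a + (c - (x + a))) \<in> \<Omega>" by blast
            then show "c \<in> \<Omega>" by simp
          qed
        next
          assume *: "cball (x + a) (\<delta> j) \<subseteq> \<Omega>"
          show "\<forall>b\<in>cball 0 (\<delta> j). x + (a + b) \<in> \<Omega>"
          proof
            fix b :: "real ^ 'n" assume "b \<in> cball 0 (\<delta> j)"
            then have "x + a + b \<in> cball (x + a) (\<delta> j)" by (simp add: dist_norm)
            with * show "x + (a + b) \<in> \<Omega>" by (auto simp: add.assoc)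
          qed
        qed
        then show ?thesis unfolding A_def by auto
      qed
      have Ao: "open (A j)" for j
        unfolding A_def using \<Omega> by (intro open_Int open_translates_in compact_sums' cLQ compact_cball open_ball)
      then have [measurable]: "A j \<in> sets borel" for j by simp
      have inc: "incseq A"
      proof (rule incseq_SucI, rule subsetI)
        fix j x assume x: "x \<in> A j"
        have "\<delta> (Suc j) \<le> \<delta> j" by (simp add: \<delta>_def divide_simps)
        then have "cball c (\<delta> (Suc j)) \<subseteq> cball c (\<delta> j)" for c :: "real ^ 'n" by (rule subset_cball)
        then show "x \<in> A (Suc j)" using x unfolding A by blast
      qed
      have un: "\<Omega>L \<inter> ball z \<rho> \<subseteq> (\<Union>j. A j)"
      proof
        fix x assume x: "x \<in> \<Omega>L \<inter> ball z \<rho>"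
        have "compact (\<Union>y\<in>{x}. \<Union>w\<in>L ` ?Q. {y + w})" by (intro compact_sums' cLQ) auto
        moreover have "(\<Union>y\<in>{x}. \<Union>w\<in>L ` ?Q. {y + w}) \<subseteq> \<Omega>" using x by (auto simp: \<Omega>L_def)
        ultimately obtain \<epsilon> where \<epsilon>: "0 < \<epsilon>" "(\<Union>c\<in>(\<Union>y\<in>{x}. \<Union>w\<in>L ` ?Q. {y + w}). ball c \<epsilon>) \<subseteq> \<Omega>"
          using compact_subset_open_imp_ball_epsilon_subset \<Omega> by metis
        obtain j where j: "\<delta> j < \<epsilon>" using reals_Archimedean[OF \<epsilon>(1)] by (auto simp: \<delta>_def inverse_eq_divide)
        have "cball (x + L y) (\<delta> j) \<subseteq> \<Omega>" if "y \<in> ?Q" for y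
        proof -
          have "cball (x + L y) (\<delta> j) \<subseteq> ball (x + L y) \<epsilon>" using j by auto
          then show ?thesis using \<epsilon>(2) that by auto
        qed
        then have "x \<in> A j" unfolding A using x by (auto simp: \<Omega>L_def)
        then show "x \<in> (\<Union>j. A j)" by blast
      qed
      have each: "(\<integral>\<^sup>+x. f x * indicator (A j) x \<partial>lborel) \<le> C * m epowr (p / q) * (\<integral>\<^sup>+x. S x * indicator (ball z R) x \<partial>lborel)" for j
      proof (cases "A j = {}")
        case False
        then obtain x0 where x0: "x0 \<in> \<Omega>" "dist z x0 < \<rho>" unfolding A_def by auto
        have "A j \<subseteq> ball x0 d \<inter> \<Omega>"
        proof
          fix x assume "x \<in> A j"
          then have "x \<in> \<Omega>" "dist z x < \<rho>" by (auto simp: A)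
          moreover have "dist x0 x \<le> dist z x0 + dist z x" by (metis dist_commute dist_triangle)
          ultimately show "x \<in> ball x0 d \<inter> \<Omega>" using x0 by (simp add: \<rho>_def)
        qed
        then have "(\<integral>\<^sup>+y. ennreal (\<gamma> y) epowr q * indicator (A j) y \<partial>lborel) \<le> (\<integral>\<^sup>+y. ennreal (\<gamma> y) epowr q * indicator (ball x0 d \<inter> \<Omega>) y \<partial>lborel)"
          by (intro nn_integral_mono) (auto simp: indicator_def)
        also have "\<dots> \<le> m" using m x0 by blast
        finally have gm: "(\<integral>\<^sup>+y. ennreal (\<gamma> y) epowr q * indicator (A j) y \<partial>lborel) \<le> m" .
        have "(\<integral>\<^sup>+x. f x * indicator (A j) x \<partial>lborel)
          \<le> C * (\<integral>\<^sup>+x. ennreal (\<gamma> x) epowr q * indicator (A j) x \<partial>lborel) epowr (p / q) *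
         (\<Sum>\<alpha> | order_mi \<alpha> \<le> r. \<integral>\<^sup>+x. ennreal (norm (V \<alpha> x)) epowr p * indicator (ball z R) x \<partial>lborel)"
          unfolding f_def
        proof (rule C(2)[rule_format, OF V u ui _ Ao, where z = z and \<delta> = "\<delta> j"])
          show "A j \<subseteq> ball z \<rho>" by (auto simp: A)
          fix x y assume x: "x \<in> A j" and y: "y \<in> ?Q"
          have "cball (x + L y) (\<delta> j) \<subseteq> ball z R"
          proof
            fix c assume "c \<in> cball (x + L y) (\<delta> j)"
            then have "dist (x + L y) c \<le> 1" using \<delta>(2)[of j] by (meson mem_cball order_trans)
            moreover have "dist z c \<le> dist z x + norm (L y) + dist (x + L y) c" by norm
            ultimately show "c \<in> ball z R" using x B[OF y] by (auto simp: A R_def)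
          qed
          then show "cball (x + L y) (\<delta> j) \<subseteq> \<Omega> \<inter> ball z R" using x y unfolding A by blast
        qed (use uV \<gamma>0 \<delta> in auto)
        also have "\<dots> \<le> C * m epowr (p / q) * (\<integral>\<^sup>+x. S x * indicator (ball z R) x \<partial>lborel)"
          using gm p by (subst S) (auto intro!: mult_right_mono mult_left_mono epowr_mono)
        finally show ?thesis .
      qed simp
      have "(\<integral>\<^sup>+x. f x * indicator (\<Omega>L \<inter> ball z \<rho>) x \<partial>lborel) \<le> (\<integral>\<^sup>+x. (SUP j. f x * indicator (A j) x) \<partial>lborel)"
      proof (intro nn_integral_mono)
        fix x
        show "f x * indicator (\<Omega>L \<inter> ball z \<rho>) x \<le> (SUP j. f x * indicator (A j) x)"
        proof (cases "x \<in> \<Omega>L \<inter> ball z \<rho>")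
          case True
          then obtain j where "x \<in> A j" using un by blast
          then have "f x * indicator (\<Omega>L \<inter> ball z \<rho>) x \<le> f x * indicator (A j) x" by (auto simp: indicator_def)
          also have "\<dots> \<le> (SUP j. f x * indicator (A j) x)" by (rule SUP_upper) simp
          finally show ?thesis .
        qed simp
      qed
      also have "\<dots> = (SUP j. \<integral>\<^sup>+x. f x * indicator (A j) x \<partial>lborel)"
      proof (rule nn_integral_monotone_convergence_SUP)
        show "incseq (\<lambda>j x. f x * indicator (A j) x)"
          using inc by (auto simp: incseq_def le_fun_def intro!: mult_left_mono split: split_indicator)
      qed measurable
      also have "\<dots> \<le> C * m epowr (p / q) * (\<integral>\<^sup>+x. S x * indicator (ball z R) x \<partial>lborel)"
        by (intro SUP_least each)
      finally show ?thesis .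
    qed
    have avg: "(\<integral>\<^sup>+z. (\<integral>\<^sup>+x. g x * indicator (ball z a) x \<partial>lborel) \<partial>lborel) = k a * (\<integral>\<^sup>+x. g x \<partial>lborel)"
      if [measurable]: "g \<in> borel_measurable borel" for g :: "real ^ 'n \<Rightarrow> ennreal" and a
    proof -
      have ind: "(indicator (ball z a) x :: ennreal) = indicator {w. norm w < a} (x - z)" for z x :: "real ^ 'n"
        by (auto simp: indicator_def dist_norm norm_minus_commute)
      have [measurable]: "{w :: real ^ 'n. norm w < a} \<in> sets borel" by measurable
      have kx: "(\<integral>\<^sup>+z. indicator {w. norm w < a} (x - z) \<partial>lborel) = k a" for x :: "real ^ 'n"
      proof -
        have "(\<integral>\<^sup>+z. indicator {w :: real ^ 'n. norm w < a} (x - z) \<partial>lborel) = (\<integral>\<^sup>+z. indicator {w :: real ^ 'n. norm w < a} z \<partial>lborel)"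
          by (rule nn_integral_lborel_reflect) measurable
        also have "\<dots> = emeasure lborel {w :: real ^ 'n. norm w < a}" by simp
        finally have "(\<integral>\<^sup>+z. indicator {w. norm w < a} (x - z) \<partial>lborel) = emeasure lborel {w :: real ^ 'n. norm w < a}" .
        moreover have "{w :: real ^ 'n. norm w < a} = ball 0 a" by auto
        ultimately show ?thesis by (simp only: k_def)
      qed
      have "(\<integral>\<^sup>+z. (\<integral>\<^sup>+x. g x * indicator (ball z a) x \<partial>lborel) \<partial>lborel)
        = (\<integral>\<^sup>+x. (\<integral>\<^sup>+z. g x * indicator {w. norm w < a} (x - z) \<partial>lborel) \<partial>lborel)"
        unfolding ind by (rule lborel_pair.Fubini') measurable
      also have "\<dots> = (\<integral>\<^sup>+x. g x * (\<integral>\<^sup>+z. indicator {w. norm w < a} (x - z) \<partial>lborel) \<partial>lborel)"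
        by (intro nn_integral_cong nn_integral_cmult) measurable
      also have "\<dots> = (\<integral>\<^sup>+x. g x \<partial>lborel) * k a"
        unfolding kx by (rule nn_integral_multc) measurable
      finally show ?thesis by (simp only: mult.commute)
    qed
    have "k \<rho> * (\<integral>\<^sup>+x. f x * indicator \<Omega>L x \<partial>lborel)
       = (\<integral>\<^sup>+z. (\<integral>\<^sup>+x. (f x * indicator \<Omega>L x) * indicator (ball z \<rho>) x \<partial>lborel) \<partial>lborel)"
      by (rule avg[symmetric]) measurable
    also have "\<dots> \<le> (\<integral>\<^sup>+z. C * m epowr (p / q) * (\<integral>\<^sup>+x. S x * indicator (ball z R) x \<partial>lborel) \<partial>lborel)"
    proof (intro nn_integral_mono)
      fix z
      have "(f x * indicator \<Omega>L x) * indicator (ball z \<rho>) x = f x * indicator (\<Omega>L \<inter> ball z \<rho>) x" for x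
        by (auto simp: indicator_def)
      then show "(\<integral>\<^sup>+x. (f x * indicator \<Omega>L x) * indicator (ball z \<rho>) x \<partial>lborel) \<le> C * m epowr (p / q) * (\<integral>\<^sup>+x. S x * indicator (ball z R) x \<partial>lborel)"
        using loc[of z] by (simp only:)
    qed
    also have "\<dots> = C * m epowr (p / q) * (\<integral>\<^sup>+z. (\<integral>\<^sup>+x. S x * indicator (ball z R) x \<partial>lborel) \<partial>lborel)"
    proof (rule nn_integral_cmult)
      have "(indicator (ball z R) x :: ennreal) = indicator {w. norm w < R} (x - z)" for z x :: "real ^ 'n"
        by (auto simp: indicator_def dist_norm norm_minus_commute)
      moreover have [measurable]: "{w :: real ^ 'n. norm w < R} \<in> sets borel" by measurable
      have "(\<lambda>z. \<integral>\<^sup>+x. S x * indicator {w. norm w < R} (x - z) \<partial>lborel) \<in> borel_measurable lborel" by measurable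
      ultimately show "(\<lambda>z. \<integral>\<^sup>+x. S x * indicator (ball z R) x \<partial>lborel) \<in> borel_measurable lborel" by simp
    qed
    also have "\<dots> = C * m epowr (p / q) * (k R * (\<integral>\<^sup>+x. S x \<partial>lborel))" by (subst avg) auto
    finally have main: "k \<rho> * (\<integral>\<^sup>+x. f x * indicator \<Omega>L x \<partial>lborel) \<le> C * m epowr (p / q) * (k R * (\<integral>\<^sup>+x. S x \<partial>lborel))" .
    have "(\<integral>\<^sup>+x. f x * indicator \<Omega>L x \<partial>lborel) = k \<rho> * (\<integral>\<^sup>+x. f x * indicator \<Omega>L x \<partial>lborel) / k \<rho>"
      using k\<rho> kfin[of \<rho>] by (simp add: mult.commute[of "k \<rho>"] ennreal_mult_divide_eq less_top)
    also have "\<dots> \<le> C * m epowr (p / q) * (k R * (\<integral>\<^sup>+x. S x \<partial>lborel)) / k \<rho>"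
      using main by (rule divide_right_mono_ennreal)
    also have "\<dots> = D * m epowr (p / q) * (\<integral>\<^sup>+x. S x \<partial>lborel)"
      by (simp add: D_def divide_ennreal_def mult_ac)
    finally show ?thesis using S[of UNIV] by (simp add: f_def)
  qed
  note fin = this
  show ?thesis
  proof (intro exI[of _ D] conjI allI impI)
    show "D < top" by fact
  qed (unfold \<Omega>L_def[symmetric], rule fin; assumption)
qed

text \<open>The sets of vertices belonging to the finitely many maps of
  \<open>cond_h1_parallelepipeds\<close> cover \<open>\<Omega>\<close>, possibly with overlaps, so
  the constants are added.\<close>

lemma Sobolev_embedding_borel:
  fixes \<Omega> :: "(real ^ 'n::finite) set"
  assumes \<Omega>: "open \<Omega>" and d: "0 < d" and h1: "cond_h1 d \<Omega>"
    and r: "1 \<le> r" and p: "1 \<le> p" "p \<le> q" and q: "real CARD('n) / real r \<le> q"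
    and crit: "real CARD('n) / real r = p \<and> 1 < p \<longrightarrow> real CARD('n) / real r < q"
  shows "\<exists>C<top. \<forall>V u \<gamma> m. weak_jet r p \<Omega> V \<longrightarrow> u \<in> borel_measurable borel \<longrightarrow>
     integrable lborel (\<lambda>x. norm (u x) powr p) \<longrightarrow>
     (\<forall>\<phi>\<in>C0_inf \<Omega>. (LINT x|lborel. u x * \<phi> x) = (LINT x|lborel. V (\<lambda>_. 0) x * \<phi> x)) \<longrightarrow>
     \<gamma> \<in> borel_measurable borel \<longrightarrow> (\<forall>x. 0 \<le> \<gamma> x) \<longrightarrow>
     (\<forall>x\<in>\<Omega>. (\<integral>\<^sup>+y. ennreal (\<gamma> y) epowr q * indicator (ball x d \<inter> \<Omega>) y \<partial>lborel) \<le> m) \<longrightarrow>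
     (\<integral>\<^sup>+x. ennreal ((\<gamma> x * norm (u x)) powr p) * indicator \<Omega> x \<partial>lborel)
     \<le> C * m epowr (p / q) *
         (\<Sum>\<alpha> | order_mi \<alpha> \<le> r. \<integral>\<^sup>+x. ennreal (norm (V \<alpha> x)) epowr p \<partial>lborel)"
proof -
  let ?Q = "cbox 0 (\<chi> i. real r) :: (real ^ 'n) set"
  obtain \<L> where \<L>: "finite \<L>" "\<forall>L\<in>\<L>. linear L \<and> inj L"
     "\<forall>x\<in>\<Omega>. \<exists>L\<in>\<L>. \<forall>y\<in>?Q. x + L y \<in> \<Omega>"
    using cond_h1_parallelepipeds[OF d h1, of r] by blast
  define T where "T L = {x\<in>\<Omega>. \<forall>y\<in>?Q. x + L y \<in> \<Omega>}" for L :: "real ^ 'n \<Rightarrow> real ^ 'n"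
  define P where "P L C \<longleftrightarrow> (\<forall>V u \<gamma> m. weak_jet r p \<Omega> V \<longrightarrow> u \<in> borel_measurable borel \<longrightarrow>
     integrable lborel (\<lambda>x. norm (u x) powr p) \<longrightarrow>
     (\<forall>\<phi>\<in>C0_inf \<Omega>. (LINT x|lborel. u x * \<phi> x) = (LINT x|lborel. V (\<lambda>_. 0) x * \<phi> x)) \<longrightarrow>
     \<gamma> \<in> borel_measurable borel \<longrightarrow> (\<forall>x. 0 \<le> \<gamma> x) \<longrightarrow>
     (\<forall>x\<in>\<Omega>. (\<integral>\<^sup>+y. ennreal (\<gamma> y) epowr q * indicator (ball x d \<inter> \<Omega>) y \<partial>lborel) \<le> m) \<longrightarrow>
     (\<integral>\<^sup>+x. ennreal ((\<gamma> x * norm (u x)) powr p) * indicator (T L) x \<partial>lborel)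
     \<le> C * m epowr (p / q) *
         (\<Sum>\<alpha> | order_mi \<alpha> \<le> r. \<integral>\<^sup>+x. ennreal (norm (V \<alpha> x)) epowr p \<partial>lborel))" for L C
  have "\<forall>L\<in>\<L>. \<exists>C. C < top \<and> P L C"
  proof
    fix L assume that: "L \<in> \<L>"
    have "linear L" "inj L" using \<L>(2) that by auto
    from Sobolev_embedding_parallelepiped[OF this \<Omega> d r p q crit]
    show "\<exists>C. C < top \<and> P L C" unfolding P_def T_def .
  qed
  from bchoice[OF this] obtain c where "\<forall>L\<in>\<L>. c L < top \<and> P L (c L)" ..
  then have c: "c L < top" "P L (c L)" if "L \<in> \<L>" for L using that by simp_all
  have Tb: "T L \<in> sets borel" if "L \<in> \<L>" for L
  proof -
    have "continuous_on ?Q L" using \<L>(2) that by (simp add: linear_continuous_on linear_conv_bounded_linear)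
    then have "compact (L ` ?Q)" by (rule compact_continuous_image) (rule compact_cbox)
    then have "open (\<Omega> \<inter> {x. \<forall>w\<in>L ` ?Q. x + w \<in> \<Omega>})" using \<Omega> by (intro open_Int open_translates_in)
    moreover have "T L = \<Omega> \<inter> {x. \<forall>w\<in>L ` ?Q. x + w \<in> \<Omega>}" by (auto simp: T_def)
    ultimately show ?thesis by simp
  qed
  define C where "C = (\<Sum>L\<in>\<L>. c L)"
  show ?thesis
  proof (intro exI[of _ C] conjI allI impI)
    show "C < top" using \<L>(1) c(1) by (auto simp: C_def less_top)
    fix V and u :: "real ^ 'n \<Rightarrow> complex" and \<gamma> :: "real ^ 'n \<Rightarrow> real" and m
    assume H: "weak_jet r p \<Omega> V" "u \<in> borel_measurable borel"
     "integrable lborel (\<lambda>x. norm (u x) powr p)"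
     "\<forall>\<phi>\<in>C0_inf \<Omega>. (LINT x|lborel. u x * \<phi> x) = (LINT x|lborel. V (\<lambda>_. 0) x * \<phi> x)"
     "\<gamma> \<in> borel_measurable borel" "\<forall>x. 0 \<le> \<gamma> x"
     "\<forall>x\<in>\<Omega>. (\<integral>\<^sup>+y. ennreal (\<gamma> y) epowr q * indicator (ball x d \<inter> \<Omega>) y \<partial>lborel) \<le> m"
    note [measurable] = H(2,5)
    define f where "f x = ennreal ((\<gamma> x * norm (u x)) powr p)" for x
    have [measurable]: "f \<in> borel_measurable borel" unfolding f_def by measurable
    let ?S = "\<Sum>\<alpha> | order_mi \<alpha> \<le> r. \<integral>\<^sup>+x. ennreal (norm (V \<alpha> x)) epowr p \<partial>lborel"
    have "(\<integral>\<^sup>+x. f x * indicator \<Omega> x \<partial>lborel) \<le> (\<integral>\<^sup>+x. (\<Sum>L\<in>\<L>. f x * indicator (T L) x) \<partial>lborel)"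
    proof (intro nn_integral_mono)
      fix x
      show "f x * indicator \<Omega> x \<le> (\<Sum>L\<in>\<L>. f x * indicator (T L) x)"
      proof (cases "x \<in> \<Omega>")
        case True
        then obtain L where L: "L \<in> \<L>" "x \<in> T L" using \<L>(3) unfolding T_def by blast
        have "f x * indicator \<Omega> x \<le> f x * indicator (T L) x" using L by (simp add: indicator_def)
        also have "\<dots> \<le> (\<Sum>L\<in>\<L>. f x * indicator (T L) x)"
          using L \<L>(1) by (intro member_le_sum[of L \<L> "\<lambda>L. f x * indicator (T L) x"]) auto
        finally show ?thesis .
      qed simp
    qed
    also have "\<dots> = (\<Sum>L\<in>\<L>. \<integral>\<^sup>+x. f x * indicator (T L) x \<partial>lborel)"
      using Tb by (intro nn_integral_sum) auto
    also have "\<dots> \<le> (\<Sum>L\<in>\<L>. c L * m epowr (p / q) * ?S)"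
    proof (rule sum_mono)
      fix L assume "L \<in> \<L>"
      from c(2)[OF this, unfolded P_def, rule_format, OF H(1-3) _ H(5)] H(4,6,7)
      show "(\<integral>\<^sup>+x. f x * indicator (T L) x \<partial>lborel) \<le> c L * m epowr (p / q) * ?S"
        unfolding f_def by blast
    qed
    also have "\<dots> = C * m epowr (p / q) * ?S" by (simp only: C_def sum_distrib_right)
    finally show "(\<integral>\<^sup>+x. ennreal ((\<gamma> x * norm (u x)) powr p) * indicator \<Omega> x \<partial>lborel) \<le> C * m epowr (p / q) * ?S"
      unfolding f_def .
  qed
qed

subsection \<open>Neighbourhoods with the cone property\<close>

text \<open>In a ball of radius \<open>R\<close> a cone of height \<open>R / 2\<close> with axis
  towards the centre stays inside: near the centre by its size, farther out because moving along it
  does not increase the distance to the centre.\<close>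

lemma cone_property_Union_balls:
  fixes F :: "(real ^ 'n::finite) set"
  assumes R: "0 < R"
  shows "cone_property (\<Union>c\<in>F. ball c R)"
proof -
  obtain b :: "real ^ 'n" where b: "norm b = 1" using norm_axis_1 by blast
  \<comment> \<open>Opening \<open>pi / 6\<close>; all that matters is that directions in the cone
    have inner product at least half their length with the axis, which is \<open>Kb\<close>.\<close>
  define \<theta> :: real where "\<theta> = arcsin (1 / 2)"
  define C where "C = inf_cone 0 (2 *\<^sub>R b) 1"
  have \<theta>6: "\<theta> = pi / 6" unfolding \<theta>_def using sin_30 by (intro arcsin_unique) auto
  have \<theta>: "0 < \<theta>" "\<theta> < pi / 2" unfolding \<theta>6 using pi_gt_zero by simp_all
  have cone: "is_cone \<theta> 0 C" unfolding is_cone_def C_def \<theta>_def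
    using b by (intro exI[of _ "2 *\<^sub>R b"] exI[of _ 1]) (auto simp: dist_norm)
  define K where "K = C \<inter> ball 0 (R / 2)"
  have K: "finite_cone 0 K"
    unfolding finite_cone_def K_def using \<theta> cone R
    by (intro exI[of _ \<theta>] exI[of _ "R / 2"] exI[of _ C]) auto
  have Kb: "norm y < R / 2 \<and> norm y \<le> 2 * (y \<bullet> b)" if "y \<in> K" for y
  proof -
    from that obtain l w where lw: "0 < l" "dist w (2 *\<^sub>R b) < 1" "y = l *\<^sub>R w" and yR: "norm y < R / 2"
      by (auto simp: K_def C_def inf_cone_def)
    define v where "v = w - 2 *\<^sub>R b"
    have v: "norm v < 1" using lw by (simp add: v_def dist_norm)
    have w: "w = 2 *\<^sub>R b + v" by (simp add: v_def)
    have bb: "b \<bullet> b = 1" using b by (simp add: dot_square_norm)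
    have "\<bar>v \<bullet> b\<bar> \<le> norm v * norm b" by (rule Cauchy_Schwarz_ineq2)
    then have vb: "\<bar>v \<bullet> b\<bar> \<le> norm v" using b by simp
    have wb: "w \<bullet> b = 2 + v \<bullet> b" by (simp add: w inner_add_left bb)
    have ww: "w \<bullet> w = 4 + 4 * (v \<bullet> b) + v \<bullet> v" by (simp add: w inner_add_left inner_add_right bb inner_commute)
    have "v \<bullet> v \<le> 1" using v by (simp add: dot_square_norm power_le_one)
    define t where "t = v \<bullet> b"
    have "norm w \<le> 2 * (w \<bullet> b)"
    proof (rule power2_le_imp_le)
      have t: "-1 < t" using vb v unfolding t_def by linarith
      have "0 \<le> (2 * t + 3)\<^sup>2" by simp
      \<comment> \<open>The difference of the two sides is \<open>(2 t + 3)^2 + 2\<close>.\<close>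
      then have "4 + 4 * t + 1 \<le> 4 * (2 + t)\<^sup>2" by (simp add: power2_eq_square algebra_simps)
      then show "(norm w)\<^sup>2 \<le> (2 * (w \<bullet> b))\<^sup>2"
        using \<open>v \<bullet> v \<le> 1\<close> ww wb unfolding t_def[symmetric] dot_square_norm[symmetric]
        by (simp add: power2_eq_square algebra_simps)
      show "0 \<le> 2 * (w \<bullet> b)" using t wb by (simp add: t_def)
    qed
    then have "norm y \<le> 2 * (y \<bullet> b)" using lw by (simp add: mult_left_mono)
    with yR show ?thesis by blast
  qed
  have main: "\<exists>f. orthogonal_transformation f \<and> (\<lambda>y. x + f (y - 0)) ` K \<subseteq> ball c R" if x: "x \<in> ball c R" for x c :: "real ^ 'n"
  proof -
    define a where "a = (if x = c then b else (1 / norm (c - x)) *\<^sub>R (c - x))"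
    have a: "norm a = 1" using b by (auto simp: a_def)
    have cx: "c - x = norm (c - x) *\<^sub>R a" by (simp add: a_def)
    obtain f where f: "orthogonal_transformation f" "f b = a"
      using orthogonal_transformation_exists_1[OF b a] by blast
    have "x + f y \<in> ball c R" if y: "y \<in> K" for y
    proof -
      have n: "norm (f y) = norm y" using f(1) by (simp add: orthogonal_transformation)
      have i: "f y \<bullet> a = y \<bullet> b" using f by (auto simp: orthogonal_transformation_def)
      define s where "s = norm (c - x)"
      have s: "0 \<le> s" "s < R" using x by (auto simp: s_def dist_norm)
      have "dist c (x + f y) < R"
      \<comment> \<open>Far from the centre, \<open>norm y < R / 2 \<le> s\<close> and
        \<open>norm y \<le> 2 (y \<bullet> b)\<close> give
        \<open>(norm y)^2 \<le> 2 s (y \<bullet> b)\<close>, so the squared distance to the centre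
        is at most \<open>s^2\<close>.\<close>
      proof (cases "s < R / 2")
        case True
        have "dist c (x + f y) \<le> s + norm (f y)" unfolding s_def dist_norm by norm
        then show ?thesis using True n Kb[OF y] by linarith
      next
        case False
        have e: "c - (x + f y) = s *\<^sub>R a - f y" using cx by (simp add: s_def algebra_simps)
        have aa: "a \<bullet> a = 1" using a by (simp add: dot_square_norm)
        have "(dist c (x + f y))\<^sup>2 = (s *\<^sub>R a - f y) \<bullet> (s *\<^sub>R a - f y)"
          unfolding dist_norm e by (simp add: dot_square_norm)
        also have "\<dots> = s\<^sup>2 - 2 * s * (y \<bullet> b) + (norm y)\<^sup>2"
          using i n aa by (simp add: inner_diff_left inner_diff_right inner_commute power2_eq_square algebra_simps dot_square_norm[of "f y", unfolded power2_eq_square])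
        also have "\<dots> \<le> s\<^sup>2"
        proof -
          have "norm y * norm y \<le> s * (2 * (y \<bullet> b))"
            using Kb[OF y] False s by (intro mult_mono) auto
          then show ?thesis by (simp add: power2_eq_square algebra_simps)
        qed
        also have "\<dots> < R\<^sup>2" using s by (intro power_strict_mono) auto
        finally show ?thesis using R by (intro power2_less_imp_less[of _ R]) auto
      qed
      then show ?thesis by simp
    qed
    then show ?thesis using f(1) by (intro exI[of _ f]) auto
  qed
  show ?thesis
    unfolding cone_property_def
  proof (intro exI[of _ "0 :: real ^ 'n"] exI[of _ K] conjI ballI K)
    fix x assume "x \<in> (\<Union>c\<in>F. ball c R)"
    then obtain c where c: "c \<in> F" "x \<in> ball c R" by blast
    from main[OF c(2)] obtain f where f: "orthogonal_transformation f" "(\<lambda>y. x + f (y - 0)) ` K \<subseteq> ball c R" by blast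
    then show "\<exists>f. orthogonal_transformation f \<and> (\<lambda>y. x + f (y - 0)) ` K \<subseteq> (\<Union>c\<in>F. ball c R)"
      using c(1) by (intro exI[of _ f]) blast
  qed
qed

text \<open>Balls of radius \<open>e\<close> about points of \<open>K\<close> stay in
  \<open>\<Omega>\<close>; halving the radius keeps the closure of a finite union inside as well.
  Equal radii provide one cone for all points.\<close>

lemma compact_cover_balls:
  fixes \<Omega> :: "(real ^ 'n::finite) set"
  assumes \<Omega>: "open \<Omega>" and K: "compact K" "K \<subseteq> \<Omega>"
  obtains U where "open U" "compact (closure U)" "closure U \<subseteq> \<Omega>" "cone_property U" "K \<subseteq> U"
proof -
  obtain e where e: "0 < e" "(\<Union>x\<in>K. ball x e) \<subseteq> \<Omega>"
    using compact_subset_open_imp_ball_epsilon_subset[OF K(1) \<Omega> K(2)] by blast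
  obtain F where F: "F \<subseteq> K" "finite F" "K \<subseteq> (\<Union>x\<in>F. ball x (e / 2))"
  proof (rule compactE_image[OF K(1), of K "\<lambda>x. ball x (e / 2)"])
    show "K \<subseteq> (\<Union>x\<in>K. ball x (e / 2))" using e(1) by force
  qed auto
  define U where "U = (\<Union>x\<in>F. ball x (e / 2))"
  have "closed (\<Union>x\<in>F. cball x (e / 2))" using F(2) by (intro closed_UN) auto
  moreover have "U \<subseteq> (\<Union>x\<in>F. cball x (e / 2))" unfolding U_def using ball_subset_cball by blast
  ultimately have cl: "closure U \<subseteq> (\<Union>x\<in>F. cball x (e / 2))" by (rule closure_minimal[rotated])
  show ?thesis
  proof (rule that[of U])
    show "open U" unfolding U_def by auto
    have "bounded (\<Union>x\<in>F. cball x (e / 2))" using F(2) by (intro bounded_UN) auto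
    then show "compact (closure U)" using cl by (meson bounded_subset closed_closure compact_eq_bounded_closed)
    have "cball x (e / 2) \<subseteq> ball x e" for x :: "real ^ 'n" using e(1) by auto
    then show "closure U \<subseteq> \<Omega>" using cl e(2) F(1) by blast
    show "cone_property U" unfolding U_def using e(1) by (intro cone_property_Union_balls) auto
    show "K \<subseteq> U" using F(3) by (simp add: U_def)
  qed
qed

subsection \<open>Multiplication by functions of Morrey type\<close>

lemma powr_sum_le:
  fixes a b :: real
  assumes "0 \<le> a" "0 \<le> b" "0 < p"
  shows "(a + b) powr p \<le> 2 powr p * (a powr p + b powr p)"
proof -
  have "(a + b) powr p \<le> (2 * max a b) powr p" using assms by (intro powr_mono2) auto
  also have "\<dots> = 2 powr p * (max a b) powr p" using assms by (simp add: powr_mult)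
  also have "\<dots> \<le> 2 powr p * (a powr p + b powr p)" by (intro mult_left_mono) (auto simp: max_def)
  finally show ?thesis .
qed

text \<open>For \<open>0 \<le> t \<le> s\<close> one has \<open>t^p \<le> t s^(p - 1)\<close>; the
  two instances with \<open>s = a + b\<close> add up to \<open>s^p\<close>. This permits taking the
  root of a sum of two powers without a further constant.\<close>

lemma powr_sum_le_sum_powr:
  fixes a b :: real
  assumes "0 \<le> a" "0 \<le> b" "1 \<le> p"
  shows "a powr p + b powr p \<le> (a + b) powr p"
proof (cases "a + b = 0")
  case True
  then have "a = 0" "b = 0" using assms by linarith+
  then show ?thesis by simp
next
  case False
  define s where "s = a + b"
  have s: "0 < s" using False assms by (simp add: s_def)
  have le: "t powr p \<le> t * s powr (p - 1)" if "0 \<le> t" "t \<le> s" for t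
  proof (cases "t = 0")
    case False
    have "t powr p = t powr 1 * t powr (p - 1)" 
      by (subst powr_add[symmetric]) simp
    also have "\<dots> \<le> t powr 1 * s powr (p - 1)" using that assms by (intro mult_left_mono powr_mono2) auto
    finally show ?thesis using that by simp
  qed simp
  have "a powr p + b powr p \<le> a * s powr (p - 1) + b * s powr (p - 1)"
    using assms by (intro add_mono le) (auto simp: s_def)
  also have "\<dots> = s powr 1 * s powr (p - 1)" using s by (simp add: s_def algebra_simps)
  also have "\<dots> = s powr p" by (subst powr_add[symmetric]) simp
  finally show ?thesis by (simp add: s_def)
qed

text \<open>Membership only concerns intersections with balls; measurability on
  \<open>\<Omega>\<close> is the limit over growing balls.\<close>

lemma Lp_loc_closure_measurable:
  fixes \<Omega> :: "(real ^ 'n::finite) set"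
  assumes "open \<Omega>" "f \<in> Lp_loc_closure p \<Omega>"
  shows "f \<in> borel_measurable (lebesgue_on \<Omega>)"
proof -
  have \<Omega>: "\<Omega> \<in> sets lebesgue" using assms(1) by simp
  have m: "(\<lambda>x. indicator (\<Omega> \<inter> ball 0 (real k)) x *\<^sub>R f x) \<in> borel_measurable lebesgue" for k :: nat
  proof -
    have "f \<in> borel_measurable (lebesgue_on (\<Omega> \<inter> ball 0 (real k)))"
      using assms(2) by (simp add: Lp_loc_closure_def Lp_def)
    then show ?thesis using \<Omega> by (subst (asm) borel_measurable_restrict_space_iff) auto
  qed
  have "(\<lambda>x. indicator \<Omega> x *\<^sub>R f x) \<in> borel_measurable lebesgue"
  proof (rule borel_measurable_LIMSEQ_metric[OF m])
    fix x :: "real ^ 'n"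
    obtain N where N: "norm x < real N" using reals_Archimedean2 by blast
    have "indicator (\<Omega> \<inter> ball 0 (real k)) x *\<^sub>R f x = indicator \<Omega> x *\<^sub>R f x" if "N \<le> k" for k
    proof -
      have "norm x < real k" using N that by (meson less_le_trans of_nat_mono)
      then show ?thesis by (simp add: indicator_def)
    qed
    then show "(\<lambda>k. indicator (\<Omega> \<inter> ball 0 (real k)) x *\<^sub>R f x) \<longlonglongrightarrow> indicator \<Omega> x *\<^sub>R f x"
      by (intro tendsto_eventually eventually_sequentiallyI)
  qed
  then show ?thesis using \<Omega> by (subst borel_measurable_restrict_space_iff) auto
qed

lemma Lp_diff:
  assumes "f \<in> Lp p A" "g \<in> Lp p A" "0 < p"
  shows "(\<lambda>x. f x - g x) \<in> Lp p A"
proof -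
  have i: "integrable (lebesgue_on A) (\<lambda>x. 2 powr p * (cmod (f x) powr p + cmod (g x) powr p))"
    using assms by (intro integrable_mult_right Bochner_Integration.integrable_add) (auto simp: Lp_def)
  have fg: "f \<in> borel_measurable (lebesgue_on A)" "g \<in> borel_measurable (lebesgue_on A)"
    using assms by (auto simp: Lp_def)
  have "integrable (lebesgue_on A) (\<lambda>x. cmod (f x - g x) powr p)"
  proof (rule Bochner_Integration.integrable_bound[OF i])
    show "(\<lambda>x. cmod (f x - g x) powr p) \<in> borel_measurable (lebesgue_on A)" using fg by measurable
    have "cmod (f x - g x) powr p \<le> 2 powr p * (cmod (f x) powr p + cmod (g x) powr p)" for x
    proof -
      have "cmod (f x - g x) powr p \<le> (cmod (f x) + cmod (g x)) powr p"
        using assms(3) by (intro powr_mono2 norm_triangle_ineq4) auto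
      also have "\<dots> \<le> 2 powr p * (cmod (f x) powr p + cmod (g x) powr p)"
        using assms(3) by (intro powr_sum_le) auto
      finally show ?thesis .
    qed
    then show "AE x in lebesgue_on A. norm (cmod (f x - g x) powr p) \<le> norm (2 powr p * (cmod (f x) powr p + cmod (g x) powr p))"
      by (intro AE_I2) simp
  qed
  then show ?thesis using fg by (simp add: Lp_def)
qed

lemma Lp_subset:
  assumes "f \<in> Lp p A" "A \<in> sets lebesgue" "B \<in> sets lebesgue" "B \<subseteq> A"
  shows "f \<in> Lp p B"
proof -
  have "f \<in> borel_measurable (lebesgue_on B)"
    by (rule measurable_restrict_mono[OF _ assms(4)]) (use assms(1) in \<open>simp add: Lp_def\<close>)
  moreover have "integrable (lebesgue_on B) (\<lambda>x. cmod (f x) powr p)"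
  proof -
    have "integrable (lebesgue_on A) (\<lambda>x. cmod (f x) powr p)" using assms(1) by (simp add: Lp_def)
    then have "set_integrable lebesgue A (\<lambda>x. cmod (f x) powr p)"
      using assms(2) by (simp add: set_integrable_def integrable_restrict_space)
    then have "set_integrable lebesgue B (\<lambda>x. cmod (f x) powr p)"
      using assms(3,4) by (rule set_integrable_subset)
    then show ?thesis using assms(3) by (simp add: set_integrable_def integrable_restrict_space)
  qed
  ultimately show ?thesis by (simp add: Lp_def)
qed

lemma morrey_ball_bound:
  fixes f :: "real ^ 'n::finite \<Rightarrow> complex"
  assumes d: "0 < d" and q: "0 < q" and f: "f \<in> Lp_loc_closure q \<Omega>" and \<delta>: "0 < \<delta>"
    and lt: "morrey_norm d q \<sigma> \<Omega> f < ennreal \<delta>" and x: "x \<in> \<Omega>"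
  shows "(\<integral>\<^sup>+y. ennreal (cmod (f y) powr q) \<partial>lebesgue_on (ball x d \<inter> \<Omega>))
     \<le> ennreal ((\<delta> * d powr (real CARD('n) / q - \<sigma>)) powr q)"
proof -
  let ?N = "Lp_norm q (ball x d \<inter> \<Omega>) f" and ?e = "\<sigma> - real CARD('n) / q"
  have "f \<in> Lp q (\<Omega> \<inter> ball x d)" using f by (simp add: Lp_loc_closure_def)
  then have fL: "f \<in> Lp q (ball x d \<inter> \<Omega>)" by (simp only: Int_commute)
  have "ennreal (d powr ?e * ?N) \<le> morrey_norm d q \<sigma> \<Omega> f"
    unfolding morrey_norm_def using x d
    by (intro SUP_upper2[of "(x, d)"]) auto
  then have "ennreal (d powr ?e * ?N) < ennreal \<delta>" using lt by (rule le_less_trans)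
  then have lt2: "d powr ?e * ?N < \<delta>" using \<delta> by (simp add: ennreal_less_iff Lp_norm_def)
  have e: "d powr ?e * ?N * d powr (- ?e) = ?N" using d by (simp add: mult.assoc mult.left_commute[of _ ?N] powr_add[symmetric])
  have "d powr ?e * ?N * d powr (- ?e) \<le> \<delta> * d powr (- ?e)" using lt2 by (intro mult_right_mono) auto
  then have "?N \<le> \<delta> * d powr (- ?e)" by (simp only: e)
  then have N: "?N \<le> \<delta> * d powr (real CARD('n) / q - \<sigma>)" by simp
  have "?N powr q \<le> (\<delta> * d powr (real CARD('n) / q - \<sigma>)) powr q"
    using q N by (intro powr_mono2) (auto simp: Lp_norm_def)
  then show ?thesis unfolding Lp_norm_powr[OF fL q, symmetric] by (rule ennreal_leI)
qed

lemma C0_inf_bounded: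
  assumes "\<phi> \<in> C0_inf \<Omega>"
  obtains B where "0 < B" "\<And>x. cmod (\<phi> x) \<le> B"
proof -
  let ?K = "closure {x. \<phi> x \<noteq> 0}"
  have "smooth \<phi>" and K: "compact ?K" using assms by (auto simp: C0_inf_def)
  then have "continuous_on UNIV \<phi>" using smooth_continuous[of \<phi> "[]"] by (simp add: partials_def)
  then have "continuous_on ?K \<phi>" by (rule continuous_on_subset) simp
  then have "bounded (\<phi> ` ?K)" using K by (intro compact_imp_bounded compact_continuous_image)
  then obtain B where B: "0 < B" "\<forall>y\<in>\<phi> ` ?K. norm y \<le> B" using bounded_pos by blast
  have "cmod (\<phi> x) \<le> B" for x
  proof (cases "\<phi> x = 0")
    case False
    then have "x \<in> ?K" by (intro subsetD[OF closure_subset]) simp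
    then show ?thesis using B(2) by simp
  qed (use B in simp)
  with B(1) show ?thesis by (rule that)
qed

lemma powr_root_le:
  fixes x a b :: real
  assumes "1 \<le> p" "0 \<le> a" "0 \<le> b" "0 \<le> x" "x \<le> a powr p + b powr p"
  shows "x powr (1 / p) \<le> a + b"
proof -
  have "x \<le> (a + b) powr p" using powr_sum_le_sum_powr[of a b p] assms by linarith
  then have "x powr (1 / p) \<le> ((a + b) powr p) powr (1 / p)" using assms by (intro powr_mono2) auto
  also have "\<dots> = a + b" using assms by (simp add: powr_powr)
  finally show ?thesis .
qed

text \<open>The conclusion includes that \<open>g u\<close> belongs to \<open>Lp\<close>: for a
  function whose power is not integrable, \<open>Lp_norm\<close> is 0 by convention and the
  inequality alone would say nothing.\<close>

theorem lemma4p3: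
  fixes \<Omega> :: "(real ^ 'n) set" and g :: "real ^ 'n \<Rightarrow> complex"
    and d p q s :: real and r :: nat
  assumes "0 < d"
    and "open \<Omega>" and "cond_h1 d \<Omega>"
    and "1 \<le> r"
    and "1 \<le> p" and "p \<le> q"
    and "real CARD('n) / real r \<le> q"
    and "real CARD('n) / real r = p \<and> 1 < p \<longrightarrow> real CARD('n) / real r < q"
    and "s \<le> p"
    and "g \<in> morrey0 d q (s / p) \<Omega>"
  shows "\<forall>\<epsilon>>0. \<exists>c>0. \<exists>\<Omega>\<^sub>\<epsilon>.
           open \<Omega>\<^sub>\<epsilon> \<and> compact (closure \<Omega>\<^sub>\<epsilon>) \<and> closure \<Omega>\<^sub>\<epsilon> \<subseteq> \<Omega> \<and> cone_property \<Omega>\<^sub>\<epsilon> \<and>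
           (\<forall>u \<in> sobolev r p \<Omega>.
              (\<lambda>x. g x * u x) \<in> Lp p \<Omega> \<and>
              Lp_norm p \<Omega> (\<lambda>x. g x * u x) \<le> \<epsilon> * sobolev_norm r p \<Omega> u + c * Lp_norm p \<Omega>\<^sub>\<epsilon> u)"
proof (intro allI impI)
  fix \<epsilon> :: real assume \<epsilon>: "0 < \<epsilon>"
  have p: "0 < p" and q: "0 < q" using assms by auto
  note op = \<open>open \<Omega>\<close>
  have \<Omega>b: "\<Omega> \<in> sets borel" and \<Omega>l: "\<Omega> \<in> sets lebesgue" using op by auto
  have "\<exists>C<top. \<forall>V u \<gamma> m. weak_jet r p \<Omega> V \<longrightarrow> u \<in> borel_measurable borel \<longrightarrow>
     integrable lborel (\<lambda>x. norm (u x) powr p) \<longrightarrow>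
     (\<forall>\<phi>\<in>C0_inf \<Omega>. (LINT x|lborel. u x * \<phi> x) = (LINT x|lborel. V (\<lambda>_. 0) x * \<phi> x)) \<longrightarrow>
     \<gamma> \<in> borel_measurable borel \<longrightarrow> (\<forall>x. 0 \<le> \<gamma> x) \<longrightarrow>
     (\<forall>x\<in>\<Omega>. (\<integral>\<^sup>+y. ennreal (\<gamma> y) epowr q * indicator (ball x d \<inter> \<Omega>) y \<partial>lborel) \<le> m) \<longrightarrow>
     (\<integral>\<^sup>+x. ennreal ((\<gamma> x * norm (u x)) powr p) * indicator \<Omega> x \<partial>lborel)
       \<le> C * m epowr (p / q) * (\<Sum>\<alpha> | order_mi \<alpha> \<le> r. \<integral>\<^sup>+x. ennreal (norm (V \<alpha> x)) epowr p \<partial>lborel)"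
    by (rule Sobolev_embedding_borel[OF assms(2,1,3,4,5,6,7,8)])
  then obtain C where C: "C < top" and emb: "\<forall>V u \<gamma> m. weak_jet r p \<Omega> V \<longrightarrow> u \<in> borel_measurable borel \<longrightarrow>
     integrable lborel (\<lambda>x. norm (u x) powr p) \<longrightarrow>
     (\<forall>\<phi>\<in>C0_inf \<Omega>. (LINT x|lborel. u x * \<phi> x) = (LINT x|lborel. V (\<lambda>_. 0) x * \<phi> x)) \<longrightarrow>
     \<gamma> \<in> borel_measurable borel \<longrightarrow> (\<forall>x. 0 \<le> \<gamma> x) \<longrightarrow>
     (\<forall>x\<in>\<Omega>. (\<integral>\<^sup>+y. ennreal (\<gamma> y) epowr q * indicator (ball x d \<inter> \<Omega>) y \<partial>lborel) \<le> m) \<longrightarrow>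
     (\<integral>\<^sup>+x. ennreal ((\<gamma> x * norm (u x)) powr p) * indicator \<Omega> x \<partial>lborel)
       \<le> C * m epowr (p / q) * (\<Sum>\<alpha> | order_mi \<alpha> \<le> r. \<integral>\<^sup>+x. ennreal (norm (V \<alpha> x)) epowr p \<partial>lborel)"
    by (elim exE conjE) (rule that)
  \<comment> \<open>The root of the embedding constant, so that all bounds become
    \<open>p\<close>-th powers.\<close>
  define c0 where "c0 = enn2real C powr (1 / p)"
  have c0: "0 \<le> c0" by (simp add: c0_def)
  have C_eq: "C = ennreal (c0 powr p)"
    using C p by (simp add: c0_def powr_powr)
  define \<kappa> where "\<kappa> = d powr (real CARD('n) / q - s / p)"
  have \<kappa>: "0 < \<kappa>" using assms(1) by (simp add: \<kappa>_def)
  \<comment> \<open>The factor \<open>\<kappa>\<close> converts the Morrey norm into the norm over a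
    ball of radius \<open>d\<close>, the 2 pays for splitting the power of a sum, and
    \<open>c0 + 1\<close> replaces \<open>c0\<close> because \<open>c0\<close> may be 0.\<close>
  define \<delta> where "\<delta> = \<epsilon> / (2 * (c0 + 1) * \<kappa>)"
  have \<delta>: "0 < \<delta>" using \<epsilon> c0 \<kappa> by (simp add: \<delta>_def)
  have "2 * c0 * (\<delta> * \<kappa>) = \<epsilon> * (c0 / (c0 + 1))"
    using \<kappa> c0 by (simp add: \<delta>_def divide_simps)
  also have "\<dots> \<le> \<epsilon> * 1" using \<epsilon> c0 by (intro mult_left_mono) auto
  finally have small: "2 * c0 * (\<delta> * \<kappa>) \<le> \<epsilon>" by simp
  have gl: "g \<in> Lp_loc_closure q \<Omega>" using assms(10) by (simp add: morrey0_def morrey_def)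
  obtain \<phi> where \<phi>: "\<phi> \<in> C0_inf \<Omega>" "\<phi> \<in> Lp_loc_closure q \<Omega>"
    and lt: "morrey_norm d q (s / p) \<Omega> (\<lambda>x. g x - \<phi> x) < ennreal \<delta>"
    using assms(10) \<delta> by (auto simp: morrey0_def morrey_def)
  define h where "h = (\<lambda>x. g x - \<phi> x)"
  have hl: "h \<in> Lp_loc_closure q \<Omega>"
    using gl \<phi>(2) q unfolding h_def Lp_loc_closure_def by (auto intro: Lp_diff)
  have hm: "h \<in> borel_measurable (lebesgue_on \<Omega>)" by (rule Lp_loc_closure_measurable[OF op hl])
  have gm: "g \<in> borel_measurable (lebesgue_on \<Omega>)" by (rule Lp_loc_closure_measurable[OF op gl])
  obtain h' where h': "borel_rep \<Omega> h h'" using borel_rep_exists[OF hm \<Omega>b] by blast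
  then have h'm [measurable]: "h' \<in> borel_measurable borel" by (simp add: borel_rep_def)
  define m where "m = ennreal ((\<delta> * \<kappa>) powr q)"
  have m: "(\<integral>\<^sup>+y. ennreal (cmod (h' y)) epowr q * indicator (ball x d \<inter> \<Omega>) y \<partial>lborel) \<le> m" if x: "x \<in> \<Omega>" for x
  proof -
    have "(\<integral>\<^sup>+y. ennreal (cmod (h' y)) epowr q * indicator (ball x d \<inter> \<Omega>) y \<partial>lborel)
       = (\<integral>\<^sup>+y. ennreal (cmod (h' y) powr q) * indicator (ball x d \<inter> \<Omega>) y \<partial>lborel)"
      using q by (simp add: ennreal_epowr)
    also have "\<dots> = (\<integral>\<^sup>+y. ennreal (cmod (h y) powr q) \<partial>lebesgue_on (ball x d \<inter> \<Omega>))"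
      by (rule borel_rep_nn_integral[OF h', symmetric]) (use op in auto)
    also have "\<dots> \<le> m"
      unfolding m_def \<kappa>_def using lt by (intro morrey_ball_bound[OF assms(1) q hl \<delta> _ x]) (simp add: h_def)
    finally show ?thesis .
  qed
  have mp: "m epowr (p / q) = ennreal ((\<delta> * \<kappa>) powr p)"
    unfolding m_def using p q \<delta> \<kappa> by (subst ennreal_epowr) (auto simp: powr_powr)
  obtain B where B: "0 < B" "\<And>x. cmod (\<phi> x) \<le> B" using C0_inf_bounded[OF \<phi>(1)] by blast
  let ?K = "closure {x. \<phi> x \<noteq> 0}"
  have K: "compact ?K" "?K \<subseteq> \<Omega>" using \<phi>(1) by (auto simp: C0_inf_def)
  obtain U where U: "open U" "compact (closure U)" "closure U \<subseteq> \<Omega>" "cone_property U" "?K \<subseteq> U"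
    using compact_cover_balls[OF op K] by blast
  have U\<Omega>: "U \<subseteq> \<Omega>" using U(3) closure_subset by blast
  have Ul: "U \<in> sets lebesgue" and Ub: "U \<in> sets borel" using U(1) by auto
  have supp: "\<phi> x = 0" if "x \<notin> U" for x
    using that U(5) closure_subset[of "{x. \<phi> x \<noteq> 0}"] by blast
  have main: "(\<lambda>x. g x * u x) \<in> Lp p \<Omega> \<and>
      Lp_norm p \<Omega> (\<lambda>x. g x * u x) \<le> \<epsilon> * sobolev_norm r p \<Omega> u + 2 * B * Lp_norm p U u"
    if u: "u \<in> sobolev r p \<Omega>" for u
  proof -
    define S where "S = sobolev_norm r p \<Omega> u"
    define N where "N = Lp_norm p U u"
    have S: "0 \<le> S" and N: "0 \<le> N" by (auto simp: S_def N_def sobolev_norm_def Lp_norm_def)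
    have uL: "u \<in> Lp p \<Omega>" using u by (simp add: sobolev_def)
    then have um: "u \<in> borel_measurable (lebesgue_on \<Omega>)" by (simp add: Lp_def)
    obtain u' where u': "borel_rep \<Omega> u u'" using borel_rep_exists[OF um \<Omega>b] by blast
    then have u'm [measurable]: "u' \<in> borel_measurable borel" by (simp add: borel_rep_def)
    have "\<exists>V. weak_jet r p \<Omega> V \<and>
      (\<forall>\<phi>\<in>C0_inf \<Omega>. (LINT x|lborel. u' x * \<phi> x) = (LINT x|lborel. V (\<lambda>_. 0) x * \<phi> x)) \<and>
      (\<Sum>\<alpha> | order_mi \<alpha> \<le> r. \<integral>\<^sup>+x. ennreal (norm (V \<alpha> x)) epowr p \<partial>lborel) = ennreal (S powr p)"
    proof (rule sobolev_borel_rep[OF op u assms(5) u'], goal_cases)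
      case (1 V)
      then show ?case unfolding S_def by (intro exI[of _ V] conjI ballI)
    qed
    then obtain V where V: "weak_jet r p \<Omega> V"
      "\<forall>\<phi>\<in>C0_inf \<Omega>. (LINT x|lborel. u' x * \<phi> x) = (LINT x|lborel. V (\<lambda>_. 0) x * \<phi> x)"
      "(\<Sum>\<alpha> | order_mi \<alpha> \<le> r. \<integral>\<^sup>+x. ennreal (norm (V \<alpha> x)) epowr p \<partial>lborel) = ennreal (S powr p)"
      by (elim exE conjE) (rule that)
    have "(\<integral>\<^sup>+x. ennreal ((cmod (h' x) * norm (u' x)) powr p) * indicator \<Omega> x \<partial>lborel)
       \<le> C * m epowr (p / q) * (\<Sum>\<alpha> | order_mi \<alpha> \<le> r. \<integral>\<^sup>+x. ennreal (norm (V \<alpha> x)) epowr p \<partial>lborel)"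
    proof (rule emb[rule_format, where \<gamma> = "\<lambda>x. cmod (h' x)"])
      show "(\<lambda>x. cmod (h' x)) \<in> borel_measurable borel" by measurable
    qed (use V(2) in \<open>simp_all only: V(1) u'm borel_rep_Lp(1)[OF u' uL \<Omega>b p] m norm_ge_zero\<close>)
    also have "\<dots> = ennreal ((c0 * (\<delta> * \<kappa>) * S) powr p)"
      unfolding C_eq mp V(3) using c0 \<delta> \<kappa> S by (simp add: ennreal_mult'[symmetric] powr_mult)
    finally have hu: "(\<integral>\<^sup>+x. ennreal ((cmod (h' x) * norm (u' x)) powr p) * indicator \<Omega> x \<partial>lborel)
       \<le> ennreal ((c0 * (\<delta> * \<kappa>) * S) powr p)" .
    have uU: "u \<in> Lp p U" by (rule Lp_subset[OF uL \<Omega>l Ul U\<Omega>])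
    have Nu: "(\<integral>\<^sup>+x. ennreal (cmod (u' x) powr p) * indicator U x \<partial>lborel) = ennreal (N powr p)"
      unfolding N_def Lp_norm_powr[OF uU p] by (rule borel_rep_nn_integral[OF u' Ub U\<Omega>, symmetric])
    have gum: "(\<lambda>x. g x * u x) \<in> borel_measurable (lebesgue_on \<Omega>)"
      by (rule borel_measurable_times[OF gm um])
    have \<phi>m [measurable]: "\<phi> \<in> borel_measurable borel" by (rule C0_inf_measurable[OF \<phi>(1)])
    have rep: "borel_rep \<Omega> (\<lambda>x. g x * u x) (\<lambda>x. (h' x + \<phi> x) * u' x)"
      unfolding borel_rep_def
    proof (intro conjI)
      show "(\<lambda>x. (h' x + \<phi> x) * u' x) \<in> borel_measurable borel" by measurable
      show "\<forall>x. x \<notin> \<Omega> \<longrightarrow> (h' x + \<phi> x) * u' x = 0" using u' by (simp add: borel_rep_def)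
      have "AE x in lebesgue. x \<in> \<Omega> \<longrightarrow> h x = h' x" "AE x in lebesgue. x \<in> \<Omega> \<longrightarrow> u x = u' x"
        using h' u' by (auto simp: borel_rep_def)
      then show "AE x in lebesgue. x \<in> \<Omega> \<longrightarrow> g x * u x = (h' x + \<phi> x) * u' x"
        by eventually_elim (auto simp: h_def algebra_simps)
    qed
    \<comment> \<open>The test function contributes only on \<open>U\<close>, where it is at most
      \<open>B\<close>; this produces the constant \<open>2 * B\<close> in front of the norm of
      \<open>u\<close> over \<open>U\<close>.\<close>
    have pt: "cmod ((h' x + \<phi> x) * u' x) powr p
       \<le> 2 powr p * (cmod (h' x) * cmod (u' x)) powr p + (2 * B) powr p * (cmod (u' x) powr p * indicator U x)" for x
    proof -
      have *: "cmod (\<phi> x) \<le> B * indicator U x" using B(2)[of x] supp[of x] by (auto simp: indicator_def)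
      have "cmod ((h' x + \<phi> x) * u' x) = cmod (h' x + \<phi> x) * cmod (u' x)" by (rule norm_mult)
      also have "\<dots> \<le> (cmod (h' x) + B * indicator U x) * cmod (u' x)"
        using norm_triangle_ineq[of "h' x" "\<phi> x"] * by (intro mult_right_mono) auto
      also have "\<dots> = cmod (h' x) * cmod (u' x) + B * indicator U x * cmod (u' x)" by (simp add: distrib_right)
      finally have "cmod ((h' x + \<phi> x) * u' x) powr p
          \<le> (cmod (h' x) * cmod (u' x) + B * indicator U x * cmod (u' x)) powr p"
        using p by (intro powr_mono2) auto
      also have "\<dots> \<le> 2 powr p * ((cmod (h' x) * cmod (u' x)) powr p + (B * indicator U x * cmod (u' x)) powr p)"
        using p B(1) by (intro powr_sum_le) auto
      also have "(B * indicator U x * cmod (u' x)) powr p = B powr p * (cmod (u' x) powr p * indicator U x)"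
        using B(1) p by (auto simp: indicator_def powr_mult)
      finally show ?thesis using B(1) by (simp add: powr_mult distrib_left mult.assoc)
    qed
    let ?I = "\<integral>\<^sup>+x. ennreal (cmod (g x * u x) powr p) \<partial>lebesgue_on \<Omega>"
    have "?I = (\<integral>\<^sup>+x. ennreal (cmod ((h' x + \<phi> x) * u' x) powr p) * indicator \<Omega> x \<partial>lborel)"
      by (rule borel_rep_nn_integral[OF rep \<Omega>b order_refl])
    also have "\<dots> \<le> (\<integral>\<^sup>+x. ennreal (2 powr p) * (ennreal ((cmod (h' x) * norm (u' x)) powr p) * indicator \<Omega> x)
         + ennreal ((2 * B) powr p) * (ennreal (cmod (u' x) powr p) * indicator U x) \<partial>lborel)"
    proof (rule nn_integral_mono)
      fix x
      have "ennreal (cmod ((h' x + \<phi> x) * u' x) powr p) \<le> ennreal (2 powr p * (cmod (h' x) * cmod (u' x)) powr p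
         + (2 * B) powr p * (cmod (u' x) powr p * indicator U x))" by (rule ennreal_leI[OF pt])
      also have "\<dots> = ennreal (2 powr p) * ennreal ((cmod (h' x) * norm (u' x)) powr p)
         + ennreal ((2 * B) powr p) * (ennreal (cmod (u' x) powr p) * indicator U x)"
        by (simp add: ennreal_mult' ennreal_indicator)
      finally show "ennreal (cmod ((h' x + \<phi> x) * u' x) powr p) * indicator \<Omega> x
         \<le> ennreal (2 powr p) * (ennreal ((cmod (h' x) * norm (u' x)) powr p) * indicator \<Omega> x)
         + ennreal ((2 * B) powr p) * (ennreal (cmod (u' x) powr p) * indicator U x)"
        by (cases "x \<in> \<Omega>") auto
    qed
    also have "\<dots> = ennreal (2 powr p) * (\<integral>\<^sup>+x. ennreal ((cmod (h' x) * norm (u' x)) powr p) * indicator \<Omega> x \<partial>lborel)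
         + ennreal ((2 * B) powr p) * (\<integral>\<^sup>+x. ennreal (cmod (u' x) powr p) * indicator U x \<partial>lborel)"
      using \<Omega>b Ub by (subst nn_integral_add) (auto simp: nn_integral_cmult)
    also have "\<dots> \<le> ennreal (2 powr p) * ennreal ((c0 * (\<delta> * \<kappa>) * S) powr p) + ennreal ((2 * B) powr p) * ennreal (N powr p)"
      using hu Nu by (intro add_mono mult_left_mono) auto
    also have "\<dots> = ennreal ((2 * c0 * (\<delta> * \<kappa>) * S) powr p + (2 * B * N) powr p)"
      using c0 \<delta> \<kappa> S B(1) N by (simp add: ennreal_mult'[symmetric] powr_mult ennreal_plus[symmetric] mult.assoc del: ennreal_plus)
    finally have I: "?I \<le> ennreal ((2 * c0 * (\<delta> * \<kappa>) * S) powr p + (2 * B * N) powr p)" .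
    \<comment> \<open>Finiteness comes first, since \<open>Lp_norm_powr\<close> identifies the norm
      with the integral only for members of \<open>Lp\<close>.\<close>
    have gu: "(\<lambda>x. g x * u x) \<in> Lp p \<Omega>"
      by (rule Lp_I[OF gum]) (rule le_less_trans[OF I], simp)
    have "ennreal (Lp_norm p \<Omega> (\<lambda>x. g x * u x) powr p) \<le> ennreal ((2 * c0 * (\<delta> * \<kappa>) * S) powr p + (2 * B * N) powr p)"
      using I Lp_norm_powr[OF gu p] by simp
    then have "Lp_norm p \<Omega> (\<lambda>x. g x * u x) powr p \<le> (2 * c0 * (\<delta> * \<kappa>) * S) powr p + (2 * B * N) powr p"
      by (subst (asm) ennreal_le_iff) auto
    then have "(Lp_norm p \<Omega> (\<lambda>x. g x * u x) powr p) powr (1 / p) \<le> 2 * c0 * (\<delta> * \<kappa>) * S + 2 * B * N"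
      using assms(5) c0 \<delta> \<kappa> S B(1) N by (intro powr_root_le) auto
    moreover have "(Lp_norm p \<Omega> (\<lambda>x. g x * u x) powr p) powr (1 / p) = Lp_norm p \<Omega> (\<lambda>x. g x * u x)"
      using p by (simp add: powr_powr Lp_norm_def)
    moreover have "2 * c0 * (\<delta> * \<kappa>) * S \<le> \<epsilon> * S" by (rule mult_right_mono[OF small S])
    ultimately show ?thesis using gu unfolding S_def N_def by auto
  qed
  show "\<exists>c>0. \<exists>\<Omega>\<^sub>\<epsilon>. open \<Omega>\<^sub>\<epsilon> \<and> compact (closure \<Omega>\<^sub>\<epsilon>) \<and> closure \<Omega>\<^sub>\<epsilon> \<subseteq> \<Omega> \<and> cone_property \<Omega>\<^sub>\<epsilon> \<and>
           (\<forall>u \<in> sobolev r p \<Omega>.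
              (\<lambda>x. g x * u x) \<in> Lp p \<Omega> \<and>
              Lp_norm p \<Omega> (\<lambda>x. g x * u x) \<le> \<epsilon> * sobolev_norm r p \<Omega> u + c * Lp_norm p \<Omega>\<^sub>\<epsilon> u)"
    using U(1-4) main B(1) by (intro exI[of _ "2 * B"] exI[of _ U] conjI ballI) auto
qed

end
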